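(* Assume (H1), (H2), (H3). 1. For any non-negative function $\psi:\mathbb X\to\mathbb R_+$, $a>0$, $x\in\mathbb X$, $y\in\mathbb R$ and $z\geqslant0$, \[ \lim_{n\to\infty} n^{3/2}\,\mathbb E_x\big(\psi(X_n)\,;\,y+S_n\in[z,z+a],\ \tau_y>n\big)=\frac{2V(x,y)}{\sqrt{2\pi}\,\sigma^3}\int_z^{z+a}\mathbb E^*_{\nu}\big(\psi(X_1^* )\,V^*(X_1^*,z'+S_1^* )\,;\,\tau^*_{z'}>1\big)\,dz'. \] 2. There exists $c>0$ such that for any $a>0$, any non-negative $\psi:\mathbb X\to\mathbb R_+$, $y\in\mathbb R$, $z\geqslant0$ and $n\geqslant1$, \[ \sup_{x\in\mathbb X}\mathbb E_x\big(\psi(X_n)\,;\,y+S_n\in[z,z+a],\ \tau_y>n\big)\leqslant\frac{c\,\|\psi\|_\infty}{n^{3/2}}(1+a^3)(1+z)(1+\max(y,0)). \]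
   Context: Let $\mathbb X$ be a finite set and $(X_n)_{n\geqslant0}$ a homogeneous Markov chain on $\mathbb X$ with transition matrix $\mathbf P$; $\mathbb P_x,\mathbb E_x$ denote probability and expectation when $X_0=x$; $\|g\|_\infty=\max_x|g(x)|$, $\mathbf Pg(x)=\sum_{x'}g(x')\mathbf P(x,x')$. (H1): there exists $k_0\geqslant1$ with $\mathbf P^{k_0}g(x)>0$ for all $x$ and every non-negative, not identically zero $g$. Then $\mathbf P$ has a unique invariant probability $\nu$, positive everywhere; $\nu(g)=\sum_xg(x)\nu(x)$. Let $f:\mathbb X\to\mathbb R$, $S_0=0$, $S_n=\sum_{k=1}^nf(X_k)$, $\tau_y=\inf\{k\geqslant1: y+S_k\leqslant0\}$. (H2): $\nu(f)=0$. (H3): for every $(\theta,a)\in\mathbb R^2$ there exist $n\geqslant0$ and $x_0,\dots,x_n$ with $\mathbf P(x_0,x_1)\cdots\mathbf P(x_{n-1},x_n)\mathbf P(x_n,x_0)>0$ and $f(x_0)+\dots+f(x_n)-(n+1)\theta\notin a\mathbb Z$. $\sigma^2=\nu(f^2)+2\sum_{n\geqslant1}\nu(f\mathbf P^nf)>0$. Under (H1)–(H3) the limit $\lim_n\sqrt n\,\mathbb P_x(\tau_y>n)$ exists and is finite, and $V(x,y):=\frac{\sqrt{2\pi}\sigma}{2}\lim_n\sqrt n\,\mathbb P_x(\tau_y>n)$. Dual chain: $\mathbf P^*(x,x^* )=\frac{\nu(x^* )}{\nu(x)}\mathbf P(x^*,x)$; $(X_n^* )_{n\geqslant0}$ is a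 Markov chain with transition matrix $\mathbf P^*$ (independent of $(X_n)$), $S_0^*=0$, $S_n^*=-\sum_{k=1}^nf(X_k^* )$, $\tau^*_z=\inf\{k\geqslant1: z+S_k^*\leqslant0\}$; $\mathbb P^*_x,\mathbb E^*_x$ refer to $X_0^*=x$ and $\mathbb E^*_\nu$ to $X_0^*$ distributed as $\nu$. The dual chain also satisfies (H1)–(H3) (with $-f$) with the same $\nu$ and $\sigma$, and $V^*(x,z):=\frac{\sqrt{2\pi}\sigma}{2}\lim_n\sqrt n\,\mathbb P^*_x(\tau^*_z>n)$. *)

theory Defs
  imports "HOL-Analysis.Analysis"
begin

definition stochastic :: "('a::finite \<Rightarrow> 'a \<Rightarrow> real) \<Rightarrow> bool" where
  "stochastic P \<longleftrightarrow> (\<forall>x x'. P x x' \<ge> 0) \<and> (\<forall>x. (\<Sum>x'\<in>UNIV. P x x') = 1)"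

definition Pop :: "('a::finite \<Rightarrow> 'a \<Rightarrow> real) \<Rightarrow> ('a \<Rightarrow> real) \<Rightarrow> 'a \<Rightarrow> real" where
  "Pop P g x = (\<Sum>x'\<in>UNIV. g x' * P x x')"

definition H1 :: "('a::finite \<Rightarrow> 'a \<Rightarrow> real) \<Rightarrow> bool" where
  "H1 P \<longleftrightarrow> (\<exists>k0::nat. k0 \<ge> 1 \<and>
     (\<forall>g. (\<forall>x. g x \<ge> 0) \<and> (\<exists>x. g x \<noteq> 0) \<longrightarrow> (\<forall>x. (Pop P ^^ k0) g x > 0)))"

definition invariant_prob :: "('a::finite \<Rightarrow> 'a \<Rightarrow> real) \<Rightarrow> ('a \<Rightarrow> real) \<Rightarrow> bool" where
  "invariant_prob P \<nu> \<longleftrightarrow> (\<forall>x. \<nu> x \<ge> 0) \<and> (\<Sum>x\<in>UNIV. \<nu> x) = 1 \<and>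
     (\<forall>x'. (\<Sum>x\<in>UNIV. \<nu> x * P x x') = \<nu> x')"

text \<open>The (unique, under H1) invariant probability.\<close>
definition inv_prob :: "('a::finite \<Rightarrow> 'a \<Rightarrow> real) \<Rightarrow> 'a \<Rightarrow> real" where
  "inv_prob P = (THE \<nu>. invariant_prob P \<nu>)"

definition H2 :: "('a::finite \<Rightarrow> 'a \<Rightarrow> real) \<Rightarrow> ('a \<Rightarrow> real) \<Rightarrow> bool" where
  "H2 P f \<longleftrightarrow> (\<Sum>x\<in>UNIV. f x * inv_prob P x) = 0"

definition H3 :: "('a::finite \<Rightarrow> 'a \<Rightarrow> real) \<Rightarrow> ('a \<Rightarrow> real) \<Rightarrow> bool" where
  "H3 P f \<longleftrightarrow> (\<forall>\<theta> a::real. \<exists>n::nat. \<exists>xs::nat \<Rightarrow> 'a.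
      (\<Prod>k<n. P (xs k) (xs (Suc k))) * P (xs n) (xs 0) > 0 \<and>
      (\<Sum>k\<le>n. f (xs k)) - real (n + 1) * \<theta> \<notin> {a * of_int m | m. True})"

definition sigma :: "('a::finite \<Rightarrow> 'a \<Rightarrow> real) \<Rightarrow> ('a \<Rightarrow> real) \<Rightarrow> real" where
  "sigma P f = sqrt ((\<Sum>x\<in>UNIV. inv_prob P x * (f x)^2) +
      2 * (\<Sum>n. (\<Sum>x\<in>UNIV. inv_prob P x * f x * (Pop P ^^ (Suc n)) f x)))"

fun path_weight :: "('a \<Rightarrow> 'a \<Rightarrow> real) \<Rightarrow> 'a \<Rightarrow> 'a list \<Rightarrow> real" where
  "path_weight P x [] = 1"
| "path_weight P x (y # ys) = P x y * path_weight P y ys"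

text \<open>E_x F(X_1,...,X_n) for the chain started at x, F a function of the list [X_1,...,X_n].\<close>
definition path_exp :: "('a::finite \<Rightarrow> 'a \<Rightarrow> real) \<Rightarrow> nat \<Rightarrow> 'a \<Rightarrow> ('a list \<Rightarrow> real) \<Rightarrow> real" where
  "path_exp P n x F = (\<Sum>xs\<in>{xs. length xs = n}. path_weight P x xs * F xs)"

definition Ssum :: "('a \<Rightarrow> real) \<Rightarrow> 'a list \<Rightarrow> nat \<Rightarrow> real" where
  "Ssum f xs k = sum_list (map f (take k xs))"

definition tau_gt :: "('a \<Rightarrow> real) \<Rightarrow> real \<Rightarrow> 'a list \<Rightarrow> nat \<Rightarrow> bool" where
  "tau_gt f y xs n \<longleftrightarrow> (\<forall>k\<in>{1..n}. y + Ssum f xs k > 0)"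

definition surv_prob :: "('a::finite \<Rightarrow> 'a \<Rightarrow> real) \<Rightarrow> ('a \<Rightarrow> real) \<Rightarrow> 'a \<Rightarrow> real \<Rightarrow> nat \<Rightarrow> real" where
  "surv_prob P f x y n = path_exp P n x (\<lambda>xs. if tau_gt f y xs n then 1 else 0)"

definition Vfun :: "('a::finite \<Rightarrow> 'a \<Rightarrow> real) \<Rightarrow> ('a \<Rightarrow> real) \<Rightarrow> real \<Rightarrow> 'a \<Rightarrow> real \<Rightarrow> real" where
  "Vfun P f s x y = sqrt (2 * pi) * s / 2 * lim (\<lambda>n. sqrt (real n) * surv_prob P f x y n)"

definition Pstar :: "('a::finite \<Rightarrow> 'a \<Rightarrow> real) \<Rightarrow> 'a \<Rightarrow> 'a \<Rightarrow> real" where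
  "Pstar P x xs = inv_prob P xs / inv_prob P x * P xs x"

definition local_exp :: "('a::finite \<Rightarrow> 'a \<Rightarrow> real) \<Rightarrow> ('a \<Rightarrow> real) \<Rightarrow> ('a \<Rightarrow> real)
    \<Rightarrow> 'a \<Rightarrow> real \<Rightarrow> real \<Rightarrow> real \<Rightarrow> nat \<Rightarrow> real" where
  "local_exp P f \<psi> x y z a n = path_exp P n x (\<lambda>xs.
      if y + Ssum f xs n \<in> {z..z+a} \<and> tau_gt f y xs n then \<psi> (last (x # xs)) else 0)"

definition dual_integrand :: "('a::finite \<Rightarrow> 'a \<Rightarrow> real) \<Rightarrow> ('a \<Rightarrow> real) \<Rightarrow> ('a \<Rightarrow> real) \<Rightarrow> real \<Rightarrow> real" where
  "dual_integrand P f \<psi> z' = (\<Sum>x0\<in>UNIV. inv_prob P x0 *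
     path_exp (Pstar P) 1 x0 (\<lambda>xs.
       if tau_gt (\<lambda>u. - f u) z' xs 1
       then \<psi> (last (x0 # xs)) * Vfun (Pstar P) (\<lambda>u. - f u) (sigma P f) (last (x0 # xs)) (z' + Ssum (\<lambda>u. - f u) xs 1)
       else 0))"

end

theory Submission
  imports Defs "HOL-Probability.Probability" "HOL-Real_Asymp.Real_Asymp"
begin

text \<open>
  A solution \<open>h\<close> of the heat equation with variance \<open>s2\<close>, corrected by the solutions of two Poisson
  equations, is harmonic for the chain \<open>(X\<^sub>n, y + S\<^sub>n)\<close> up to terms of third order in its derivatives. If \<open>h\<close> is
  odd in space, it almost vanishes where the chain is killed, so the killed chain maps it to
  \<open>\<partial>\<^sub>y h\<close> at the origin times the harmonic function \<open>W = V\<close>.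

  To find the window at time \<open>n\<close>, the path is cut in pieces. Over the last piece, reversing time turns
  the killed chain into the killed dual chain started in the window; there the Gaussian kernel coming
  from the local limit theorem (Fourier operators, non-lattice condition) may be replaced by its odd
  reflection, and the principle above produces the integral of \<open>V\<^sup>*\<close> times the derivative of the
  Gaussian density. That derivative is again an odd heat function, so the principle, applied once more
  over the first half of the path, gives \<open>V\<close> and the order \<open>n\<^bsup>-3/2\<^esup>\<close>. The uniform bound is the same
  cutting in three with the survival estimate \<open>O(n\<^bsup>-1/2\<^esup>)\<close> at both ends and the local bound in the middle.
\<close>

section \<open>Ergodicity of a primitive stochastic matrix\<close>

text \<open>The obstacle is one of orders: the local limit theorem has error o(1/sqrt k) times the
  mass of its target, but the answer in the bulk is only of order 1/m. So its target is not the
  window but the window carried back by n killed steps, of mass O(1/sqrt n); with k = \<epsilon> m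
  free steps and n = (1 - \<epsilon>) m killed ones the error is o(1/m). Ignoring the killing during
  the free steps and reflecting the Gaussian each cost sqrt k / n^(3/2), about sqrt \<epsilon> / m,
  because the carried-back window grows at most linearly in the height, with factor n^(-3/2). Hence
  \<epsilon> is fixed before the widening \<delta> and the accuracy \<zeta>, and m is taken large
  last.

  Comparison with a heat function leaves third-order one-step defects. They are weighted by survival
  probabilities O(j^(-1/2)), so that k steps cost sqrt k defects and not k. This needs an a priori
  survival bound, which comes from martingales alone. Windows are discontinuous, so the local limit
  theorem is proved for smoothing by a kernel with compactly supported Fourier transform and reaches
  windows by widening and shrinking them.\<close>

definition l1norm :: "('a::finite => real) => real" where
  "l1norm g = (\<Sum>x\<in>UNIV. \<bar>g x\<bar>)"

text \<open>On a finite type \<open>l1norm\<close> serves as a bound of the sup norm that needs no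
  maximum; the constants built from it are not meant to be sharp.\<close>

lemma l1norm_bound: "\<bar>g x\<bar> \<le> l1norm g"
  unfolding l1norm_def by (rule member_le_sum) auto

lemma l1norm_nonneg: "0 \<le> l1norm g"
  unfolding l1norm_def by (simp add: sum_nonneg)

lemma finite_range_extrema:
  fixes g :: "'a::finite => real"
  shows "\<exists>a b. \<forall>u. g a \<le> g u \<and> g u \<le> g b"
proof -
  have "Min (range g) \<in> range g" "Max (range g) \<in> range g" by (simp_all del: Max_in Min_in add: Min_in Max_in)
  then obtain a b where "Min (range g) = g a" "Max (range g) = g b" by (meson imageE)
  moreover have "\<And>u. Min (range g) \<le> g u \<and> g u \<le> Max (range g)" by simp
  ultimately show ?thesis by metis
qed

lemma sum_indicator_right:
  fixes g :: "'a::finite => real"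
  shows "(\<Sum>x\<in>UNIV. g x * (if x = u then 1 else 0)) = g u"
  by (simp add: if_distrib[of "\<lambda>c. _ * c"] cong: if_cong)

lemma sum_indicator_left:
  fixes g :: "'a::finite => real"
  shows "(\<Sum>x\<in>UNIV. (if x = u then 1 else 0) * g x) = g u"
  by (simp add: if_distrib[of "\<lambda>c. c * _"] cong: if_cong)

lemma Pop_iter_add: "(Pop P ^^ n) (\<lambda>x. g x + h x) x = (Pop P ^^ n) g x + (Pop P ^^ n) h x"
proof (induction n arbitrary: x)
  case (Suc n)
  then show ?case by (simp add: Pop_def fun_eq_iff algebra_simps sum.distrib)
qed simp

lemma Pop_iter_mult: "(Pop P ^^ n) (\<lambda>x. c * g x) x = c * (Pop P ^^ n) g x"
proof (induction n arbitrary: x)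
  case (Suc n)
  then show ?case by (simp add: Pop_def fun_eq_iff algebra_simps sum_distrib_left)
qed simp

lemma Pop_iter_sum: "(Pop P ^^ n) (\<lambda>x. \<Sum>i\<in>I. g i x) x = (\<Sum>i\<in>I. (Pop P ^^ n) (g i) x)"
proof (induction n arbitrary: x)
  case (Suc n)
  have "(Pop P ^^ Suc n) (\<lambda>x. \<Sum>i\<in>I. g i x) x = (\<Sum>x'\<in>UNIV. (\<Sum>i\<in>I. (Pop P ^^ n) (g i) x') * P x x')"
    by (simp add: Pop_def[of P "(Pop P ^^ n) _"] Suc)
  also have "\<dots> = (\<Sum>i\<in>I. \<Sum>x'\<in>UNIV. (Pop P ^^ n) (g i) x' * P x x')"
    by (subst sum.swap) (simp add: sum_distrib_right)
  finally show ?case by (simp add: Pop_def[of P "(Pop P ^^ n) _"])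
qed simp

text \<open>Positivity is asked of indicators, which spans all functions by linearity. In this form
  it passes to the reversed matrix, where the adjoint identity exchanges the two states.\<close>

locale primitive =
  fixes P :: "'a::finite => 'a => real"
  assumes P_nonneg: "0 \<le> P x x'"
    and P_sum: "(\<Sum>x'\<in>UNIV. P x x') = 1"
    and P_prim: "\<exists>k0. k0 \<ge> 1 \<and> (\<forall>x x'. (Pop P ^^ k0) (\<lambda>u. if u = x' then 1 else 0) x > 0)"
begin

lemma Pop_iter_mono: "(\<And>x. g x \<le> h x) ==> (Pop P ^^ n) g x \<le> (Pop P ^^ n) h x"
proof (induction n arbitrary: x)
  case (Suc n)
  then show ?case by (simp add: Pop_def) (intro sum_mono mult_right_mono P_nonneg, auto)
qed simp

lemma Pop_iter_const: "(Pop P ^^ n) (\<lambda>x. c) x = c"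
proof (induction n arbitrary: x)
  case (Suc n)
  then show ?case by (simp add: Pop_def fun_eq_iff sum_distrib_left[symmetric] P_sum)
qed simp

lemma Pop_iter_range: "(\<And>x. a \<le> g x \<and> g x \<le> b) ==> a \<le> (Pop P ^^ n) g x \<and> (Pop P ^^ n) g x \<le> b"
  using Pop_iter_mono[of "\<lambda>x. a" g n x] Pop_iter_mono[of g "\<lambda>x. b" n x] by (simp add: Pop_iter_const)

lemma Pop_iter_ind: "(Pop P ^^ n) g x = (\<Sum>x'\<in>UNIV. g x' * (Pop P ^^ n) (\<lambda>u. if u = x' then 1 else 0) x)"
proof -
  have "g = (\<lambda>x. \<Sum>x'\<in>UNIV. g x' * (if x = x' then 1 else 0))"
    by (auto simp: fun_eq_iff if_distrib cong: if_cong)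
  then have "(Pop P ^^ n) g x = (Pop P ^^ n) (\<lambda>x. \<Sum>x'\<in>UNIV. g x' * (if x = x' then 1 else 0)) x"
    by simp
  also have "\<dots> = (\<Sum>x'\<in>UNIV. g x' * (Pop P ^^ n) (\<lambda>u. if u = x' then 1 else 0) x)"
    by (simp only: Pop_iter_sum Pop_iter_mult)
  finally show ?thesis .
qed

lemma Pop_osc_le:
  assumes "\<And>x x'. \<bar>g x - g x'\<bar> \<le> d"
  shows "\<bar>(Pop P ^^ n) g x - (Pop P ^^ n) g x'\<bar> \<le> d"
proof -
  obtain a b where rr: "\<And>u. g a \<le> g u \<and> g u \<le> g b" using finite_range_extrema[of g] by blast
  from Pop_iter_range[of _ g, OF rr, of n x] Pop_iter_range[of _ g, OF rr, of n x'] assms[of b a]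
  show ?thesis by linarith
qed

text \<open>Doeblin's argument: after \<open>k0\<close> steps every state gives positive mass to the
  point where g is largest, so the minimum rises by a fixed fraction of the oscillation while the
  maximum does not rise.\<close>

lemma ergodic_contraction:
  "\<exists>C \<rho>. 0 \<le> C \<and> 0 < \<rho> \<and> \<rho> < 1 \<and> (\<forall>g d n x x'. (\<forall>x x'. \<bar>g x - g x'\<bar> \<le> d) --> \<bar>(Pop P ^^ n) g x - (Pop P ^^ n) g x'\<bar> \<le> C * \<rho> ^ n * d)"
proof -
  obtain k0 where k0: "k0 \<ge> 1" "\<And>x x'. (Pop P ^^ k0) (\<lambda>u. if u = x' then 1 else 0) x > 0" (is "\<And>x x'. ?E x x' > 0")
    using P_prim by blast
  \<comment> \<open>Half of the minimal entry, so that 1 - \<beta> stays positive even with a single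
    state and has a positive \<open>k0\<close>-th root.\<close>
  define \<beta> where "\<beta> = Min (range (\<lambda>(x,x'). (Pop P ^^ k0) (\<lambda>u. if u = x' then 1 else 0) x)) / 2"
  have b1: "\<beta> > 0" unfolding \<beta>_def using k0 by (auto simp: Min_gr_iff)
  have b2: "2 * \<beta> \<le> ?E x x'" for x x'
    unfolding \<beta>_def by (auto intro!: Min_le)
  have b3: "?E x x' \<le> 1" for x x'
    using Pop_iter_range[of 0 "\<lambda>u. if u = x' then 1 else 0" 1] by auto
  have b4: "\<beta> < 1" using b1 b2[of undefined undefined] b3[of undefined undefined] by linarith
  have step: "\<bar>(Pop P ^^ k0) g x - (Pop P ^^ k0) g x'\<bar> \<le> (1 - \<beta>) * d"
    if d: "\<forall>x x'. \<bar>g x - g x'\<bar> \<le> d" for g d x x'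
  proof -
    obtain a b where rr: "\<And>u. g a \<le> g u \<and> g u \<le> g b" using finite_range_extrema[of g] by blast
    have up: "(Pop P ^^ k0) g u \<le> g b" for u using Pop_iter_range[of _ g, OF rr] by blast
    \<comment> \<open>Lowering g to its minimum away from the maximizer \<open>b\<close> leaves
      exactly the mass that the chain gives to \<open>b\<close>.\<close>
    have lo: "(Pop P ^^ k0) g u \<ge> g a + \<beta> * (g b - g a)" for u
    proof -
      have "(Pop P ^^ k0) (\<lambda>x. g a + (g b - g a) * (if x = b then 1 else 0)) u \<le> (Pop P ^^ k0) g u"
        by (rule Pop_iter_mono) (use rr in auto)
      then have "g a + (g b - g a) * ?E u b \<le> (Pop P ^^ k0) g u"
        by (simp only: Pop_iter_add Pop_iter_mult Pop_iter_const)
      moreover have "\<beta> * (g b - g a) \<le> (g b - g a) * ?E u b"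
        by (subst mult.commute, rule mult_left_mono) (use b1 b2[of b u] rr[of b] in auto)
      ultimately show ?thesis by linarith
    qed
    have "(1-\<beta>) * (g b - g a) \<le> (1-\<beta>) * d"
      by (rule mult_left_mono) (use d b4 in \<open>auto intro: order_trans[OF abs_ge_self]\<close>)
    then show ?thesis using up[of x] up[of x'] lo[of x] lo[of x'] by (simp add: algebra_simps abs_le_iff)
  qed
  have iter: "\<bar>(Pop P ^^ (k0 * j)) g x - (Pop P ^^ (k0 * j)) g x'\<bar> \<le> (1 - \<beta>)^j * d"
    if d: "\<forall>x x'. \<bar>g x - g x'\<bar> \<le> d" for g d x x' j
    using d
  proof (induction j arbitrary: x x' g d)
    case (Suc j)
    have "(Pop P ^^ (k0 * Suc j)) g = (Pop P ^^ (k0 * j)) ((Pop P ^^ k0) g)"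
      by (simp add: funpow_add add.commute[of k0])
    moreover have "\<forall>x x'. \<bar>(Pop P ^^ k0) g x - (Pop P ^^ k0) g x'\<bar> \<le> (1 - \<beta>) * d"
      using step[OF Suc.prems] by blast
    ultimately show ?case using Suc.IH[of "(Pop P ^^ k0) g" "(1-\<beta>)*d" x x'] by (simp add: ac_simps)
  qed simp
  \<comment> \<open>The contraction 1 - \<beta> per block of \<open>k0\<close> steps is spread
    evenly over the steps; the prefactor 1/\<rho>^k0 pays for the incomplete last block.\<close>
  define \<rho> where "\<rho> = root k0 (1-\<beta>)"
  have rho: "0 < \<rho>" "\<rho> < 1" "\<rho> ^ k0 = 1 - \<beta>"
    using b4 b1 k0(1) by (auto simp: \<rho>_def)
  have all: "\<bar>(Pop P ^^ n) g x - (Pop P ^^ n) g x'\<bar> \<le> (1/\<rho>^k0) * \<rho> ^ n * d"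
    if d: "\<forall>x x'. \<bar>g x - g x'\<bar> \<le> d" for g d x x' n
  proof -
    have d0: "0 \<le> d" using d[rule_format, of x x] by simp
    have n: "n = n mod k0 + k0 * (n div k0)" by simp
    have e: "\<bar>(Pop P ^^ n) g x - (Pop P ^^ n) g x'\<bar> \<le> (1-\<beta>)^(n div k0) * d"
      apply (subst (1 2) n)
      apply (subst (1 2) funpow_add)
      apply (simp only: o_apply)
      by (rule Pop_osc_le) (use iter[OF d] in blast)
    have "(1-\<beta>)^(n div k0) = \<rho> ^ (k0 * (n div k0))" using rho(3) by (simp add: power_mult)
    also have "\<dots> * \<rho> ^ k0 \<le> \<rho> ^ n"
    proof -
      have "n \<le> k0 * (n div k0) + k0" using n mod_less_divisor[of k0 n] k0(1) by linarith
      then show ?thesis using rho(1,2) power_decreasing[of n "k0 * (n div k0) + k0" \<rho>] by (simp only: power_add)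
    qed
    finally have "(1-\<beta>)^(n div k0) \<le> (1/\<rho>^k0) * \<rho> ^ n"
      using rho(1) by (simp add: pos_le_divide_eq)
    then show ?thesis using e d0 by (meson mult_right_mono order_trans)
  qed
  show ?thesis
    by (rule exI[of _ "1/\<rho>^k0"], rule exI[of _ \<rho>]) (use rho all b4 in auto)
qed

text \<open>Averaging never leaves the range of P^n g, and that range shrinks geometrically; so the
  values at one state are Cauchy and all states share the limit.\<close>

lemma Pop_iter_limit:
  "\<exists>c. \<forall>x. (\<lambda>n. (Pop P ^^ n) g x) \<longlonglongrightarrow> c"
proof -
  obtain C \<rho> where C: "0 \<le> C" "0 < \<rho>" "\<rho> < 1"
    "\<And>g d n x x'. (\<forall>x x'. \<bar>g x - g x'\<bar> \<le> d) ==> \<bar>(Pop P ^^ n) g x - (Pop P ^^ n) g x'\<bar> \<le> C * \<rho> ^ n * d"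
    using ergodic_contraction by metis
  define d where "d = 2 * l1norm g"
  have d: "\<forall>x x'. \<bar>g x - g x'\<bar> \<le> d"
  proof (intro allI)
    fix x x' show "\<bar>g x - g x'\<bar> \<le> d"
      unfolding d_def using l1norm_bound[of g x] l1norm_bound[of g x'] by linarith
  qed
  define e where "e n = C * \<rho> ^ n * d" for n
  have e0: "e \<longlonglongrightarrow> 0" unfolding e_def
    using C by (intro tendsto_eq_intros LIMSEQ_power_zero) auto
  have osc: "\<bar>(Pop P ^^ n) g x - (Pop P ^^ n) g x'\<bar> \<le> e n" for n x x'
    using C(4)[OF d] unfolding e_def by simp
  have step: "\<bar>(Pop P ^^ (n + k)) g x - (Pop P ^^ n) g x'\<bar> \<le> e n" for n k x x'
  proof -
    have rr: "(Pop P ^^ n) g x' - e n \<le> (Pop P ^^ n) g u \<and> (Pop P ^^ n) g u \<le> (Pop P ^^ n) g x' + e n" for u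
      using osc[of n u x'] by linarith
    have "(Pop P ^^ (n + k)) g x = (Pop P ^^ k) ((Pop P ^^ n) g) x" by (simp add: add.commute[of n] funpow_add)
    with Pop_iter_range[of _ "(Pop P ^^ n) g", OF rr, of k x] show ?thesis by linarith
  qed
  have "Cauchy (\<lambda>n. (Pop P ^^ n) g undefined)"
  proof (rule metric_CauchyI)
    fix r :: real assume "r > 0"
    then have "\<forall>\<^sub>F n in sequentially. e n < r/2" using e0
      by (intro order_tendstoD) auto
    then obtain N where N: "e N < r/2" by (auto simp: eventually_sequentially)
    have "dist ((Pop P ^^ m) g undefined) ((Pop P ^^ n) g undefined) < r" if "m \<ge> N" "n \<ge> N" for m n
      using step[of N "m-N" undefined undefined] step[of N "n-N" undefined undefined] that N
      by (simp add: dist_real_def)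
    then show "\<exists>M. \<forall>m\<ge>M. \<forall>n\<ge>M. dist ((Pop P ^^ m) g undefined) ((Pop P ^^ n) g undefined) < r" by blast
  qed
  then obtain c where c: "(\<lambda>n. (Pop P ^^ n) g undefined) \<longlonglongrightarrow> c"
    using Cauchy_convergent_iff convergent_def by blast
  have "(\<lambda>n. (Pop P ^^ n) g x) \<longlonglongrightarrow> c" for x
  proof -
    have "(\<lambda>n. (Pop P ^^ n) g x - (Pop P ^^ n) g undefined) \<longlonglongrightarrow> 0"
      by (rule Lim_null_comparison[OF _ e0]) (use osc in auto)
    from tendsto_add[OF this c] show ?thesis by simp
  qed
  then show ?thesis by blast
qed

lemma invariant_iter:
  assumes "invariant_prob P \<nu>"
  shows "(\<Sum>x\<in>UNIV. \<nu> x * (Pop P ^^ n) g x) = (\<Sum>x\<in>UNIV. \<nu> x * g x)"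
proof (induction n arbitrary: g)
  case (Suc n)
  have "(\<Sum>x\<in>UNIV. \<nu> x * (Pop P ^^ Suc n) g x) = (\<Sum>x\<in>UNIV. \<nu> x * (Pop P ^^ n) (Pop P g) x)"
    by (simp add: funpow_swap1)
  also have "\<dots> = (\<Sum>x\<in>UNIV. \<nu> x * Pop P g x)" by (rule Suc)
  also have "\<dots> = (\<Sum>x'\<in>UNIV. (\<Sum>x\<in>UNIV. \<nu> x * P x x') * g x')"
    unfolding Pop_def sum_distrib_left sum_distrib_right
    by (subst sum.swap) (simp add: ac_simps)
  also have "\<dots> = (\<Sum>x\<in>UNIV. \<nu> x * g x)"
    using assms by (simp add: invariant_prob_def)
  finally show ?case .
qed simp

text \<open>Integrating P^n 1_u against an invariant law always gives its mass at u, while P^n 1_u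
  tends to a constant that does not depend on the law.\<close>

lemma invariant_prob_unique:
  assumes "invariant_prob P \<nu>" "invariant_prob P \<nu>'"
  shows "\<nu> = \<nu>'"
proof
  fix u
  define g where "g x = (if x = u then 1 else 0::real)" for x :: 'a
  obtain c where c: "\<And>x. (\<lambda>n. (Pop P ^^ n) g x) \<longlonglongrightarrow> c" using Pop_iter_limit by blast
  have *: "\<mu> u = c" if m: "invariant_prob P \<mu>" for \<mu>
  proof -
    have "(\<lambda>n. \<Sum>x\<in>UNIV. \<mu> x * (Pop P ^^ n) g x) \<longlonglongrightarrow> (\<Sum>x\<in>UNIV. \<mu> x * c)"
      by (intro tendsto_intros c)
    then have "(\<lambda>n::nat. \<mu> u) \<longlonglongrightarrow> c" using m
      by (simp add: invariant_iter[OF m] sum_distrib_right[symmetric] invariant_prob_def)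
         (simp add: g_def sum_indicator_right)
    then show ?thesis by (simp add: LIMSEQ_const_iff)
  qed
  show "\<nu> u = \<nu>' u" using *[OF assms(1)] *[OF assms(2)] by simp
qed

text \<open>The common limit of P^n g is linear, positive, normalized and unchanged when g is
  replaced by Pg; its values on indicators are the invariant weights.\<close>

lemma invariant_prob_exists: "\<exists>\<nu>. invariant_prob P \<nu>"
proof -
  define c where "c g = (SOME c. \<forall>x. (\<lambda>n. (Pop P ^^ n) g x) \<longlonglongrightarrow> c)" for g
  have c: "(\<lambda>n. (Pop P ^^ n) g x) \<longlonglongrightarrow> c g" for g x
    unfolding c_def using someI_ex[OF Pop_iter_limit[of g]] by blast
  define \<delta> where "\<delta> x' = (\<lambda>u::'a. if u = x' then 1 else 0::real)" for x'
  define \<nu> where "\<nu> x' = c (\<delta> x')" for x'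
  have lin: "c g = (\<Sum>x\<in>UNIV. g x * \<nu> x)" for g
  proof (rule LIMSEQ_unique[OF c[of g undefined]])
    show "(\<lambda>n. (Pop P ^^ n) g undefined) \<longlonglongrightarrow> (\<Sum>x\<in>UNIV. g x * \<nu> x)"
      apply (subst Pop_iter_ind)
      unfolding \<nu>_def \<delta>_def by (intro tendsto_intros c)
  qed
  have "\<nu> x \<ge> 0" for x
    unfolding \<nu>_def
    by (rule LIMSEQ_le_const[OF c[of "\<delta> x" undefined]])
       (use Pop_iter_range[of 0 "\<delta> x" 1] in \<open>auto simp: \<delta>_def\<close>)
  moreover have "sum \<nu> UNIV = 1"
  proof -
    have "c (\<lambda>x. 1) = 1"
      by (rule LIMSEQ_unique[OF c[of _ undefined]]) (simp add: Pop_iter_const)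
    then show ?thesis using lin[of "\<lambda>x. 1"] by simp
  qed
  moreover have "(\<Sum>x\<in>UNIV. \<nu> x * P x x') = \<nu> x'" for x'
  proof -
    have 1: "Pop P (\<delta> x') = (\<lambda>x. P x x')" by (simp add: Pop_def \<delta>_def fun_eq_iff sum_indicator_left)
    have "(\<lambda>n. (Pop P ^^ n) (Pop P (\<delta> x')) undefined) \<longlonglongrightarrow> c (\<delta> x')"
      using LIMSEQ_Suc[OF c[of "\<delta> x'" undefined]] by (simp add: funpow_swap1)
    then have "c (Pop P (\<delta> x')) = c (\<delta> x')" using c LIMSEQ_unique by blast
    then show ?thesis using lin[of "Pop P (\<delta> x')"] unfolding 1 by (simp add: \<nu>_def ac_simps)
  qed
  ultimately show ?thesis unfolding invariant_prob_def by blast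
qed

lemma invariant_prob_inv_prob: "invariant_prob P (inv_prob P)"
proof -
  obtain \<nu> where \<nu>: "invariant_prob P \<nu>" using invariant_prob_exists by blast
  have "inv_prob P = \<nu>" unfolding inv_prob_def
    by (rule the_equality) (use \<nu> invariant_prob_unique in auto)
  with \<nu> show ?thesis by simp
qed

end

lemma primitiveI:
  assumes "stochastic P" "H1 P"
  shows "primitive P"
proof
  show "0 \<le> P x x'" "(\<Sum>x'\<in>UNIV. P x x') = 1" for x x' using assms by (auto simp: stochastic_def)
  obtain k0 where k0: "k0 \<ge> 1" "\<And>g x. (\<forall>x. g x \<ge> 0) \<and> (\<exists>x. g x \<noteq> 0) ==> (Pop P ^^ k0) g x > 0"
    using assms(2) unfolding H1_def by blast
  show "\<exists>k0\<ge>1. \<forall>x x'. (Pop P ^^ k0) (\<lambda>u. if u = x' then 1 else 0) x > 0"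
    by (rule exI[of _ k0]) (use k0 in auto)
qed

section \<open>The additive chain and its correctors\<close>

text \<open>The second component of an argument pair is the current position $y + S_k$; \<open>kop\<close> is the
  transition operator killed at the first position $\le 0$.\<close>

definition fop :: "('a::finite => 'a => real) => ('a => real) => ('a => real => real) => 'a => real => real" where
  "fop P f g x y = (\<Sum>x'\<in>UNIV. P x x' * g x' (y + f x'))"

definition kop :: "('a::finite => 'a => real) => ('a => real) => ('a => real => real) => 'a => real => real" where
  "kop P f g x y = (\<Sum>x'\<in>UNIV. P x x' * (if y + f x' > 0 then g x' (y + f x') else 0))"

lemma fop_iter_add: "(fop P f ^^ n) (\<lambda>x y. g x y + h x y) x y = (fop P f ^^ n) g x y + (fop P f ^^ n) h x y"
proof (induction n arbitrary: x y)
  case (Suc n)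
  then show ?case by (simp add: fop_def[of P f "(fop P f ^^ n) _"] algebra_simps sum.distrib)
qed simp

lemma fop_iter_mult: "(fop P f ^^ n) (\<lambda>x y. c * g x y) x y = c * (fop P f ^^ n) g x y"
proof (induction n arbitrary: x y)
  case (Suc n)
  then show ?case by (simp add: fop_def[of P f "(fop P f ^^ n) _"] algebra_simps sum_distrib_left)
qed simp

lemma fop_iter_diff: "(fop P f ^^ n) (\<lambda>x y. g x y - h x y) x y = (fop P f ^^ n) g x y - (fop P f ^^ n) h x y"
  using fop_iter_add[of n P f g "\<lambda>x y. (-1) * h x y" x y] fop_iter_mult[of n P f "-1" h x y] by simp

lemma fop_iter_shift: "(fop P f ^^ n) (\<lambda>x y. g x (y + v)) x y = (fop P f ^^ n) g x (y + v)"
proof (induction n arbitrary: x y)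
  case (Suc n)
  then show ?case by (simp add: fop_def[of P f "(fop P f ^^ n) _"] algebra_simps)
qed simp

lemma kop_iter_add: "(kop P f ^^ n) (\<lambda>x y. g x y + h x y) x y = (kop P f ^^ n) g x y + (kop P f ^^ n) h x y"
proof (induction n arbitrary: x y)
  case (Suc n)
  then show ?case
    by (simp add: kop_def[of P f "(kop P f ^^ n) _"] sum.distrib[symmetric] if_distrib algebra_simps cong: if_cong)
qed simp

lemma kop_iter_mult: "(kop P f ^^ n) (\<lambda>x y. c * g x y) x y = c * (kop P f ^^ n) g x y"
proof (induction n arbitrary: x y)
  case (Suc n)
  then show ?case
    by (simp add: kop_def[of P f "(kop P f ^^ n) _"] sum_distrib_left)
       (rule sum.cong, auto)
qed simp

lemma kop_iter_diff: "(kop P f ^^ n) (\<lambda>x y. g x y - h x y) x y = (kop P f ^^ n) g x y - (kop P f ^^ n) h x y"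
  using kop_iter_add[of n P f g "\<lambda>x y. (-1) * h x y" x y] kop_iter_mult[of n P f "-1" h x y] by simp

lemma funpow_add_apply: "(F ^^ (m + n)) g x y = (F ^^ m) ((F ^^ n) g) x y"
  by (simp add: funpow_add)

text \<open>The expression under the root in \<open>sigma\<close>, with the invariant law as an
  argument so that it can be compared between the chain and its reversal.\<close>

definition asym_var :: "('a::finite => 'a => real) => ('a => real) => ('a => real) => real" where
  "asym_var P f \<nu> = (\<Sum>x\<in>UNIV. \<nu> x * (f x)^2) + 2 * (\<Sum>n. (\<Sum>x\<in>UNIV. \<nu> x * f x * (Pop P ^^ (Suc n)) f x))"

locale centered_chain = primitive P for P :: "'a::finite => 'a => real" +
  fixes f \<nu> :: "'a => real"
  assumes invariant: "invariant_prob P \<nu>"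
    and centered: "(\<Sum>x\<in>UNIV. \<nu> x * f x) = 0"
begin

lemma nu_nonneg: "\<nu> x \<ge> 0" and nu_sum: "(\<Sum>x\<in>UNIV. \<nu> x) = 1"
  using invariant by (auto simp: invariant_prob_def)

lemma nu_Pop: "(\<Sum>x\<in>UNIV. \<nu> x * (Pop P ^^ n) g x) = (\<Sum>x\<in>UNIV. \<nu> x * g x)"
  by (rule invariant_iter[OF invariant])

lemma nu_pos: "\<nu> x > 0"
proof -
  obtain k0 where k0: "k0 \<ge> 1" "\<And>x x'. (Pop P ^^ k0) (\<lambda>u. if u = x' then 1 else 0) x > 0"
    using P_prim by blast
  obtain u where u: "\<nu> u > 0"
    using nu_sum nu_nonneg by (metis less_eq_real_def sum.neutral zero_neq_one)
  have "0 < \<nu> u * (Pop P ^^ k0) (\<lambda>u. if u = x then 1 else 0) u" using u k0 by simp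
  also have "\<dots> \<le> (\<Sum>w\<in>UNIV. \<nu> w * (Pop P ^^ k0) (\<lambda>u. if u = x then 1 else 0) w)"
    by (rule member_le_sum) (use nu_nonneg less_imp_le[OF k0(2)] in auto)
  also have "\<dots> = \<nu> x" by (simp add: nu_Pop sum_indicator_right)
  finally show ?thesis .
qed

text \<open>By invariance the \<open>\<nu>\<close>-mean of P^n g is that of g, so the distance to it
  is at most the oscillation of P^n g.\<close>

lemma geometric_ergodicity:
  "\<exists>C \<rho>. 0 \<le> C \<and> 0 < \<rho> \<and> \<rho> < 1 \<and> (\<forall>g n x. \<bar>(Pop P ^^ n) g x - (\<Sum>x\<in>UNIV. \<nu> x * g x)\<bar> \<le> C * \<rho> ^ n * l1norm g)"
proof -
  obtain C \<rho> where C: "0 \<le> C" "0 < \<rho>" "\<rho> < 1"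
    "\<And>g d n x x'. (\<forall>x x'. \<bar>g x - g x'\<bar> \<le> d) ==> \<bar>(Pop P ^^ n) g x - (Pop P ^^ n) g x'\<bar> \<le> C * \<rho> ^ n * d"
    using ergodic_contraction by metis
  have "\<bar>(Pop P ^^ n) g x - (\<Sum>x\<in>UNIV. \<nu> x * g x)\<bar> \<le> (2 * C) * \<rho> ^ n * l1norm g" for g n x
  proof -
    have d: "\<forall>x x'. \<bar>g x - g x'\<bar> \<le> 2 * l1norm g"
    proof (intro allI)
      fix x x' show "\<bar>g x - g x'\<bar> \<le> 2 * l1norm g"
        using l1norm_bound[of g x] l1norm_bound[of g x'] by linarith
    qed
    have "(Pop P ^^ n) g x - (\<Sum>x\<in>UNIV. \<nu> x * g x) = (\<Sum>x'\<in>UNIV. \<nu> x' * (Pop P ^^ n) g x) - (\<Sum>x'\<in>UNIV. \<nu> x' * (Pop P ^^ n) g x')"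
      by (simp add: nu_Pop sum_distrib_right[symmetric] nu_sum)
    also have "\<dots> = (\<Sum>x'\<in>UNIV. \<nu> x' * ((Pop P ^^ n) g x - (Pop P ^^ n) g x'))"
      by (simp add: sum_subtractf[symmetric] algebra_simps)
    also have "\<bar>\<dots>\<bar> \<le> (\<Sum>x'\<in>UNIV. \<nu> x' * (C * \<rho> ^ n * (2 * l1norm g)))"
    proof (rule order_trans[OF sum_abs], rule sum_mono)
      fix x' show "\<bar>\<nu> x' * ((Pop P ^^ n) g x - (Pop P ^^ n) g x')\<bar> \<le> \<nu> x' * (C * \<rho> ^ n * (2 * l1norm g))"
        using C(4)[OF d, of n x x'] nu_nonneg[of x'] by (auto simp: abs_mult intro!: mult_left_mono)
    qed
    also have "\<dots> = (2 * C) * \<rho> ^ n * l1norm g"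
      by (simp add: sum_distrib_right[symmetric] nu_sum)
    finally show ?thesis .
  qed
  then show ?thesis using C by (intro exI[of _ "2*C"] exI[of _ \<rho>]) auto
qed

section \<open>Poisson equations and the asymptotic variance\<close>

lemma Poisson_summable:
  assumes "(\<Sum>x\<in>UNIV. \<nu> x * g x) = 0"
  shows "summable (\<lambda>n. \<bar>(Pop P ^^ n) g x\<bar>)"
proof -
  obtain C \<rho> where C: "0 \<le> C" "0 < \<rho>" "\<rho> < 1"
    "\<And>g n x. \<bar>(Pop P ^^ n) g x - (\<Sum>x\<in>UNIV. \<nu> x * g x)\<bar> \<le> C * \<rho> ^ n * l1norm g"
    using geometric_ergodicity by metis
  have "summable (\<lambda>n. C * l1norm g * \<rho> ^ n)" using C by (intro summable_mult summable_geometric) auto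
  then show ?thesis
    by (rule summable_comparison_test'[where N=0]) (use C(4)[of _ g] assms in \<open>simp add: ac_simps\<close>)
qed

text \<open>The Neumann series of (I - P)^(-1), which converges on centred functions by geometric
  ergodicity.\<close>

lemma Poisson_solution:
  assumes "(\<Sum>x\<in>UNIV. \<nu> x * g x) = 0"
  shows "(\<Sum>n. (Pop P ^^ n) g x) = g x + Pop P (\<lambda>x. \<Sum>n. (Pop P ^^ n) g x) x"
proof -
  have s: "summable (\<lambda>n. (Pop P ^^ n) g x)" for x
    using Poisson_summable[OF assms] by (rule summable_rabs_cancel)
  have "Pop P (\<lambda>x. \<Sum>n. (Pop P ^^ n) g x) x = (\<Sum>x'\<in>UNIV. \<Sum>n. (Pop P ^^ n) g x' * P x x')"
    unfolding Pop_def by (simp add: suminf_mult2[OF s[unfolded Pop_def]])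
  also have "\<dots> = (\<Sum>n. \<Sum>x'\<in>UNIV. (Pop P ^^ n) g x' * P x x')"
    by (rule suminf_sum[symmetric]) (intro summable_mult2 s)
  also have "\<dots> = (\<Sum>n. (Pop P ^^ Suc n) g x)" by (simp add: Pop_def[of P "(Pop P ^^ _) g"])
  also have "\<dots> = (\<Sum>n. (Pop P ^^ n) g x) - g x"
    using suminf_split_head[OF s[of x]] by simp
  finally show ?thesis by simp
qed

text \<open>With this \<open>rr\<close>, the function $y + \mathit{rr}(x)$ is harmonic for \<open>fop P f\<close>.\<close>

definition rr :: "'a => real" where "rr x = (\<Sum>n. (Pop P ^^ n) f x) - f x"

text \<open>The conditional variance of one increment of the martingale y +
  \<open>rr\<close>.\<close>

definition step_var :: "'a => real" where "step_var x = (\<Sum>x'\<in>UNIV. P x x' * (f x' + rr x' - rr x)^2)"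

definition s2 :: real where "s2 = asym_var P f \<nu>"

text \<open>The conditional variance of the martingale depends on the state; this second corrector
  solves the Poisson equation that replaces it by its mean \<open>s2\<close>.\<close>

definition qq :: "'a => real" where "qq x = (\<Sum>n. (Pop P ^^ n) (\<lambda>x. (step_var x - s2) / 2) x)"

lemma rr_eq: "(\<Sum>x'\<in>UNIV. P x x' * (f x' + rr x')) = rr x"
proof -
  have "(\<Sum>x'\<in>UNIV. P x x' * (f x' + rr x')) = Pop P (\<lambda>x. \<Sum>n. (Pop P ^^ n) f x) x"
    unfolding rr_def Pop_def[of P "\<lambda>x. \<Sum>n. _ n x"] by (simp add: mult.commute)
  then show ?thesis using Poisson_solution[of f x] centered unfolding rr_def by simp
qed

lemma mean_step: "(\<Sum>x'\<in>UNIV. P x x' * (f x' + rr x' - rr x)) = 0"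
proof -
  have "(\<Sum>x'\<in>UNIV. P x x' * (f x' + rr x' - rr x)) = (\<Sum>x'\<in>UNIV. P x x' * (f x' + rr x')) - (\<Sum>x'\<in>UNIV. P x x') * rr x"
    unfolding sum_distrib_right sum_subtractf[symmetric] by (simp add: algebra_simps)
  then show ?thesis using P_sum rr_eq by simp
qed

text \<open>The series starts at n = 1: the position already contains f of the current state, so
  only future increments enter the corrector.\<close>

lemma rr_suminf: "rr x = (\<Sum>n. (Pop P ^^ Suc n) f x)"
  using suminf_split_head[OF summable_rabs_cancel[OF Poisson_summable[OF centered]], of x]
  unfolding rr_def by simp

lemma s2_eq: "s2 = (\<Sum>x\<in>UNIV. \<nu> x * (f x)^2) + 2 * (\<Sum>x\<in>UNIV. \<nu> x * f x * rr x)"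
proof -
  have s: "summable (\<lambda>n. (Pop P ^^ Suc n) f x)" for x
    using summable_rabs_cancel[OF Poisson_summable[OF centered]] by (subst summable_Suc_iff)
  have "(\<Sum>n. \<Sum>x\<in>UNIV. \<nu> x * f x * (Pop P ^^ Suc n) f x) = (\<Sum>x\<in>UNIV. \<Sum>n. \<nu> x * f x * (Pop P ^^ Suc n) f x)"
    by (rule suminf_sum) (intro summable_mult s)
  also have "\<dots> = (\<Sum>x\<in>UNIV. \<nu> x * f x * rr x)"
    unfolding rr_suminf by (intro sum.cong refl suminf_mult s)
  finally show ?thesis unfolding s2_def asym_var_def by simp
qed

lemma step_var_eq: "step_var x = (\<Sum>x'\<in>UNIV. P x x' * (f x' + rr x')^2) - (rr x)^2"
proof -
  have "step_var x = (\<Sum>x'\<in>UNIV. P x x' * (f x' + rr x')^2 - 2 * rr x * (P x x' * (f x' + rr x')) + P x x' * (rr x)^2)"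
    unfolding step_var_def by (intro sum.cong refl) (simp add: power2_eq_square algebra_simps)
  also have "\<dots> = (\<Sum>x'\<in>UNIV. P x x' * (f x' + rr x')^2) - 2 * rr x * rr x + (rr x)^2"
    by (simp add: sum.distrib sum_subtractf sum_distrib_left[symmetric] sum_distrib_right[symmetric] rr_eq P_sum)
  finally show ?thesis by (simp add: power2_eq_square)
qed

text \<open>Under \<open>\<nu>\<close> the mean of (f + rr)^2 - rr^2 is that of f^2 + 2 f rr, and f
  rr collects all covariances at positive lags.\<close>

lemma nu_step_var: "(\<Sum>x\<in>UNIV. \<nu> x * step_var x) = s2"
proof -
  have "(\<Sum>x\<in>UNIV. \<nu> x * step_var x) = (\<Sum>x\<in>UNIV. \<nu> x * (Pop P ^^ 1) (\<lambda>x'. (f x' + rr x')^2) x) - (\<Sum>x\<in>UNIV. \<nu> x * (rr x)^2)"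
    by (simp add: step_var_eq Pop_def sum_subtractf[symmetric] algebra_simps)
  also have "\<dots> = (\<Sum>x\<in>UNIV. \<nu> x * (f x + rr x)^2) - (\<Sum>x\<in>UNIV. \<nu> x * (rr x)^2)"
    by (simp only: nu_Pop)
  also have "\<dots> = s2" unfolding s2_eq
    by (simp add: sum_subtractf[symmetric] sum.distrib[symmetric] sum_distrib_left power2_eq_square algebra_simps)
  finally show ?thesis .
qed

lemma qq_eq: "(\<Sum>x'\<in>UNIV. P x x' * qq x') = qq x - (step_var x - s2) / 2"
proof -
  have "(\<Sum>x\<in>UNIV. \<nu> x * ((step_var x - s2) / 2)) = ((\<Sum>x\<in>UNIV. \<nu> x * step_var x) - (\<Sum>x\<in>UNIV. \<nu> x) * s2) / 2"
    by (simp add: sum_distrib_right sum_subtractf[symmetric] sum_divide_distrib algebra_simps diff_divide_distrib)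
  then have "(\<Sum>x\<in>UNIV. \<nu> x * ((step_var x - s2) / 2)) = 0" using nu_step_var nu_sum by simp
  from Poisson_solution[OF this, of x] show ?thesis unfolding qq_def
    by (simp add: Pop_def[of P "\<lambda>x. \<Sum>n. _ n x"] mult.commute)
qed

lemma s2_nonneg: "s2 \<ge> 0"
  unfolding nu_step_var[symmetric] step_var_def
  by (intro sum_nonneg mult_nonneg_nonneg nu_nonneg P_nonneg) auto

text \<open>Zero variance forces every martingale increment on an allowed transition to vanish, as
  \<open>\<nu>\<close> charges every state.\<close>

lemma s2_zero_coboundary:
  assumes "s2 = 0" "P x x' > 0"
  shows "f x' = rr x - rr x'"
proof -
  have "\<forall>x\<in>UNIV. \<nu> x * step_var x = 0"
    using assms(1) unfolding nu_step_var[symmetric]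
    by (subst (asm) sum_nonneg_eq_0_iff)
       (auto intro!: sum_nonneg mult_nonneg_nonneg nu_nonneg P_nonneg simp: step_var_def)
  then have "\<nu> x = 0 \<or> step_var x = 0" by simp
  then have "step_var x = 0" using nu_pos[of x] by linarith
  then have "\<forall>x'\<in>UNIV. P x x' * (f x' + rr x' - rr x)^2 = 0"
    unfolding step_var_def by (subst (asm) sum_nonneg_eq_0_iff) (auto intro!: mult_nonneg_nonneg P_nonneg)
  then show ?thesis using assms(2) by (auto simp: power2_eq_square dest!: spec[of _ x'])
qed

text \<open>A coboundary sums to zero around every closed path of the chain, so one cycle with
  nonzero sum excludes the degenerate case.\<close>

lemma s2_pos_if_cycle:
  assumes "(\<Prod>k<n. P (xs k) (xs (Suc k))) * P (xs n) (xs 0) > 0" "(\<Sum>k\<le>n. f (xs k)) \<noteq> 0"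
  shows "s2 > 0"
proof (rule ccontr)
  assume "\<not> s2 > 0"
  then have s: "s2 = 0" using s2_nonneg by simp
  have n0: "(\<Prod>k<n. P (xs k) (xs (Suc k))) \<noteq> 0" "P (xs n) (xs 0) \<noteq> 0" using assms(1) by (metis mult_zero_left less_irrefl, metis mult_zero_right less_irrefl)
  have pos: "P (xs n) (xs 0) > 0" "\<And>k. k < n ==> P (xs k) (xs (Suc k)) > 0"
    using n0 P_nonneg by (auto simp: order_less_le prod_zero_iff)
  have "(\<Sum>k<m. f (xs (Suc k))) = rr (xs 0) - rr (xs m)" if "m \<le> n" for m
    using that
  proof (induction m)
    case (Suc m)
    then show ?case using s2_zero_coboundary[OF s pos(2)[of m]] by simp
  qed simp
  then have "(\<Sum>k<n. f (xs (Suc k))) + f (xs 0) = 0"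
    using s2_zero_coboundary[OF s pos(1)] by simp
  moreover have "(\<Sum>k\<le>n. f (xs k)) = f (xs 0) + (\<Sum>k<n. f (xs (Suc k)))"
    by (simp add: sum.atMost_shift)
  ultimately show False using assms(2) by simp
qed

end

section \<open>The survival probability\<close>

context primitive
begin

lemma fop_mono: "(\<And>x y. g x y \<le> h x y) ==> fop P f g x y \<le> fop P f h x y"
  unfolding fop_def by (intro sum_mono mult_left_mono P_nonneg)

lemma fop_iter_mono: "(\<And>x y. g x y \<le> h x y) ==> (fop P f ^^ n) g x y \<le> (fop P f ^^ n) h x y"
proof (induction n arbitrary: x y)
  case (Suc n)
  then show ?case by (simp add: fop_mono)
qed simp

lemma fop_iter_const: "(fop P f ^^ n) (\<lambda>x y. c) x y = c"
proof (induction n arbitrary: x y)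
  case (Suc n)
  then show ?case by (simp add: fop_def[of P f "(fop P f ^^ n) _"] sum_distrib_right[symmetric] P_sum)
qed simp

lemma fop_iter_abs_le:
  assumes "\<And>x y. \<bar>g x y\<bar> \<le> h x y"
  shows "\<bar>(fop P f ^^ n) g x y\<bar> \<le> (fop P f ^^ n) h x y"
proof -
  have "(fop P f ^^ n) (\<lambda>x y. - 1 * g x y) x y \<le> (fop P f ^^ n) h x y" "(fop P f ^^ n) g x y \<le> (fop P f ^^ n) h x y"
    by (rule fop_iter_mono; use assms in \<open>smt (verit)\<close>)+
  then show ?thesis unfolding fop_iter_mult by (simp add: abs_le_iff)
qed

lemma fop_iter_bound:
  "(\<And>x y. \<bar>g x y\<bar> \<le> c) ==> \<bar>(fop P f ^^ n) g x y\<bar> \<le> c"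
  using fop_iter_abs_le[of g "\<lambda>x y. c" n f x y] by (simp add: fop_iter_const)

lemma kop_mono: "(\<And>x y. y > 0 ==> g x y \<le> h x y) ==> kop P f g x y \<le> kop P f h x y"
  unfolding kop_def by (intro sum_mono mult_left_mono P_nonneg) auto

lemma kop_iter_mono:
  "(\<And>x y. y > 0 ==> g x y \<le> h x y) ==> n > 0 \<or> y > 0 ==> (kop P f ^^ n) g x y \<le> (kop P f ^^ n) h x y"
proof (induction n arbitrary: x y)
  case (Suc n)
  have "kop P f ((kop P f ^^ n) g) x y \<le> kop P f ((kop P f ^^ n) h) x y"
    by (rule kop_mono) (use Suc in auto)
  then show ?case by simp
qed auto

lemma kop_iter_zero: "(kop P f ^^ n) (\<lambda>x y. 0) x y = 0"
  using kop_iter_mult[of n P f 0 "\<lambda>x y. 0" x y] by simp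

lemma kop_iter_nonneg: "(\<And>x y. y > 0 ==> 0 \<le> g x y) ==> n > 0 \<or> y > 0 ==> 0 \<le> (kop P f ^^ n) g x y"
  using kop_iter_mono[of "\<lambda>x y. 0" g n y f x] by (simp add: kop_iter_zero)

lemma kop_iter_abs_le:
  assumes "\<And>x y. y > 0 ==> \<bar>g x y\<bar> \<le> h x y" "n > 0 \<or> y > 0"
  shows "\<bar>(kop P f ^^ n) g x y\<bar> \<le> (kop P f ^^ n) h x y"
proof -
  have "(kop P f ^^ n) (\<lambda>x y. - 1 * g x y) x y \<le> (kop P f ^^ n) h x y" "(kop P f ^^ n) g x y \<le> (kop P f ^^ n) h x y"
    by (rule kop_iter_mono; use assms in \<open>smt (verit)\<close>)+
  then show ?thesis unfolding kop_iter_mult by (simp add: abs_le_iff)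
qed

lemma kop_le_fop: "(\<And>x y. 0 \<le> g x y) ==> kop P f g x y \<le> fop P f g x y"
  unfolding kop_def fop_def by (intro sum_mono mult_left_mono P_nonneg) auto

lemma kop_below: "y \<le> - l1norm f ==> kop P f g x y = 0"
proof -
  assume "y \<le> - l1norm f"
  then have "\<not> y + f x' > 0" for x' using l1norm_bound[of f x'] by linarith
  then show ?thesis by (simp add: kop_def)
qed

lemma fop_iter_nonneg: "(\<And>x y. 0 \<le> g x y) ==> 0 \<le> (fop P f ^^ n) g x y"
  using fop_iter_mono[of "\<lambda>x y. 0" g n f x y] by (simp add: fop_iter_const)

lemma kop_iter_le_fop_iter:
  assumes "\<And>x y. 0 \<le> g x y"
  shows "0 \<le> (kop P f ^^ n) g x y \<and> (kop P f ^^ n) g x y \<le> (fop P f ^^ n) g x y"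
proof (induction n arbitrary: x y)
  case (Suc n)
  have "0 \<le> kop P f ((kop P f ^^ n) g) x y"
    unfolding kop_def[of P f "(kop P f ^^ n) g"] using Suc by (intro sum_nonneg mult_nonneg_nonneg P_nonneg) auto
  moreover have "kop P f ((kop P f ^^ n) g) x y \<le> fop P f ((kop P f ^^ n) g) x y"
    by (rule kop_le_fop) (use Suc in auto)
  moreover have "fop P f ((kop P f ^^ n) g) x y \<le> fop P f ((fop P f ^^ n) g) x y"
    by (rule fop_mono) (use Suc in auto)
  ultimately show ?case by simp
qed (use assms in auto)

definition surv :: "('a => real) => nat => 'a => real => real" where
  "surv f n x y = (kop P f ^^ n) (\<lambda>x y. 1) x y"

lemma surv_range: "0 \<le> surv f n x y" "surv f n x y \<le> 1"
  using kop_iter_le_fop_iter[of "\<lambda>x y. 1" n f x y] by (auto simp: surv_def fop_iter_const)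

lemma kop_iter_sup_bound:
  assumes "\<And>x y. y > 0 ==> \<bar>g x y\<bar> \<le> c" "n > 0 \<or> y > 0"
  shows "\<bar>(kop P f ^^ n) g x y\<bar> \<le> c * surv f n x y"
  using kop_iter_abs_le[of g "\<lambda>x y. c * 1" n y f x] assms kop_iter_mult[of n P f c "\<lambda>x y. 1" x y]
  by (simp add: surv_def)

end

locale pos_chain = centered_chain +
  assumes s2_pos: "s2 > 0"
begin

lemma fop_linear: "fop P f (\<lambda>x y. y + rr x) x y = y + rr x"
proof -
  have "fop P f (\<lambda>x y. y + rr x) x y = (\<Sum>x'\<in>UNIV. P x x') * y + (\<Sum>x'\<in>UNIV. P x x' * (f x' + rr x'))"
    unfolding fop_def sum_distrib_right sum.distrib[symmetric] by (simp add: algebra_simps)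
  then show ?thesis by (simp add: P_sum rr_eq)
qed

text \<open>The square of the martingale drifts by \<open>step_var\<close>; adding 2
  \<open>qq\<close> makes the drift the constant \<open>s2\<close>.\<close>

lemma fop_quadratic: "fop P f (\<lambda>x y. (y + rr x)^2 + 2 * qq x) x y = (y + rr x)^2 + 2 * qq x + s2"
proof -
  have "fop P f (\<lambda>x y. (y + rr x)^2 + 2 * qq x) x y =
     (\<Sum>x'\<in>UNIV. P x x') * (y + rr x)^2 + 2 * (y + rr x) * (\<Sum>x'\<in>UNIV. P x x' * (f x' + rr x' - rr x))
      + step_var x + 2 * (\<Sum>x'\<in>UNIV. P x x' * qq x')"
    unfolding fop_def sum_distrib_right sum_distrib_left step_var_def sum.distrib[symmetric]
    by (intro sum.cong refl) (simp add: power2_eq_square algebra_simps)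
  then show ?thesis unfolding P_sum mean_step qq_eq by (simp add: diff_divide_distrib)
qed

lemma fop_iter_quadratic:
  "(fop P f ^^ n) (\<lambda>x y. (y + rr x)^2 + 2 * qq x) x y = (y + rr x)^2 + 2 * qq x + n * s2"
proof (induction n arbitrary: x y)
  case (Suc n)
  have "(fop P f ^^ Suc n) (\<lambda>x y. (y + rr x)^2 + 2 * qq x) x y
     = fop P f (\<lambda>x y. ((y + rr x)^2 + 2 * qq x) + n * s2) x y"
    using Suc by (simp add: fop_def[of P f "(fop P f ^^ n) _"] fop_def[of P f "\<lambda>x y. ((y + rr x)^2 + 2 * qq x) + n * s2"])
  also have "\<dots> = fop P f (\<lambda>x y. (y + rr x)^2 + 2 * qq x) x y + n * s2"
    using fop_iter_add[of 1 P f "\<lambda>x y. (y + rr x)^2 + 2 * qq x" "\<lambda>x y. n * s2" x y] fop_iter_const[where n=1]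
    by simp
  finally show ?case unfolding fop_quadratic by (simp add: distrib_right)
qed simp

text \<open>The first moment comes from the quadratic martingale through 2 \<alpha> |v| \<le>
  \<alpha>^2 + v^2, which avoids a Cauchy-Schwarz inequality for \<open>fop\<close>.\<close>

lemma abs_moment:
  "\<exists>C>0. \<forall>n x y. (fop P f ^^ n) (\<lambda>x w. \<bar>w - y\<bar>) x y \<le> C * sqrt (1 + real n)"
proof -
  define c where "c = (l1norm rr)^2 + 2 * l1norm qq"
  have c0: "c \<ge> 0" unfolding c_def using l1norm_nonneg[of qq] by simp
  have main: "(fop P f ^^ n) (\<lambda>x w. \<bar>w - y\<bar>) x y \<le> (1 + 2 * c + s2 + 1) * sqrt (1 + real n)" for n x y
  proof -
    \<comment> \<open>The diffusive scale, which balances the two terms of the quadratic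
      inequality.\<close>
    define \<alpha> where "\<alpha> = sqrt (1 + real n)"
    have a: "\<alpha> > 0" "\<alpha>^2 = 1 + n" "\<alpha> \<ge> 1" unfolding \<alpha>_def by auto
    have pw: "\<bar>w - y\<bar> \<le> \<alpha>/2 + c/\<alpha> + (1/\<alpha>) * ((w - y + rr x)^2 + 2 * qq x)" for x w
    proof -
      have r2: "(rr x)^2 \<le> (l1norm rr)^2" using l1norm_bound[of rr x] l1norm_nonneg[of rr]
        by (metis abs_le_square_iff abs_of_nonneg)
      have q2: "- l1norm qq \<le> qq x" using l1norm_bound[of qq x] by linarith
      have "(w - y)^2 \<le> 2 * (w - y + rr x)^2 + 2 * (rr x)^2"
        using zero_le_power2[of "(w - y) + 2 * rr x"] by (simp add: power2_eq_square algebra_simps)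
      then have sq: "(w-y)^2 \<le> 2 * ((w - y + rr x)^2 + 2 * qq x) + 2 * c"
      proof -
        assume *: "(w - y)^2 \<le> 2 * (w - y + rr x)^2 + 2 * (rr x)^2"
        define A where "A = (w - y + rr x)^2"
        define E where "E = (w - y)^2"
        define r where "r = (rr x)^2"
        define L where "L = (l1norm rr)^2"
        have 1: "E \<le> 2 * A + 2 * L" using * r2 unfolding A_def[symmetric] E_def[symmetric] r_def[symmetric] L_def[symmetric] by argo
        have 2: "0 \<le> 4 * qq x + 4 * l1norm qq" using q2 by argo
        show ?thesis unfolding c_def A_def[symmetric] E_def[symmetric] L_def[symmetric] using 1 2 by argo
      qed
      have "0 \<le> (\<alpha> - \<bar>w-y\<bar>)^2" by simp
      then have "2 * \<alpha> * \<bar>w-y\<bar> \<le> \<alpha>^2 + (w-y)^2" by (simp add: power2_eq_square algebra_simps)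
      then have "2 * \<alpha> * \<bar>w-y\<bar> \<le> \<alpha>^2 + 2 * c + 2 * ((w - y + rr x)^2 + 2 * qq x)" using sq by linarith
      then have "\<bar>w-y\<bar> \<le> (\<alpha>^2 + 2 * c + 2 * ((w - y + rr x)^2 + 2 * qq x)) / (2 * \<alpha>)"
        using a(1) by (simp only: pos_le_divide_eq) (simp only: mult.commute)
      also have "\<dots> = \<alpha>/2 + c/\<alpha> + (1/\<alpha>) * ((w - y + rr x)^2 + 2 * qq x)"
        using a(1) by (simp add: add_divide_distrib power2_eq_square[of \<alpha>])
      finally show ?thesis .
    qed
    have "(fop P f ^^ n) (\<lambda>x w. \<bar>w - y\<bar>) x y \<le> (fop P f ^^ n) (\<lambda>x w. (\<alpha>/2 + c/\<alpha>) + (1/\<alpha>) * ((w - y + rr x)^2 + 2 * qq x)) x y"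
      by (rule fop_iter_mono) (use pw in auto)
    also have "\<dots> = (\<alpha>/2 + c/\<alpha>) + (1/\<alpha>) * ((fop P f ^^ n) (\<lambda>x w. (w - y + rr x)^2 + 2 * qq x) x y)"
      by (simp only: fop_iter_add fop_iter_mult fop_iter_const)
    also have "(fop P f ^^ n) (\<lambda>x w. (w - y + rr x)^2 + 2 * qq x) x y = (rr x)^2 + 2 * qq x + n * s2"
      using fop_iter_shift[of n P f "\<lambda>x w. (w + rr x)^2 + 2 * qq x" "-y" x y] fop_iter_quadratic[of n x 0] by simp
    also have "(1/\<alpha>) * \<dots> \<le> (1/\<alpha>) * (c + \<alpha>^2 * s2)"
    proof (rule mult_left_mono)
      have r2: "(rr x)^2 \<le> (l1norm rr)^2" using l1norm_bound[of rr x] l1norm_nonneg[of rr]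
        by (metis abs_le_square_iff abs_of_nonneg)
      have "qq x \<le> l1norm qq" using l1norm_bound[of qq x] by linarith
      then show "(rr x)^2 + 2 * qq x + n * s2 \<le> c + \<alpha>^2 * s2" unfolding c_def a(2) using r2 s2_pos by (simp add: algebra_simps)
    qed (use a in auto)
    also have "(\<alpha>/2 + c/\<alpha>) + (1/\<alpha>) * (c + \<alpha>^2 * s2) = \<alpha>/2 + 2 * (c/\<alpha>) + \<alpha> * s2" using a(1)
      by (simp add: field_simps power2_eq_square)
    also have "\<dots> \<le> (1 + 2 * c + s2 + 1) * \<alpha>"
    proof -
      have "c / \<alpha> \<le> c" using a(1,3) c0 by (simp add: pos_divide_le_eq) (metis mult_right_mono mult.commute mult.left_neutral)
      also have "c \<le> c * \<alpha>" using a(3) c0 by (simp add: mult_le_cancel_left1)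
      finally show ?thesis using a(1) by (simp add: algebra_simps)
    qed
    finally show ?thesis unfolding \<alpha>_def by simp
  qed
  show ?thesis
    by (rule exI[of _ "1 + 2 * c + s2 + 1"]) (use main c0 s2_pos in auto)
qed

text \<open>With L = sqrt n, surviving n steps means either reaching L before dying, which the
  linear martingale bounds by O((1 + y)/L), or staying n steps in (0, L). The mean time spent in the
  strip is O(L (1 + y)) by the quadratic martingale, so Markov's inequality gives the same order for
  the second case.\<close>

lemma survival_bound:
  "\<exists>C>0. \<forall>n\<ge>1. \<forall>x y. surv f n x y \<le> C * (1 + max y 0) / sqrt n"
proof -
  define F where "F = l1norm f"
  define R where "R = l1norm rr"
  define K where "K = l1norm qq"
  \<comment> \<open>Starting at height at least -F, one step leads no lower than -2F;
    \<open>c0\<close> keeps the corrected height nonnegative there.\<close>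
  define c0 where "c0 = 2 * F + R"
  define c1 where "c1 = c0^2 + 2 * K"
  have F: "\<bar>f x\<bar> \<le> F" "0 \<le> F" and R: "\<bar>rr x\<bar> \<le> R" "0 \<le> R" and K: "\<bar>qq x\<bar> \<le> K" "0 \<le> K" for x
    unfolding F_def R_def K_def by (rule l1norm_bound l1norm_nonneg)+
  have main: "surv f n x y \<le> (2 * c0 + (2 * c0 + c1 + 2 * K + 1)/s2 + 1) * (1 + max y 0) / sqrt n"
    if n: "n \<ge> 1" for n x y
  proof -
    define L where "L = sqrt n"
    have L: "L \<ge> 1" "L^2 = n" "L > 0" using n unfolding L_def by auto
    \<comment> \<open>A harmonic function of the free chain, nonnegative at all heights that occur
      and at least 1 above L: it dominates the probability of passing L.\<close>
    define \<Lambda> where "\<Lambda> x y = (1/L) * ((y + rr x) + c0)" for x y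
    have fL: "fop P f \<Lambda> x y = \<Lambda> x y" for x y
      unfolding \<Lambda>_def
      using fop_iter_mult[of 1 P f "1/L" "\<lambda>x y. (y + rr x) + c0"] fop_iter_add[of 1 P f "\<lambda>x y. y + rr x" "\<lambda>x y. c0"]
       fop_iter_const[where n=1] by (simp add: fop_linear)
    have L1: "\<Lambda> x y \<ge> 1" if "y \<ge> L" for x y
      using that L R(1)[of x] F unfolding \<Lambda>_def c0_def by (simp add: field_simps)
    have L0: "\<Lambda> x y \<ge> 0" if "y \<ge> - 2 * F" for x y
      using that L R(1)[of x] F unfolding \<Lambda>_def c0_def by (intro mult_nonneg_nonneg) auto
    \<comment> \<open>The transition operator killed on leaving the strip (0, L).\<close>
    define B where "B g x y = (\<Sum>x'\<in>UNIV. P x x' * (if 0 < y + f x' \<and> y + f x' < L then g x' (y + f x') else 0))" for g x y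
    have B01: "0 \<le> (B ^^ n) (\<lambda>x y. 1) x y \<and> (B ^^ n) (\<lambda>x y. 1) x y \<le> 1" for n x y
    proof (induction n arbitrary: x y)
      case (Suc n)
      have "0 \<le> B ((B ^^ n) (\<lambda>x y. 1)) x y"
        unfolding B_def[of "(B ^^ n) _"] using Suc by (intro sum_nonneg mult_nonneg_nonneg P_nonneg) auto
      moreover have "B ((B ^^ n) (\<lambda>x y. 1)) x y \<le> (\<Sum>x'\<in>UNIV. P x x' * 1)"
        unfolding B_def[of "(B ^^ n) _"] using Suc by (intro sum_mono mult_left_mono P_nonneg) auto
      ultimately show ?case using P_sum by simp
    qed simp
    have Bdec: "(B ^^ Suc n) (\<lambda>x y. 1) x y \<le> (B ^^ n) (\<lambda>x y. 1) x y" for n x y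
    proof (induction n arbitrary: x y)
      case 0 then show ?case using B01[of 1] by simp
    next
      case (Suc n)
      have "B ((B ^^ Suc n) (\<lambda>x y. 1)) x y \<le> B ((B ^^ n) (\<lambda>x y. 1)) x y"
        unfolding B_def[of "(B ^^ Suc n) _"] B_def[of "(B ^^ n) _"] using Suc
        by (intro sum_mono mult_left_mono P_nonneg) auto
      then show ?case by simp
    qed
    have one: "surv f n x y \<le> (B ^^ n) (\<lambda>x y. 1) x y + \<Lambda> x y" if "y \<ge> - F" for n x y
      using that
    proof (induction n arbitrary: x y)
      case 0
      then show ?case using L0[of y x] F by (simp add: surv_def)
    next
      case (Suc n)
      have "surv f (Suc n) x y = (\<Sum>x'\<in>UNIV. P x x' * (if y + f x' > 0 then surv f n x' (y + f x') else 0))"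
        unfolding surv_def by (simp add: kop_def[of P f "(kop P f ^^ n) _"])
      also have "\<dots> \<le> (\<Sum>x'\<in>UNIV. P x x' * ((if 0 < y + f x' \<and> y + f x' < L then (B ^^ n) (\<lambda>x y. 1) x' (y + f x') else 0) + \<Lambda> x' (y + f x')))"
      proof (intro sum_mono mult_left_mono P_nonneg)
        fix x'
        have "y + f x' \<ge> - 2 * F" using Suc.prems F(1)[of x'] by linarith
        then show "(if y + f x' > 0 then surv f n x' (y + f x') else 0) \<le> (if 0 < y + f x' \<and> y + f x' < L then (B ^^ n) (\<lambda>x y. 1) x' (y + f x') else 0) + \<Lambda> x' (y + f x')"
          using L0[of "y + f x'" x'] L1[of "y + f x'" x'] surv_range(2)[of f n x' "y + f x'"] Suc.IH[of "y + f x'" x'] F(2)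
          by auto
      qed
      also have "\<dots> = B ((B ^^ n) (\<lambda>x y. 1)) x y + fop P f \<Lambda> x y"
        by (simp add: B_def[of "(B ^^ n) _"] fop_def distrib_left sum.distrib)
      finally show ?case by (simp add: fL)
    qed
    \<comment> \<open>A function with drift exactly -1, the discrete analogue of y (L - y)/s2,
      raised so that it stays nonnegative one step outside the strip. It dominates the mean time
      spent in the strip.\<close>
    define \<Phi> where "\<Phi> x y = (1/s2) * ((L * (y + rr x) + (-1) * ((y + rr x)^2 + 2 * qq x)) + (L * c0 + c1))" for x y
    have f\<Phi>: "fop P f \<Phi> x y = \<Phi> x y - 1" for x y
    proof -
      have "fop P f \<Phi> x y = (1/s2) * ((L * (y + rr x) + (-1) * ((y + rr x)^2 + 2 * qq x + s2)) + (L * c0 + c1))"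
        unfolding \<Phi>_def
        using fop_iter_mult[of 1 P f "1/s2" "\<lambda>x y. (L * (y + rr x) + (-1) * ((y + rr x)^2 + 2 * qq x)) + (L * c0 + c1)"]
          fop_iter_add[of 1 P f "\<lambda>x y. L * (y + rr x) + (-1) * ((y + rr x)^2 + 2 * qq x)" "\<lambda>x y. L * c0 + c1"]
          fop_iter_add[of 1 P f "\<lambda>x y. L * (y + rr x)" "\<lambda>x y. (-1) * ((y + rr x)^2 + 2 * qq x)"]
          fop_iter_mult[of 1 P f L "\<lambda>x y. y + rr x"] fop_iter_mult[of 1 P f "-1" "\<lambda>x y. (y + rr x)^2 + 2 * qq x"]
          fop_iter_const[where n=1]
        by (simp only: One_nat_def funpow.simps o_apply id_apply fop_linear fop_quadratic)
      then show ?thesis unfolding \<Phi>_def using s2_pos by (simp add: field_simps)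
    qed
    have \<Phi>0: "\<Phi> x y \<ge> 0" if "y \<ge> - 2 * F" "y \<le> L + 2 * F" for x y
    proof -
      define m where "m = y + rr x + c0"
      have m: "0 \<le> m" "m \<le> L + 2 * c0" unfolding m_def c0_def distrib_left using that R(1)[of x] R(2) F(2) by linarith+
      have "0 \<le> m * (L + 2 * c0 - m)" using m by simp
      also have "\<dots> = L * (y + rr x) - (y + rr x)^2 + L * c0 + c0^2"
        unfolding m_def by (simp add: power2_eq_square algebra_simps)
      finally have "0 \<le> L * (y + rr x) + (-1) * ((y + rr x)^2 + 2 * qq x) + (L * c0 + c1)"
        unfolding c1_def distrib_left[of "-1"] using abs_le_D1[OF K(1)[of x]] by linarith
      then show ?thesis unfolding \<Phi>_def using s2_pos by (intro mult_nonneg_nonneg) auto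
    qed
    have U: "(\<Sum>i<n. (B ^^ i) (\<lambda>x y. 1) x y) \<le> \<Phi> x y" if "y \<ge> - F" "y \<le> L + F" for n x y
      using that
    proof (induction n arbitrary: x y)
      case 0 then show ?case using \<Phi>0[of y x] F by simp
    next
      case (Suc n)
      have "(\<Sum>i<Suc n. (B ^^ i) (\<lambda>x y. 1) x y) = 1 + (\<Sum>i<n. (B ^^ Suc i) (\<lambda>x y. 1) x y)"
        by (subst sum.lessThan_Suc_shift) simp
      also have "(\<Sum>i<n. (B ^^ Suc i) (\<lambda>x y. 1) x y) = (\<Sum>x'\<in>UNIV. P x x' * (if 0 < y + f x' \<and> y + f x' < L then (\<Sum>i<n. (B ^^ i) (\<lambda>x y. 1) x' (y + f x')) else 0))"
      proof -
        have "(\<Sum>i<n. (B ^^ Suc i) (\<lambda>x y. 1) x y) = (\<Sum>i<n. \<Sum>x'\<in>UNIV. P x x' * (if 0 < y + f x' \<and> y + f x' < L then (B ^^ i) (\<lambda>x y. 1) x' (y + f x') else 0))"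
          by (simp add: B_def[of "(B ^^ _) _"])
        also have "\<dots> = (\<Sum>x'\<in>UNIV. \<Sum>i<n. P x x' * (if 0 < y + f x' \<and> y + f x' < L then (B ^^ i) (\<lambda>x y. 1) x' (y + f x') else 0))"
          by (rule sum.swap)
        also have "\<dots> = (\<Sum>x'\<in>UNIV. P x x' * (if 0 < y + f x' \<and> y + f x' < L then (\<Sum>i<n. (B ^^ i) (\<lambda>x y. 1) x' (y + f x')) else 0))"
          by (intro sum.cong refl) (auto simp: sum_distrib_left)
        finally show ?thesis .
      qed
      also have "\<dots> \<le> fop P f \<Phi> x y" unfolding fop_def
      proof (intro sum_mono mult_left_mono P_nonneg)
        fix x'
        have "y + f x' \<ge> - 2 * F" "y + f x' \<le> L + 2 * F" using Suc.prems F(1)[of x'] by linarith+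
        then show "(if 0 < y + f x' \<and> y + f x' < L then (\<Sum>i<n. (B ^^ i) (\<lambda>x y. 1) x' (y + f x')) else 0) \<le> \<Phi> x' (y + f x')"
          using \<Phi>0[of "y + f x'" x'] Suc.IH[of "y + f x'" x'] F(2) by auto
      qed
      finally show ?case by (simp add: f\<Phi>)
    qed
    \<comment> \<open>Markov's inequality in operator form: the survival probabilities in the strip
      decrease, so n times the last one is at most their sum.\<close>
    have nB: "n * (B ^^ n) (\<lambda>x y. 1) x y \<le> \<Phi> x y" if "y \<ge> - F" "y \<le> L + F" for x y
    proof -
      have "n * (B ^^ n) (\<lambda>x y. 1) x y = (\<Sum>i<n. (B ^^ n) (\<lambda>x y. 1) x y)" by simp
      also have "\<dots> \<le> (\<Sum>i<n. (B ^^ i) (\<lambda>x y. 1) x y)"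
      proof (rule sum_mono)
        fix i assume "i \<in> {..<n}"
        then show "(B ^^ n) (\<lambda>x y. 1) x y \<le> (B ^^ i) (\<lambda>x y. 1) x y"
          by (intro lift_Suc_antimono_le[of "\<lambda>i. (B ^^ i) (\<lambda>x y. 1) x y", OF Bdec]) simp
      qed
      finally show ?thesis using U[OF that, where n=n and x=x] by linarith
    qed
    define C where "C = 2 * c0 + (2 * c0 + c1 + 2 * K + 1)/s2 + 1"
    have cs: "c0 \<ge> 0" "c1 \<ge> 0" unfolding c0_def c1_def using F R K by auto
    have C1: "C \<ge> 1" unfolding C_def using cs K s2_pos by simp
    have "surv f n x y \<le> C * (1 + max y 0) / L"
    proof (cases "y \<le> L")
      case False
      have "surv f n x y \<le> 1" by (rule surv_range)
      also have "1 \<le> y / L" using False L by simp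
      also have "\<dots> \<le> C * (1 + max y 0) / L"
      proof (rule divide_right_mono)
        have "y \<le> 1 + max y 0" by linarith
        also have "\<dots> \<le> C * (1 + max y 0)" using C1 mult_right_mono[of 1 C "1 + max y 0"] by simp
        finally show "y \<le> C * (1 + max y 0)" .
      qed (use L in auto)
      finally show ?thesis .
    next
      case y: True
      show ?thesis
      proof (cases "y \<ge> - F")
        case False
        then have "surv f n x y = 0" using kop_below[of y f] n
          by (cases n) (auto simp: surv_def F_def)
        then show ?thesis using C1 L by simp
      next
        case True
        define Y where "Y = 1 + max y 0"
        have Y: "Y \<ge> 1" "y \<le> Y" "y + 1 \<le> Y \<or> y < 0" unfolding Y_def by auto
        have ly: "L * y \<le> L * Y" using Y L by simp
        have "(B ^^ n) (\<lambda>x y. 1) x y \<le> \<Phi> x y / n"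
          using nB[OF True, where x=x] y F(2) n by (simp add: pos_le_divide_eq mult.commute)
        also have "\<Phi> x y \<le> (1/s2) * (L * (y + R) + 2 * K + (L * c0 + c1))"
          unfolding \<Phi>_def
        proof (rule mult_left_mono)
          have "L * (y + rr x) \<le> L * (y + R)" using R(1)[of x] L by simp
          moreover have "0 \<le> (y + rr x)^2" by simp
          ultimately show "L * (y + rr x) + - 1 * ((y + rr x)^2 + 2 * qq x) + (L * c0 + c1) \<le> L * (y + R) + 2 * K + (L * c0 + c1)"
            unfolding distrib_left[of "-1"] using abs_le_D2[OF K(1)[of x]] by linarith
        qed (use s2_pos in auto)
        also have "\<dots> \<le> (1/s2) * ((2 * c0 + c1 + 2 * K + 1) * (L * Y))"
        proof (rule mult_left_mono)
          have LY: "1 \<le> L * Y" "L \<le> L * Y" using mult_mono[of 1 L 1 Y] mult_left_mono[of 1 Y L] L Y by auto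
          have "L * (y + R) \<le> L * Y + R * (L * Y)" using ly mult_left_mono[OF LY(2) R(2)] by (simp add: algebra_simps)
          moreover have "L * c0 \<le> c0 * (L * Y)" using mult_left_mono[OF LY(2) cs(1)] by (simp add: mult.commute)
          moreover have "c1 \<le> c1 * (L * Y)" "2 * K \<le> 2 * K * (L * Y)" using mult_left_mono[OF LY(1) cs(2)] mult_left_mono[OF LY(1), of "2*K"] K(2) by auto
          moreover have "R * (L * Y) \<le> c0 * (L * Y)" using LY F(2) unfolding c0_def by (intro mult_right_mono) auto
          ultimately show "L * (y + R) + 2 * K + (L * c0 + c1) \<le> (2 * c0 + c1 + 2 * K + 1) * (L * Y)"
            by (simp add: algebra_simps)
        qed (use s2_pos in auto)
        finally have b: "(B ^^ n) (\<lambda>x y. 1) x y \<le> (1/s2) * ((2 * c0 + c1 + 2 * K + 1) * (L * Y)) / n"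
          by (simp add: divide_right_mono)
        also have "\<dots> = (2 * c0 + c1 + 2 * K + 1)/s2 * Y / L"
          using L s2_pos n unfolding L(2)[symmetric] by (simp add: field_simps power2_eq_square)
        finally have b: "(B ^^ n) (\<lambda>x y. 1) x y \<le> (2 * c0 + c1 + 2 * K + 1)/s2 * Y / L" .
        have "\<Lambda> x y \<le> (2 * c0 + 1) * Y / L"
        proof -
          have "c0 \<le> c0 * Y" "R \<le> c0" using cs Y F(2) unfolding c0_def by (auto simp: mult_le_cancel_left1)
          then have "y + rr x + c0 \<le> (2 * c0 + 1) * Y" using R(1)[of x] Y(2) by (simp add: algebra_simps)
          then show ?thesis unfolding \<Lambda>_def using L by (simp add: divide_right_mono)
        qed
        with one[OF True, where n=n and x=x] b have "surv f n x y \<le> (2 * c0 + c1 + 2 * K + 1)/s2 * Y / L + (2 * c0 + 1) * Y / L" by linarith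
        also have "\<dots> = C * Y / L" unfolding C_def by (simp add: add_divide_distrib algebra_simps)
        finally show ?thesis unfolding Y_def .
      qed
    qed
    then show ?thesis unfolding L_def C_def .
  qed
  have "2 * c0 + (2 * c0 + c1 + 2 * K + 1)/s2 + 1 > 0"
    unfolding c0_def c1_def using F R K s2_pos by (intro add_nonneg_pos add_nonneg_nonneg divide_nonneg_pos) auto
  with main show ?thesis by blast
qed

end

section \<open>Heat functions as approximate harmonic functions\<close>

text \<open>A heat solution carried together with all its space derivatives, \<open>h j\<close>
  being the j-th, so that bounds on derivatives can be quoted without differentiating. Only positive
  times are constrained, since the kernels are singular at time 0.\<close>

definition heat_seq :: "real => (nat => real => real => real) => bool" where
  "heat_seq c h \<longleftrightarrow> (\<forall>j s y. s > 0 --> (h j s has_real_derivative h (Suc j) s y) (at y) \<and>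
      ((\<lambda>s. h j s y) has_real_derivative c / 2 * h (j + 2) s y) (at s))"

lemma heat_seq_y: "heat_seq c h ==> s > 0 ==> (h j s has_real_derivative h (Suc j) s y) (at y)"
  and heat_seq_s: "heat_seq c h ==> s > 0 ==> ((\<lambda>s. h j s y) has_real_derivative c / 2 * h (j + 2) s y) (at s)"
  by (auto simp: heat_seq_def)

lemma heat_taylor_y:
  assumes h: "heat_seq c h" and s: "s > 0" and n: "n > 0" and B: "\<And>w. \<bar>h (j + n) s w\<bar> \<le> B"
  shows "\<bar>h j s (Y + d) - (\<Sum>m<n. h (j + m) s Y / fact m * d ^ m)\<bar> \<le> B * \<bar>d\<bar> ^ n"
proof (cases "d = 0")
  case True
  have "(\<Sum>m<n. h (j + m) s Y / fact m * 0 ^ m) = h j s Y"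
    using n by (subst sum.remove[of _ 0]) (auto intro!: sum.neutral)
  moreover have "0 \<le> B" using B[of 0] by linarith
  ultimately show ?thesis using True by simp
next
  case False
  have "\<exists>t. (if Y + d < Y then Y + d < t \<and> t < Y else Y < t \<and> t < Y + d) \<and>
    h j s (Y + d) = (\<Sum>m<n. h (j + m) s Y / fact m * (Y + d - Y) ^ m) + h (j + n) s t / fact n * (Y + d - Y) ^ n"
  proof (rule Taylor[where diff = "\<lambda>m. h (j + m) s" and a = "min Y (Y + d)" and b = "max Y (Y + d)"])
    show "\<forall>m t. m < n \<and> min Y (Y + d) \<le> t \<and> t \<le> max Y (Y + d) -->
        ((h (j + m) s) has_real_derivative h (j + Suc m) s t) (at t)"
      using heat_seq_y[OF h s] by simp
  qed (use n False in auto)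
  then obtain t where "h j s (Y + d) = (\<Sum>m<n. h (j + m) s Y / fact m * (Y + d - Y) ^ m) + h (j + n) s t / fact n * (Y + d - Y) ^ n"
    by blast
  then have t: "h j s (Y + d) - (\<Sum>m<n. h (j + m) s Y / fact m * d ^ m) = h (j + n) s t / fact n * d ^ n" by simp
  have "\<bar>h (j + n) s t / fact n * d ^ n\<bar> \<le> B * \<bar>d\<bar> ^ n"
  proof -
    have f1: "(1::real) \<le> fact n" using fact_ge_1 by simp
    have "\<bar>h (j + n) s t / fact n\<bar> = \<bar>h (j + n) s t\<bar> / fact n" by simp
    also have "\<dots> \<le> \<bar>h (j + n) s t\<bar>" using f1 by (simp add: divide_le_eq mult_le_cancel_left1)
    also have "\<dots> \<le> B" by (rule B)
    finally have "\<bar>h (j + n) s t / fact n\<bar> * \<bar>d ^ n\<bar> \<le> B * \<bar>d ^ n\<bar>" by (rule mult_right_mono) simp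
    then show ?thesis by (simp only: abs_mult power_abs)
  qed
  then show ?thesis using t by simp
qed

text \<open>Each time derivative is traded for two space derivatives and a factor c/2; the factorial
  in the remainder is given away.\<close>

lemma heat_taylor_s:
  assumes h: "heat_seq c h" and s: "s > 0" and n: "n > 0" and d: "d \<ge> 0" and c: "c \<ge> 0"
    and B: "\<And>t. s \<le> t ==> t \<le> s + d ==> \<bar>h (j + 2 * n) t Y\<bar> \<le> B"
  shows "\<bar>h j (s + d) Y - (\<Sum>m<n. (c/2)^m * h (j + 2 * m) s Y / fact m * d ^ m)\<bar> \<le> (c/2)^n * B * d ^ n"
proof (cases "d = 0")
  case True
  have "(\<Sum>m<n. (c/2)^m * h (j + 2 * m) s Y / fact m * 0 ^ m) = h j s Y"
    using n by (subst sum.remove[of _ 0]) (auto intro!: sum.neutral)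
  moreover have "0 \<le> B" using B[of s] d by auto
  ultimately show ?thesis using True c n by simp
next
  case False
  have "\<exists>t. (if s + d < s then s + d < t \<and> t < s else s < t \<and> t < s + d) \<and>
    h j (s + d) Y = (\<Sum>m<n. ((c/2)^m * h (j + 2 * m) s Y) / fact m * (s + d - s) ^ m) + ((c/2)^n * h (j + 2 * n) t Y) / fact n * (s + d - s) ^ n"
  proof (rule Taylor[where f = "\<lambda>t. h j t Y" and diff = "\<lambda>m t. (c/2)^m * h (j + 2 * m) t Y" and a = "s" and b = "s + d"])
    show "\<forall>m t. m < n \<and> s \<le> t \<and> t \<le> s + d -->
        ((\<lambda>t. (c/2)^m * h (j + 2 * m) t Y) has_real_derivative (c/2)^Suc m * h (j + 2 * Suc m) t Y) (at t)"
    proof (intro allI impI)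
      fix m t assume "m < n \<and> s \<le> t \<and> t \<le> s + d"
      then have "t > 0" using s by auto
      from DERIV_cmult[OF heat_seq_s[OF h this, of "j + 2 * m" Y], of "(c/2)^m"]
      show "((\<lambda>t. (c/2)^m * h (j + 2 * m) t Y) has_real_derivative (c/2)^Suc m * h (j + 2 * Suc m) t Y) (at t)"
        by (simp add: ac_simps)
    qed
  qed (use n False d in auto)
  then obtain t where t0: "if s + d < s then s + d < t \<and> t < s else s < t \<and> t < s + d"
    and t1: "h j (s + d) Y = (\<Sum>m<n. ((c/2)^m * h (j + 2 * m) s Y) / fact m * (s + d - s) ^ m) + ((c/2)^n * h (j + 2 * n) t Y) / fact n * (s + d - s) ^ n"
    by blast
  from t0 d have t0: "s < t" "t < s + d" by (auto split: if_splits)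
  from t1 have t: "h j (s + d) Y - (\<Sum>m<n. (c/2)^m * h (j + 2 * m) s Y / fact m * d ^ m) = (c/2)^n * h (j + 2 * n) t Y / fact n * d ^ n"
    by simp
  have "\<bar>(c/2)^n * h (j + 2 * n) t Y / fact n * d ^ n\<bar> \<le> (c/2)^n * B * d ^ n"
  proof -
    have f1: "(1::real) \<le> fact n" using fact_ge_1 by simp
    have "\<bar>(c/2)^n * h (j + 2 * n) t Y / fact n\<bar> = ((c/2)^n * \<bar>h (j + 2 * n) t Y\<bar>) / fact n" using c by (simp add: abs_mult)
    also have "\<dots> \<le> (c/2)^n * \<bar>h (j + 2 * n) t Y\<bar>" using f1 mult_left_mono[OF f1, of "(c/2)^n * \<bar>h (j + 2 * n) t Y\<bar>"] c by (subst pos_divide_le_eq) auto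
    also have "\<dots> \<le> (c/2)^n * B" using B[of t] t0 c by (intro mult_left_mono) auto
    finally have "\<bar>(c/2)^n * h (j + 2 * n) t Y / fact n\<bar> * \<bar>d ^ n\<bar> \<le> (c/2)^n * B * \<bar>d ^ n\<bar>" by (rule mult_right_mono) simp
    then show ?thesis using d by (simp only: abs_mult[of _ "d ^ n"] abs_of_nonneg[OF zero_le_power[OF d]])
  qed
  then show ?thesis using t by simp
qed

lemma sum_inverse_sqrt: "(\<Sum>j<k. 1 / sqrt (real (Suc j))) \<le> 2 * sqrt k"
proof (induction k)
  case (Suc k)
  have "1 / sqrt (real (Suc k)) \<le> 2 * (sqrt (Suc k) - sqrt k)"
  proof -
    have a: "sqrt (Suc k) \<ge> sqrt k" "sqrt (Suc k) > 0" by auto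
    have "(sqrt (Suc k) - sqrt k) * (sqrt (Suc k) + sqrt k) = 1" by (simp add: algebra_simps)
    moreover have "(sqrt (Suc k) - sqrt k) * (sqrt (Suc k) + sqrt k) \<le> (sqrt (Suc k) - sqrt k) * (2 * sqrt (Suc k))"
      using a by (intro mult_left_mono) auto
    ultimately have "1 \<le> (2 * (sqrt (Suc k) - sqrt k)) * sqrt (Suc k)" by (simp add: algebra_simps)
    then show ?thesis using a(2) by (simp add: pos_divide_le_eq)
  qed
  with Suc show ?case by simp
qed simp

context pos_chain
begin

text \<open>The heat function read at the martingale height y + \<open>rr\<close>, which removes the
  conditional mean, with the term in \<open>qq\<close> that replaces the conditional variance by
  \<open>s2\<close>.\<close>

definition usol :: "(nat => real => real => real) => real => 'a => real => real" where
  "usol h s x y = h 0 s (y + rr x) + qq x * h 2 s (y + rr x)"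

text \<open>Expanding at Y = y + rr, the first-order term vanishes because the increments have mean
  zero. The second-order terms add up to (s2/2 + qq) h'', since P \<open>qq\<close> differs from
  \<open>qq\<close> by exactly (step_var - s2)/2; this is what one unit of heat time produces. What
  remains is of third and fourth order.\<close>

lemma fop_usol:
  "\<exists>C>0. \<forall>h s B x y. heat_seq s2 h --> s > 0 -->
     (\<forall>t w. s \<le> t --> t \<le> s + 1 --> \<bar>h 3 t w\<bar> \<le> B \<and> \<bar>h 4 t w\<bar> \<le> B) -->
     \<bar>fop P f (usol h s) x y - usol h (s + 1) x y\<bar> \<le> C * B"
proof -
  define D where "D = l1norm f + 2 * l1norm rr"
  define K where "K = l1norm qq"
  have K: "\<bar>qq x\<bar> \<le> K" "0 \<le> K" for x unfolding K_def by (rule l1norm_bound l1norm_nonneg)+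
  have D0: "0 \<le> D" unfolding D_def using l1norm_nonneg[of f] l1norm_nonneg[of rr] by simp
  have D: "\<bar>f x' + rr x' - rr x\<bar> \<le> D" for x x'
    unfolding D_def using l1norm_bound[of f x'] l1norm_bound[of rr x'] l1norm_bound[of rr x] by linarith
  have "\<bar>fop P f (usol h s) x y - usol h (s + 1) x y\<bar> \<le> (D^3 + K * D + (s2/2)^2 + K * (s2/2) + 1) * B"
    if h: "heat_seq s2 h" and s: "s > 0" and B: "\<And>t w. s \<le> t ==> t \<le> s + 1 ==> \<bar>h 3 t w\<bar> \<le> B \<and> \<bar>h 4 t w\<bar> \<le> B" for h s B x y
  proof -
    have B0: "0 \<le> B" using B[of s 0] by auto
    define Y where "Y = y + rr x"
    define d where "d x' = f x' + rr x' - rr x" for x'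
    define E1 where "E1 x' = h 0 s (Y + d x') - (h 0 s Y + h 1 s Y * d x' + h 2 s Y / 2 * (d x')^2)" for x'
    define E2 where "E2 x' = h 2 s (Y + d x') - h 2 s Y" for x'
    define E3 where "E3 = h 0 (s + 1) Y - (h 0 s Y + s2/2 * h 2 s Y)"
    define E4 where "E4 = h 2 (s + 1) Y - h 2 s Y"
    have e1: "\<bar>E1 x'\<bar> \<le> D^3 * B" for x'
    proof -
      have "\<bar>E1 x'\<bar> \<le> B * \<bar>d x'\<bar>^3"
        using heat_taylor_y[OF h s, of 3 0 B Y "d x'"] B[of s] by (simp add: E1_def numeral_3_eq_3 numeral_2_eq_2)
      also have "\<dots> \<le> B * D^3" using D[of x' x] B0 unfolding d_def by (intro mult_left_mono power_mono) auto
      finally show ?thesis by (simp add: mult.commute)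
    qed
    have e2: "\<bar>qq x' * E2 x'\<bar> \<le> K * D * B" for x'
    proof -
      have "\<bar>E2 x'\<bar> \<le> B * \<bar>d x'\<bar>"
        using heat_taylor_y[OF h s, of 1 2 B Y "d x'"] B[of s] by (simp add: E2_def)
      also have "\<dots> \<le> B * D" using D[of x' x] B0 unfolding d_def by (intro mult_left_mono) auto
      finally have "\<bar>E2 x'\<bar> \<le> D * B" by (simp add: mult.commute)
      then have "\<bar>qq x'\<bar> * \<bar>E2 x'\<bar> \<le> K * (D * B)" using K by (intro mult_mono) auto
      then show ?thesis by (simp add: abs_mult)
    qed
    have e3: "\<bar>E3\<bar> \<le> (s2/2)^2 * B"
    proof -
      have "\<bar>h 0 (s + 1) Y - (\<Sum>m<2. (s2/2)^m * h (0 + 2 * m) s Y / fact m * 1 ^ m)\<bar> \<le> (s2/2)^2 * B * 1 ^ 2"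
        by (rule heat_taylor_s[OF h s]) (use B s2_pos in auto)
      then show ?thesis by (simp add: E3_def eval_nat_numeral)
    qed
    have e4: "\<bar>qq x * E4\<bar> \<le> K * (s2/2) * B"
    proof -
      have "\<bar>E4\<bar> \<le> s2/2 * B"
        using heat_taylor_s[OF h s, of 1 1 2 Y B] B s2_pos by (simp add: E4_def)
      then have "\<bar>qq x\<bar> * \<bar>E4\<bar> \<le> K * (s2/2 * B)" using K by (intro mult_mono) auto
      then show ?thesis by (simp add: abs_mult)
    qed
    have "fop P f (usol h s) x y = (\<Sum>x'\<in>UNIV. P x x' * (h 0 s (Y + d x') + qq x' * h 2 s (Y + d x')))"
      unfolding fop_def usol_def Y_def d_def by (simp add: algebra_simps)
    also have "\<dots> = (\<Sum>x'\<in>UNIV. P x x' * h 0 s Y + h 1 s Y * (P x x' * d x') + h 2 s Y / 2 * (P x x' * (d x')^2)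
         + h 2 s Y * (P x x' * qq x') + P x x' * (E1 x' + qq x' * E2 x'))"
      by (intro sum.cong refl) (simp add: E1_def E2_def algebra_simps)
    also have "\<dots> = (\<Sum>x'\<in>UNIV. P x x') * h 0 s Y + h 1 s Y * (\<Sum>x'\<in>UNIV. P x x' * d x') + h 2 s Y / 2 * (\<Sum>x'\<in>UNIV. P x x' * (d x')^2)
         + h 2 s Y * (\<Sum>x'\<in>UNIV. P x x' * qq x') + (\<Sum>x'\<in>UNIV. P x x' * (E1 x' + qq x' * E2 x'))"
      by (simp only: sum.distrib sum_distrib_left[symmetric] sum_distrib_right[symmetric])
    also have "\<dots> = h 0 s Y + h 2 s Y / 2 * step_var x + h 2 s Y * (qq x - (step_var x - s2)/2) + (\<Sum>x'\<in>UNIV. P x x' * (E1 x' + qq x' * E2 x'))"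
      unfolding P_sum qq_eq using mean_step[of x] by (simp add: d_def step_var_def)
    also have "\<dots> = h 0 s Y + (s2/2 + qq x) * h 2 s Y + (\<Sum>x'\<in>UNIV. P x x' * (E1 x' + qq x' * E2 x'))"
      by (simp add: field_simps)
    finally have eq: "fop P f (usol h s) x y - usol h (s + 1) x y = (\<Sum>x'\<in>UNIV. P x x' * (E1 x' + qq x' * E2 x')) - E3 - qq x * E4"
      unfolding usol_def Y_def[symmetric] E3_def E4_def by (simp add: algebra_simps)
    have "\<bar>\<Sum>x'\<in>UNIV. P x x' * (E1 x' + qq x' * E2 x')\<bar> \<le> (\<Sum>x'\<in>UNIV. P x x' * (D^3 * B + K * D * B))"
    proof (rule order_trans[OF sum_abs], rule sum_mono)
      fix x' show "\<bar>P x x' * (E1 x' + qq x' * E2 x')\<bar> \<le> P x x' * (D^3 * B + K * D * B)"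
      proof -
        have "\<bar>E1 x' + qq x' * E2 x'\<bar> \<le> D^3 * B + K * D * B" using e1[of x'] e2[of x'] by linarith
        then show ?thesis using P_nonneg[of x x'] by (simp add: abs_mult mult_left_mono)
      qed
    qed
    then have "\<bar>\<Sum>x'\<in>UNIV. P x x' * (E1 x' + qq x' * E2 x')\<bar> \<le> D^3 * B + K * D * B"
      by (simp add: sum_distrib_right[symmetric] P_sum)
    then have "\<bar>fop P f (usol h s) x y - usol h (s + 1) x y\<bar> \<le> D^3 * B + K * D * B + (s2/2)^2 * B + K * (s2/2) * B"
      unfolding eq using e3 e4 by linarith
    also have "\<dots> \<le> (D^3 + K * D + (s2/2)^2 + K * (s2/2) + 1) * B" using B0 unfolding distrib_right by linarith
    finally show ?thesis .
  qed
  moreover have "D^3 + K * D + (s2/2)^2 + K * (s2/2) + 1 > 0"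
    using D0 K s2_pos by (intro add_nonneg_pos add_nonneg_nonneg) auto
  ultimately show ?thesis by blast
qed

section \<open>Killing as a perturbation, and the harmonic function of the killed chain\<close>

abbreviation lin :: "'a => real => real" where "lin \<equiv> (\<lambda>x y. y + rr x)"

definition exit1 :: "'a => real => real" where
  "exit1 x y = (\<Sum>x'\<in>UNIV. P x x' * (if y + f x' \<le> 0 then 1 else 0))"

lemma exit1_eq: "exit1 x y = 1 - kop P f (\<lambda>x y. 1) x y"
proof -
  have "exit1 x y + kop P f (\<lambda>x y. 1) x y = (\<Sum>x'\<in>UNIV. P x x')"
    unfolding exit1_def kop_def sum.distrib[symmetric] by (intro sum.cong refl) auto
  then show ?thesis using P_sum by simp
qed

text \<open>The probability of being killed exactly at step j + 1; it is kept in this telescoping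
  form.\<close>

lemma kop_iter_exit1: "(kop P f ^^ j) exit1 x y = surv f j x y - surv f (Suc j) x y"
proof -
  have "exit1 = (\<lambda>x y. (\<lambda>x y. 1) x y - kop P f (\<lambda>x y. 1) x y)" by (simp add: fun_eq_iff exit1_eq)
  then show ?thesis by (simp add: kop_iter_diff surv_def funpow_swap1)
qed

text \<open>Free and killed steps differ only on arrival at a height at most 0, and from y \<ge>
  -|f| such a height is at least -2|f|. Hence only the values of g near the origin matter.\<close>

lemma kop_exit_bound:
  assumes "y \<ge> - l1norm f" "\<And>x w. - 2 * l1norm f \<le> w ==> w \<le> 0 ==> \<bar>g x w\<bar> \<le> b"
  shows "\<bar>fop P f g x y - kop P f g x y\<bar> \<le> b * exit1 x y"
proof -
  have "fop P f g x y - kop P f g x y = (\<Sum>x'\<in>UNIV. P x x' * (if y + f x' \<le> 0 then g x' (y + f x') else 0))"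
    unfolding fop_def kop_def sum_subtractf[symmetric] by (intro sum.cong refl) auto
  also have "\<bar>\<dots>\<bar> \<le> (\<Sum>x'\<in>UNIV. P x x' * (if y + f x' \<le> 0 then b else 0))"
  proof (rule order_trans[OF sum_abs], rule sum_mono)
    fix x'
    have "- 2 * l1norm f \<le> y + f x'" using assms(1) l1norm_bound[of f x'] by linarith
    then show "\<bar>P x x' * (if y + f x' \<le> 0 then g x' (y + f x') else 0)\<bar> \<le> P x x' * (if y + f x' \<le> 0 then b else 0)"
      using assms(2)[of "y + f x'" x'] P_nonneg[of x x'] by (auto simp: abs_mult intro!: mult_left_mono)
  qed
  also have "\<dots> = b * exit1 x y" unfolding exit1_def sum_distrib_left by (intro sum.cong refl) auto
  finally show ?thesis .
qed

text \<open>A discrete Duhamel formula: \<open>a\<close> is an approximate evolution, and its defect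
  at each index is carried forward by the killed chain.\<close>

lemma kop_telescope:
  "(kop P f ^^ k) (a 0) x y = a k x y + (\<Sum>j<k. (kop P f ^^ j) (\<lambda>x y. kop P f (a (k - 1 - j)) x y - a (k - j) x y) x y)"
proof (induction k arbitrary: a x y)
  case (Suc k)
  have "(kop P f ^^ Suc k) (a 0) x y = (kop P f ^^ k) (kop P f (a 0)) x y" by (simp add: funpow_swap1)
  also have "\<dots> = (kop P f ^^ k) (a 1) x y + (kop P f ^^ k) (\<lambda>x y. kop P f (a 0) x y - a 1 x y) x y"
    by (simp add: kop_iter_diff)
  also have "(kop P f ^^ k) (a 1) x y = a (Suc k) x y + (\<Sum>j<k. (kop P f ^^ j) (\<lambda>x y. kop P f (a (Suc (k - 1 - j))) x y - a (Suc (k - j)) x y) x y)"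
    using Suc[of "\<lambda>i. a (Suc i)" x y] by simp
  also have "(\<Sum>j<k. (kop P f ^^ j) (\<lambda>x y. kop P f (a (Suc (k - 1 - j))) x y - a (Suc (k - j)) x y) x y)
     = (\<Sum>j<k. (kop P f ^^ j) (\<lambda>x y. kop P f (a (Suc k - 1 - j)) x y - a (Suc k - j) x y) x y)"
    by (intro sum.cong refl) (simp add: Suc_diff_Suc Suc_diff_le less_imp_le)
  finally show ?case by simp
qed simp

lemma sum_surv_bound:
  "\<exists>C>0. \<forall>k x y. k \<ge> 1 --> (\<Sum>j<k. surv f j x y) \<le> C * (1 + max y 0) * sqrt k"
proof -
  obtain C where C: "C > 0" "\<And>n x y. n \<ge> 1 ==> surv f n x y \<le> C * (1 + max y 0) / sqrt n"
    using survival_bound by blast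
  have "(\<Sum>j<k. surv f j x y) \<le> (4 * C + 2) * (1 + max y 0) * sqrt k" if "k \<ge> 1" for k x y
  proof -
    have "surv f j x y \<le> (2 * C + 1) * (1 + max y 0) * (1 / sqrt (Suc j))" for j
    proof (cases "j = 0")
      case True
      have "surv f j x y \<le> 1" by (rule surv_range)
      also have "1 \<le> (2 * C + 1) * (1 + max y 0)" using C(1) mult_mono[of 1 "2 * C + 1" 1 "1 + max y 0"] by simp
      finally show ?thesis using True by simp
    next
      case False
      then have j: "1 \<le> j" by simp
      have "sqrt (Suc j) \<le> sqrt (4 * j)" using j by (intro real_sqrt_le_mono) simp
      then have sj: "sqrt (Suc j) \<le> 2 * sqrt j" by (simp add: real_sqrt_mult)
      have "surv f j x y \<le> C * (1 + max y 0) * (1 / sqrt j)" using C(2)[OF j, of x y] by simp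
      also have "\<dots> \<le> C * (1 + max y 0) * (2 / sqrt (Suc j))"
        using C(1) j sj by (intro mult_left_mono) (auto simp: field_simps)
      also have "\<dots> \<le> (2 * C + 1) * (1 + max y 0) * (1 / sqrt (Suc j))"
        by (simp add: divide_right_mono field_simps)
      finally show ?thesis .
    qed
    then have "(\<Sum>j<k. surv f j x y) \<le> (\<Sum>j<k. (2 * C + 1) * (1 + max y 0) * (1 / sqrt (Suc j)))" by (intro sum_mono) blast
    also have "\<dots> = (2 * C + 1) * (1 + max y 0) * (\<Sum>j<k. 1 / sqrt (Suc j))" by (rule sum_distrib_left[symmetric])
    also have "\<dots> \<le> (2 * C + 1) * (1 + max y 0) * (2 * sqrt k)"
      using C(1) by (intro mult_left_mono sum_inverse_sqrt) auto
    finally show ?thesis by (simp add: algebra_simps)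
  qed
  then show ?thesis using C(1) by (intro exI[of _ "4 * C + 2"]) auto
qed

text \<open>This is the function $V$ of the paper, constructed as a harmonic function of the killed chain.\<close>

definition W :: "'a => real => real" where
  "W x y = lim (\<lambda>k. (kop P f ^^ k) lin x y)"

text \<open>\<open>lin\<close> is harmonic for the free chain, so each killed step loses only its
  value at an exit point, which is bounded. The losses telescope to a multiple of the probability of
  dying after step k; k \<ge> 1 ensures that all heights tested are positive.\<close>

lemma kop_lin_diff:
  assumes "1 \<le> k" "k \<le> l"
  shows "\<bar>(kop P f ^^ k) lin x y - (kop P f ^^ l) lin x y\<bar> \<le> (2 * l1norm f + l1norm rr) * surv f k x y"
proof -
  define b where "b = 2 * l1norm f + l1norm rr"
  have b: "\<bar>lin x w\<bar> \<le> b" if "- 2 * l1norm f \<le> w" "w \<le> 0" for x w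
    using that l1norm_bound[of rr x] unfolding b_def by linarith
  have step1: "\<bar>(kop P f ^^ j) lin x y - (kop P f ^^ Suc j) lin x y\<bar> \<le> b * (surv f j x y - surv f (Suc j) x y)" if "j \<ge> 1" for j
  proof -
    have eq: "(kop P f ^^ j) lin x y - (kop P f ^^ Suc j) lin x y = (kop P f ^^ j) (\<lambda>x y. lin x y - kop P f lin x y) x y"
      by (simp add: kop_iter_diff funpow_swap1)
    have "\<bar>(kop P f ^^ j) (\<lambda>x y. lin x y - kop P f lin x y) x y\<bar> \<le> (kop P f ^^ j) (\<lambda>x y. b * exit1 x y) x y"
    proof (rule kop_iter_abs_le)
      fix x y :: _ assume "(0::real) < y"
      then have "y \<ge> - l1norm f" using l1norm_nonneg[of f] by linarith
      from kop_exit_bound[OF this, of lin b x] b show "\<bar>lin x y - kop P f lin x y\<bar> \<le> b * exit1 x y"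
        by (simp add: fop_linear)
    qed (use that in auto)
    then show ?thesis unfolding eq kop_iter_mult[of j P f b exit1] kop_iter_exit1 .
  qed
  have "\<bar>(kop P f ^^ k) lin x y - (kop P f ^^ l) lin x y\<bar> \<le> b * (surv f k x y - surv f l x y)"
    using assms(2)
  proof (induction l rule: dec_induct)
    case (step l)
    have "l \<ge> 1" using step assms by simp
    with step.IH step1[of l] show ?case unfolding right_diff_distrib by linarith
  qed simp
  also have "\<dots> \<le> b * surv f k x y"
    using surv_range(1)[of f l x y] l1norm_nonneg[of f] l1norm_nonneg[of rr] unfolding b_def by (intro mult_left_mono) auto
  finally show ?thesis unfolding b_def .
qed

text \<open>The losses after step k are controlled by survival, so the a priori bound O(k^(-1/2))
  makes the sequence Cauchy.\<close>

lemma W_limit: "(\<lambda>k. (kop P f ^^ k) lin x y) \<longlonglongrightarrow> W x y"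
proof -
  obtain C where C: "C > 0" "\<And>n x y. n \<ge> 1 ==> surv f n x y \<le> C * (1 + max y 0) / sqrt n"
    using survival_bound by blast
  define b where "b = 2 * l1norm f + l1norm rr"
  have b0: "b \<ge> 0" unfolding b_def using l1norm_nonneg[of f] l1norm_nonneg[of rr] by simp
  define e where "e n = b * (C * (1 + max y 0) / sqrt (real n))" for n
  have e0: "e \<longlonglongrightarrow> 0" unfolding e_def by real_asymp
  have le: "\<bar>(kop P f ^^ k) lin x y - (kop P f ^^ l) lin x y\<bar> \<le> e k" if "1 \<le> k" "k \<le> l" for k l
    using order_trans[OF kop_lin_diff[OF that, of x y] mult_left_mono[OF C(2)[OF that(1), of x y], of b, unfolded b_def]] b0
    unfolding e_def b_def .
  have "Cauchy (\<lambda>k. (kop P f ^^ k) lin x y)"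
  proof (rule metric_CauchyI)
    fix r :: real assume "r > 0"
    then have "\<forall>\<^sub>F n in sequentially. e n < r/2" using e0 by (intro order_tendstoD) auto
    then obtain N where N: "\<And>n. n \<ge> N ==> e n < r/2" by (auto simp: eventually_sequentially)
    define M where "M = max N 1"
    have "dist ((kop P f ^^ m) lin x y) ((kop P f ^^ n) lin x y) < r" if "m \<ge> M" "n \<ge> M" for m n
      using le[of M m] le[of M n] that N[of M] unfolding M_def dist_real_def by linarith
    then show "\<exists>M. \<forall>m\<ge>M. \<forall>n\<ge>M. dist ((kop P f ^^ m) lin x y) ((kop P f ^^ n) lin x y) < r" by blast
  qed
  then show ?thesis unfolding W_def
    using Cauchy_convergent_iff convergent_LIMSEQ_iff by blast
qed

text \<open>Passing to the limit in the second index of \<open>kop_lin_diff\<close>.\<close>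

lemma W_rate:
  "\<exists>C>0. \<forall>k x y. k \<ge> 1 --> \<bar>(kop P f ^^ k) lin x y - W x y\<bar> \<le> C * (1 + max y 0) / sqrt k"
proof -
  obtain C where C: "C > 0" "\<And>n x y. n \<ge> 1 ==> surv f n x y \<le> C * (1 + max y 0) / sqrt n"
    using survival_bound by blast
  define b where "b = 2 * l1norm f + l1norm rr + 1"
  have b0: "b > 0" unfolding b_def using l1norm_nonneg[of f] l1norm_nonneg[of rr] by simp
  have "\<bar>(kop P f ^^ k) lin x y - W x y\<bar> \<le> b * C * (1 + max y 0) / sqrt k" if k: "k \<ge> 1" for k x y
  proof (rule LIMSEQ_le_const2)
    show "(\<lambda>l. \<bar>(kop P f ^^ k) lin x y - (kop P f ^^ l) lin x y\<bar>) \<longlonglongrightarrow> \<bar>(kop P f ^^ k) lin x y - W x y\<bar>"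
      by (intro tendsto_intros W_limit)
    have "\<bar>(kop P f ^^ k) lin x y - (kop P f ^^ l) lin x y\<bar> \<le> b * C * (1 + max y 0) / sqrt k" if "k \<le> l" for l
    proof -
      have "\<bar>(kop P f ^^ k) lin x y - (kop P f ^^ l) lin x y\<bar> \<le> (2 * l1norm f + l1norm rr) * surv f k x y"
        by (rule kop_lin_diff[OF k that])
      also have "\<dots> \<le> b * surv f k x y" unfolding b_def using surv_range(1)[of f k x y] by (intro mult_right_mono) auto
      also have "\<dots> \<le> b * (C * (1 + max y 0) / sqrt k)" using C(2)[OF k, of x y] b0 by (intro mult_left_mono) auto
      finally show ?thesis by simp
    qed
    then show "\<exists>N. \<forall>l\<ge>N. \<bar>(kop P f ^^ k) lin x y - (kop P f ^^ l) lin x y\<bar> \<le> b * C * (1 + max y 0) / sqrt k" by blast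
  qed
  then show ?thesis using b0 C(1) by (intro exI[of _ "b * C"]) auto
qed

lemma W_below: "y \<le> - l1norm f ==> W x y = 0"
proof -
  assume y: "y \<le> - l1norm f"
  have "(\<lambda>k. (kop P f ^^ Suc k) lin x y) \<longlonglongrightarrow> W x y" using W_limit by (rule LIMSEQ_Suc)
  moreover have "(kop P f ^^ Suc k) lin x y = 0" for k using kop_below[OF y] by simp
  ultimately show ?thesis by (simp add: LIMSEQ_const_iff)
qed

end

section \<open>Gaussian kernels\<close>

text \<open>\<open>gd c j s\<close> is the $j$-th derivative of the centred Gaussian density with variance $c s$.\<close>

fun gd :: "real => nat => real => real => real" where
  "gd c 0 s y = exp (- y\<^sup>2 / (2 * c * s)) / sqrt (2 * pi * c * s)"
| "gd c (Suc 0) s y = - y / (c * s) * gd c 0 s y"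
| "gd c (Suc (Suc j)) s y = - (y * gd c (Suc j) s y + real (Suc j) * gd c j s y) / (c * s)"

lemmas gd_0 = gd.simps(1) and gd_1 = gd.simps(2) and gd_SS = gd.simps(3)

declare gd.simps [simp del]

text \<open>The recursion is Hermite's three-term relation; differentiating it reproduces it with
  the index raised by one, which is the induction step here and for the time derivative.\<close>

lemma gd_deriv_y:
  assumes "c > 0" "s > 0"
  shows "(gd c j s has_real_derivative gd c (Suc j) s y) (at y)"
proof (induction j rule: less_induct)
  case (less j)
  consider "j = 0" | "j = Suc 0" | i where "j = Suc (Suc i)" by (metis not0_implies_Suc)
  then show ?case
  proof cases
    case 1
    have "((\<lambda>y. exp (- y\<^sup>2 / (2 * c * s)) / sqrt (2 * pi * c * s)) has_real_derivative - y / (c * s) * (exp (- y\<^sup>2 / (2 * c * s)) / sqrt (2 * pi * c * s))) (at y)"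
      using assms by (auto intro!: derivative_eq_intros simp: field_simps)
    then show ?thesis using 1 by (simp add: gd_0[abs_def] gd_1)
  next
    case 2
    have d0: "(gd c 0 s has_real_derivative gd c (Suc 0) s y) (at y)" using less 2 by blast
    have e: "gd c (Suc 0) s = (\<lambda>y. (- 1 / (c * s)) * (y * gd c 0 s y))" by (simp add: fun_eq_iff gd_1)
    have "((\<lambda>y. (- 1 / (c * s)) * (y * gd c 0 s y)) has_real_derivative (- 1 / (c * s)) * (1 * gd c 0 s y + gd c (Suc 0) s y * y)) (at y)"
      by (intro DERIV_cmult DERIV_mult DERIV_ident d0)
    moreover have "(- 1 / (c * s)) * (1 * gd c 0 s y + gd c (Suc 0) s y * y) = gd c (Suc (Suc 0)) s y"
      unfolding gd_SS using assms by (simp add: field_simps)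
    ultimately show ?thesis using 2 e by simp
  next
    case 3
    have d0: "(gd c i s has_real_derivative gd c (Suc i) s y) (at y)" and
      d1: "(gd c (Suc i) s has_real_derivative gd c (Suc (Suc i)) s y) (at y)" using less 3 by auto
    have e: "gd c (Suc (Suc i)) s = (\<lambda>y. (- 1 / (c * s)) * (y * gd c (Suc i) s y + real (Suc i) * gd c i s y))"
      using assms by (simp add: fun_eq_iff gd_SS field_simps)
    have "((\<lambda>y. (- 1 / (c * s)) * (y * gd c (Suc i) s y + real (Suc i) * gd c i s y)) has_real_derivative
        (- 1 / (c * s)) * ((1 * gd c (Suc i) s y + gd c (Suc (Suc i)) s y * y) + real (Suc i) * gd c (Suc i) s y)) (at y)"
      by (intro DERIV_cmult DERIV_mult DERIV_add DERIV_ident d0 d1)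
    moreover have "(- 1 / (c * s)) * ((1 * gd c (Suc i) s y + gd c (Suc (Suc i)) s y * y) + real (Suc i) * gd c (Suc i) s y) = gd c (Suc (Suc (Suc i))) s y"
      unfolding gd_SS[of c "Suc i"] using assms by (simp add: field_simps)
    ultimately show ?thesis using 3 e by simp
  qed
qed

lemma gd_deriv_s:
  assumes "c > 0" "s > 0"
  shows "((\<lambda>s. gd c j s y) has_real_derivative c / 2 * gd c (j + 2) s y) (at s)"
proof (induction j rule: less_induct)
  case (less j)
  have inv: "((\<lambda>s. inverse (c * s)) has_real_derivative - (inverse (c * s) / s)) (at s)"
    using assms by (auto intro!: derivative_eq_intros simp: field_simps)
  have g2: "gd c 2 s y = (y\<^sup>2 / (c * s) - 1) * gd c 0 s y / (c * s)"
    using assms by (simp add: numeral_2_eq_2 gd_SS gd_1 field_simps)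
  have d0: "((\<lambda>s. gd c 0 s y) has_real_derivative c / 2 * gd c 2 s y) (at s)"
  proof -
    define E where "E = exp (- y\<^sup>2 / (2 * c * s))"
    define q where "q = sqrt (2 * pi * c * s)"
    have q: "q > 0" "q * q = 2 * pi * c * s" unfolding q_def using mult_pos_pos[OF mult_pos_pos[OF pi_gt_zero assms(1)] assms(2)] by (auto simp: mult.assoc)
    have de: "((\<lambda>s. exp (- y\<^sup>2 / (2 * c * s))) has_real_derivative E * (y\<^sup>2 / (2 * c * s * s))) (at s)"
      unfolding E_def using assms by (auto intro!: derivative_eq_intros simp: field_simps power2_eq_square)
    have dq: "((\<lambda>s. sqrt (2 * pi * c * s)) has_real_derivative pi * c / q) (at s)"
    proof -
      have pp: "0 < 2 * pi * c * s" by (intro mult_pos_pos) (use assms in auto)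
      have "inverse (sqrt (2 * pi * c * s)) / 2 * (2 * pi * c) = pi * c / q" using q(1) unfolding q_def by (simp add: field_simps)
      with DERIV_chain2[where f = sqrt and g = "\<lambda>s. 2 * pi * c * s", OF DERIV_real_sqrt[OF pp] DERIV_cmult_Id]
      show ?thesis by (simp only:)
    qed
    have "((\<lambda>s. exp (- y\<^sup>2 / (2 * c * s)) / sqrt (2 * pi * c * s)) has_real_derivative (E * (y\<^sup>2 / (2 * c * s * s)) * q - E * (pi * c / q)) / (q * q)) (at s)"
      using DERIV_divide[OF de dq] q assms unfolding q_def E_def by simp
    moreover have "(E * (y\<^sup>2 / (2 * c * s * s)) * q - E * (pi * c / q)) / (q * q) = c / 2 * gd c 2 s y"
    proof -
      have "(E * (y\<^sup>2 / (2 * c * s * s)) * q - E * (pi * c / q)) / (q * q) = (E / q) * (y\<^sup>2 / (2 * c * s * s)) - (E / q) * (pi * c / (q * q))"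
        using q(1) by (simp add: field_simps)
      also have "pi * c / (q * q) = 1 / (2 * s)" unfolding q(2) using assms by (simp add: field_simps)
      also have "E / q = gd c 0 s y" by (simp add: gd_0 E_def q_def)
      also have "gd c 0 s y * (y\<^sup>2 / (2 * c * s * s)) - gd c 0 s y * (1 / (2 * s)) = c / 2 * gd c 2 s y"
        unfolding g2 using assms by (simp add: field_simps)
      finally show ?thesis .
    qed
    ultimately show ?thesis unfolding gd_0[abs_def] by (simp only:)
  qed
  consider "j = 0" | "j = Suc 0" | i where "j = Suc (Suc i)" by (metis not0_implies_Suc)
  then show ?case
  proof cases
    case 1 then show ?thesis using d0 by (simp add: numeral_2_eq_2)
  next
    case 2
    have e: "(\<lambda>s. gd c j s y) = (\<lambda>s. (- y) * (inverse (c * s) * gd c 0 s y))" unfolding 2 by (simp add: fun_eq_iff gd_1 divide_inverse)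
    have "((\<lambda>s. (- y) * (inverse (c * s) * gd c 0 s y)) has_real_derivative
        (- y) * (- (inverse (c * s) / s) * gd c 0 s y + c / 2 * gd c 2 s y * inverse (c * s))) (at s)"
      by (intro DERIV_cmult DERIV_mult inv d0)
    moreover have "(- y) * (- (inverse (c * s) / s) * gd c 0 s y + c / 2 * gd c 2 s y * inverse (c * s)) = c / 2 * gd c (Suc 0 + 2) s y"
    proof -
      have g3: "gd c (Suc 0 + 2) s y = - (y * gd c 2 s y + 2 * (- y / (c * s) * gd c 0 s y)) / (c * s)"
        by (simp add: numeral_2_eq_2 gd_SS[of c "Suc 0"] gd_1)
      show ?thesis unfolding g3 using assms by (simp add: field_simps)
    qed
    ultimately show ?thesis unfolding e unfolding 2 by (simp only:)
  next
    case 3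
    have d0: "((\<lambda>s. gd c i s y) has_real_derivative c / 2 * gd c (i + 2) s y) (at s)"
      and d1: "((\<lambda>s. gd c (Suc i) s y) has_real_derivative c / 2 * gd c (Suc i + 2) s y) (at s)" using less 3 by auto
    have e: "(\<lambda>s. gd c j s y) = (\<lambda>s. (- 1) * (inverse (c * s) * (y * gd c (Suc i) s y + real (Suc i) * gd c i s y)))"
      unfolding 3 by (simp add: fun_eq_iff gd_SS divide_inverse algebra_simps)
    define A where "A = y * gd c (Suc i) s y + real (Suc i) * gd c i s y"
    have "((\<lambda>s. (- 1) * (inverse (c * s) * (y * gd c (Suc i) s y + real (Suc i) * gd c i s y))) has_real_derivative
       (- 1) * (- (inverse (c * s) / s) * A + (y * (c / 2 * gd c (Suc i + 2) s y) + real (Suc i) * (c / 2 * gd c (i + 2) s y)) * inverse (c * s))) (at s)"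
      unfolding A_def by (intro DERIV_cmult DERIV_mult DERIV_add inv d0 d1)
    moreover have "(- 1) * (- (inverse (c * s) / s) * A + (y * (c / 2 * gd c (Suc i + 2) s y) + real (Suc i) * (c / 2 * gd c (i + 2) s y)) * inverse (c * s)) = c / 2 * gd c (Suc (Suc i) + 2) s y"
    proof -
      have a: "A = - gd c (i + 2) s y * (c * s)" unfolding A_def using assms by (simp add: gd_SS)
      have b: "gd c (Suc (Suc i) + 2) s y = - (y * gd c (Suc i + 2) s y + real (i + 3) * gd c (i + 2) s y) / (c * s)"
        by (simp add: gd_SS[of c "Suc (Suc i)"])
      show ?thesis unfolding a b using assms by (simp add: field_simps)
    qed
    ultimately show ?thesis unfolding e unfolding 3 by (simp only:)
  qed
qed

lemma heat_seq_gd: "c > 0 ==> heat_seq c (gd c)"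
  unfolding heat_seq_def using gd_deriv_y gd_deriv_s by blast

lemma heat_seq_shift: "heat_seq c h ==> heat_seq c (\<lambda>j s y. h j s (y + v))"
  unfolding heat_seq_def
proof (intro allI impI conjI)
  fix j s y assume h: "\<forall>j s y. 0 < s --> (h j s has_real_derivative h (Suc j) s y) (at y) \<and> ((\<lambda>s. h j s y) has_real_derivative c / 2 * h (j + 2) s y) (at s)" and s: "0 < (s::real)"
  show "((\<lambda>y. h j s (y + v)) has_real_derivative h (Suc j) s (y + v)) (at y)"
    using h s DERIV_shift[of "h j s" "h (Suc j) s (y + v)" y v] by blast
  show "((\<lambda>s. h j s (y + v)) has_real_derivative c / 2 * h (j + 2) s (y + v)) (at s)" using h s by blast
qed

lemma heat_seq_diff: "heat_seq c h ==> heat_seq c g ==> heat_seq c (\<lambda>j s y. h j s y - g j s y)"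
  unfolding heat_seq_def by (auto intro!: derivative_eq_intros simp: algebra_simps)

lemma heat_seq_Suc: "heat_seq c h ==> heat_seq c (\<lambda>j. h (Suc j))"
  unfolding heat_seq_def by auto

text \<open>Parabolic scaling; it reduces bounds at all times to time one.\<close>

lemma gd_scale:
  assumes "c > 0" "s > 0"
  shows "gd c j s y = gd c j 1 (y / sqrt s) / (sqrt s) ^ Suc j"
proof (induction j rule: less_induct)
  case (less j)
  have s: "sqrt s * sqrt s = s" "sqrt s > 0" using assms by auto
  have y: "y = sqrt s * (y / sqrt s)" using s by simp
  consider "j = 0" | "j = Suc 0" | i where "j = Suc (Suc i)" by (metis not0_implies_Suc)
  then show ?case
  proof cases
    case 1 then show ?thesis using assms by (simp add: gd_0 real_sqrt_mult power_divide field_simps)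
  next
    case 2
    have g: "gd c 0 s y = gd c 0 1 (y / sqrt s) / sqrt s" using less 2 by fastforce
    show ?thesis unfolding 2 gd_1 g using assms s
      by (simp add: field_simps)
  next
    case 3
    have g0: "gd c i s y = gd c i 1 (y / sqrt s) / (sqrt s) ^ Suc i"
      and g1: "gd c (Suc i) s y = gd c (Suc i) 1 (y / sqrt s) / (sqrt s) ^ Suc (Suc i)" using less 3 by auto
    define r where "r = sqrt s"
    define w where "w = y / sqrt s"
    have r: "r > 0" "s = r * r" "y = r * w" using s unfolding r_def w_def by auto
    show ?thesis unfolding 3 gd_SS g0 g1 w_def[symmetric] r_def[symmetric] unfolding r(2,3)
      using r(1) assms by (simp add: field_simps)
  qed
qed

lemma power_le_exp: "0 \<le> u ==> u ^ i \<le> fact i * exp (u::real)"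
proof -
  assume u: "0 \<le> u"
  have "(\<Sum>n\<in>{i}. u ^ n /\<^sub>R fact n) \<le> (\<Sum>n. u ^ n /\<^sub>R fact n)"
    by (rule sum_le_suminf) (use u summable_exp_generic[of u] in auto)
  then show ?thesis by (simp add: exp_def field_simps)
qed

text \<open>The recursion multiplies lower derivatives by y, so the induction only closes when all
  powers of y are carried along.\<close>

lemma gd_one_bound:
  assumes "c > 0"
  shows "\<exists>C. \<forall>y. \<bar>y\<bar> ^ i * \<bar>gd c j 1 y\<bar> \<le> C"
proof (induction j arbitrary: i rule: less_induct)
  case (less j)
  have g0: "\<exists>C. \<forall>y. \<bar>y\<bar> ^ i * \<bar>gd c 0 1 y\<bar> \<le> C" for i
  proof (intro exI allI)
    fix y :: real
    define u where "u = y\<^sup>2 / (2 * c)"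
    have u: "u \<ge> 0" "y\<^sup>2 = 2 * c * u" using assms unfolding u_def by auto
    have "\<bar>y\<bar> ^ i \<le> 1 + (y\<^sup>2) ^ i"
    proof (cases "\<bar>y\<bar> \<le> 1")
      case True then show ?thesis using power_le_one[of "\<bar>y\<bar>" i] by (simp add: add_increasing2)
    next
      case False
      then have "\<bar>y\<bar> ^ i \<le> \<bar>y\<bar> ^ (2 * i)" by (intro power_increasing) auto
      then show ?thesis by (simp add: power_mult)
    qed
    also have "\<dots> \<le> 1 + (2 * c) ^ i * (fact i * exp u)"
      unfolding u(2) power_mult_distrib using power_le_exp[OF u(1), of i] assms by (simp add: mult_left_mono)
    finally have "\<bar>y\<bar> ^ i * exp (- u) \<le> (1 + (2 * c) ^ i * (fact i * exp u)) * exp (- u)" by (simp add: mult_right_mono)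
    also have "\<dots> = exp (- u) + (2 * c) ^ i * fact i" by (simp add: algebra_simps exp_minus_inverse[symmetric]) (simp add: exp_minus)
    also have "\<dots> \<le> 1 + (2 * c) ^ i * fact i" using u by simp
    finally have "\<bar>y\<bar> ^ i * exp (- u) / sqrt (2 * pi * c) \<le> (1 + (2 * c) ^ i * fact i) / sqrt (2 * pi * c)" using assms by (simp add: divide_right_mono)
    then show "\<bar>y\<bar> ^ i * \<bar>gd c 0 1 y\<bar> \<le> (1 + (2 * c) ^ i * fact i) / sqrt (2 * pi * c)"
      using assms by (simp add: u_def gd_0)
  qed
  consider "j = 0" | "j = Suc 0" | k where "j = Suc (Suc k)" by (metis not0_implies_Suc)
  then show ?case
  proof cases
    case 1 then show ?thesis using g0 by simp
  next
    case 2
    obtain C where C: "\<And>y. \<bar>y\<bar> ^ Suc i * \<bar>gd c 0 1 y\<bar> \<le> C" using g0[of "Suc i"] by blast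
    have "\<bar>y\<bar> ^ i * \<bar>gd c j 1 y\<bar> \<le> C / c" for y
    proof -
      have "\<bar>y\<bar> ^ i * \<bar>gd c j 1 y\<bar> = \<bar>y\<bar> ^ Suc i * \<bar>gd c 0 1 y\<bar> / c"
        unfolding 2 gd_1 using assms by (simp add: abs_mult)
      then show ?thesis using C[of y] assms by (simp add: divide_right_mono)
    qed
    then show ?thesis by blast
  next
    case 3
    obtain C0 C1 where C: "\<And>y. \<bar>y\<bar> ^ i * \<bar>gd c k 1 y\<bar> \<le> C0" "\<And>y. \<bar>y\<bar> ^ Suc i * \<bar>gd c (Suc k) 1 y\<bar> \<le> C1"
      using less[of k i] less[of "Suc k" "Suc i"] 3 by auto
    have "\<bar>y\<bar> ^ i * \<bar>gd c j 1 y\<bar> \<le> (C1 + real (Suc k) * C0) / c" for y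
    proof -
      have "\<bar>gd c j 1 y\<bar> = \<bar>y * gd c (Suc k) 1 y + real (Suc k) * gd c k 1 y\<bar> / c"
        unfolding 3 gd_SS using assms by (simp add: abs_divide del: of_nat_Suc)
      also have "\<dots> \<le> (\<bar>y\<bar> * \<bar>gd c (Suc k) 1 y\<bar> + real (Suc k) * \<bar>gd c k 1 y\<bar>) / c"
        using assms abs_triangle_ineq[of "y * gd c (Suc k) 1 y" "real (Suc k) * gd c k 1 y"] by (intro divide_right_mono) (auto simp: abs_mult simp del: of_nat_Suc)
      finally have "\<bar>y\<bar> ^ i * \<bar>gd c j 1 y\<bar> \<le> \<bar>y\<bar> ^ i * ((\<bar>y\<bar> * \<bar>gd c (Suc k) 1 y\<bar> + real (Suc k) * \<bar>gd c k 1 y\<bar>) / c)"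
        by (rule mult_left_mono) simp
      also have "\<dots> = (\<bar>y\<bar> ^ Suc i * \<bar>gd c (Suc k) 1 y\<bar> + real (Suc k) * (\<bar>y\<bar> ^ i * \<bar>gd c k 1 y\<bar>)) / c"
        by (simp add: algebra_simps del: of_nat_Suc)
      also have "\<dots> \<le> (C1 + real (Suc k) * C0) / c"
        using C[of y] assms by (intro divide_right_mono add_mono mult_left_mono) auto
      finally show ?thesis .
    qed
    then show ?thesis by blast
  qed
qed

lemma gd_bound:
  assumes "c > 0"
  shows "\<exists>C>0. \<forall>s y. s > 0 --> \<bar>gd c j s y\<bar> \<le> C / (sqrt s) ^ Suc j"
proof -
  obtain C where C: "\<And>y. \<bar>gd c j 1 y\<bar> \<le> C" using gd_one_bound[OF assms, of 0 j] by auto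
  have C0: "C \<ge> 0" using C[of 0] by (meson abs_ge_zero order_trans)
  have "\<bar>gd c j s y\<bar> \<le> (C + 1) / (sqrt s) ^ Suc j" if "s > 0" for s y
  proof -
    have "\<bar>gd c j s y\<bar> = \<bar>gd c j 1 (y / sqrt s)\<bar> / (sqrt s) ^ Suc j"
      using gd_scale[OF assms that, of j y] that by (simp add: abs_divide)
    also have "\<dots> \<le> (C + 1) / (sqrt s) ^ Suc j" using C[of "y / sqrt s"] that by (intro divide_right_mono) auto
    finally show ?thesis .
  qed
  then show ?thesis using C0 by (intro exI[of _ "C + 1"]) auto
qed

lemma gd_normal_density: "c > 0 ==> s > 0 ==> gd c 0 s y = normal_density 0 (sqrt (c * s)) y"
  by (simp add: gd_0 normal_density_def field_simps)

text \<open>In classical notation erf(x / sqrt(2 c)): the probability that a centred Gaussian of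
  variance c lies within distance x of 0, continued as an odd function.\<close>

definition gerf :: "real => real => real" where
  "gerf c x = 2 * (LBINT u=0..x. gd c 0 1 u)"

lemma continuous_gd0: "c > 0 ==> continuous_on A (gd c 0 1)"
  by (auto simp: gd_0[abs_def] intro!: continuous_intros)

lemma gerf_deriv:
  assumes "c > 0"
  shows "(gerf c has_real_derivative 2 * gd c 0 1 x) (at x)"
proof -
  have "(at x within {min 0 (x - 1)..max 0 (x + 1)}) = at x"
    by (intro at_within_interior) auto
  moreover have "min 0 (x - 1) \<le> x" "x \<le> max 0 (x + 1)"
    by auto
  ultimately have "((\<lambda>x. LBINT u=0..x. gd c 0 1 u) has_real_derivative gd c 0 1 x) (at x)"
    using interval_integral_FTC2[of "min 0 (x - 1)" 0 "max 0 (x + 1)" "gd c 0 1" x] continuous_gd0[OF assms]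
    by (auto simp: zero_ereal_def has_real_derivative_iff_has_vector_derivative split del: if_split)
  from DERIV_cmult[OF this, of 2] show ?thesis by (simp add: gerf_def[abs_def])
qed

lemma gerf_0: "gerf c 0 = 0"
  unfolding gerf_def zero_ereal_def by (simp only: interval_integral_endpoints_same)

text \<open>Shifting the tail to the origin, (t + x)^2 \<ge> t^2 + x^2 for nonnegative t and x
  splits off the factor exp(-t^2/(2c)).\<close>

lemma gerf_tail:
  assumes c: "c > 0" and t: "t \<ge> 0"
  shows "0 \<le> 1 - gerf c t" "1 - gerf c t \<le> exp (- t\<^sup>2 / (2 * c))"
proof -
  define \<phi> where "\<phi> = gd c 0 1"
  have phi: "\<phi> = normal_density 0 (sqrt c)" unfolding \<phi>_def using gd_normal_density[OF c, of 1] by (simp add: fun_eq_iff)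
  have int: "integrable lborel \<phi>" unfolding phi using c by simp
  have one: "(LBINT x. \<phi> x) = 1" unfolding phi using c by simp
  have pos: "\<phi> x \<ge> 0" for x unfolding phi by simp
  have even: "\<phi> (- x) = \<phi> x" for x unfolding \<phi>_def by (simp add: gd_0)
  have meas: "\<phi> \<in> borel_measurable borel" unfolding phi by simp
  define T where "T s = (LBINT x. indicator {s..} x * \<phi> x)" for s :: real
  have intI: "integrable lborel (\<lambda>x. indicator A x * \<phi> x)" if "A \<in> sets borel" for A
    using integrable_mult_indicator[of A lborel \<phi>] int that by simp
  have half: "T 0 = 1/2"
  proof -
    have "T 0 = (LBINT x. indicator {..0} x * \<phi> x)"
      unfolding T_def by (subst lborel_integral_real_affine[where c="-1" and t=0]) (auto simp: even indicator_def intro!: Bochner_Integration.integral_cong)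
    moreover have "(LBINT x. \<phi> x) = (LBINT x. indicator {0..} x * \<phi> x + indicator {..0} x * \<phi> x)"
    proof (rule integral_cong_AE)
      have "AE x in lborel. x \<noteq> (0::real)" by (rule AE_lborel_singleton)
      then show "AE x in lborel. \<phi> x = indicator {0..} x * \<phi> x + indicator {..0} x * \<phi> x"
        by eventually_elim (auto simp: indicator_def)
    qed (use meas in auto)
    ultimately show ?thesis using one intI[of "{0..}"] intI[of "{..0}"] by (simp add: T_def)
  qed
  have split: "T 0 = (LBINT u=0..t. \<phi> u) + T t"
  proof -
    have "T 0 = (LBINT x. indicator {0..t} x * \<phi> x + indicator {t..} x * \<phi> x)"
      unfolding T_def
    proof (rule integral_cong_AE)
      have "AE x in lborel. x \<noteq> t" by (rule AE_lborel_singleton)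
      then show "AE x in lborel. indicator {0..} x * \<phi> x = indicator {0..t} x * \<phi> x + indicator {t..} x * \<phi> x"
        by eventually_elim (use t in \<open>auto simp: indicator_def\<close>)
    qed (use meas in auto)
    also have "\<dots> = (LBINT x. indicator {0..t} x * \<phi> x) + T t"
      using intI[of "{0..t}"] intI[of "{t..}"] by (simp add: T_def)
    also have "(LBINT x. indicator {0..t} x * \<phi> x) = (LBINT u=0..t. \<phi> u)"
      using t by (simp add: zero_ereal_def interval_integral_Icc set_lebesgue_integral_def)
    finally show ?thesis .
  qed
  have eq: "1 - gerf c t = 2 * T t" unfolding gerf_def using split half by (simp add: \<phi>_def)
  have "T t \<ge> 0" unfolding T_def by (intro integral_nonneg_AE) (use pos in auto)
  then show "0 \<le> 1 - gerf c t" using eq by simp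
  have "T t = (LBINT x. indicator {0..} x * \<phi> (t + x))"
    unfolding T_def by (subst lborel_integral_real_affine[where c="1" and t=t]) (auto simp: indicator_def intro!: Bochner_Integration.integral_cong)
  also have "\<dots> \<le> (LBINT x. exp (- t\<^sup>2 / (2 * c)) * (indicator {0..} x * \<phi> x))"
  proof (rule integral_mono')
    show "integrable lborel (\<lambda>x. exp (- t\<^sup>2 / (2 * c)) * (indicator {0..} x * \<phi> x))" using intI by simp
    fix x :: real
    have "\<phi> (t + x) \<le> exp (- t\<^sup>2 / (2 * c)) * \<phi> x" if x: "x \<ge> 0"
    proof -
      have "- (t + x)\<^sup>2 / (2 * c) \<le> - t\<^sup>2 / (2 * c) + - x\<^sup>2 / (2 * c)"
        using c t x by (simp add: field_simps power2_eq_square)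
      then have "exp (- (t + x)\<^sup>2 / (2 * c)) \<le> exp (- t\<^sup>2 / (2 * c)) * exp (- x\<^sup>2 / (2 * c))"
        by (simp add: exp_add[symmetric])
      then show ?thesis unfolding \<phi>_def using c by (simp add: gd_0 divide_right_mono)
    qed
    then show "indicator {0..} x * \<phi> (t + x) \<le> exp (- t\<^sup>2 / (2 * c)) * (indicator {0..} x * \<phi> x)"
      by (auto simp: indicator_def)
    show "0 \<le> exp (- t\<^sup>2 / (2 * c)) * (indicator {0..} x * \<phi> x)" using pos by simp
  qed
  also have "\<dots> = exp (- t\<^sup>2 / (2 * c)) * T 0" by (simp add: T_def)
  finally show "1 - gerf c t \<le> exp (- t\<^sup>2 / (2 * c))" using eq half by simp
qed

text \<open>The odd heat function with initial value sign(y); for y > 0 it is the probability that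
  Brownian motion of variance c, started at y, has not hit 0 by time s.\<close>

definition erfseq :: "real => nat => real => real => real" where
  "erfseq c j s y = (case j of 0 => gerf c (y / sqrt s) | Suc i => 2 * gd c i s y)"

lemma heat_seq_erf:
  assumes "c > 0"
  shows "heat_seq c (erfseq c)"
  unfolding heat_seq_def
proof (intro allI impI conjI)
  fix j and s y :: real assume s: "0 < s"
  show "(erfseq c j s has_real_derivative erfseq c (Suc j) s y) (at y)"
  proof (cases j)
    case 0
    have "((\<lambda>y. gerf c (y / sqrt s)) has_real_derivative 2 * gd c 0 1 (y / sqrt s) * (1 / sqrt s)) (at y)"
      by (rule DERIV_chain2[OF gerf_deriv[OF assms]]) (intro DERIV_cdivide DERIV_ident)
    then show ?thesis using 0 gd_scale[OF assms s, of 0 y] s by (simp add: erfseq_def[abs_def])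
  next
    case (Suc i)
    then show ?thesis using DERIV_cmult[OF gd_deriv_y[OF assms s, of i y], of 2] by (simp add: erfseq_def[abs_def])
  qed
  show "((\<lambda>s. erfseq c j s y) has_real_derivative c / 2 * erfseq c (j + 2) s y) (at s)"
  proof (cases j)
    case 0
    have "((\<lambda>s. gerf c (y / sqrt s)) has_real_derivative 2 * gd c 0 1 (y / sqrt s) * (- y / (2 * s * sqrt s))) (at s)"
      by (rule DERIV_chain2[OF gerf_deriv[OF assms]])
         (use s in \<open>auto intro!: derivative_eq_intros simp: field_simps\<close>)
    moreover have "2 * gd c 0 1 (y / sqrt s) * (- y / (2 * s * sqrt s)) = c / 2 * (2 * gd c (Suc 0) s y)"
      using gd_scale[OF assms s, of 0 y] s assms by (simp add: gd_1 field_simps)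
    ultimately show ?thesis using 0 by (simp add: erfseq_def[abs_def] numeral_2_eq_2)
  next
    case (Suc i)
    then show ?thesis using DERIV_cmult[OF gd_deriv_s[OF assms s, of i y], of 2] by (simp add: erfseq_def[abs_def])
  qed
qed

section \<open>Asymptotics of the killed chain against heat functions\<close>

lemma gd_bound_uniform:
  assumes "c > 0"
  shows "\<exists>C>0. \<forall>j\<le>6. \<forall>s y. s > 0 --> \<bar>gd c j s y\<bar> \<le> C / (sqrt s) ^ Suc j"
proof -
  obtain C where C: "\<And>j. C j > 0" "\<And>j s y. s > 0 ==> \<bar>gd c j s y\<bar> \<le> C j / (sqrt s) ^ Suc j"
    using gd_bound[OF assms] by metis
  define D where "D = (\<Sum>j\<le>6. C j)"
  have D: "C j \<le> D" if "j \<le> 6" for j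
    unfolding D_def by (rule member_le_sum) (use that less_imp_le[OF C(1)] in auto)
  have "\<bar>gd c j s y\<bar> \<le> D / (sqrt s) ^ Suc j" if "j \<le> 6" "s > 0" for j s y
    using C(2)[OF that(2), of j y] divide_right_mono[OF D[OF that(1)], of "(sqrt s) ^ Suc j"] that(2) by simp
  moreover have "D > 0" using D[of 0] C(1)[of 0] by simp
  ultimately show ?thesis by blast
qed

lemma sum_by_parts_surv:
  fixes s :: "nat => real"
  shows "(\<Sum>j<k. real (Suc j) * (s j - s (Suc j))) = (\<Sum>j<k. s j) - k * s k"
  by (induction k) (auto simp: algebra_simps)

context pos_chain
begin

lemma fop_iter_usol:
  "\<exists>C>0. \<forall>h m B k x y. heat_seq s2 h --> m > 0 -->
     (\<forall>t w. m \<le> t --> t \<le> m + real k --> \<bar>h 3 t w\<bar> \<le> B \<and> \<bar>h 4 t w\<bar> \<le> B) -->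
     \<bar>(fop P f ^^ k) (usol h m) x y - usol h (m + k) x y\<bar> \<le> C * B * k"
proof -
  obtain C where C: "C > 0" "\<And>h s B x y. heat_seq s2 h ==> s > 0 ==>
     (\<And>t w. s \<le> t ==> t \<le> s + 1 ==> \<bar>h 3 t w\<bar> \<le> B \<and> \<bar>h 4 t w\<bar> \<le> B) ==>
     \<bar>fop P f (usol h s) x y - usol h (s + 1) x y\<bar> \<le> C * B"
    using fop_usol by metis
  have "\<bar>(fop P f ^^ k) (usol h m) x y - usol h (m + k) x y\<bar> \<le> C * B * k"
    if h: "heat_seq s2 h" and m: "m > 0" and B: "\<forall>t w. m \<le> t --> t \<le> m + real k --> \<bar>h 3 t w\<bar> \<le> B \<and> \<bar>h 4 t w\<bar> \<le> B" for h m B k x y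
    using B
  proof (induction k arbitrary: x y)
    case (Suc k)
    have IH: "\<bar>(fop P f ^^ k) (usol h m) x y - usol h (m + k) x y\<bar> \<le> C * B * k" for x y
      by (rule Suc.IH) (use Suc.prems in auto)
    have "\<bar>(fop P f ^^ 1) (\<lambda>x y. (fop P f ^^ k) (usol h m) x y - usol h (m + k) x y) x y\<bar> \<le> C * B * k"
      by (rule fop_iter_bound) (rule IH)
    then have 1: "\<bar>(fop P f ^^ Suc k) (usol h m) x y - fop P f (usol h (m + k)) x y\<bar> \<le> C * B * k"
      unfolding fop_iter_diff by simp
    have 2: "\<bar>fop P f (usol h (m + k)) x y - usol h (m + k + 1) x y\<bar> \<le> C * B"
      by (rule C(2)[OF h]) (use m Suc.prems in auto)
    have "m + real (Suc k) = m + k + 1" by simp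
    then show ?case using 1 2 by (simp add: algebra_simps)
  qed simp
  then show ?thesis using C(1) by blast
qed

text \<open>An odd heat function looks near the origin like its slope times the height. The slope is
  frozen at its final value and the difference is run through the Duhamel formula. Inside, each step
  has a third-order defect weighted by survival. At an exit the difference is O(B (j + 1)), because
  the slope moves by O(B) per unit of time; summation by parts against the exit probabilities turns
  this into a sum of survival probabilities as well, of order sqrt k.\<close>

lemma kop_heat_lin:
  "\<exists>C>0. \<forall>h m B k x y. heat_seq s2 h --> m > 0 --> k \<ge> 1 --> y \<ge> - l1norm f -->
     (\<forall>t w. m \<le> t --> t \<le> m + real k --> \<bar>h 3 t w\<bar> \<le> B \<and> \<bar>h 4 t w\<bar> \<le> B) -->
     (\<forall>t. m \<le> t --> t \<le> m + real k --> h 0 t 0 = 0 \<and> h 2 t 0 = 0) -->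
     \<bar>(kop P f ^^ k) (usol h m) x y - h 1 (m + k) 0 * (kop P f ^^ k) lin x y\<bar> \<le> C * (1 + \<bar>y\<bar>) ^ 3 * B * sqrt k"
proof -
  obtain C1 where C1: "C1 > 0" "\<And>h s B x y. heat_seq s2 h ==> s > 0 ==>
     (\<And>t w. s \<le> t ==> t \<le> s + 1 ==> \<bar>h 3 t w\<bar> \<le> B \<and> \<bar>h 4 t w\<bar> \<le> B) ==>
     \<bar>fop P f (usol h s) x y - usol h (s + 1) x y\<bar> \<le> C1 * B"
    using fop_usol by metis
  obtain C2 where C2: "C2 > 0" "\<And>k x y. k \<ge> 1 ==> (\<Sum>j<k. surv f j x y) \<le> C2 * (1 + max y 0) * sqrt k"
    using sum_surv_bound by blast
  define F where "F = l1norm f"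
  define R where "R = l1norm rr"
  define K where "K = l1norm qq"
  have F: "0 \<le> F" and R: "\<bar>rr x\<bar> \<le> R" "0 \<le> R" and K: "\<bar>qq x\<bar> \<le> K" "0 \<le> K" for x
    unfolding F_def R_def K_def by (rule l1norm_bound l1norm_nonneg)+
  define G where "G = 2 * F + R"
  define G' where "G' = G ^ 3 + K * G + s2 / 2 * G"
  have G: "G \<ge> 0" "G' \<ge> 0" unfolding G'_def G_def using F R K s2_pos by auto
  define C where "C = (1 + R)^3 + K * (1 + R) + (C1 + G') * C2"
  have main: "\<bar>(kop P f ^^ k) (usol h m) x y - h 1 (m + k) 0 * (kop P f ^^ k) lin x y\<bar> \<le> C * (1 + \<bar>y\<bar>) ^ 3 * B * sqrt k"
    if h: "heat_seq s2 h" and m: "m > 0" and k: "k \<ge> 1" and y: "y \<ge> - F"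
      and B: "\<And>t w. m \<le> t ==> t \<le> m + real k ==> \<bar>h 3 t w\<bar> \<le> B \<and> \<bar>h 4 t w\<bar> \<le> B"
      and z: "\<And>t. m \<le> t ==> t \<le> m + real k ==> h 0 t 0 = 0 \<and> h 2 t 0 = 0" for h m B k x y
  proof -
    have B0: "B \<ge> 0" using B[of m 0] by (meson abs_ge_zero le_add_same_cancel1 of_nat_0_le_iff order_refl order_trans)
    define H where "H = h 1 (m + k) 0"
    \<comment> \<open>The slope \<open>H\<close> is taken at the final time, so the linear part is
      one fixed multiple of a harmonic function and contributes no defect of its own.\<close>
    define a where "a i x y = usol h (m + real i) x y - H * lin x y" for i x y
    have apt: "\<bar>a i x w\<bar> \<le> B * \<bar>w + rr x\<bar>^3 + K * (B * \<bar>w + rr x\<bar>) + s2 / 2 * B * real (k - i) * \<bar>w + rr x\<bar>" if i: "i \<le> k" for i x w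
    proof -
      define v where "v = w + rr x"
      define s where "s = m + real i"
      have s: "s > 0" "m \<le> s" "s \<le> m + k" using m i unfolding s_def by auto
      have "\<bar>h 0 s (0 + v) - (\<Sum>j<3. h (0 + j) s 0 / fact j * v ^ j)\<bar> \<le> B * \<bar>v\<bar> ^ 3"
        by (rule heat_taylor_y[OF h s(1)]) (use B[OF s(2,3)] in auto)
      then have t0: "\<bar>h 0 s v - h 1 s 0 * v\<bar> \<le> B * \<bar>v\<bar> ^ 3"
        using z[OF s(2,3)] by (simp add: eval_nat_numeral)
      have "\<bar>h 2 s (0 + v) - (\<Sum>j<1. h (2 + j) s 0 / fact j * v ^ j)\<bar> \<le> B * \<bar>v\<bar> ^ 1"
        by (rule heat_taylor_y[OF h s(1)]) (use B[OF s(2,3)] in auto)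
      then have "\<bar>h 2 s v\<bar> \<le> B * \<bar>v\<bar>"
        using z[OF s(2,3)] by simp
      then have t2: "\<bar>qq x * h 2 s v\<bar> \<le> K * (B * \<bar>v\<bar>)"
        unfolding abs_mult using K by (intro mult_mono) auto
      \<comment> \<open>The drift of the slope: its time derivative is a multiple of the third space
        derivative, hence bounded by B over the remaining k - i units.\<close>
      have "\<bar>h 1 (s + real (k - i)) 0 - (\<Sum>j<1. (s2/2)^j * h (1 + 2 * j) s 0 / fact j * real (k - i) ^ j)\<bar> \<le> (s2/2)^1 * B * real (k - i) ^ 1"
        by (rule heat_taylor_s[OF h s(1)]) (use B s i s2_pos in \<open>auto simp: s_def of_nat_diff numeral_3_eq_3\<close>)
      then have "\<bar>H - h 1 s 0\<bar> \<le> s2/2 * B * real (k - i)"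
        using i unfolding H_def s_def by (simp add: of_nat_diff)
      then have t1: "\<bar>(h 1 s 0 - H) * v\<bar> \<le> s2/2 * B * real (k - i) * \<bar>v\<bar>"
        unfolding abs_mult abs_minus_commute[of "h 1 s 0"] by (rule mult_right_mono) simp
      have "a i x w = (h 0 s v - h 1 s 0 * v) + qq x * h 2 s v + (h 1 s 0 - H) * v"
        unfolding a_def usol_def s_def[symmetric] v_def[symmetric] by (simp add: algebra_simps)
      then show ?thesis unfolding v_def[symmetric] using t0 t1 t2 by linarith
    qed
    have stp: "\<bar>kop P f (a (k - 1 - j)) x y - a (k - j) x y\<bar> \<le> C1 * B + G' * B * real (Suc j) * exit1 x y"
      if j: "j < k" and y: "y \<ge> - F" for j x y
    proof -
      define i where "i = k - 1 - j"
      have i: "i \<le> k" "k - j = Suc i" "k - i = Suc j" unfolding i_def using j by auto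
      have mi: "m + real (Suc i) = m + real i + 1" by simp
      have "fop P f (a i) x y = fop P f (usol h (m + i)) x y - H * lin x y"
        unfolding a_def using fop_iter_diff[of 1 P f "usol h (m + i)" "\<lambda>x y. H * lin x y" x y]
           fop_iter_mult[of 1 P f H lin x y] by (simp add: fop_linear)
      then have e: "fop P f (a i) x y - a (Suc i) x y = fop P f (usol h (m + i)) x y - usol h (m + i + 1) x y"
        unfolding a_def mi by simp
      have e1: "\<bar>fop P f (a i) x y - a (Suc i) x y\<bar> \<le> C1 * B" unfolding e
      proof (rule C1(2)[OF h])
        fix t w assume "m + real i \<le> t" "t \<le> m + real i + 1"
        moreover have "real i + 1 \<le> k" using i(2) by linarith
        ultimately show "\<bar>h 3 t w\<bar> \<le> B \<and> \<bar>h 4 t w\<bar> \<le> B" by (intro B) auto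
      qed (use m in auto)
      have e2: "\<bar>fop P f (a i) x y - kop P f (a i) x y\<bar> \<le> (G' * B * real (Suc j)) * exit1 x y"
      proof (rule kop_exit_bound)
        show "- l1norm f \<le> y" using y F_def by simp
        fix x w assume w: "- 2 * l1norm f \<le> w" "w \<le> 0"
        define v where "v = \<bar>w + rr x\<bar>"
        have v: "0 \<le> v" "v \<le> G" using w R(1)[of x] unfolding v_def G_def F_def by auto
        have "\<bar>a i x w\<bar> \<le> B * v^3 + K * (B * v) + s2 / 2 * B * real (Suc j) * v"
          using apt[OF i(1), of x w] unfolding i(3) v_def .
        also have "\<dots> \<le> B * G^3 + K * (B * G) + s2 / 2 * B * real (Suc j) * G"
          using v B0 K s2_pos by (intro add_mono mult_left_mono power_mono mult_nonneg_nonneg) auto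
        also have "\<dots> \<le> (B * G^3) * real (Suc j) + (K * (B * G)) * real (Suc j) + s2 / 2 * B * real (Suc j) * G"
        proof -
          have "X \<le> X * real (Suc j)" if "X \<ge> 0" for X using mult_left_mono[OF _ that, of 1 "real (Suc j)"] by simp
          from this[of "B * G^3"] this[of "K * (B * G)"] show ?thesis using B0 G K by auto
        qed
        also have "\<dots> = G' * B * real (Suc j)" unfolding G'_def by (simp add: algebra_simps)
        finally show "\<bar>a i x w\<bar> \<le> G' * B * real (Suc j)" .
      qed
      show ?thesis using e1 e2 unfolding i(2) i_def[symmetric] by linarith
    qed
    have each: "\<bar>(kop P f ^^ j) (\<lambda>x y. kop P f (a (k - 1 - j)) x y - a (k - j) x y) x y\<bar> \<le> C1 * B * surv f j x y + G' * B * (real (Suc j) * (surv f j x y - surv f (Suc j) x y))"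
      if j: "j < k" for j
    proof -
      have eq: "(kop P f ^^ j) (\<lambda>x y. C1 * B * 1 + G' * B * real (Suc j) * exit1 x y) x y = C1 * B * surv f j x y + G' * B * (real (Suc j) * (surv f j x y - surv f (Suc j) x y))"
        unfolding kop_iter_add kop_iter_mult[of j P f "C1 * B" "\<lambda>x y. 1"] kop_iter_mult[of j P f "G' * B * real (Suc j)" exit1] kop_iter_exit1 surv_def by simp
      show ?thesis
      proof (cases "j = 0")
        case True
        then show ?thesis unfolding eq[symmetric] using stp[OF j y, of x] by simp
      next
        case False
        then show ?thesis unfolding eq[symmetric]
          by (intro kop_iter_abs_le) (use stp[OF j] F in auto)
      qed
    qed
    have "(kop P f ^^ k) (a 0) x y = (kop P f ^^ k) (usol h m) x y - H * (kop P f ^^ k) lin x y"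
      unfolding a_def kop_iter_diff kop_iter_mult[of k P f H lin] by simp
    then have tel: "(kop P f ^^ k) (usol h m) x y - H * (kop P f ^^ k) lin x y = a k x y + (\<Sum>j<k. (kop P f ^^ j) (\<lambda>x y. kop P f (a (k - 1 - j)) x y - a (k - j) x y) x y)"
      using kop_telescope[of k a x y] by simp
    have "\<bar>\<Sum>j<k. (kop P f ^^ j) (\<lambda>x y. kop P f (a (k - 1 - j)) x y - a (k - j) x y) x y\<bar> \<le> (\<Sum>j<k. C1 * B * surv f j x y + G' * B * (real (Suc j) * (surv f j x y - surv f (Suc j) x y)))"
      by (rule order_trans[OF sum_abs], rule sum_mono) (use each in auto)
    also have "\<dots> = C1 * B * (\<Sum>j<k. surv f j x y) + G' * B * (\<Sum>j<k. real (Suc j) * (surv f j x y - surv f (Suc j) x y))"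
      by (simp only: sum.distrib sum_distrib_left)
    \<comment> \<open>Summation by parts trades the growing weight for a plain sum of survival
      probabilities; the boundary term has the favourable sign.\<close>
    also have "(\<Sum>j<k. real (Suc j) * (surv f j x y - surv f (Suc j) x y)) = (\<Sum>j<k. surv f j x y) - k * surv f k x y"
      by (rule sum_by_parts_surv)
    also have "C1 * B * (\<Sum>j<k. surv f j x y) + G' * B * ((\<Sum>j<k. surv f j x y) - k * surv f k x y) \<le> (C1 + G') * B * (\<Sum>j<k. surv f j x y)"
    proof -
      have "0 \<le> G' * B * (k * surv f k x y)" using G B0 surv_range(1)[of f k x y] by simp
      then show ?thesis by (simp add: algebra_simps)
    qed
    also have "\<dots> \<le> (C1 + G') * B * (C2 * (1 + max y 0) * sqrt k)"
      using C2(2)[OF k, of x y] C1(1) G B0 by (intro mult_left_mono) auto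
    also have "\<dots> \<le> (C1 + G') * B * (C2 * (1 + \<bar>y\<bar>)^3 * sqrt k)"
    proof -
      have "1 + max y 0 \<le> (1 + \<bar>y\<bar>)^1" by simp
      also have "\<dots> \<le> (1 + \<bar>y\<bar>)^3" by (rule power_increasing) auto
      finally show ?thesis using C1(1) C2(1) G B0 by (intro mult_left_mono mult_right_mono) auto
    qed
    finally have S: "\<bar>\<Sum>j<k. (kop P f ^^ j) (\<lambda>x y. kop P f (a (k - 1 - j)) x y - a (k - j) x y) x y\<bar> \<le> (C1 + G') * C2 * ((1 + \<bar>y\<bar>)^3 * B * sqrt k)"
      by (simp add: ac_simps)
    have "\<bar>a k x y\<bar> \<le> ((1 + R)^3 + K * (1 + R)) * ((1 + \<bar>y\<bar>)^3 * B * sqrt k)"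
    proof -
      define v where "v = \<bar>y + rr x\<bar>"
      define u where "u = (1 + R) * (1 + \<bar>y\<bar>)"
      have "v \<le> \<bar>y\<bar> + R" using R(1)[of x] unfolding v_def by linarith
      moreover have "\<bar>y\<bar> + R \<le> u" unfolding u_def using R(2) by (simp add: algebra_simps)
      ultimately have v: "0 \<le> v" "v \<le> u" unfolding v_def by auto
      have "\<bar>a k x y\<bar> \<le> B * v^3 + K * (B * v)" using apt[of k x y] unfolding v_def by simp
      also have "\<dots> \<le> B * u^3 + K * (B * u)" using v B0 K by (intro add_mono mult_left_mono power_mono) auto
      also have "u^3 = (1 + R)^3 * (1 + \<bar>y\<bar>)^3" unfolding u_def by (rule power_mult_distrib)
      also have "K * (B * u) \<le> K * (B * ((1 + R) * (1 + \<bar>y\<bar>)^3))"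
        unfolding u_def using self_le_power[of "1 + \<bar>y\<bar>" 3] K(2) B0 R(2) by (intro mult_left_mono) auto
      also have "B * ((1 + R)^3 * (1 + \<bar>y\<bar>)^3) + K * (B * ((1 + R) * (1 + \<bar>y\<bar>)^3)) = ((1 + R)^3 + K * (1 + R)) * ((1 + \<bar>y\<bar>)^3 * B) * 1"
        by (simp add: algebra_simps)
      also have "\<dots> \<le> ((1 + R)^3 + K * (1 + R)) * ((1 + \<bar>y\<bar>)^3 * B) * sqrt k"
        using k K(2) R(2) B0 by (intro mult_left_mono) auto
      finally show ?thesis by (simp add: ac_simps)
    qed
    with S have "\<bar>a k x y + (\<Sum>j<k. (kop P f ^^ j) (\<lambda>x y. kop P f (a (k - 1 - j)) x y - a (k - j) x y) x y)\<bar>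
       \<le> ((1 + R)^3 + K * (1 + R)) * ((1 + \<bar>y\<bar>)^3 * B * sqrt k) + (C1 + G') * C2 * ((1 + \<bar>y\<bar>)^3 * B * sqrt k)" by linarith
    also have "\<dots> = C * (1 + \<bar>y\<bar>)^3 * B * sqrt k" unfolding C_def by (simp add: algebra_simps)
    finally show ?thesis using tel unfolding H_def by simp
  qed
  have "C > 0" unfolding C_def using R K C1 C2 G by (intro add_pos_nonneg) auto
  then show ?thesis using main unfolding F_def by (intro exI[of _ C]) auto
qed

text \<open>Two replacements in \<open>kop_heat_lin\<close>: dropping the correctors changes the
  function by O(B1) on the event of survival, and the iterates of \<open>lin\<close> are within
  O(k^(-1/2)) of \<open>W\<close>. Both cost B1 / sqrt k.\<close>

lemma kop_heat:
  "\<exists>C>0. \<forall>h m B B1 k x y. heat_seq s2 h --> m > 0 --> k \<ge> 1 --> y \<ge> - l1norm f -->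
     (\<forall>t w. m \<le> t --> t \<le> m + real k --> \<bar>h 3 t w\<bar> \<le> B \<and> \<bar>h 4 t w\<bar> \<le> B) -->
     (\<forall>t. m \<le> t --> t \<le> m + real k --> h 0 t 0 = 0 \<and> h 2 t 0 = 0) -->
     (\<forall>w. \<bar>h 1 m w\<bar> \<le> B1 \<and> \<bar>h 2 m w\<bar> \<le> B1) --> \<bar>h 1 (m + k) 0\<bar> \<le> B1 -->
     \<bar>(kop P f ^^ k) (\<lambda>x y. h 0 m y) x y - h 1 (m + k) 0 * W x y\<bar> \<le> C * (1 + \<bar>y\<bar>) ^ 3 * (B * sqrt k + B1 / sqrt k)"
proof -
  obtain C1 where C1: "C1 > 0" "\<And>h m B k x y. heat_seq s2 h ==> m > 0 ==> k \<ge> 1 ==> y \<ge> - l1norm f ==>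
     (\<forall>t w. m \<le> t --> t \<le> m + real k --> \<bar>h 3 t w\<bar> \<le> B \<and> \<bar>h 4 t w\<bar> \<le> B) ==>
     (\<forall>t. m \<le> t --> t \<le> m + real k --> h 0 t 0 = 0 \<and> h 2 t 0 = 0) ==>
     \<bar>(kop P f ^^ k) (usol h m) x y - h 1 (m + k) 0 * (kop P f ^^ k) lin x y\<bar> \<le> C1 * (1 + \<bar>y\<bar>) ^ 3 * B * sqrt k"
    using kop_heat_lin by metis
  obtain C2 where C2: "C2 > 0" "\<And>k x y. k \<ge> 1 ==> \<bar>(kop P f ^^ k) lin x y - W x y\<bar> \<le> C2 * (1 + max y 0) / sqrt k"
    using W_rate by blast
  obtain C3 where C3: "C3 > 0" "\<And>n x y. n \<ge> 1 ==> surv f n x y \<le> C3 * (1 + max y 0) / sqrt n"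
    using survival_bound by blast
  define R where "R = l1norm rr"
  define K where "K = l1norm qq"
  have R: "\<bar>rr x\<bar> \<le> R" "0 \<le> R" and K: "\<bar>qq x\<bar> \<le> K" "0 \<le> K" for x
    unfolding R_def K_def by (rule l1norm_bound l1norm_nonneg)+
  define C where "C = C1 + C2 + (R + K) * C3"
  have "\<bar>(kop P f ^^ k) (\<lambda>x y. h 0 m y) x y - h 1 (m + k) 0 * W x y\<bar> \<le> C * (1 + \<bar>y\<bar>) ^ 3 * (B * sqrt k + B1 / sqrt k)"
    if h: "heat_seq s2 h" and m: "m > 0" and k: "k \<ge> 1" and y: "y \<ge> - l1norm f"
      and B: "\<forall>t w. m \<le> t --> t \<le> m + real k --> \<bar>h 3 t w\<bar> \<le> B \<and> \<bar>h 4 t w\<bar> \<le> B"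
      and z: "\<forall>t. m \<le> t --> t \<le> m + real k --> h 0 t 0 = 0 \<and> h 2 t 0 = 0"
      and B1: "\<forall>w. \<bar>h 1 m w\<bar> \<le> B1 \<and> \<bar>h 2 m w\<bar> \<le> B1" and H: "\<bar>h 1 (m + k) 0\<bar> \<le> B1" for h m B B1 k x y
  proof -
    have B0: "B \<ge> 0" using B[rule_format, of m 0] by (meson abs_ge_zero le_add_same_cancel1 of_nat_0_le_iff order_refl order_trans)
    have B10: "B1 \<ge> 0" using H by linarith
    define Z where "Z = (1 + \<bar>y\<bar>)^3"
    have Z: "1 + max y 0 \<le> Z" "Z \<ge> 1"
    proof -
      have "1 + max y 0 \<le> (1 + \<bar>y\<bar>)^1" by simp
      also have "\<dots> \<le> (1 + \<bar>y\<bar>)^3" by (rule power_increasing) auto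
      finally show "1 + max y 0 \<le> Z" unfolding Z_def .
      then show "Z \<ge> 1" by linarith
    qed
    have sk: "sqrt k > 0" using k by simp
    have 1: "\<bar>(kop P f ^^ k) (usol h m) x y - h 1 (m + k) 0 * (kop P f ^^ k) lin x y\<bar> \<le> C1 * Z * B * sqrt k"
      unfolding Z_def by (rule C1(2)[OF h m k y B z])
    have 2: "\<bar>h 1 (m + k) 0 * (kop P f ^^ k) lin x y - h 1 (m + k) 0 * W x y\<bar> \<le> C2 * Z * (B1 / sqrt k)"
    proof -
      have "\<bar>h 1 (m + k) 0 * (kop P f ^^ k) lin x y - h 1 (m + k) 0 * W x y\<bar> = \<bar>h 1 (m + k) 0\<bar> * \<bar>(kop P f ^^ k) lin x y - W x y\<bar>"
        by (simp add: abs_mult[symmetric] right_diff_distrib)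
      also have "\<dots> \<le> B1 * (C2 * (1 + max y 0) / sqrt k)"
        using H C2(2)[OF k, of x y] B10 by (intro mult_mono) auto
      also have "\<dots> \<le> B1 * (C2 * Z / sqrt k)"
        using Z C2(1) sk B10 by (intro mult_left_mono divide_right_mono) auto
      finally show ?thesis by (simp add: ac_simps)
    qed
    have 3: "\<bar>(kop P f ^^ k) (\<lambda>x y. h 0 m y) x y - (kop P f ^^ k) (usol h m) x y\<bar> \<le> (R + K) * C3 * Z * (B1 / sqrt k)"
    proof -
      have pt: "\<bar>h 0 m w - usol h m x w\<bar> \<le> (R + K) * B1" for x w
      proof -
        have "\<bar>h 0 m (w + rr x) - (\<Sum>j<1. h (0 + j) m w / fact j * (rr x) ^ j)\<bar> \<le> B1 * \<bar>rr x\<bar> ^ 1"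
          by (rule heat_taylor_y[OF h m]) (use B1 in auto)
        then have "\<bar>h 0 m (w + rr x) - h 0 m w\<bar> \<le> B1 * \<bar>rr x\<bar>" by simp
        also have "\<dots> \<le> B1 * R" using R B10 by (intro mult_left_mono) auto
        finally have a: "\<bar>h 0 m (w + rr x) - h 0 m w\<bar> \<le> R * B1" by (simp add: mult.commute)
        have "\<bar>qq x * h 2 m (w + rr x)\<bar> \<le> K * B1"
          unfolding abs_mult using K B1 by (intro mult_mono) auto
        with a show ?thesis unfolding usol_def distrib_right by linarith
      qed
      have "(kop P f ^^ k) (\<lambda>x y. h 0 m y) x y - (kop P f ^^ k) (usol h m) x y = (kop P f ^^ k) (\<lambda>x y. h 0 m y - usol h m x y) x y"
        unfolding kop_iter_diff by simp
      moreover have "\<bar>(kop P f ^^ k) (\<lambda>x y. h 0 m y - usol h m x y) x y\<bar> \<le> (R + K) * B1 * surv f k x y"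
        by (rule kop_iter_sup_bound) (use pt k in auto)
      moreover have "(R + K) * B1 * surv f k x y \<le> (R + K) * B1 * (C3 * Z / sqrt k)"
      proof (rule mult_left_mono)
        have "surv f k x y \<le> C3 * (1 + max y 0) / sqrt k" by (rule C3(2)[OF k])
        also have "\<dots> \<le> C3 * Z / sqrt k" using Z C3(1) sk by (intro divide_right_mono mult_left_mono) auto
        finally show "surv f k x y \<le> C3 * Z / sqrt k" .
      qed (use R K B10 in auto)
      ultimately show ?thesis by (simp add: ac_simps)
    qed
    have "\<bar>(kop P f ^^ k) (\<lambda>x y. h 0 m y) x y - h 1 (m + k) 0 * W x y\<bar> \<le> C1 * Z * B * sqrt k + C2 * Z * (B1 / sqrt k) + (R + K) * C3 * Z * (B1 / sqrt k)"
      using 1 2 3 by linarith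
    also have "\<dots> = C1 * Z * (B * sqrt k) + (C2 + (R + K) * C3) * Z * (B1 / sqrt k)" by (simp add: algebra_simps)
    also have "\<dots> \<le> C * Z * (B * sqrt k) + C * Z * (B1 / sqrt k)"
      unfolding C_def using C1(1) C2(1) C3(1) R K Z B0 B10 sk by (intro add_mono mult_right_mono) auto
    finally show ?thesis unfolding Z_def by (simp add: algebra_simps)
  qed
  moreover have "C > 0" unfolding C_def using C1 C2 C3 R K by (intro add_pos_nonneg) auto
  ultimately show ?thesis by blast
qed

text \<open>The free chain sends the Gaussian at time m close to the Gaussian at time m + k, whose
  height gives the first term; the other two are the correctors and k accumulated third-order
  defects.\<close>

lemma fop_iter_gd:
  "\<exists>C>0. \<forall>m k x y. m \<ge> 1 --> \<bar>(fop P f ^^ k) (\<lambda>x y. gd s2 0 m y) x y\<bar> \<le> C * (1 / sqrt (m + real k) + 1 / m + real k / m\<^sup>2)"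
proof -
  obtain C1 where C1: "C1 > 0" "\<And>h m B k x y. heat_seq s2 h ==> m > 0 ==>
     (\<forall>t w. m \<le> t --> t \<le> m + real k --> \<bar>h 3 t w\<bar> \<le> B \<and> \<bar>h 4 t w\<bar> \<le> B) ==>
     \<bar>(fop P f ^^ k) (usol h m) x y - usol h (m + k) x y\<bar> \<le> C1 * B * k"
    using fop_iter_usol by metis
  obtain C2 where C2: "C2 > 0" "\<And>j s y. j \<le> 6 ==> s > 0 ==> \<bar>gd s2 j s y\<bar> \<le> C2 / (sqrt s) ^ Suc j"
    using gd_bound_uniform[OF s2_pos] by blast
  define R where "R = l1norm rr"
  define K where "K = l1norm qq"
  have R: "\<bar>rr x\<bar> \<le> R" "0 \<le> R" and K: "\<bar>qq x\<bar> \<le> K" "0 \<le> K" for x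
    unfolding R_def K_def by (rule l1norm_bound l1norm_nonneg)+
  have dec: "C2 / (sqrt s) ^ j \<le> C2 / (sqrt s) ^ i" if "i \<le> j" "s \<ge> 1" for i j s
    using that C2(1) by (intro divide_left_mono power_increasing mult_pos_pos zero_less_power) auto
  have sq2: "(sqrt s)^2 = s" "(sqrt s)^4 = s^2" if "s \<ge> 0" for s :: real
  proof -
    show "(sqrt s)^2 = s" using that by simp
    have "(sqrt s)^4 = ((sqrt s)^2)^2" by (simp add: power_mult[symmetric])
    then show "(sqrt s)^4 = s^2" using that by simp
  qed
  have h: "heat_seq s2 (gd s2)" by (rule heat_seq_gd[OF s2_pos])
  define C where "C = C2 * (1 + K) + C2 * (R + K) + C1 * C2"
  have "\<bar>(fop P f ^^ k) (\<lambda>x y. gd s2 0 m y) x y\<bar> \<le> C * (1 / sqrt (m + real k) + 1 / m + real k / m\<^sup>2)"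
    if m: "m \<ge> 1" for m k x y
  proof -
    have us: "\<bar>usol (gd s2) s x y\<bar> \<le> C2 * (1 + K) * (1 / sqrt s)" if s: "s \<ge> 1" for s x y
    proof -
      have "\<bar>gd s2 0 s (y + rr x)\<bar> \<le> C2 / sqrt s" using C2(2)[of 0 s "y + rr x"] s by simp
      moreover have "\<bar>gd s2 2 s (y + rr x)\<bar> \<le> C2 / sqrt s" using C2(2)[of 2 s "y + rr x"] dec[of 1 3 s] s by (simp add: eval_nat_numeral)
      then have "\<bar>qq x * gd s2 2 s (y + rr x)\<bar> \<le> K * (C2 / sqrt s)"
        unfolding abs_mult using K by (intro mult_mono) auto
      ultimately have "\<bar>usol (gd s2) s x y\<bar> \<le> C2 / sqrt s + K * (C2 / sqrt s)" unfolding usol_def by linarith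
      then show ?thesis by (simp add: algebra_simps add_divide_distrib)
    qed
    have pt: "\<bar>gd s2 0 m w - usol (gd s2) m x w\<bar> \<le> C2 * (R + K) * (1 / m)" for x w
    proof -
      have b1: "\<bar>gd s2 1 m w\<bar> \<le> C2 / m" for w using C2(2)[of 1 m w] m sq2(1)[of m] by (simp add: power2_eq_square)
      have b2: "\<bar>gd s2 2 m w\<bar> \<le> C2 / m" for w using C2(2)[of 2 m w] dec[of 2 3 m] m sq2(1)[of m] by (simp add: eval_nat_numeral)
      have "\<bar>gd s2 0 m (w + rr x) - (\<Sum>j<1. gd s2 (0 + j) m w / fact j * (rr x) ^ j)\<bar> \<le> C2 / m * \<bar>rr x\<bar> ^ 1"
        by (rule heat_taylor_y[OF h]) (use b1 m in auto)
      then have "\<bar>gd s2 0 m (w + rr x) - gd s2 0 m w\<bar> \<le> C2 / m * \<bar>rr x\<bar>" by simp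
      also have "\<dots> \<le> C2 / m * R" using R C2(1) m by (intro mult_left_mono) auto
      finally have a: "\<bar>gd s2 0 m (w + rr x) - gd s2 0 m w\<bar> \<le> R * (C2 / m)" by (simp add: mult.commute)
      have "\<bar>qq x * gd s2 2 m (w + rr x)\<bar> \<le> K * (C2 / m)"
        unfolding abs_mult using K b2 by (intro mult_mono) auto
      with a have "\<bar>gd s2 0 m w - usol (gd s2) m x w\<bar> \<le> R * (C2 / m) + K * (C2 / m)" unfolding usol_def by linarith
      then show ?thesis by (simp add: algebra_simps add_divide_distrib)
    qed
    have 1: "\<bar>(fop P f ^^ k) (\<lambda>x y. gd s2 0 m y - usol (gd s2) m x y) x y\<bar> \<le> C2 * (R + K) * (1 / m)"
      by (rule fop_iter_bound) (use pt in auto)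
    have 2: "\<bar>(fop P f ^^ k) (usol (gd s2) m) x y - usol (gd s2) (m + k) x y\<bar> \<le> C1 * (C2 / m\<^sup>2) * k"
    proof (rule C1(2)[OF h], safe)
      fix t w assume t: "m \<le> t"
      then have t1: "t \<ge> 1" using m by simp
      have tm: "C2 / (sqrt t) ^ 4 \<le> C2 / m\<^sup>2"
        unfolding sq2(2)[OF order_trans[OF zero_le_one t1]] using t m C2(1) by (intro divide_left_mono power_mono) auto
      show "\<bar>gd s2 3 t w\<bar> \<le> C2 / m\<^sup>2" using C2(2)[of 3 t w] tm t1 by simp
      show "\<bar>gd s2 4 t w\<bar> \<le> C2 / m\<^sup>2" using C2(2)[of 4 t w] tm dec[of 4 5 t] t1 by simp
    qed (use m in auto)
    have 3: "\<bar>usol (gd s2) (m + k) x y\<bar> \<le> C2 * (1 + K) * (1 / sqrt (m + k))" by (rule us) (use m in auto)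
    have "\<bar>(fop P f ^^ k) (\<lambda>x y. gd s2 0 m y) x y\<bar> \<le> C2 * (1 + K) * (1 / sqrt (m + k)) + C2 * (R + K) * (1 / m) + C1 * C2 * (k / m\<^sup>2)"
      using 1 2 3 unfolding fop_iter_diff by (simp only: times_divide_eq_right times_divide_eq_left)
    also have "\<dots> \<le> C * (1 / sqrt (m + k)) + C * (1 / m) + C * (k / m\<^sup>2)"
      unfolding C_def using C1 C2(1) R K m by (intro add_mono mult_right_mono) auto
    finally show ?thesis by (simp add: algebra_simps)
  qed
  moreover have "C > 0" unfolding C_def using C1 C2(1) R K by (intro add_pos_nonneg) auto
  ultimately show ?thesis by blast
qed

end

context pos_chain
begin

text \<open>The indicator of survival is replaced by the error function at a small heat time m. The
  latter is odd with final slope 2 / sqrt(2 pi s2 (m + k)), so \<open>kop_heat\<close> gives the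
  limit; the replacement only matters in a layer of width sqrt m above 0, where a surviving path is
  unlikely to end.\<close>

lemma surv_asymp: "(\<lambda>k. sqrt k * surv f k x y) \<longlonglongrightarrow> 2 * W x y / sqrt (2 * pi * s2)"
proof (cases "y \<ge> - l1norm f")
  case False
  then have "W x y = 0" by (intro W_below) simp
  moreover have "surv f (Suc k) x y = 0" for k unfolding surv_def using kop_below[of y f] False by simp
  then have "(\<lambda>k. sqrt (Suc k) * surv f (Suc k) x y) \<longlonglongrightarrow> 0" by simp
  then have "(\<lambda>k. sqrt k * surv f k x y) \<longlonglongrightarrow> 0" by (rule LIMSEQ_imp_Suc)
  ultimately show ?thesis by simp
next
  case y: True
  \<comment> \<open>m must be o(k) so as not to alter the limit, and much larger than k^(2/3) so
    that the error k / m^(3/2) vanishes; any exponent strictly between 2/3 and 1 would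
    serve.\<close>
  define m where "m k = real k powr (3/4)" for k :: nat
  define h where "h = erfseq s2"
  have h: "heat_seq s2 h" unfolding h_def by (rule heat_seq_erf[OF s2_pos])
  obtain C1 where C1: "C1 > 0" "\<And>h m B B1 k x y. heat_seq s2 h ==> m > 0 ==> k \<ge> 1 ==> y \<ge> - l1norm f ==>
     (\<forall>t w. m \<le> t --> t \<le> m + real k --> \<bar>h 3 t w\<bar> \<le> B \<and> \<bar>h 4 t w\<bar> \<le> B) ==>
     (\<forall>t. m \<le> t --> t \<le> m + real k --> h 0 t 0 = 0 \<and> h 2 t 0 = 0) ==>
     (\<forall>w. \<bar>h 1 m w\<bar> \<le> B1 \<and> \<bar>h 2 m w\<bar> \<le> B1) ==> \<bar>h 1 (m + k) 0\<bar> \<le> B1 ==>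
     \<bar>(kop P f ^^ k) (\<lambda>x y. h 0 m y) x y - h 1 (m + k) 0 * W x y\<bar> \<le> C1 * (1 + \<bar>y\<bar>) ^ 3 * (B * sqrt k + B1 / sqrt k)"
    using kop_heat by metis
  obtain C2 where C2: "C2 > 0" "\<And>j s y. j \<le> 6 ==> s > 0 ==> \<bar>gd s2 j s y\<bar> \<le> C2 / (sqrt s) ^ Suc j"
    using gd_bound_uniform[OF s2_pos] by blast
  obtain C3 where C3: "C3 > 0" "\<And>m k x y. m \<ge> 1 ==> \<bar>(fop P f ^^ k) (\<lambda>x y. gd s2 0 m y) x y\<bar> \<le> C3 * (1 / sqrt (m + real k) + 1 / m + real k / m\<^sup>2)"
    using fop_iter_gd by blast
  obtain C4 where C4: "C4 > 0" "\<And>n x y. n \<ge> 1 ==> surv f n x y \<le> C4 * (1 + max y 0) / sqrt n"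
    using survival_bound by blast
  have dec: "C2 / (sqrt s) ^ j \<le> C2 / (sqrt s) ^ i" if "i \<le> j" "s \<ge> 1" for i j s
    using that C2(1) by (intro divide_left_mono power_increasing mult_pos_pos zero_less_power) auto
  have inc: "C2 / (sqrt t) ^ j \<le> C2 / (sqrt s) ^ j" if "s \<le> t" "s \<ge> 1" for s t j
    using that C2(1) by (intro divide_left_mono power_mono mult_pos_pos zero_less_power) auto
  define Z where "Z = (1 + \<bar>y\<bar>)^3"
  define e1 where "e1 k = C1 * Z * (2 * C2 * (sqrt k * sqrt k) / (sqrt (m k))^3 + 2 * C2 / sqrt (m k))" for k :: nat
  define e2 where "e2 k = sqrt k * (sqrt (2 * pi * s2 * m k) * (C3 * (1 / sqrt (k / 2) + 1 / m k + real k / (m k)\<^sup>2)) * (C4 * (1 + max y 0) / sqrt (k / 2)))" for k :: nat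
  have main: "\<bar>sqrt k * surv f k x y - sqrt k * (2 / sqrt (2 * pi * s2 * (m k + k))) * W x y\<bar> \<le> e1 k + e2 k" if k: "k \<ge> 2" for k
  proof -
    have m1: "m k \<ge> 1" unfolding m_def using k by (intro ge_one_powr_ge_zero) auto
    define A where "A = (kop P f ^^ k) (\<lambda>x y. h 0 (m k) y) x y"
    have H: "h 1 (m k + k) 0 = 2 / sqrt (2 * pi * s2 * (m k + k))" unfolding h_def erfseq_def by (simp add: gd_0)
    have h1: "h (Suc j) s w = 2 * gd s2 j s w" for j s w unfolding h_def erfseq_def by simp
    have a: "\<bar>A - h 1 (m k + k) 0 * W x y\<bar> \<le> C1 * (1 + \<bar>y\<bar>) ^ 3 * (2 * (C2 / (sqrt (m k))^3) * sqrt k + 2 * (C2 / sqrt (m k)) / sqrt k)"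
      unfolding A_def
    proof (rule C1(2)[OF h])
      show "\<forall>t w. m k \<le> t --> t \<le> m k + real k --> \<bar>h 3 t w\<bar> \<le> 2 * (C2 / (sqrt (m k))^3) \<and> \<bar>h 4 t w\<bar> \<le> 2 * (C2 / (sqrt (m k))^3)"
      proof (intro allI impI)
        fix t w assume t: "m k \<le> t"
        have "\<bar>gd s2 2 t w\<bar> \<le> C2 / (sqrt (m k))^3" using C2(2)[of 2 t w] inc[OF t m1, of 3] t m1 by simp
        moreover have "\<bar>gd s2 3 t w\<bar> \<le> C2 / (sqrt (m k))^3" using C2(2)[of 3 t w] inc[OF t m1, of 3] dec[of 3 4 t] t m1 by simp
        ultimately show "\<bar>h 3 t w\<bar> \<le> 2 * (C2 / (sqrt (m k))^3) \<and> \<bar>h 4 t w\<bar> \<le> 2 * (C2 / (sqrt (m k))^3)"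
        proof -
          have "h 3 t w = 2 * gd s2 2 t w" "h 4 t w = 2 * gd s2 3 t w"
            using h1[of 2 t w] h1[of 3 t w] by (simp_all add: eval_nat_numeral)
          then show ?thesis using \<open>\<bar>gd s2 2 t w\<bar> \<le> _\<close> \<open>\<bar>gd s2 3 t w\<bar> \<le> _\<close> by linarith
        qed
      qed
      show "\<forall>t. m k \<le> t --> t \<le> m k + real k --> h 0 t 0 = 0 \<and> h 2 t 0 = 0"
        using h1[of 1] by (simp add: h_def erfseq_def gerf_0 gd_1 numeral_2_eq_2)
      show "\<forall>w. \<bar>h 1 (m k) w\<bar> \<le> 2 * (C2 / sqrt (m k)) \<and> \<bar>h 2 (m k) w\<bar> \<le> 2 * (C2 / sqrt (m k))"
      proof
        fix w
        have "\<bar>gd s2 0 (m k) w\<bar> \<le> C2 / sqrt (m k)" using C2(2)[of 0 "m k" w] m1 by simp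
        moreover have "\<bar>gd s2 1 (m k) w\<bar> \<le> C2 / sqrt (m k)" using C2(2)[of 1 "m k" w] dec[of 1 2 "m k"] m1 by (simp add: eval_nat_numeral)
        ultimately show "\<bar>h 1 (m k) w\<bar> \<le> 2 * (C2 / sqrt (m k)) \<and> \<bar>h 2 (m k) w\<bar> \<le> 2 * (C2 / sqrt (m k))"
        proof -
          have "h 1 (m k) w = 2 * gd s2 0 (m k) w" "h 2 (m k) w = 2 * gd s2 1 (m k) w"
            using h1[of 0 "m k" w] h1[of 1 "m k" w] by (simp_all add: eval_nat_numeral)
          then show ?thesis using \<open>\<bar>gd s2 0 (m k) w\<bar> \<le> _\<close> \<open>\<bar>gd s2 1 (m k) w\<bar> \<le> _\<close> by linarith
        qed
      qed
      have "\<bar>gd s2 0 (m k + k) 0\<bar> \<le> C2 / sqrt (m k)" using C2(2)[of 0 "m k + k" 0] inc[of "m k" "m k + k" 1] m1 by simp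
      then show "\<bar>h 1 (m k + k) 0\<bar> \<le> 2 * (C2 / sqrt (m k))" using h1[of 0 "m k + k" 0] by simp
    qed (use m1 k y in auto)
    have sk: "sqrt k > 0" using k by simp
    have b1: "\<bar>sqrt k * A - sqrt k * (2 / sqrt (2 * pi * s2 * (m k + k))) * W x y\<bar> \<le> e1 k"
    proof -
      have "sqrt k * A - sqrt k * (2 / sqrt (2 * pi * s2 * (m k + k))) * W x y = sqrt k * (A - h 1 (m k + k) 0 * W x y)"
        unfolding H by (simp add: right_diff_distrib)
      then have "\<bar>sqrt k * A - sqrt k * (2 / sqrt (2 * pi * s2 * (m k + k))) * W x y\<bar> = sqrt k * \<bar>A - h 1 (m k + k) 0 * W x y\<bar>"
        by (simp add: abs_mult)
      also have "\<dots> \<le> sqrt k * (C1 * Z * (2 * (C2 / (sqrt (m k))^3) * sqrt k + 2 * (C2 / sqrt (m k)) / sqrt k))"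
        using a sk unfolding Z_def by (intro mult_left_mono) auto
      also have "\<dots> = e1 k" unfolding e1_def using sk
        by (simp add: algebra_simps)
      finally show ?thesis .
    qed
    \<comment> \<open>The defect 1 - \<open>h 0\<close> of the initial layer is dominated by a
      multiple of a Gaussian density with factor sqrt m.\<close>
    have b2: "0 \<le> surv f k x y - A" "surv f k x y - A \<le> (sqrt (2 * pi * s2 * m k) * (C3 * (1 / sqrt (k / 2) + 1 / m k + real k / (m k)\<^sup>2)) * (C4 * (1 + max y 0) / sqrt (k / 2)))"
    proof -
      have eq: "surv f k x y - A = (kop P f ^^ k) (\<lambda>x y. 1 - h 0 (m k) y) x y"
        unfolding surv_def A_def kop_iter_diff by simp
      have h0: "h 0 (m k) w = gerf s2 (w / sqrt (m k))" for w unfolding h_def erfseq_def by simp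
      have t0: "0 \<le> 1 - h 0 (m k) w" and t1: "1 - h 0 (m k) w \<le> sqrt (2 * pi * s2 * m k) * gd s2 0 (m k) w" if w: "w > 0" for w
      proof -
        have wm: "w / sqrt (m k) \<ge> 0" using w m1 by simp
        show "0 \<le> 1 - h 0 (m k) w" unfolding h0 by (rule gerf_tail(1)[OF s2_pos wm])
        have p: "sqrt (2 * pi * s2 * m k) > 0" using s2_pos m1 by simp
        have "exp (- (w / sqrt (m k))\<^sup>2 / (2 * s2)) = sqrt (2 * pi * s2 * m k) * gd s2 0 (m k) w"
          unfolding gd_0 using p m1 s2_pos by (simp add: power_divide field_simps)
        then show "1 - h 0 (m k) w \<le> sqrt (2 * pi * s2 * m k) * gd s2 0 (m k) w"
          unfolding h0 using gerf_tail(2)[OF s2_pos wm] by simp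
      qed
      show "0 \<le> surv f k x y - A" unfolding eq by (rule kop_iter_nonneg) (use t0 k in auto)
      \<comment> \<open>About half of the steps spread the Gaussian to height O(k^(-1/2)), the
        others contribute a survival factor of the same order.\<close>
      define k2 where "k2 = k div 2"
      define k1 where "k1 = k - k2"
      have kk: "k = k1 + k2" "k1 \<ge> 1" "real k / 2 \<le> k1" "real k / 2 \<le> m k + k2" unfolding k1_def k2_def using k m1 by auto
      have "surv f k x y - A \<le> (kop P f ^^ k) (\<lambda>x y. sqrt (2 * pi * s2 * m k) * gd s2 0 (m k) y) x y"
        unfolding eq by (rule kop_iter_mono) (use t1 k in auto)
      also have "\<dots> = sqrt (2 * pi * s2 * m k) * (kop P f ^^ k) (\<lambda>x y. gd s2 0 (m k) y) x y"
        by (rule kop_iter_mult)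
      also have "(kop P f ^^ k) (\<lambda>x y. gd s2 0 (m k) y) x y = (kop P f ^^ k1) ((kop P f ^^ k2) (\<lambda>x y. gd s2 0 (m k) y)) x y"
        unfolding kk(1) by (rule funpow_add_apply)
      also have "\<dots> \<le> C3 * (1 / sqrt (k / 2) + 1 / m k + real k / (m k)\<^sup>2) * surv f k1 x y"
      proof (rule order_trans[OF abs_ge_self], rule kop_iter_sup_bound)
        fix x y
        have g0: "\<And>x y. 0 \<le> gd s2 0 (m k) y" using s2_pos m1 by (simp add: gd_0)
        have "\<bar>(kop P f ^^ k2) (\<lambda>x y. gd s2 0 (m k) y) x y\<bar> \<le> \<bar>(fop P f ^^ k2) (\<lambda>x y. gd s2 0 (m k) y) x y\<bar>"
          using kop_iter_le_fop_iter[of "\<lambda>x y. gd s2 0 (m k) y" k2 f x y] g0 by auto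
        also have "\<dots> \<le> C3 * (1 / sqrt (m k + real k2) + 1 / m k + real k2 / (m k)\<^sup>2)" by (rule C3(2)[OF m1])
        also have "\<dots> \<le> C3 * (1 / sqrt (k / 2) + 1 / m k + real k / (m k)\<^sup>2)"
        proof (intro mult_left_mono add_mono)
          show "1 / sqrt (m k + real k2) \<le> 1 / sqrt (real k / 2)"
            using kk(4) k by (intro divide_left_mono real_sqrt_le_mono) auto
          show "real k2 / (m k)\<^sup>2 \<le> real k / (m k)\<^sup>2" unfolding k2_def by (intro divide_right_mono) auto
        qed (use C3(1) in auto)
        finally show "\<bar>(kop P f ^^ k2) (\<lambda>x y. gd s2 0 (m k) y) x y\<bar> \<le> C3 * (1 / sqrt (k / 2) + 1 / m k + real k / (m k)\<^sup>2)" .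
      qed (use kk in auto)
      also have "surv f k1 x y \<le> C4 * (1 + max y 0) / sqrt (k / 2)"
      proof -
        have "surv f k1 x y \<le> C4 * (1 + max y 0) / sqrt k1" by (rule C4(2)[OF kk(2)])
        also have "\<dots> \<le> C4 * (1 + max y 0) / sqrt (k / 2)"
          using kk(2,3) k C4(1) by (intro divide_left_mono real_sqrt_le_mono) auto
        finally show ?thesis .
      qed
      finally show "surv f k x y - A \<le> (sqrt (2 * pi * s2 * m k) * (C3 * (1 / sqrt (k / 2) + 1 / m k + real k / (m k)\<^sup>2)) * (C4 * (1 + max y 0) / sqrt (k / 2)))"
        using C3(1) s2_pos m1 by (simp add: mult_left_mono mult.assoc)
    qed
    have "\<bar>sqrt k * surv f k x y - sqrt k * A\<bar> = sqrt k * (surv f k x y - A)"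
      using b2(1) sk by (simp add: abs_mult right_diff_distrib[symmetric] del: right_diff_distrib)
    also have "\<dots> \<le> e2 k" unfolding e2_def using b2(2) sk by (intro mult_left_mono) auto
    finally show ?thesis using b1 by linarith
  qed
  have e1: "e1 \<longlonglongrightarrow> 0"
  proof -
    have "(\<lambda>k::nat. C1 * Z * (2 * C2 * (sqrt (real k) * sqrt k) / (sqrt (real k powr (3/4)))^3 + 2 * C2 / sqrt (real k powr (3/4)))) \<longlonglongrightarrow> 0"
      by real_asymp
    then show ?thesis unfolding e1_def m_def .
  qed
  have e2: "e2 \<longlonglongrightarrow> 0"
  proof -
    define c1 where "c1 = sqrt (2 * pi * s2)"
    define c4 where "c4 = C4 * (1 + max y 0)"
    have "(\<lambda>k::nat. sqrt (real k) * (c1 * sqrt (real k powr (3/4)) * (C3 * (1 / sqrt (real k / 2) + 1 / (real k powr (3/4)) + real k / (real k powr (3/4))\<^sup>2)) * (c4 / sqrt (real k / 2)))) \<longlonglongrightarrow> 0"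
      by real_asymp
    then show ?thesis unfolding e2_def m_def c1_def c4_def by (simp add: real_sqrt_mult)
  qed
  have lim1: "(\<lambda>k. sqrt k * (2 / sqrt (2 * pi * s2 * (m k + k))) * W x y) \<longlonglongrightarrow> 2 / sqrt (2 * pi * s2) * W x y"
  proof -
    define c1 where "c1 = sqrt (2 * pi * s2)"
    have "(\<lambda>k::nat. sqrt (real k) * (1 / sqrt (real k powr (3/4) + real k))) \<longlonglongrightarrow> 1" by real_asymp
    then have "(\<lambda>k::nat. 2 / c1 * W x y * (sqrt (real k) * (1 / sqrt (real k powr (3/4) + real k)))) \<longlonglongrightarrow> 2 / c1 * W x y * 1"
      by (intro tendsto_intros)
    then show ?thesis unfolding m_def c1_def by (simp add: real_sqrt_mult ac_simps)
  qed
  have "(\<lambda>k. sqrt k * surv f k x y - sqrt k * (2 / sqrt (2 * pi * s2 * (m k + k))) * W x y) \<longlonglongrightarrow> 0"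
  proof (rule Lim_null_comparison)
    show "\<forall>\<^sub>F k in sequentially. norm (sqrt k * surv f k x y - sqrt k * (2 / sqrt (2 * pi * s2 * (m k + k))) * W x y) \<le> e1 k + e2 k"
      using main by (auto simp: eventually_sequentially intro!: exI[of _ 2])
    show "(\<lambda>k. e1 k + e2 k) \<longlonglongrightarrow> 0" using tendsto_add[OF e1 e2] by simp
  qed
  from tendsto_add[OF this lim1] show ?thesis by simp
qed

end

section \<open>Translation between path sums and killed operators\<close>

lemma lists_Suc: "{xs :: 'a list. length xs = Suc n} = (\<lambda>(x, xs). x # xs) ` (UNIV \<times> {xs. length xs = n})"
  by (auto simp: length_Suc_conv image_iff)

lemma path_exp_Suc: "path_exp P (Suc n) x F = (\<Sum>x'\<in>UNIV. P x x' * path_exp P n x' (\<lambda>xs. F (x' # xs)))"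
proof -
  have "path_exp P (Suc n) x F = (\<Sum>(x', xs)\<in>UNIV \<times> {xs. length xs = n}. P x x' * path_weight P x' xs * F (x' # xs))"
    unfolding path_exp_def lists_Suc by (subst sum.reindex) (auto simp: inj_on_def case_prod_beta)
  also have "\<dots> = (\<Sum>x'\<in>UNIV. \<Sum>xs\<in>{xs. length xs = n}. P x x' * path_weight P x' xs * F (x' # xs))"
    by (rule sum.cartesian_product[symmetric])
  finally show ?thesis by (simp add: path_exp_def sum_distrib_left mult.assoc)
qed

lemma tau_gt_Cons: "tau_gt f y (x' # xs) (Suc n) \<longleftrightarrow> y + f x' > 0 \<and> tau_gt f (y + f x') xs n"
proof -
  have gen: "(\<forall>k\<in>{1..Suc n}. Q k) \<longleftrightarrow> Q 1 \<and> (\<forall>k\<in>{1..n}. Q (Suc k))" for Q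
  proof (intro iffI ballI conjI)
    fix k assume Q: "Q 1 \<and> (\<forall>k\<in>{1..n}. Q (Suc k))" and k: "k \<in> {1..Suc n}"
    obtain j where j: "k = Suc j" using k by (cases k) auto
    show "Q k" using Q k j by (cases "j = 0") auto
  qed auto
  show ?thesis unfolding tau_gt_def gen Ssum_def by (simp add: add.assoc)
qed

text \<open>Induction on the first step. The stopping time looks at k \<ge> 1, so \<open>kop\<close>
  tests the height on arrival and the starting height may be negative.\<close>

lemma path_exp_kop:
  "path_exp P n x (\<lambda>xs. if tau_gt f y xs n then g (last (x # xs)) (y + Ssum f xs n) else 0) = (kop P f ^^ n) g x y"
proof (induction n arbitrary: x y)
  case 0
  then show ?case by (simp add: path_exp_def tau_gt_def Ssum_def)
next
  case (Suc n)
  have "path_exp P n x' (\<lambda>xs. if tau_gt f y (x' # xs) (Suc n) then g (last (x # x' # xs)) (y + Ssum f (x' # xs) (Suc n)) else 0)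
     = (if y + f x' > 0 then (kop P f ^^ n) g x' (y + f x') else 0)" for x'
  proof (cases "y + f x' > 0")
    case True
    have "(\<lambda>xs. if tau_gt f y (x' # xs) (Suc n) then g (last (x # x' # xs)) (y + Ssum f (x' # xs) (Suc n)) else 0)
        = (\<lambda>xs. if tau_gt f (y + f x') xs n then g (last (x' # xs)) (y + f x' + Ssum f xs n) else 0)"
      using True by (auto simp: fun_eq_iff tau_gt_Cons Ssum_def add.assoc)
    then show ?thesis using True Suc[of x' "y + f x'"] by simp
  next
    case False
    then show ?thesis by (simp add: tau_gt_Cons path_exp_def)
  qed
  then show ?case unfolding path_exp_Suc by (simp add: kop_def[of P f "(kop P f ^^ n) g"])
qed

lemma local_exp_kop:
  "local_exp P f \<psi> x y z a n = (kop P f ^^ n) (\<lambda>x y. if y \<in> {z..z+a} then \<psi> x else 0) x y"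
proof -
  have "(\<lambda>xs. if y + Ssum f xs n \<in> {z..z+a} \<and> tau_gt f y xs n then \<psi> (last (x # xs)) else 0) =
    (\<lambda>xs. if tau_gt f y xs n then (\<lambda>x y. if y \<in> {z..z+a} then \<psi> x else 0) (last (x # xs)) (y + Ssum f xs n) else 0)"
    by (auto simp: fun_eq_iff)
  then show ?thesis unfolding local_exp_def using path_exp_kop[of P n x f y "\<lambda>x y. if y \<in> {z..z+a} then \<psi> x else 0"] by simp
qed

lemma surv_prob_kop: "surv_prob P f x y n = (kop P f ^^ n) (\<lambda>x y. 1) x y"
  unfolding surv_prob_def using path_exp_kop[of P n x f y "\<lambda>x y. 1"] by simp

lemma (in pos_chain) Vfun_eq_W: "Vfun P f (sqrt s2) x y = W x y"
proof -
  have "lim (\<lambda>n. sqrt (real n) * surv_prob P f x y n) = 2 * W x y / sqrt (2 * pi * s2)"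
    unfolding surv_prob_kop using limI[OF surv_asymp[of x y]] by (simp add: surv_def)
  then show ?thesis unfolding Vfun_def using s2_pos by (simp add: real_sqrt_mult)
qed

text \<open>The first dual step starts from the invariant law, so its starting point integrates out
  and only the arrival state remains.\<close>

lemma dual_integrand_eq:
  assumes "\<And>x'. (\<Sum>x0\<in>UNIV. inv_prob P x0 * Pstar P x0 x') = inv_prob P x'"
  shows "dual_integrand P f \<psi> z = (\<Sum>u\<in>UNIV. inv_prob P u * \<psi> u *
     (if z - f u > 0 then Vfun (Pstar P) (\<lambda>u. - f u) (sigma P f) u (z - f u) else 0))"
proof -
  define v where "v u = \<psi> u * (if z - f u > 0 then Vfun (Pstar P) (\<lambda>u. - f u) (sigma P f) u (z - f u) else 0)" for u
  have "path_exp (Pstar P) 1 x0 (\<lambda>xs. if tau_gt (\<lambda>u. - f u) z xs 1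
       then \<psi> (last (x0 # xs)) * Vfun (Pstar P) (\<lambda>u. - f u) (sigma P f) (last (x0 # xs)) (z + Ssum (\<lambda>u. - f u) xs 1) else 0)
     = (\<Sum>u\<in>UNIV. Pstar P x0 u * v u)" for x0
    unfolding One_nat_def path_exp_Suc
    by (intro sum.cong refl) (simp add: path_exp_def tau_gt_def Ssum_def v_def)
  then have "dual_integrand P f \<psi> z = (\<Sum>x0\<in>UNIV. inv_prob P x0 * (\<Sum>u\<in>UNIV. Pstar P x0 u * v u))"
    unfolding dual_integrand_def by simp
  also have "\<dots> = (\<Sum>u\<in>UNIV. (\<Sum>x0\<in>UNIV. inv_prob P x0 * Pstar P x0 u) * v u)"
    unfolding sum_distrib_left sum_distrib_right by (subst sum.swap) (simp add: mult.assoc)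
  finally show ?thesis unfolding assms v_def by (simp add: mult.assoc)
qed

section \<open>Fourier operators and the non-lattice condition\<close>

text \<open>The Fourier (twisted transition) operator: its n-th power gives the expectation of exp(i
  t S_n) g(X_n) from x.\<close>

definition cop :: "('a::finite => 'a => real) => ('a => real) => real => ('a => complex) => 'a => complex" where
  "cop P f t g x = (\<Sum>x'\<in>UNIV. of_real (P x x') * cis (t * f x') * g x')"

definition cind :: "'a => 'a => complex" where "cind u x = (if x = u then 1 else 0)"

lemma cop_iter_add: "(cop P f t ^^ n) (\<lambda>x. g x + h x) x = (cop P f t ^^ n) g x + (cop P f t ^^ n) h x"
proof (induction n arbitrary: x)
  case (Suc n)
  then show ?case by (simp add: cop_def[of P f t "(cop P f t ^^ n) _"] algebra_simps sum.distrib)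
qed simp

lemma cop_iter_mult: "(cop P f t ^^ n) (\<lambda>x. c * g x) x = c * (cop P f t ^^ n) g x"
proof (induction n arbitrary: x)
  case (Suc n)
  then show ?case by (simp add: cop_def[of P f t "(cop P f t ^^ n) _"] algebra_simps sum_distrib_left)
qed simp

lemma cop_iter_diff: "(cop P f t ^^ n) (\<lambda>x. g x - h x) x = (cop P f t ^^ n) g x - (cop P f t ^^ n) h x"
  using cop_iter_add[of n P f t g "\<lambda>x. (-1) * h x" x] cop_iter_mult[of n P f t "-1" h x] by simp

lemma cop_iter_sum: "(cop P f t ^^ n) (\<lambda>x. \<Sum>i\<in>I. g i x) x = (\<Sum>i\<in>I. (cop P f t ^^ n) (g i) x)"
proof (induction n arbitrary: x)
  case (Suc n)
  have "(cop P f t ^^ Suc n) (\<lambda>x. \<Sum>i\<in>I. g i x) x = (\<Sum>x'\<in>UNIV. \<Sum>i\<in>I. of_real (P x x') * cis (t * f x') * (cop P f t ^^ n) (g i) x')"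
    by (simp add: cop_def[of P f t "(cop P f t ^^ n) _"] Suc sum_distrib_left)
  also have "\<dots> = (\<Sum>i\<in>I. \<Sum>x'\<in>UNIV. of_real (P x x') * cis (t * f x') * (cop P f t ^^ n) (g i) x')"
    by (rule sum.swap)
  finally show ?case by (simp add: cop_def[of P f t "(cop P f t ^^ n) _"])
qed simp

lemma cop_iter_cind: "(cop P f t ^^ n) g x = (\<Sum>u\<in>UNIV. g u * (cop P f t ^^ n) (cind u) x)"
proof -
  have "g = (\<lambda>x. \<Sum>u\<in>UNIV. g u * cind u x)"
    by (auto simp: fun_eq_iff cind_def if_distrib[of "\<lambda>c. _ * c"] cong: if_cong)
  then have "(cop P f t ^^ n) g x = (cop P f t ^^ n) (\<lambda>x. \<Sum>u\<in>UNIV. g u * cind u x) x" by simp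
  also have "\<dots> = (\<Sum>u\<in>UNIV. g u * (cop P f t ^^ n) (cind u) x)"
    by (simp only: cop_iter_sum cop_iter_mult)
  finally show ?thesis .
qed

lemma cop_iter_split: "(cop P f t ^^ (m + n)) g x = (\<Sum>u\<in>UNIV. (cop P f t ^^ n) g u * (cop P f t ^^ m) (cind u) x)"
proof -
  have "(cop P f t ^^ (m + n)) g x = (cop P f t ^^ m) ((cop P f t ^^ n) g) x" by (simp add: funpow_add)
  then show ?thesis by (simp only: cop_iter_cind[of m P f t "(cop P f t ^^ n) g"])
qed

text \<open>Plane waves are eigenfunctions of translation in the height, so on them the free chain
  acts through the twisted operator. Real parts are taken because \<open>fop\<close> acts on real
  functions.\<close>

lemma cop_fop: "(fop P f ^^ n) (\<lambda>x y. Re (cis (t * y) * g x)) x y = Re (cis (t * y) * (cop P f t ^^ n) g x)"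
proof (induction n arbitrary: x y)
  case (Suc n)
  have "(fop P f ^^ Suc n) (\<lambda>x y. Re (cis (t * y) * g x)) x y = (\<Sum>x'\<in>UNIV. P x x' * Re (cis (t * (y + f x')) * (cop P f t ^^ n) g x'))"
    by (simp only: funpow.simps o_apply fop_def[of P f "(fop P f ^^ n) _"] Suc)
  also have "\<dots> = Re (cis (t * y) * (\<Sum>x'\<in>UNIV. of_real (P x x') * cis (t * f x') * (cop P f t ^^ n) g x'))"
    unfolding sum_distrib_left Re_sum
  proof (intro sum.cong refl)
    fix x'
    have "cis (t * y) * (complex_of_real (P x x') * cis (t * f x') * (cop P f t ^^ n) g x') = complex_of_real (P x x') * (cis (t * (y + f x')) * (cop P f t ^^ n) g x')"
      by (simp add: distrib_left cis_mult[symmetric])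
    moreover have "Re (complex_of_real a * z) = a * Re z" for a z by simp
    ultimately show "P x x' * Re (cis (t * (y + f x')) * (cop P f t ^^ n) g x') = Re (cis (t * y) * (complex_of_real (P x x') * cis (t * f x') * (cop P f t ^^ n) g x'))"
      by (simp only:)
  qed
  finally show ?case by (simp add: cop_def[of P f t "(cop P f t ^^ n) _"])
qed simp

lemma cop_0_iter: "(cop P f 0 ^^ n) (\<lambda>x. of_real (g x)) x = of_real ((Pop P ^^ n) g x)"
proof (induction n arbitrary: x)
  case (Suc n)
  then show ?case by (simp add: cop_def[of P f 0 "(cop P f 0 ^^ n) _"] Pop_def[of P "(Pop P ^^ n) _"] mult.commute)
qed simp

lemma continuous_cop_iter: "continuous_on A (\<lambda>t. (cop P f t ^^ n) g x)"
proof (induction n arbitrary: x)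
  case (Suc n)
  have "continuous_on A (\<lambda>t. \<Sum>x'\<in>UNIV. of_real (P x x') * cis (t * f x') * (cop P f t ^^ n) g x')"
    by (intro continuous_intros Suc)
  then show ?case by (simp add: cop_def[of P f _ "(cop P f _ ^^ n) _"])
qed simp

text \<open>Equality in the triangle inequality: no summand may lose length when projected on the
  direction of the sum.\<close>

lemma norm_sum_eq_aligned:
  fixes z :: "'i => complex"
  assumes "finite I" "norm (\<Sum>i\<in>I. z i) = (\<Sum>i\<in>I. norm (z i))" "(\<Sum>i\<in>I. z i) = of_real (norm (\<Sum>i\<in>I. z i)) * u" "norm u = 1" "i \<in> I"
  shows "z i = of_real (norm (z i)) * u"
proof -
  have cu: "cnj u * u = 1" using assms(4) by (metis complex_norm_square mult.commute of_real_1 power_one)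
  have le: "Re (cnj u * z j) \<le> norm (z j)" for j
    using complex_Re_le_cmod[of "cnj u * z j"] assms(4) by (simp add: norm_mult)
  have "(\<Sum>j\<in>I. norm (z j) - Re (cnj u * z j)) = 0"
  proof -
    have "(\<Sum>j\<in>I. Re (cnj u * z j)) = Re (cnj u * (\<Sum>j\<in>I. z j))" by (simp add: sum_distrib_left Re_sum)
    also have "cnj u * (\<Sum>j\<in>I. z j) = of_real (norm (\<Sum>i\<in>I. z i)) * (cnj u * u)" by (subst assms(3)) simp
    finally show ?thesis using cu assms(2) by (simp add: sum_subtractf)
  qed
  then have "norm (z i) - Re (cnj u * z i) = 0"
    using assms(1,5) le by (subst (asm) sum_nonneg_eq_0_iff) auto
  then have r: "Re (cnj u * z i) = norm (cnj u * z i)" using assms(4) by (simp add: norm_mult)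
  then have "cnj u * z i = of_real (norm (cnj u * z i))"
  proof -
    have "(Im (cnj u * z i))\<^sup>2 = 0" using cmod_power2[of "cnj u * z i"] r by simp
    then have "Im (cnj u * z i) = 0" by (simp only: power2_eq_iff_nonneg zero_power2 power_eq_0_iff)
    with r show ?thesis by (simp only: complex_eq_iff Re_complex_of_real Im_complex_of_real)
  qed
  then have "cnj u * z i = of_real (norm (z i))" using assms(4) by (simp add: norm_mult)
  then have "u * (cnj u * z i) = of_real (norm (z i)) * u" by simp
  then show ?thesis using cu by (simp add: mult.assoc[symmetric] mult.commute[of u])
qed

context primitive
begin

lemma cop_iter_norm_le:
  assumes "\<And>x. norm (g x) \<le> h x"
  shows "norm ((cop P f t ^^ n) g x) \<le> (Pop P ^^ n) h x"
proof (induction n arbitrary: x)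
  case (Suc n)
  have "norm ((cop P f t ^^ Suc n) g x) \<le> (\<Sum>x'\<in>UNIV. norm (of_real (P x x') * cis (t * f x') * (cop P f t ^^ n) g x'))"
    by (simp add: cop_def[of P f t "(cop P f t ^^ n) _"] norm_sum)
  also have "\<dots> \<le> (\<Sum>x'\<in>UNIV. (Pop P ^^ n) h x' * P x x')"
    using Suc P_nonneg by (intro sum_mono) (auto simp: norm_mult mult.commute intro!: mult_left_mono)
  finally show ?case by (simp add: Pop_def[of P "(Pop P ^^ n) _"])
qed (use assms in simp)

lemma cop_iter_bound: "(\<And>x. norm (g x) \<le> b) ==> norm ((cop P f t ^^ n) g x) \<le> b"
  using cop_iter_norm_le[of g "\<lambda>x. b", where f=f and t=t and n=n and x=x] by (simp add: Pop_iter_const)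

definition pn :: "nat => 'a => 'a => real" where
  "pn n x u = (Pop P ^^ n) (\<lambda>v. if v = u then 1 else 0) x"

lemma cop_cind_norm: "norm ((cop P f t ^^ n) (cind u) x) \<le> pn n x u"
  unfolding pn_def by (rule cop_iter_norm_le) (simp add: cind_def)

lemma pn_nonneg: "0 \<le> pn n x u"
  using cop_cind_norm[where f="\<lambda>_. 0"] norm_ge_zero order_trans by blast

lemma pn_sum: "(\<Sum>u\<in>UNIV. pn n x u) = 1"
  using Pop_iter_ind[of n "\<lambda>x. 1" x] unfolding pn_def by (simp add: Pop_iter_const)

lemma pn_split: "pn (m + n) x u = (\<Sum>v\<in>UNIV. pn m x v * pn n v u)"
proof -
  have "pn (m + n) x u = (Pop P ^^ m) ((Pop P ^^ n) (\<lambda>v. if v = u then 1 else 0)) x" unfolding pn_def by (simp add: funpow_add)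
  also have "\<dots> = (\<Sum>v\<in>UNIV. pn n v u * pn m x v)" unfolding pn_def by (rule Pop_iter_ind)
  finally show ?thesis by (simp add: mult.commute)
qed

lemma pn_Suc: "pn (Suc n) x u = (\<Sum>v\<in>UNIV. P x v * pn n v u)"
  unfolding pn_def by (simp add: Pop_def[of P "(Pop P ^^ n) _"] mult.commute)

lemma pn_pos_eventually: "\<exists>k0. \<forall>k\<ge>k0. \<forall>x u. pn k x u > 0"
proof -
  obtain k0 where k0: "k0 \<ge> 1" "\<And>x u. pn k0 x u > 0" using P_prim unfolding pn_def by blast
  have "pn (k0 + j) x u > 0" for j x u
  proof (induction j arbitrary: x)
    case 0 then show ?case using k0 by simp
  next
    case (Suc j)
    obtain v where v: "P x v > 0" using P_sum[of x] P_nonneg[of x] by (metis less_eq_real_def sum.neutral zero_neq_one)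
    have "0 < P x v * pn (k0 + j) v u" using v Suc by simp
    also have "\<dots> \<le> (\<Sum>v\<in>UNIV. P x v * pn (k0 + j) v u)"
      by (rule member_le_sum) (use P_nonneg pn_nonneg in auto)
    finally show ?case using pn_Suc[of "k0 + j" x u] by simp
  qed
  then show ?thesis by (metis le_Suc_ex)
qed

text \<open>Each step changes the phase by at most |t| |f|, and the operators do not increase the
  sup norm, so the changes add up.\<close>

lemma cop_lipschitz:
  assumes "\<And>x. norm (g x) \<le> b"
  shows "norm ((cop P f t ^^ n) g x - (cop P f 0 ^^ n) g x) \<le> n * \<bar>t\<bar> * l1norm f * b"
proof (induction n arbitrary: x)
  case (Suc n)
  have b0: "b \<ge> 0" using assms norm_ge_zero order_trans by blast
  define A where "A = (cop P f t ^^ n) g"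
  define B where "B = (cop P f 0 ^^ n) g"
  have cis1: "norm (cis (t * f x') - 1) \<le> \<bar>t\<bar> * l1norm f" for x'
  proof -
    have "norm (cis (t * f x') - 1) \<le> \<bar>t * f x'\<bar>"
      using iexp_approx1[of "t * f x'" 0] by (simp add: cis_conv_exp)
    also have "\<dots> \<le> \<bar>t\<bar> * l1norm f" unfolding abs_mult using l1norm_bound[of f x'] by (intro mult_left_mono) auto
    finally show ?thesis .
  qed
  have "(cop P f t ^^ Suc n) g x - (cop P f 0 ^^ Suc n) g x = (\<Sum>x'\<in>UNIV. of_real (P x x') * ((cis (t * f x') - 1) * A x' + (A x' - B x')))"
    unfolding A_def B_def by (simp add: cop_def[of P f t "(cop P f t ^^ n) _"] cop_def[of P f 0 "(cop P f 0 ^^ n) _"] sum_subtractf[symmetric] algebra_simps)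
  also have "norm \<dots> \<le> (\<Sum>x'\<in>UNIV. P x x' * (\<bar>t\<bar> * l1norm f * b + n * \<bar>t\<bar> * l1norm f * b))"
  proof (rule order_trans[OF norm_sum], rule sum_mono)
    fix x'
    have "norm ((cis (t * f x') - 1) * A x') \<le> \<bar>t\<bar> * l1norm f * b"
      unfolding norm_mult using cis1[of x'] cop_iter_bound[of g b, where f=f and t=t and n=n and x=x'] assms l1norm_nonneg[of f] unfolding A_def by (intro mult_mono) auto
    then have "norm ((cis (t * f x') - 1) * A x' + (A x' - B x')) \<le> \<bar>t\<bar> * l1norm f * b + n * \<bar>t\<bar> * l1norm f * b"
      using Suc[of x'] unfolding A_def[symmetric] B_def[symmetric] by (meson add_mono norm_triangle_le)
    then show "norm (of_real (P x x') * ((cis (t * f x') - 1) * A x' + (A x' - B x'))) \<le> P x x' * (\<bar>t\<bar> * l1norm f * b + n * \<bar>t\<bar> * l1norm f * b)"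
      using P_nonneg[of x x'] by (simp add: norm_mult mult_left_mono)
  qed
  also have "\<dots> = Suc n * \<bar>t\<bar> * l1norm f * b" unfolding sum_distrib_right[symmetric] P_sum by (simp add: algebra_simps)
  finally show ?case .
qed simp

end

locale nonlattice_chain = pos_chain +
  assumes nonlattice: "H3 P f"
begin

text \<open>If no power of the twisted operator contracts, then all paths with common endpoints and length
  have the same phase; this yields an eigenfunction of modulus one and contradicts the non-lattice condition.\<close>

lemma cop_contracts:
  assumes t: "t \<noteq> 0"
  shows "\<exists>N. \<forall>x. (\<Sum>u\<in>UNIV. norm ((cop P f t ^^ N) (cind u) x)) < 1"
proof (rule ccontr)
  assume "\<not> ?thesis"
  then have ex: "\<exists>x. (\<Sum>u\<in>UNIV. norm ((cop P f t ^^ N) (cind u) x)) \<ge> 1" for N by (meson not_less)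
  define A where "A N x u = (cop P f t ^^ N) (cind u) x" for N x u
  obtain k0 where k0: "\<And>k x u. k \<ge> k0 ==> pn k x u > 0" using pn_pos_eventually by blast
  have nA: "norm (A N x u) \<le> pn N x u" for N x u unfolding A_def by (rule cop_cind_norm)
  \<comment> \<open>A row of full total length at time k0 + N allows no cancellation at all; as
    every intermediate state v is reached with positive probability after \<open>k0\<close> steps,
    the row from each v is full at time N.\<close>
  have eq: "norm (A N v u) = pn N v u" for N u v
  proof -
    obtain x where x: "(\<Sum>u\<in>UNIV. norm (A (k0 + N) x u)) \<ge> 1" using ex unfolding A_def by blast
    have "(\<Sum>u\<in>UNIV. pn (k0 + N) x u - norm (A (k0 + N) x u)) \<le> 0" using x pn_sum[of "k0 + N" x] by (simp add: sum_subtractf)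
    then have "\<forall>u\<in>UNIV. pn (k0 + N) x u - norm (A (k0 + N) x u) = 0"
      using nA by (subst sum_nonneg_eq_0_iff[symmetric]) (auto intro!: antisym sum_nonneg)
    then have e: "norm (A (k0 + N) x u) = pn (k0 + N) x u" by simp
    have "A (k0 + N) x u = (\<Sum>v\<in>UNIV. A N v u * A k0 x v)" unfolding A_def by (rule cop_iter_split)
    then have "norm (A (k0 + N) x u) \<le> (\<Sum>v\<in>UNIV. norm (A N v u) * norm (A k0 x v))" by (simp add: norm_mult[symmetric] norm_sum)
    also have "\<dots> \<le> (\<Sum>v\<in>UNIV. norm (A N v u) * pn k0 x v)" by (intro sum_mono mult_left_mono nA) auto
    finally have "(\<Sum>v\<in>UNIV. pn k0 x v * (pn N v u - norm (A N v u))) \<le> 0"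
      unfolding e pn_split by (simp add: sum_subtractf algebra_simps)
    then have "\<forall>v\<in>UNIV. pn k0 x v * (pn N v u - norm (A N v u)) = 0"
      using nA pn_nonneg by (subst sum_nonneg_eq_0_iff[symmetric]) (auto intro!: antisym sum_nonneg mult_nonneg_nonneg)
    then have "pn k0 x v = 0 \<or> pn N v u = norm (A N v u)" by simp
    then show ?thesis using k0[of k0 x v] by auto
  qed
  define w0 where "w0 = (undefined :: 'a)"
  \<comment> \<open>The common phase of all N-step paths from x to the reference state
    \<open>w0\<close>.\<close>
  define \<phi> where "\<phi> N x = A N x w0 / of_real (pn N x w0)" for N x
  have phi1: "norm (\<phi> N x) = 1" "\<phi> N x \<noteq> 0" "A N x w0 = of_real (pn N x w0) * \<phi> N x" if "N \<ge> k0" for N x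
  proof -
    have p: "pn N x w0 > 0" using k0 that by blast
    show "norm (\<phi> N x) = 1" unfolding \<phi>_def using p eq[of N x w0] by (simp add: norm_divide)
    then show "\<phi> N x \<noteq> 0" by auto
    show "A N x w0 = of_real (pn N x w0) * \<phi> N x" unfolding \<phi>_def using p by simp
  qed
  have edge: "cis (t * f v) * \<phi> N v = \<phi> (Suc N) x" if N: "N \<ge> k0" and v: "P x v > 0" for N x v
  proof -
    define z where "z v = of_real (P x v) * cis (t * f v) * A N v w0" for v
    have s: "(\<Sum>v\<in>UNIV. z v) = A (Suc N) x w0" unfolding z_def A_def by (simp add: cop_def[of P f t "(cop P f t ^^ N) _"])
    have nz: "norm (z v) = P x v * pn N v w0" for v unfolding z_def using P_nonneg[of x v] by (simp add: norm_mult eq)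
    have "z v = of_real (norm (z v)) * \<phi> (Suc N) x"
    proof (rule norm_sum_eq_aligned[of UNIV z])
      show "norm (\<Sum>v\<in>UNIV. z v) = (\<Sum>v\<in>UNIV. norm (z v))" unfolding s nz eq by (rule pn_Suc)
      show "(\<Sum>v\<in>UNIV. z v) = of_real (norm (\<Sum>v\<in>UNIV. z v)) * \<phi> (Suc N) x"
        unfolding s eq using phi1(3)[of "Suc N" x] N by simp
      show "norm (\<phi> (Suc N) x) = 1" using phi1(1) N by simp
    qed auto
    then have "of_real (P x v * pn N v w0) * (cis (t * f v) * \<phi> N v) = of_real (P x v * pn N v w0) * \<phi> (Suc N) x"
      unfolding nz unfolding z_def phi1(3)[OF N, of v] by (simp add: ac_simps)
    moreover have "P x v * pn N v w0 > 0" using v k0[OF N, of v w0] by simp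
    ultimately show ?thesis by (metis less_irrefl mult_left_cancel of_real_eq_0_iff)
  qed
  \<comment> \<open>The phase gained by one extra step; along an allowed transition it depends on
    time and state only through their difference, and so becomes constant once all states
    communicate.\<close>
  define c where "c N x = \<phi> (Suc N) x / \<phi> N x" for N x
  have cedge: "c (Suc N) x = c N v" if N: "N \<ge> k0" and v: "P x v > 0" for N x v
    unfolding c_def using edge[OF N v] edge[of "Suc N" x v] N v phi1(2)[OF N, of v] phi1(2)[of "Suc N" x]
    by (metis cis_neq_zero le_SucI mult_divide_mult_cancel_left)
  have cpath: "c (N + k) x = c N v" if N: "N \<ge> k0" and v: "pn k x v > 0" for N k x v
    using v
  proof (induction k arbitrary: x)
    case 0
    then show ?case by (simp add: pn_def split: if_splits)
  next
    case (Suc k)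
    have "(\<Sum>w\<in>UNIV. P x w * pn k w v) > 0" using Suc.prems unfolding pn_Suc .
    then obtain w where "P x w * pn k w v > 0" by (meson not_less sum_nonpos)
    then have w: "P x w > 0" "pn k w v > 0"
      using P_nonneg[of x w] pn_nonneg[of k w v] by (auto simp: zero_less_mult_iff)
    have "c (N + Suc k) x = c (N + k) w" using cedge[of "N + k" x w] N w by simp
    then show ?case using Suc.IH[OF w(2)] by simp
  qed
  have cc: "c (k0 + k) x = c k0 v" if "k \<ge> k0" for k x v
    by (rule cpath) (use k0 that in auto)
  \<comment> \<open>One \<open>k0\<close> makes the phases well defined, the other connects every
    pair of states.\<close>
  define M where "M = k0 + k0"
  define \<gamma> where "\<gamma> = c k0 w0"
  have cM: "\<phi> (Suc M) x = \<gamma> * \<phi> M x" for x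
    using cc[of k0 x w0] phi1(2)[of M x] unfolding M_def \<gamma>_def c_def[of "k0 + k0"] by (simp add: field_simps)
  have g1: "norm \<gamma> = 1" unfolding \<gamma>_def c_def using phi1(1) by (simp add: norm_divide)
  have cyc: "cis (t * f v) * \<phi> M v = \<gamma> * \<phi> M x" if "P x v > 0" for x v
    using edge[OF _ that, of M] cM[of x] unfolding M_def by simp
  obtain \<theta> where \<theta>: "\<gamma> = cis \<theta>"
  proof -
    have "\<gamma> \<noteq> 0" using g1 by auto
    then have "cis (Arg \<gamma>) = \<gamma>" using g1 by (simp add: cis_Arg sgn_eq)
    then show ?thesis using that[of "Arg \<gamma>"] by simp
  qed
  \<comment> \<open>The eigenvalue cis \<theta> fixes the phase of every cycle modulo 2 pi; dividing
    by t gives the slope \<theta>/t and the lattice step 2 pi/t, at which the condition is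
    contradicted.\<close>
  obtain n xs where xs: "(\<Prod>k<n. P (xs k) (xs (Suc k))) * P (xs n) (xs 0) > 0"
    "(\<Sum>k\<le>n. f (xs k)) - real (n + 1) * (\<theta> / t) \<notin> {2 * pi / t * of_int m | m. True}"
    using nonlattice unfolding H3_def by blast
  have n0: "(\<Prod>k<n. P (xs k) (xs (Suc k))) \<noteq> 0" "P (xs n) (xs 0) \<noteq> 0" using xs(1) by (metis mult_zero_left less_irrefl, metis mult_zero_right less_irrefl)
  have pos: "P (xs n) (xs 0) > 0" "\<And>k. k < n ==> P (xs k) (xs (Suc k)) > 0"
    using n0 P_nonneg by (auto simp: order_less_le prod_zero_iff)
  have "cis (t * (\<Sum>k<m. f (xs (Suc k)))) * \<phi> M (xs m) = \<gamma> ^ m * \<phi> M (xs 0)" if "m \<le> n" for m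
    using that
  proof (induction m)
    case (Suc m)
    have "cis (t * (\<Sum>k<Suc m. f (xs (Suc k)))) * \<phi> M (xs (Suc m)) = cis (t * (\<Sum>k<m. f (xs (Suc k)))) * (cis (t * f (xs (Suc m))) * \<phi> M (xs (Suc m)))"
      by (simp add: distrib_left cis_mult[symmetric])
    also have "\<dots> = cis (t * (\<Sum>k<m. f (xs (Suc k)))) * (\<gamma> * \<phi> M (xs m))" using cyc[OF pos(2)[of m]] Suc.prems by simp
    also have "\<dots> = \<gamma> * (\<gamma> ^ m * \<phi> M (xs 0))" using Suc.IH Suc.prems by (simp add: ac_simps)
    finally show ?case by simp
  qed simp
  from this[of n] have "cis (t * (\<Sum>k<n. f (xs (Suc k)))) * \<phi> M (xs n) = \<gamma> ^ n * \<phi> M (xs 0)" by simp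
  moreover have "cis (t * f (xs 0)) * \<phi> M (xs 0) = \<gamma> * \<phi> M (xs n)" by (rule cyc[OF pos(1)])
  ultimately have "cis (t * (\<Sum>k<n. f (xs (Suc k)))) * (cis (t * f (xs 0)) * \<phi> M (xs 0)) = \<gamma> ^ Suc n * \<phi> M (xs 0)" by (simp add: ac_simps)
  then have "(cis (t * (\<Sum>k<n. f (xs (Suc k)))) * cis (t * f (xs 0))) * \<phi> M (xs 0) = \<gamma> ^ Suc n * \<phi> M (xs 0)" by (simp only: mult.assoc)
  then have "cis (t * (\<Sum>k<n. f (xs (Suc k)))) * cis (t * f (xs 0)) = \<gamma> ^ Suc n"
    using phi1(2)[of M "xs 0"] by (simp add: M_def)
  then have "cis (t * (\<Sum>k\<le>n. f (xs k))) = cis (real (Suc n) * \<theta>)"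
  proof -
    assume *: "cis (t * (\<Sum>k<n. f (xs (Suc k)))) * cis (t * f (xs 0)) = \<gamma> ^ Suc n"
    have e1: "cis \<theta> ^ Suc n = cis (real (Suc n) * \<theta>)" by (rule Complex.DeMoivre)
    have e2: "t * (\<Sum>k\<le>n. f (xs k)) = t * (\<Sum>k<n. f (xs (Suc k))) + t * f (xs 0)" by (simp add: sum.atMost_shift algebra_simps)
    show ?thesis unfolding e2 e1[symmetric] cis_mult[symmetric] using * unfolding \<theta> .
  qed
  then have "sin (t * (\<Sum>k\<le>n. f (xs k))) = sin (real (Suc n) * \<theta>) \<and> cos (t * (\<Sum>k\<le>n. f (xs k))) = cos (real (Suc n) * \<theta>)"
    by (metis cis.sel)
  then obtain m :: int where m: "t * (\<Sum>k\<le>n. f (xs k)) = real (Suc n) * \<theta> + 2 * m * pi"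
    unfolding sin_cos_eq_iff by auto
  have "(\<Sum>k\<le>n. f (xs k)) - real (n + 1) * (\<theta> / t) = (t * (\<Sum>k\<le>n. f (xs k)) - real (Suc n) * \<theta>) / t" using t by (simp add: field_simps)
  also have "\<dots> = 2 * pi / t * of_int m" unfolding m by simp
  finally show False using xs(2) by blast
qed

end

section \<open>Gaussian decay of the Fourier operators on compact frequency ranges\<close>

lemma power_div_exp:
  fixes r :: real
  assumes "0 < r" "r < 1" "N \<ge> 1"
  shows "r ^ (k div N) \<le> (1 / r) * exp (ln r * k / N)"
proof -
  have "real k / N \<le> real (k div N) + 1"
  proof -
    have "k < (k div N + 1) * N" using assms(3) by (metis Suc_eq_plus1 div_less_iff_less_mult lessI less_le_trans zero_less_one)
    then have "real k \<le> real ((k div N + 1) * N)" by linarith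
    also have "\<dots> = (real (k div N) + 1) * real N" by (simp add: algebra_simps)
    finally show ?thesis using assms(3) by (simp add: divide_le_eq)
  qed
  then have "ln r * (real (k div N) + 1) \<le> ln r * (k / N)"
    using assms by (intro mult_left_mono_neg) auto
  then have "exp (ln r * (real (k div N) + 1)) \<le> exp (ln r * k / N)" by simp
  moreover have "exp (ln r * (real (k div N) + 1)) = r ^ (k div N) * r"
    using assms by (simp add: distrib_left exp_add mult.commute[of "ln r"] exp_of_nat_mult)
  ultimately have "r ^ (k div N) * r \<le> exp (ln r * k / N)" by (simp only:)
  then show ?thesis using assms(1) by (simp add: pos_le_divide_eq)
qed

text \<open>Damped plane waves are heat solutions; writing the j-th derivative as a phase shift by j
  pi/2 keeps one formula for all j and makes the earlier comparison with heat functions available in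
  Fourier variables.\<close>

lemma heat_seq_cos: "heat_seq c (\<lambda>j s y. t ^ j * exp (- (c * t\<^sup>2 * s / 2)) * cos (t * y + \<phi> + j * (pi / 2)))"
  unfolding heat_seq_def
proof (intro allI impI conjI)
  fix j and s y :: real
  have c1: "cos (x + pi / 2) = - sin x" for x by (simp add: cos_add)
  have c2: "cos (x + pi) = - cos x" for x by simp
  have "((\<lambda>y. t ^ j * exp (- (c * t\<^sup>2 * s / 2)) * cos (t * y + \<phi> + j * (pi / 2))) has_real_derivative
        t ^ j * exp (- (c * t\<^sup>2 * s / 2)) * (- sin (t * y + \<phi> + j * (pi / 2)) * t)) (at y)"
    by (auto intro!: derivative_eq_intros)
  moreover have "t ^ j * exp (- (c * t\<^sup>2 * s / 2)) * (- sin (t * y + \<phi> + j * (pi / 2)) * t) = t ^ Suc j * exp (- (c * t\<^sup>2 * s / 2)) * cos (t * y + \<phi> + real (Suc j) * (pi / 2))"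
  proof -
    have e: "t * y + \<phi> + real (Suc j) * (pi / 2) = (t * y + \<phi> + j * (pi / 2)) + pi / 2" by (simp add: algebra_simps)
    show ?thesis unfolding e c1 by simp
  qed
  ultimately show "((\<lambda>y. t ^ j * exp (- (c * t\<^sup>2 * s / 2)) * cos (t * y + \<phi> + j * (pi / 2))) has_real_derivative
        t ^ Suc j * exp (- (c * t\<^sup>2 * s / 2)) * cos (t * y + \<phi> + real (Suc j) * (pi / 2))) (at y)" by (simp only:)
  have "((\<lambda>s. t ^ j * exp (- (c * t\<^sup>2 * s / 2)) * cos (t * y + \<phi> + j * (pi / 2))) has_real_derivative
        t ^ j * (exp (- (c * t\<^sup>2 * s / 2)) * (- (c * t\<^sup>2 / 2))) * cos (t * y + \<phi> + j * (pi / 2))) (at s)"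
    by (auto intro!: derivative_eq_intros)
  moreover have "t ^ j * (exp (- (c * t\<^sup>2 * s / 2)) * (- (c * t\<^sup>2 / 2))) * cos (t * y + \<phi> + j * (pi / 2)) = c / 2 * (t ^ (j + 2) * exp (- (c * t\<^sup>2 * s / 2)) * cos (t * y + \<phi> + real (j + 2) * (pi / 2)))"
  proof -
    have e: "t * y + \<phi> + real (j + 2) * (pi / 2) = (t * y + \<phi> + j * (pi / 2)) + pi" by (simp add: algebra_simps)
    show ?thesis unfolding e c2 by (simp add: power_add power2_eq_square algebra_simps)
  qed
  ultimately show "((\<lambda>s. t ^ j * exp (- (c * t\<^sup>2 * s / 2)) * cos (t * y + \<phi> + j * (pi / 2))) has_real_derivative
      c / 2 * (t ^ (j + 2) * exp (- (c * t\<^sup>2 * s / 2)) * cos (t * y + \<phi> + real (j + 2) * (pi / 2)))) (at s)" by (simp only:)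
qed

lemma cos_lipschitz: "\<bar>cos a - cos b\<bar> \<le> \<bar>a - b\<bar>" for a b :: real
proof -
  have "\<bar>cos a - cos b\<bar> = 2 * \<bar>sin ((a + b) / 2)\<bar> * \<bar>sin ((b - a) / 2)\<bar>" by (simp add: cos_diff_cos abs_mult)
  also have "\<dots> \<le> 2 * 1 * \<bar>(b - a) / 2\<bar>" by (intro mult_mono abs_sin_x_le_abs_x) auto
  finally show ?thesis by simp
qed

context pos_chain
begin

text \<open>All derivatives of a plane wave of frequency t are bounded by powers of |t|, at every
  time. The heat comparison, started at time 1, thus gives the Gaussian factor without any spectral
  perturbation theory: k defects of size |t|^3, and O(|t|) for the correctors and the shift of
  time.\<close>

lemma fop_iter_cos:
  "\<exists>C>0. \<forall>t \<phi> k x y. \<bar>t\<bar> \<le> 1 -->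
     \<bar>(fop P f ^^ k) (\<lambda>x y. cos (t * y + \<phi>)) x y - exp (- (s2 * t\<^sup>2 * k / 2)) * cos (t * y + \<phi>)\<bar> \<le> C * (k * \<bar>t\<bar> ^ 3 + \<bar>t\<bar>)"
proof -
  obtain C1 where C1: "C1 > 0" "\<And>h m B k x y. heat_seq s2 h ==> m > 0 ==>
     (\<forall>t w. m \<le> t --> t \<le> m + real k --> \<bar>h 3 t w\<bar> \<le> B \<and> \<bar>h 4 t w\<bar> \<le> B) ==>
     \<bar>(fop P f ^^ k) (usol h m) x y - usol h (m + k) x y\<bar> \<le> C1 * B * k"
    using fop_iter_usol by metis
  define c where "c = l1norm rr + l1norm qq + s2"
  have c0: "c \<ge> 0" unfolding c_def using l1norm_nonneg[of rr] l1norm_nonneg[of qq] s2_pos by simp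
  have "\<bar>(fop P f ^^ k) (\<lambda>x y. cos (t * y + \<phi>)) x y - exp (- (s2 * t\<^sup>2 * k / 2)) * cos (t * y + \<phi>)\<bar> \<le> (C1 + 2 * c) * (k * \<bar>t\<bar> ^ 3 + \<bar>t\<bar>)"
    if t: "\<bar>t\<bar> \<le> 1" for t \<phi> k x y
  proof -
    define h where "h = (\<lambda>j s y. t ^ j * exp (- (s2 * t\<^sup>2 * s / 2)) * cos (t * y + \<phi> + real j * (pi / 2)))"
    have h: "heat_seq s2 h" unfolding h_def by (rule heat_seq_cos)
    have hb: "\<bar>h j s w\<bar> \<le> \<bar>t\<bar> ^ j" if "s \<ge> 0" for j s w
    proof -
      have "\<bar>h j s w\<bar> = \<bar>t\<bar> ^ j * exp (- (s2 * t\<^sup>2 * s / 2)) * \<bar>cos (t * w + \<phi> + real j * (pi / 2))\<bar>" unfolding h_def by (simp add: abs_mult power_abs)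
      also have "\<dots> \<le> \<bar>t\<bar> ^ j * 1 * 1" using that s2_pos by (intro mult_mono) auto
      finally show ?thesis by simp
    qed
    have t4: "\<bar>t\<bar> ^ 4 \<le> \<bar>t\<bar> ^ 3" using t by (intro power_decreasing) auto
    have t2: "\<bar>t\<bar> ^ 2 \<le> \<bar>t\<bar>" using t power_decreasing[of 1 2 "\<bar>t\<bar>"] by simp
    have a: "\<bar>(fop P f ^^ k) (usol h 1) x y - usol h (1 + real k) x y\<bar> \<le> C1 * \<bar>t\<bar> ^ 3 * k"
    proof (rule C1(2)[OF h], simp, intro allI impI)
      fix r w :: real assume "1 \<le> r"
      then show "\<bar>h 3 r w\<bar> \<le> \<bar>t\<bar> ^ 3 \<and> \<bar>h 4 r w\<bar> \<le> \<bar>t\<bar> ^ 3"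
        using hb[of r 3 w] order_trans[OF hb[of r 4 w] t4] by simp
    qed
    have us: "\<bar>usol h (1 + s) x y - exp (- (s2 * t\<^sup>2 * s / 2)) * cos (t * y + \<phi>)\<bar> \<le> c * \<bar>t\<bar>" if s: "s \<ge> 0" for s x y
    proof -
      define e1 where "e1 = exp (- (s2 * t\<^sup>2 * s / 2))"
      define e2 where "e2 = exp (- (s2 * t\<^sup>2 * (1 + s) / 2))"
      have e: "0 \<le> e1" "e1 \<le> 1" "0 \<le> e2" "e2 \<le> 1" unfolding e1_def e2_def using s s2_pos by auto
      have e12: "\<bar>e2 - e1\<bar> \<le> s2 * \<bar>t\<bar>"
      proof -
        have "e2 = e1 * exp (- (s2 * t\<^sup>2 / 2))" unfolding e1_def e2_def exp_add[symmetric]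
          by (rule arg_cong[of _ _ exp]) (simp add: field_simps)
        then have "e2 - e1 = e1 * (exp (- (s2 * t\<^sup>2 / 2)) - 1)" by (simp add: right_diff_distrib)
        then have "\<bar>e2 - e1\<bar> = e1 * \<bar>exp (- (s2 * t\<^sup>2 / 2)) - 1\<bar>" using e(1) by (simp only: abs_mult abs_of_nonneg)
        also have "\<dots> \<le> 1 * \<bar>exp (- (s2 * t\<^sup>2 / 2)) - 1\<bar>" using e by (intro mult_right_mono) auto
        also have "\<bar>exp (- (s2 * t\<^sup>2 / 2)) - 1\<bar> \<le> s2 * t\<^sup>2 / 2"
          using exp_ge_add_one_self[of "- (s2 * t\<^sup>2 / 2)"] s2_pos by (simp add: abs_le_iff)
        also have "s2 * t\<^sup>2 / 2 \<le> s2 * \<bar>t\<bar>" using mult_left_mono[OF t2, of s2] s2_pos by simp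
        finally show ?thesis by simp
      qed
      have 1: "\<bar>h 0 (1 + s) (y + rr x) - e2 * cos (t * y + \<phi>)\<bar> \<le> l1norm rr * \<bar>t\<bar>"
      proof -
        have "h 0 (1 + s) (y + rr x) - e2 * cos (t * y + \<phi>) = e2 * (cos (t * (y + rr x) + \<phi>) - cos (t * y + \<phi>))"
          unfolding h_def e2_def by (simp add: algebra_simps)
        also have "\<bar>\<dots>\<bar> \<le> 1 * \<bar>(t * (y + rr x) + \<phi>) - (t * y + \<phi>)\<bar>" unfolding abs_mult abs_of_nonneg[OF e(3)] by (rule mult_mono[OF e(4) cos_lipschitz]) auto
        also have "(t * (y + rr x) + \<phi>) - (t * y + \<phi>) = t * rr x" by (simp add: algebra_simps)
        also have "1 * \<bar>t * rr x\<bar> = \<bar>t\<bar> * \<bar>rr x\<bar>" by (simp add: abs_mult)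
        also have "\<dots> \<le> \<bar>t\<bar> * l1norm rr" using l1norm_bound[of rr x] by (intro mult_left_mono) auto
        finally show ?thesis by (simp add: mult.commute)
      qed
      have 2: "\<bar>qq x * h 2 (1 + s) (y + rr x)\<bar> \<le> l1norm qq * \<bar>t\<bar>"
        unfolding abs_mult using l1norm_bound[of qq x] order_trans[OF hb[of "1 + s" 2] t2] s l1norm_nonneg[of qq] by (intro mult_mono) auto
      have 3: "\<bar>e2 * cos (t * y + \<phi>) - e1 * cos (t * y + \<phi>)\<bar> \<le> s2 * \<bar>t\<bar>"
      proof -
        have "\<bar>e2 * cos (t * y + \<phi>) - e1 * cos (t * y + \<phi>)\<bar> = \<bar>e2 - e1\<bar> * \<bar>cos (t * y + \<phi>)\<bar>" unfolding abs_mult[symmetric] left_diff_distrib ..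
        also have "\<dots> \<le> \<bar>e2 - e1\<bar> * 1" by (intro mult_left_mono) auto
        finally show ?thesis using e12 by simp
      qed
      have "\<bar>usol h (1 + s) x y - e1 * cos (t * y + \<phi>)\<bar> \<le> l1norm rr * \<bar>t\<bar> + l1norm qq * \<bar>t\<bar> + s2 * \<bar>t\<bar>"
        unfolding usol_def using 1 2 3 by linarith
      then show ?thesis unfolding c_def e1_def by (simp add: algebra_simps)
    qed
    have b: "\<bar>(fop P f ^^ k) (\<lambda>x y. cos (t * y + \<phi>) - usol h 1 x y) x y\<bar> \<le> c * \<bar>t\<bar>"
    proof (rule fop_iter_bound)
      fix x y show "\<bar>cos (t * y + \<phi>) - usol h 1 x y\<bar> \<le> c * \<bar>t\<bar>" using us[of 0 x y] by (simp add: abs_minus_commute)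
    qed
    have "\<bar>(fop P f ^^ k) (\<lambda>x y. cos (t * y + \<phi>)) x y - exp (- (s2 * t\<^sup>2 * k / 2)) * cos (t * y + \<phi>)\<bar> \<le> C1 * \<bar>t\<bar> ^ 3 * k + c * \<bar>t\<bar> + c * \<bar>t\<bar>"
      using a b us[OF of_nat_0_le_iff[of k], of x y] unfolding fop_iter_diff by linarith
    also have "\<dots> \<le> C1 * (k * \<bar>t\<bar> ^ 3) + 2 * c * (k * \<bar>t\<bar> ^ 3) + (2 * c * \<bar>t\<bar> + C1 * \<bar>t\<bar>)"
      using c0 C1(1) by (simp add: algebra_simps)
    also have "\<dots> = (C1 + 2 * c) * (k * \<bar>t\<bar> ^ 3 + \<bar>t\<bar>)" by (simp add: algebra_simps)
    finally show ?thesis .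
  qed
  then show ?thesis using C1(1) c0 by (intro exI[of _ "C1 + 2 * c"]) auto
qed

text \<open>Real and imaginary part are the cosine estimate at phases 0 and -pi/2.\<close>

lemma cop_one_clt:
  "\<exists>C>0. \<forall>t k x. \<bar>t\<bar> \<le> 1 --> norm ((cop P f t ^^ k) (\<lambda>_. 1) x - of_real (exp (- (s2 * t\<^sup>2 * k / 2)))) \<le> C * (k * \<bar>t\<bar> ^ 3 + \<bar>t\<bar>)"
proof -
  obtain C where C: "C > 0" "\<And>t \<phi> k x y. \<bar>t\<bar> \<le> 1 ==>
     \<bar>(fop P f ^^ k) (\<lambda>x y. cos (t * y + \<phi>)) x y - exp (- (s2 * t\<^sup>2 * k / 2)) * cos (t * y + \<phi>)\<bar> \<le> C * (k * \<bar>t\<bar> ^ 3 + \<bar>t\<bar>)"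
    using fop_iter_cos by blast
  have "norm ((cop P f t ^^ k) (\<lambda>_. 1) x - of_real (exp (- (s2 * t\<^sup>2 * k / 2)))) \<le> 2 * C * (k * \<bar>t\<bar> ^ 3 + \<bar>t\<bar>)" if t: "\<bar>t\<bar> \<le> 1" for t k x
  proof -
    define z where "z = (cop P f t ^^ k) (\<lambda>_. 1) x"
    have r: "(fop P f ^^ k) (\<lambda>x y. cos (t * y + 0)) x 0 = Re z"
      using cop_fop[of k P f t "\<lambda>_. 1" x 0] unfolding z_def by simp
    have "(fop P f ^^ k) (\<lambda>x y. Re (cis (t * y) * (- \<i>))) x 0 = Re ((cop P f t ^^ k) (\<lambda>x. - \<i> * 1) x)"
      using cop_fop[of k P f t "\<lambda>_. - \<i>" x 0] by simp
    also have "(cop P f t ^^ k) (\<lambda>x. - \<i> * 1) x = - \<i> * z" unfolding z_def by (rule cop_iter_mult)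
    finally have i: "(fop P f ^^ k) (\<lambda>x y. cos (t * y + - (pi/2))) x 0 = Im z"
      by (simp add: cos_diff)
    have "\<bar>Re z - exp (- (s2 * t\<^sup>2 * k / 2))\<bar> \<le> C * (k * \<bar>t\<bar> ^ 3 + \<bar>t\<bar>)" using C(2)[OF t, of k 0 x 0] r by simp
    moreover have "\<bar>Im z\<bar> \<le> C * (k * \<bar>t\<bar> ^ 3 + \<bar>t\<bar>)" using C(2)[OF t, of k "-(pi/2)" x 0] i by simp
    ultimately show ?thesis
      using cmod_le[of "z - of_real (exp (- (s2 * t\<^sup>2 * k / 2)))"] unfolding z_def[symmetric] by simp
  qed
  then show ?thesis using C(1) by (intro exI[of _ "2 * C"]) auto
qed

text \<open>For small t the twist is negligible over l steps while the chain forgets its state at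
  rate \<rho>^l; l is left free to balance the two.\<close>

lemma cop_cind_mixing:
  "\<exists>C>0. \<exists>\<rho>. 0 < \<rho> \<and> \<rho> < 1 \<and> (\<forall>t l g x. (\<forall>x. norm (g x) \<le> 1) -->
     norm ((cop P f t ^^ l) g x - (\<Sum>u\<in>UNIV. of_real (\<nu> u) * g u)) \<le> C * (l * \<bar>t\<bar> + \<rho> ^ l))"
proof -
  obtain C \<rho> where C: "0 \<le> C" "0 < \<rho>" "\<rho> < 1"
    "\<And>g n x. \<bar>(Pop P ^^ n) g x - (\<Sum>x\<in>UNIV. \<nu> x * g x)\<bar> \<le> C * \<rho> ^ n * l1norm g"
    using geometric_ergodicity by metis
  define D where "D = l1norm f + card (UNIV :: 'a set) * C + 1"
  have "norm ((cop P f t ^^ l) g x - (\<Sum>u\<in>UNIV. of_real (\<nu> u) * g u)) \<le> D * (l * \<bar>t\<bar> + \<rho> ^ l)" if g: "\<And>x. norm (g x) \<le> 1" for t l g x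
  proof -
    have 1: "norm ((cop P f t ^^ l) g x - (cop P f 0 ^^ l) g x) \<le> l * \<bar>t\<bar> * l1norm f" using cop_lipschitz[of g 1, where f=f and t=t and n=l and x=x] g by simp
    have ci: "cind u = (\<lambda>x. of_real (if x = u then 1 else 0))" for u :: 'a by (auto simp: cind_def fun_eq_iff)
    have c0: "(cop P f 0 ^^ l) (cind u) x = of_real (pn l x u)" for u unfolding ci cop_0_iter pn_def ..
    have "(cop P f 0 ^^ l) g x - (\<Sum>u\<in>UNIV. of_real (\<nu> u) * g u) = (\<Sum>u\<in>UNIV. g u * of_real (pn l x u - \<nu> u))"
      unfolding cop_iter_cind[of l P f 0 g] c0 by (simp add: sum_subtractf algebra_simps)
    also have "norm \<dots> \<le> (\<Sum>u\<in>(UNIV :: 'a set). C * \<rho> ^ l)"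
    proof (rule order_trans[OF norm_sum], rule sum_mono)
      fix u :: 'a
      have "l1norm (\<lambda>v. if v = u then 1 else 0 :: real) = 1"
        unfolding l1norm_def by (simp add: if_distrib[of abs] cong: if_cong)
      then have "\<bar>pn l x u - \<nu> u\<bar> \<le> C * \<rho> ^ l"
        using C(4)[of l "\<lambda>v. if v = u then 1 else 0" x] unfolding pn_def by (simp add: sum_indicator_right)
      then show "norm (g u * of_real (pn l x u - \<nu> u)) \<le> C * \<rho> ^ l"
        using mult_mono[OF g[of u], of "\<bar>pn l x u - \<nu> u\<bar>" "C * \<rho> ^ l"] by (simp add: norm_mult del: of_real_diff)
    qed
    finally have 2: "norm ((cop P f 0 ^^ l) g x - (\<Sum>u\<in>UNIV. of_real (\<nu> u) * g u)) \<le> card (UNIV :: 'a set) * C * \<rho> ^ l" by simp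
    have "norm ((cop P f t ^^ l) g x - (\<Sum>u\<in>UNIV. of_real (\<nu> u) * g u)) \<le> l * \<bar>t\<bar> * l1norm f + card (UNIV :: 'a set) * C * \<rho> ^ l"
      using norm_triangle_le[OF add_mono[OF 1 2]] by simp
    also have "\<dots> \<le> D * (l * \<bar>t\<bar>) + D * \<rho> ^ l"
    proof (rule add_mono)
      have "l * \<bar>t\<bar> * l1norm f \<le> (l * \<bar>t\<bar>) * D" unfolding D_def using C(1) by (intro mult_left_mono) auto
      then show "l * \<bar>t\<bar> * l1norm f \<le> D * (l * \<bar>t\<bar>)" by (simp add: ac_simps)
      show "card (UNIV :: 'a set) * C * \<rho> ^ l \<le> D * \<rho> ^ l" unfolding D_def using C l1norm_nonneg[of f] by (intro mult_right_mono) auto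
    qed
    finally show ?thesis by (simp add: distrib_left)
  qed
  moreover have "D > 0" unfolding D_def using C l1norm_nonneg[of f] by (simp add: add_nonneg_pos)
  ultimately show ?thesis using C(2,3) by blast
qed

lemma contraction_power:
  assumes c: "\<And>g x. (\<forall>x. norm (g x) \<le> 1) ==> norm ((cop P f t ^^ N) g x) \<le> r" and r: "0 < r" "r < 1" and N: "N \<ge> 1"
    and g: "\<forall>x. norm (g x) \<le> 1"
  shows "norm ((cop P f t ^^ k) g x) \<le> (1 / r) * exp (ln r * k / N)"
proof -
  have c': "norm ((cop P f t ^^ N) g x) \<le> r * b" if "\<forall>x. norm (g x) \<le> b" "b > 0" for g x b
  proof -
    have "norm ((cop P f t ^^ N) (\<lambda>x. of_real (1 / b) * g x) x) \<le> r"
      by (rule c) (use that in \<open>auto simp: norm_mult divide_le_eq simp del: of_real_divide\<close>)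
    then show ?thesis unfolding cop_iter_mult using that by (simp add: norm_mult norm_divide field_simps)
  qed
  have it: "norm ((cop P f t ^^ (N * j)) g x) \<le> r ^ j" for j x
  proof (induction j arbitrary: x)
    case (Suc j)
    have "(cop P f t ^^ (N * Suc j)) g x = (cop P f t ^^ N) ((cop P f t ^^ (N * j)) g) x" by (simp add: funpow_add)
    then show ?case using c'[of "(cop P f t ^^ (N * j)) g" "r ^ j" x] Suc r by simp
  qed (use g in simp)
  have "(cop P f t ^^ k) g x = (cop P f t ^^ (k mod N)) ((cop P f t ^^ (N * (k div N))) g) x"
    by (metis funpow_add mod_mult_div_eq o_apply)
  then have "norm ((cop P f t ^^ k) g x) \<le> r ^ (k div N)" using cop_iter_bound[of "(cop P f t ^^ (N * (k div N))) g" "r ^ (k div N)", where f=f and t=t] it by simp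
  then show ?thesis using power_div_exp[OF r N, of k] by linarith
qed

text \<open>A contraction by 1/2 within about M/t^2 steps, iterated, is a decay exp(-c t^2 k). The
  contraction comes from the Gaussian factor once t^2 times the number of steps is large.\<close>

lemma cop_decay_near_0:
  "\<exists>\<delta>>0. \<exists>c>0. \<forall>t k g x. \<bar>t\<bar> \<le> \<delta> --> (\<forall>x. norm (g x) \<le> 1) --> norm ((cop P f t ^^ k) g x) \<le> 2 * exp (- (c * t\<^sup>2 * k))"
proof -
  obtain C1 where C1: "C1 > 0" "\<And>t k x. \<bar>t\<bar> \<le> 1 ==> norm ((cop P f t ^^ k) (\<lambda>_. 1) x - of_real (exp (- (s2 * t\<^sup>2 * k / 2)))) \<le> C1 * (k * \<bar>t\<bar> ^ 3 + \<bar>t\<bar>)"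
    using cop_one_clt by blast
  obtain C2 \<rho> where C20: "C2 > 0" "0 < \<rho>" "\<rho> < 1" "\<forall>t l g x. (\<forall>x. norm (g x) \<le> 1) -->
     norm ((cop P f t ^^ l) g x - (\<Sum>u\<in>UNIV. of_real (\<nu> u) * g u)) \<le> C2 * (l * \<bar>t\<bar> + \<rho> ^ l)"
    using cop_cind_mixing by (elim exE conjE)
  note C2 = C20(1-3) C20(4)[rule_format]
  have "(\<lambda>l. C2 * \<rho> ^ l) \<longlonglongrightarrow> 0" using C2 by (intro tendsto_eq_intros LIMSEQ_power_zero) auto
  then have "\<forall>\<^sub>F l in sequentially. C2 * \<rho> ^ l < 1/8" by (rule order_tendstoD) simp
  \<comment> \<open>Three errors of 1/8 are budgeted for the factor 1/2: incomplete mixing after l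
    steps, the Gaussian factor after M/t^2 steps, and everything proportional to |t|, which \<delta>
    controls.\<close>
  then obtain l where l: "C2 * \<rho> ^ l < 1/8" by (auto simp: eventually_sequentially)
  have "((\<lambda>M. exp (- (s2 * M / 2))) \<longlongrightarrow> 0) at_top"
  proof -
    have "((\<lambda>M. exp (- (c * M / 2))) \<longlongrightarrow> 0) at_top" if "c > 0" for c :: real using that by real_asymp
    then show ?thesis using s2_pos by blast
  qed
  then have "\<forall>\<^sub>F M in at_top. exp (- (s2 * M / 2)) < 1/8" by (rule order_tendstoD) simp
  then obtain M0 where M0: "\<And>M. M \<ge> M0 ==> exp (- (s2 * M / 2)) < 1/8" by (auto simp: eventually_at_top_linorder)
  define M where "M = max M0 1"
  have M: "exp (- (s2 * M / 2)) < 1/8" "M \<ge> 1" using M0[of M] unfolding M_def by auto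
  define M' where "M' = M + 1 + l"
  define \<delta> where "\<delta> = min 1 (1 / (8 * (C1 * (M + 2) + C2 * l + 1)))"
  have D0: "C1 * (M + 2) + C2 * l + 1 > 0" using C1 C2 M by (simp add: add_nonneg_pos)
  have d: "\<delta> > 0" "\<delta> \<le> 1" "(C1 * (M + 2) + C2 * l + 1) * \<delta> \<le> 1/8"
  proof -
    show "\<delta> > 0" "\<delta> \<le> 1" unfolding \<delta>_def using D0 by auto
    have "(C1 * (M + 2) + C2 * l + 1) * \<delta> \<le> (C1 * (M + 2) + C2 * l + 1) * (1 / (8 * (C1 * (M + 2) + C2 * l + 1)))"
      unfolding \<delta>_def using D0 by (intro mult_left_mono) auto
    also have "\<dots> = 1/8" using D0 by (simp add: field_simps)
    finally show "(C1 * (M + 2) + C2 * l + 1) * \<delta> \<le> 1/8" .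
  qed
  \<comment> \<open>A block of N steps halves the norm and N t^2 \<le> M', so the rate per step is
    at least t^2 ln 2 / M'.\<close>
  define c where "c = ln 2 / M'"
  have M'0: "M' > 0" unfolding M'_def using M by simp
  have c0: "c > 0" unfolding c_def using M'0 by simp
  have "norm ((cop P f t ^^ k) g x) \<le> 2 * exp (- (c * t\<^sup>2 * k))" if t: "\<bar>t\<bar> \<le> \<delta>" and g: "\<forall>x. norm (g x) \<le> 1" for t k g x
  proof (cases "t = 0")
    case True
    then show ?thesis using cop_iter_bound[of g 1, where f=f and t=t and n=k and x=x] g by simp
  next
    case False
    define N0 where "N0 = nat \<lceil>M / t\<^sup>2\<rceil>"
    define N where "N = N0 + l"
    have t2: "t\<^sup>2 > 0" "t\<^sup>2 \<le> 1" using False t d by (auto simp: abs_square_le_1 power2_eq_square[symmetric])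
    have N0: "M / t\<^sup>2 \<le> N0" "N0 \<le> M / t\<^sup>2 + 1" unfolding N0_def using M t2 by (auto simp: of_nat_nat)
    have N00: "N0 \<ge> 1"
    proof -
      have "0 < M / t\<^sup>2" using M t2 by simp
      then show ?thesis using N0(1) by linarith
    qed
    have N1: "N \<ge> 1" unfolding N_def using N00 by simp
    have NM: "N * t\<^sup>2 \<le> M'"
    proof -
      have "N * t\<^sup>2 \<le> (M / t\<^sup>2 + 1 + l) * t\<^sup>2" unfolding N_def using N0 t2 by (intro mult_right_mono) auto
      also have "\<dots> = M + (1 + l) * t\<^sup>2" using t2 by (simp add: field_simps)
      also have "\<dots> \<le> M + (1 + l) * 1" using t2 by (intro add_mono mult_left_mono) auto
      finally show ?thesis unfolding M'_def by simp
    qed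
    have con: "norm ((cop P f t ^^ N) g x) \<le> 1/2" if g: "\<forall>x. norm (g x) \<le> 1" for g x
    proof -
      define b where "b = (\<Sum>u\<in>UNIV. of_real (\<nu> u) * g u)"
      have bn: "norm b \<le> 1"
      proof -
        have "norm b \<le> (\<Sum>u\<in>UNIV. \<nu> u * 1)" unfolding b_def
          by (rule order_trans[OF norm_sum], rule sum_mono) (use nu_nonneg g in \<open>auto simp: norm_mult intro!: mult_left_le\<close>)
        then show ?thesis using nu_sum by simp
      qed
      \<comment> \<open>The inner l steps make g nearly the constant b, its
        \<open>\<nu>\<close>-mean; the outer N0 steps then act on a constant, where the central
        limit estimate applies.\<close>
      have "(cop P f t ^^ N) g x = (cop P f t ^^ N0) ((cop P f t ^^ l) g) x" unfolding N_def by (simp add: funpow_add)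
      also have "\<dots> = (cop P f t ^^ N0) (\<lambda>x. (cop P f t ^^ l) g x - b) x + b * (cop P f t ^^ N0) (\<lambda>x. 1) x"
      proof -
        have "(cop P f t ^^ N0) (\<lambda>x. b * 1) x = b * (cop P f t ^^ N0) (\<lambda>x. 1) x" by (rule cop_iter_mult)
        then show ?thesis unfolding cop_iter_diff by simp
      qed
      finally have "norm ((cop P f t ^^ N) g x) \<le> norm ((cop P f t ^^ N0) (\<lambda>x. (cop P f t ^^ l) g x - b) x) + norm b * norm ((cop P f t ^^ N0) (\<lambda>x. 1) x)"
        by (metis norm_mult norm_triangle_ineq)
      also have "norm ((cop P f t ^^ N0) (\<lambda>x. (cop P f t ^^ l) g x - b) x) \<le> C2 * (l * \<bar>t\<bar> + \<rho> ^ l)"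
        by (rule cop_iter_bound) (use C2(4)[OF g[rule_format]] in \<open>simp add: b_def\<close>)
      also have "norm b * norm ((cop P f t ^^ N0) (\<lambda>x. 1) x) \<le> 1 * (C1 * (N0 * \<bar>t\<bar> ^ 3 + \<bar>t\<bar>) + exp (- (s2 * t\<^sup>2 * N0 / 2)))"
      proof (rule mult_mono)
        have "norm ((cop P f t ^^ N0) (\<lambda>_. 1) x - of_real (exp (- (s2 * t\<^sup>2 * N0 / 2)))) \<le> C1 * (N0 * \<bar>t\<bar> ^ 3 + \<bar>t\<bar>)"
          by (rule C1(2)) (use t d in auto)
        then show "norm ((cop P f t ^^ N0) (\<lambda>x. 1) x) \<le> C1 * (N0 * \<bar>t\<bar> ^ 3 + \<bar>t\<bar>) + exp (- (s2 * t\<^sup>2 * N0 / 2))"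
          using norm_triangle_ineq2[of "(cop P f t ^^ N0) (\<lambda>_. 1) x" "of_real (exp (- (s2 * t\<^sup>2 * N0 / 2)))"] by (simp only: norm_of_real abs_exp_cancel)
      qed (use bn in auto)
      also have "exp (- (s2 * t\<^sup>2 * N0 / 2)) \<le> exp (- (s2 * M / 2))"
      proof -
        have "M \<le> t\<^sup>2 * N0" using N0(1) t2 by (simp add: divide_le_eq mult.commute)
        then show ?thesis using s2_pos by (simp add: mult.assoc mult_left_mono)
      qed
      also have "N0 * \<bar>t\<bar> ^ 3 \<le> (M + 1) * \<bar>t\<bar>"
      proof -
        have "N0 * \<bar>t\<bar> ^ 3 = (N0 * t\<^sup>2) * \<bar>t\<bar>"
        proof -
          have "\<bar>t\<bar> ^ 3 = \<bar>t\<bar>\<^sup>2 * \<bar>t\<bar>" by (simp only: power3_eq_cube power2_eq_square)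
          then show ?thesis by simp
        qed
        also have "\<dots> \<le> (M + 1) * \<bar>t\<bar>"
        proof (rule mult_right_mono)
          have "N0 * t\<^sup>2 \<le> (M / t\<^sup>2 + 1) * t\<^sup>2" using N0 t2 by (intro mult_right_mono) auto
          also have "\<dots> = M + t\<^sup>2" using t2 by (simp add: field_simps)
          finally show "N0 * t\<^sup>2 \<le> M + 1" using t2 by simp
        qed simp
        finally show ?thesis .
      qed
      finally have "norm ((cop P f t ^^ N) g x) \<le> C2 * (l * \<bar>t\<bar> + \<rho> ^ l) + 1 * (C1 * ((M + 1) * \<bar>t\<bar> + \<bar>t\<bar>) + exp (- (s2 * M / 2)))"
        using C1(1) by simp
      also have "\<dots> = (C1 * (M + 2) + C2 * l) * \<bar>t\<bar> + C2 * \<rho> ^ l + exp (- (s2 * M / 2))" by (simp add: algebra_simps)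
      also have "\<dots> \<le> (C1 * (M + 2) + C2 * l + 1) * \<delta> + 1/8 + 1/8"
      proof -
        have "(C1 * (M + 2) + C2 * l) * \<bar>t\<bar> \<le> (C1 * (M + 2) + C2 * l + 1) * \<delta>"
          by (rule mult_mono) (use D0 t d in auto)
        then show ?thesis using l M(1) by linarith
      qed
      also have "\<dots> \<le> 1/2" using d(3) by simp
      finally show ?thesis .
    qed
    have "norm ((cop P f t ^^ k) g x) \<le> (1 / (1/2)) * exp (ln (1/2) * k / N)"
      by (rule contraction_power[OF con]) (use N1 g in auto)
    also have "ln (1/2) * k / N \<le> - (c * t\<^sup>2 * k)"
    proof -
      have "c * t\<^sup>2 * k \<le> ln 2 * k / N"
      proof -
        have "N * t\<^sup>2 / M' \<le> 1" using NM M'0 by simp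
        then have "(ln 2 * k / N) * (N * t\<^sup>2 / M') \<le> (ln 2 * k / N) * 1" by (intro mult_left_mono) auto
        moreover have "(ln 2 * k / N) * (N * t\<^sup>2 / M') = c * t\<^sup>2 * k" unfolding c_def using N1 by (simp add: field_simps)
        ultimately show ?thesis by simp
      qed
      then show ?thesis by (simp add: ln_div)
    qed
    finally show ?thesis by simp
  qed
  then show ?thesis using d(1) c0 by blast
qed

end

context nonlattice_chain
begin

text \<open>Near 0 the previous estimate applies. On the remaining compact set of frequencies each
  one is contracted by some power, contraction is an open condition that persists for higher powers,
  and compactness makes power and factor uniform.\<close>

lemma cop_decay:
  assumes lam: "l0 > 0"
  shows "\<exists>C>0. \<exists>c>0. \<forall>t k g x. \<bar>t\<bar> \<le> l0 --> (\<forall>x. norm (g x) \<le> 1) --> norm ((cop P f t ^^ k) g x) \<le> C * exp (- (c * t\<^sup>2 * k))"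
proof -
  obtain \<delta> c1 where d: "\<delta> > 0" "c1 > 0" "\<And>t k g x. \<bar>t\<bar> \<le> \<delta> ==> (\<forall>x. norm (g x) \<le> 1) ==> norm ((cop P f t ^^ k) g x) \<le> 2 * exp (- (c1 * t\<^sup>2 * k))"
    using cop_decay_near_0 by metis
  define K where "K = {-l0..-\<delta>} \<union> {\<delta>..l0}"
  have Kc: "compact K" unfolding K_def by (intro compact_Un compact_Icc)
  define U where "U N = {t. \<forall>x. (\<Sum>u\<in>UNIV. norm ((cop P f t ^^ N) (cind u) x)) < 1}" for N
  have Uo: "open (U N)" for N
  proof -
    have "U N = (\<Inter>x. {t. (\<Sum>u\<in>UNIV. norm ((cop P f t ^^ N) (cind u) x)) < 1})" unfolding U_def by auto
    moreover have "open {t. (\<Sum>u\<in>UNIV. norm ((cop P f t ^^ N) (cind u) x)) < 1}" for x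
      by (intro open_Collect_less continuous_intros continuous_cop_iter)
    ultimately show ?thesis by (auto intro!: open_INT)
  qed
  \<comment> \<open>The total row length at time N + 1 is an average of those at time N, so
    contraction is never lost and a finite subcover reduces to a single power.\<close>
  have Umono: "U N \<subseteq> U (Suc N)" for N
  proof
    fix t assume t: "t \<in> U N"
    have "(\<Sum>u\<in>UNIV. norm ((cop P f t ^^ Suc N) (cind u) x)) < 1" for x
    proof -
      have "(\<Sum>u\<in>UNIV. norm ((cop P f t ^^ Suc N) (cind u) x)) \<le> (\<Sum>u\<in>UNIV. \<Sum>v\<in>UNIV. P x v * norm ((cop P f t ^^ N) (cind u) v))"
      proof (rule sum_mono)
        fix u
        have "norm ((cop P f t ^^ Suc N) (cind u) x) \<le> (\<Sum>v\<in>UNIV. norm (of_real (P x v) * cis (t * f v) * (cop P f t ^^ N) (cind u) v))"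
          by (simp add: cop_def[of P f t "(cop P f t ^^ N) _"] norm_sum)
        then show "norm ((cop P f t ^^ Suc N) (cind u) x) \<le> (\<Sum>v\<in>UNIV. P x v * norm ((cop P f t ^^ N) (cind u) v))"
          using P_nonneg by (simp add: norm_mult)
      qed
      also have "\<dots> = (\<Sum>v\<in>UNIV. P x v * (\<Sum>u\<in>UNIV. norm ((cop P f t ^^ N) (cind u) v)))"
        unfolding sum_distrib_left by (rule sum.swap)
      also have "\<dots> < (\<Sum>v\<in>UNIV. P x v * 1)"
      proof -
        obtain v where v: "P x v > 0" using P_sum[of x] P_nonneg[of x] by (metis less_eq_real_def sum.neutral zero_neq_one)
        show ?thesis
        proof (rule sum_strict_mono_ex1)
          show "\<forall>a\<in>UNIV. P x a * (\<Sum>u\<in>UNIV. norm ((cop P f t ^^ N) (cind u) a)) \<le> P x a * 1"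
          proof
            fix a
            have "(\<Sum>u\<in>UNIV. norm ((cop P f t ^^ N) (cind u) a)) \<le> 1" using t unfolding U_def by (simp add: less_imp_le)
            then show "P x a * (\<Sum>u\<in>UNIV. norm ((cop P f t ^^ N) (cind u) a)) \<le> P x a * 1" using P_nonneg by (rule mult_left_mono)
          qed
          show "\<exists>a\<in>UNIV. P x a * (\<Sum>u\<in>UNIV. norm ((cop P f t ^^ N) (cind u) a)) < P x a * 1"
            using t v unfolding U_def by (intro bexI[of _ v] mult_strict_left_mono) auto
        qed simp
      qed
      finally show ?thesis using P_sum by simp
    qed
    then show "t \<in> U (Suc N)" unfolding U_def by blast
  qed
  have Uinc: "U M \<subseteq> U N" if "M \<le> N" for M N by (rule lift_Suc_mono_le[of U, OF Umono that])
  have cov: "K \<subseteq> (\<Union>N. U N)"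
  proof
    fix t assume "t \<in> K"
    then have "t \<noteq> 0" unfolding K_def using d(1) by auto
    from cop_contracts[OF this] show "t \<in> (\<Union>N. U N)" unfolding U_def by blast
  qed
  obtain N0 where N0: "K \<subseteq> U N0"
  proof -
    obtain D where D: "D \<subseteq> range U" "finite D" "K \<subseteq> \<Union>D" using compactE[OF Kc cov] Uo by (metis imageE)
    then obtain I where I: "finite I" "D = U ` I" by (meson finite_subset_image)
    have "\<Union>D \<subseteq> U (Max (insert 0 I))"
    proof
      fix t assume "t \<in> \<Union>D"
      then obtain i where i: "i \<in> I" "t \<in> U i" unfolding I(2) by blast
      have "i \<le> Max (insert 0 I)" using i I(1) by (intro Max_ge) auto
      from Uinc[OF this] i show "t \<in> U (Max (insert 0 I))" by blast
    qed
    then show ?thesis using D(3) that by blast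
  qed
  \<comment> \<open>The successor guarantees a block length of at least 1, by which exponents are
    divided below.\<close>
  define N where "N = Suc N0"
  have KN: "K \<subseteq> U N" unfolding N_def using N0 Umono by blast
  have "\<exists>r. 0 < r \<and> r < 1 \<and> (\<forall>t\<in>K. \<forall>x. (\<Sum>u\<in>UNIV. norm ((cop P f t ^^ N) (cind u) x)) \<le> r)"
  proof (cases "K = {}")
    case True then show ?thesis by (intro exI[of _ "1/2"]) auto
  next
    case False
    have "\<exists>r<1. \<forall>t\<in>K. (\<Sum>u\<in>UNIV. norm ((cop P f t ^^ N) (cind u) x)) \<le> r" for x
    proof -
      have "continuous_on K (\<lambda>t. \<Sum>u\<in>UNIV. norm ((cop P f t ^^ N) (cind u) x))"
        by (intro continuous_intros continuous_cop_iter)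
      from continuous_attains_sup[OF Kc False this] obtain t0 where "t0 \<in> K" "\<forall>t\<in>K. (\<Sum>u\<in>UNIV. norm ((cop P f t ^^ N) (cind u) x)) \<le> (\<Sum>u\<in>UNIV. norm ((cop P f t0 ^^ N) (cind u) x))" by blast
      then show ?thesis using KN unfolding U_def by blast
    qed
    then obtain r where r: "\<And>x. r x < 1" "\<And>x t. t \<in> K ==> (\<Sum>u\<in>UNIV. norm ((cop P f t ^^ N) (cind u) x)) \<le> r x" by metis
    define r0 where "r0 = Max (insert (1/2) (range r))"
    have "r0 < 1" unfolding r0_def using r(1) by (subst Max_less_iff) auto
    moreover have "1/2 \<le> r0" unfolding r0_def by (rule Max_ge) auto
    moreover have "r x \<le> r0" for x unfolding r0_def by (rule Max_ge) auto
    ultimately show ?thesis using r(2) by (intro exI[of _ r0]) (auto intro: order_trans)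
  qed
  then obtain r where r: "0 < r" "r < 1" "\<And>t x. t \<in> K ==> (\<Sum>u\<in>UNIV. norm ((cop P f t ^^ N) (cind u) x)) \<le> r" by blast
  \<comment> \<open>Away from 0 the decay is exp(ln r k/N); dividing by l0^2 puts it in the form
    valid near 0, since |t| \<le> l0.\<close>
  define c2 where "c2 = - ln r / (N * l0\<^sup>2)"
  have c2: "c2 > 0" unfolding c2_def using r(1,2) lam by (intro divide_pos_pos mult_pos_pos) (auto simp: N_def)
  define c where "c = min c1 c2"
  define C where "C = max 2 (1 / r)"
  have "norm ((cop P f t ^^ k) g x) \<le> C * exp (- (c * t\<^sup>2 * k))" if t: "\<bar>t\<bar> \<le> l0" and g: "\<forall>x. norm (g x) \<le> 1" for t k g x
  proof (cases "\<bar>t\<bar> \<le> \<delta>")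
    case True
    have "norm ((cop P f t ^^ k) g x) \<le> 2 * exp (- (c1 * t\<^sup>2 * k))" by (rule d(3)[OF True g])
    also have "\<dots> \<le> C * exp (- (c * t\<^sup>2 * k))" unfolding C_def c_def
      by (intro mult_mono) (auto intro!: mult_right_mono)
    finally show ?thesis .
  next
    case False
    then have tK: "t \<in> K" unfolding K_def using t by auto
    have con: "norm ((cop P f t ^^ N) g x) \<le> r" if g: "\<forall>x. norm (g x) \<le> 1" for g x
    proof -
      have "norm ((cop P f t ^^ N) g x) \<le> (\<Sum>u\<in>UNIV. norm (g u * (cop P f t ^^ N) (cind u) x))"
        unfolding cop_iter_cind[of N P f t g] by (rule norm_sum)
      also have "\<dots> \<le> (\<Sum>u\<in>UNIV. norm ((cop P f t ^^ N) (cind u) x))"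
        using g by (intro sum_mono) (auto simp: norm_mult intro!: mult_left_le_one_le)
      also have "\<dots> \<le> r" by (rule r(3)[OF tK])
      finally show ?thesis .
    qed
    have "norm ((cop P f t ^^ k) g x) \<le> (1 / r) * exp (ln r * k / N)"
      by (rule contraction_power[OF con r(1,2)]) (use g in \<open>auto simp: N_def\<close>)
    also have "\<dots> \<le> C * exp (- (c * t\<^sup>2 * k))"
    proof (rule mult_mono)
      have "c * t\<^sup>2 * k \<le> c2 * l0\<^sup>2 * k"
      proof (rule mult_right_mono)
        have "t\<^sup>2 \<le> l0\<^sup>2" using power_mono[OF t abs_ge_zero, of 2] by simp
        moreover have "c \<le> c2" unfolding c_def by simp
        ultimately show "c * t\<^sup>2 \<le> c2 * l0\<^sup>2" using c2 by (intro mult_mono) auto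
      qed simp
      also have "\<dots> = - (ln r * k / N)"
      proof -
        have "real N \<noteq> 0" "l0\<^sup>2 \<noteq> 0" using lam by (auto simp: N_def)
        then show ?thesis unfolding c2_def by (simp add: field_simps)
      qed
      finally show "exp (ln r * k / N) \<le> exp (- (c * t\<^sup>2 * k))" by simp
    qed (auto simp: C_def)
    finally show ?thesis .
  qed
  moreover have "C > 0" "c > 0" unfolding C_def c_def using d c2 by auto
  ultimately show ?thesis by blast
qed

end

section \<open>The local limit theorem\<close>

text \<open>The Fejer kernel: a probability density whose Fourier transform is the triangle 1 -
  |t|/l on [-l, l]. The value at 0 is the continuous extension.\<close>

definition fejer :: "real => real => real" where
  "fejer l v = (if v = 0 then l / (2 * pi) else (1 - cos (l * v)) / (pi * l * v\<^sup>2))"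

lemma fejer_nonneg: "l > 0 ==> fejer l v \<ge> 0"
  unfolding fejer_def by (auto intro!: divide_nonneg_nonneg)

lemma fejer_even: "fejer l (- v) = fejer l v"
  unfolding fejer_def by simp

lemma fejer_measurable [measurable]: "fejer l \<in> borel_measurable borel"
  unfolding fejer_def[abs_def] by measurable

lemma fejer_fourier:
  assumes l: "l > 0"
  shows "has_bochner_integral lborel (\<lambda>t. (1 - t / l) * cos (t * v) * indicator {0..l} t) (pi * fejer l v)"
proof (cases "v = 0")
  case True
  have "has_bochner_integral lborel (\<lambda>t. (1 - t / l) * indicator {0..l} t) ((l - l\<^sup>2 / (2 * l)) - (0 - 0\<^sup>2 / (2 * l)))"
    by (rule has_bochner_integral_FTC_Icc_real) (use l in \<open>auto intro!: derivative_eq_intros continuous_intros\<close>)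
  then show ?thesis using True l by (simp add: fejer_def power2_eq_square)
next
  case False
  define F where "F t = (1 - t / l) * sin (t * v) / v - cos (t * v) / (l * v\<^sup>2)" for t
  have "has_bochner_integral lborel (\<lambda>t. ((1 - t / l) * cos (t * v)) * indicator {0..l} t) (F l - F 0)"
  proof (rule has_bochner_integral_FTC_Icc_real)
    fix t
    show "(F has_real_derivative (1 - t / l) * cos (t * v)) (at t)"
      unfolding F_def using l False by (auto intro!: derivative_eq_intros simp: field_simps power2_eq_square)
    show "isCont (\<lambda>t. (1 - t / l) * cos (t * v)) t" using l by (auto intro!: continuous_intros)
  qed (use l in auto)
  moreover have "F l - F 0 = pi * fejer l v"
    unfolding F_def fejer_def using l False by (simp add: field_simps)
  ultimately show ?thesis by simp
qed

text \<open>The primitive of (1 - cos A)/A^2 that vanishes at 0, obtained by parts from the sine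
  integral \<open>Si\<close>; the removable singularity is filled in.\<close>

definition Psi :: "real => real" where "Psi A = Si A - (if A = 0 then 0 else (1 - cos A) / A)"

lemma Psi_deriv: "A > 0 ==> (Psi has_real_derivative (1 - cos A) / A\<^sup>2) (at A)"
proof -
  assume A: "A > 0"
  have "((\<lambda>A. Si A - (1 - cos A) / A) has_real_derivative sinc A - (sin A * A - (1 - cos A)) / (A * A)) (at A)"
    by (intro DERIV_diff DERIV_Si) (use A in \<open>auto intro!: derivative_eq_intros\<close>)
  moreover have "sinc A - (sin A * A - (1 - cos A)) / (A * A) = (1 - cos A) / A\<^sup>2"
    using A by (simp add: field_simps power2_eq_square)
  ultimately have "((\<lambda>A. Si A - (1 - cos A) / A) has_real_derivative (1 - cos A) / A\<^sup>2) (at A)" by simp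
  then show ?thesis
    by (rule has_field_derivative_transform_within_open[where S="{0<..}"]) (use A in \<open>auto simp: Psi_def\<close>)
qed

lemma Psi_continuous: "continuous_on {0..} Psi"
proof -
  have "isCont Psi A" if "A > 0" for A using Psi_deriv[OF that] by (rule DERIV_isCont)
  moreover have "isCont Psi 0"
  proof -
    have "((\<lambda>A::real. (1 - cos A) / A) \<longlongrightarrow> 0) (at 0)" by real_asymp
    then have "((\<lambda>A::real. if A = 0 then 0 else (1 - cos A) / A) \<longlongrightarrow> 0) (at 0)"
      by (rule Lim_transform_eventually) (auto simp: eventually_at_filter)
    moreover have "(Si \<longlongrightarrow> Si 0) (at 0)" using isCont_Si[of 0] by (simp add: isCont_def)
    ultimately have "(Psi \<longlongrightarrow> Si 0 - 0) (at 0)" unfolding Psi_def[abs_def] by (intro tendsto_diff)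
    then show ?thesis unfolding isCont_def by (simp add: Psi_def)
  qed
  ultimately have "isCont Psi A" if "A \<ge> 0" for A using that by (cases "A = 0") auto
  then show ?thesis by (simp add: continuous_at_imp_continuous_on)
qed

lemma Psi_0: "Psi 0 = 0"
  by (simp add: Psi_def Si_def zero_ereal_def)

lemma Psi_at_top: "(Psi \<longlongrightarrow> pi / 2) at_top"
proof -
  have "((\<lambda>A::real. (1 - cos A) / A) \<longlongrightarrow> 0) at_top"
  proof (rule Lim_null_comparison)
    show "\<forall>\<^sub>F A in at_top. norm ((1 - cos A) / A) \<le> 2 / A"
      using eventually_gt_at_top[of "0::real"]
    proof eventually_elim
      case (elim A)
      have "\<bar>1 - cos A\<bar> \<le> 2" using abs_cos_le_one[of A] by linarith
      then show ?case using elim by (simp add: divide_right_mono)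
    qed
    show "((\<lambda>A::real. 2 / A) \<longlongrightarrow> 0) at_top" by real_asymp
  qed
  then have "((\<lambda>A. Si A - (1 - cos A) / A) \<longlongrightarrow> pi / 2 - 0) at_top" by (intro tendsto_diff Si_at_top)
  moreover have "\<forall>\<^sub>F A in at_top. Si A - (1 - cos A) / A = Psi A"
    using eventually_gt_at_top[of "0::real"] by eventually_elim (auto simp: Psi_def)
  ultimately show ?thesis by (subst (asm) diff_zero) (rule Lim_transform_eventually)
qed

lemma fejer_nn_integral_Icc:
  assumes l: "l > 0" and a: "a > 0"
  shows "(\<integral>\<^sup>+x. indicator {-a..a} x * ennreal (fejer l x) \<partial>lborel) = ennreal (2 / pi * Psi (l * a))"
proof -
  have r: "(fejer l has_integral (1 / pi * Psi (l * a) - 1 / pi * Psi (l * 0))) {0..a}"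
  proof (rule fundamental_theorem_of_calculus_interior)
    show "continuous_on {0..a} (\<lambda>x. 1 / pi * Psi (l * x))"
      by (intro continuous_intros continuous_on_compose2[OF Psi_continuous]) (use l in auto)
    fix x assume x: "x \<in> {0<..<a}"
    have "((\<lambda>x. 1 / pi * Psi (l * x)) has_real_derivative 1 / pi * ((1 - cos (l * x)) / (l * x)\<^sup>2 * l)) (at x)"
      by (intro DERIV_cmult DERIV_chain2[OF Psi_deriv]) (use l x in \<open>auto intro!: derivative_eq_intros\<close>)
    moreover have "1 / pi * ((1 - cos (l * x)) / (l * x)\<^sup>2 * l) = fejer l x"
      unfolding fejer_def using l x by (simp add: field_simps power2_eq_square)
    ultimately show "((\<lambda>x. 1 / pi * Psi (l * x)) has_vector_derivative fejer l x) (at x)"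
      by (simp add: has_real_derivative_iff_has_vector_derivative)
  qed (use a in auto)
  then have r: "(fejer l has_integral (1 / pi * Psi (l * a))) {0..a}" by (simp add: Psi_0)
  have "((\<lambda>x. fejer l (- x)) has_integral (1 / pi * Psi (l * a))) {- a..- 0}"
    using has_integral_reflect_real[of "fejer l" _ 0 a] r by (metis has_integral_reflect_real)
  then have "(fejer l has_integral (1 / pi * Psi (l * a))) {- a..0}" by (simp add: fejer_even)
  from has_integral_combine[OF _ _ this r] have "(fejer l has_integral (2 / pi * Psi (l * a))) {-a..a}" using a by (simp add: field_simps)
  then have "((\<lambda>x. if x \<in> {-a..a} then fejer l x else 0) has_integral (2 / pi * Psi (l * a))) UNIV"
    by (simp only: has_integral_restrict_UNIV)
  from nn_integral_has_integral_lborel[OF _ _ this] fejer_nonneg[OF l]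
  have "(\<integral>\<^sup>+x. ennreal (if x \<in> {-a..a} then fejer l x else 0) \<partial>lborel) = ennreal (2 / pi * Psi (l * a))" by simp
  moreover have "(\<lambda>x. ennreal (if x \<in> {-a..a} then fejer l x else 0)) = (\<lambda>x. indicator {-a..a} x * ennreal (fejer l x))"
    by (auto simp: indicator_def fun_eq_iff)
  ultimately show ?thesis by simp
qed

text \<open>Monotone convergence along growing intervals; the total mass 1 is the Dirichlet integral
  pi/2 for \<open>Si\<close>.\<close>

lemma fejer_integral:
  assumes l: "l > 0"
  shows "integrable lborel (fejer l)" "(LBINT x. fejer l x) = 1"
proof -
  have "(\<lambda>n. \<integral>\<^sup>+x. indicator {-real (Suc n)..real (Suc n)} x * ennreal (fejer l x) \<partial>lborel) \<longlonglongrightarrow> (\<integral>\<^sup>+x. ennreal (fejer l x) \<partial>lborel)"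
  proof (rule nn_integral_LIMSEQ)
    show "incseq (\<lambda>n x. indicator {-real (Suc n)..real (Suc n)} x * ennreal (fejer l x))"
      by (auto simp: incseq_def le_fun_def indicator_def)
    fix x :: real
    have "\<forall>\<^sub>F n in sequentially. indicator {-real (Suc n)..real (Suc n)} x * ennreal (fejer l x) = ennreal (fejer l x)"
    proof -
      obtain N where N: "\<bar>x\<bar> \<le> real N" using real_arch_simple by blast
      show ?thesis using eventually_ge_at_top[of N] by eventually_elim (use N in \<open>auto simp: indicator_def\<close>)
    qed
    then show "(\<lambda>n. indicator {-real (Suc n)..real (Suc n)} x * ennreal (fejer l x)) \<longlonglongrightarrow> ennreal (fejer l x)"
      by (rule tendsto_eventually)
  qed measurable
  moreover have "(\<lambda>n. \<integral>\<^sup>+x. indicator {-real (Suc n)..real (Suc n)} x * ennreal (fejer l x) \<partial>lborel) \<longlonglongrightarrow> ennreal 1"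
  proof -
    have "filterlim (\<lambda>n. l * real (Suc n)) at_top sequentially" using l by real_asymp
    then have "(\<lambda>n. Psi (l * real (Suc n))) \<longlonglongrightarrow> pi / 2" by (rule filterlim_compose[OF Psi_at_top])
    then have "(\<lambda>n. 2 / pi * Psi (l * real (Suc n))) \<longlonglongrightarrow> 2 / pi * (pi / 2)" by (intro tendsto_intros)
    then have "(\<lambda>n. ennreal (2 / pi * Psi (l * real (Suc n)))) \<longlonglongrightarrow> ennreal 1" by (intro tendsto_ennrealI) simp
    then show ?thesis by (simp add: fejer_nn_integral_Icc[OF l] del: of_nat_Suc)
  qed
  ultimately have nn: "(\<integral>\<^sup>+x. ennreal (fejer l x) \<partial>lborel) = ennreal 1" by (rule LIMSEQ_unique)
  show i: "integrable lborel (fejer l)"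
    by (rule integrableI_nonneg) (use fejer_nonneg[OF l] nn in auto)
  have "ennreal (LBINT x. fejer l x) = ennreal 1"
    using nn_integral_eq_integral[OF i] fejer_nonneg[OF l] nn by auto
  moreover have "0 \<le> (LBINT x. fejer l x)" using fejer_nonneg[OF l] by (simp add: integral_nonneg_AE)
  ultimately show "(LBINT x. fejer l x) = 1" by (subst (asm) ennreal_inj) auto
qed

text \<open>By scaling the mass in [-\<delta>, \<delta>] depends on l \<delta> only and tends to 1
  as l grows. This is how smoothing by \<open>fejer\<close> can later be undone.\<close>

lemma fejer_concentrates:
  assumes "\<delta> > 0" "\<zeta> > 0"
  shows "\<exists>l>0. (LBINT x. indicator {-\<delta>..\<delta>} x * fejer l x) \<ge> 1 - \<zeta>"
proof -
  have "((\<lambda>l. 2 / pi * Psi (l * \<delta>)) \<longlongrightarrow> 2 / pi * (pi / 2)) at_top"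
  proof (intro tendsto_intros filterlim_compose[OF Psi_at_top])
    show "filterlim (\<lambda>l. l * \<delta>) at_top at_top" using assms by real_asymp
  qed
  then have "\<forall>\<^sub>F l in at_top. 2 / pi * Psi (l * \<delta>) > 1 - \<zeta>" using assms by (intro order_tendstoD) auto
  then obtain l where l: "l > 0" "2 / pi * Psi (l * \<delta>) > 1 - \<zeta>"
    using eventually_happens[OF eventually_conj[OF _ eventually_gt_at_top[of "0::real"]]] by auto
  have i: "integrable lborel (\<lambda>x. indicator {-\<delta>..\<delta>} x * fejer l x)"
    using integrable_mult_indicator[OF _ fejer_integral(1)[OF l(1)], of "{-\<delta>..\<delta>}"] by simp
  have "ennreal (LBINT x. indicator {-\<delta>..\<delta>} x * fejer l x) = (\<integral>\<^sup>+x. ennreal (indicator {-\<delta>..\<delta>} x * fejer l x) \<partial>lborel)"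
    by (rule nn_integral_eq_integral[OF i, symmetric]) (use fejer_nonneg[OF l(1)] in auto)
  also have "\<dots> = ennreal (2 / pi * Psi (l * \<delta>))"
    using fejer_nn_integral_Icc[OF l(1) assms(1)] by (simp add: ennreal_mult' ennreal_indicator)
  finally have e: "ennreal (LBINT x. indicator {-\<delta>..\<delta>} x * fejer l x) = ennreal (2 / pi * Psi (l * \<delta>))" .
  have I0: "0 \<le> (LBINT x. indicator {-\<delta>..\<delta>} x * fejer l x)" using fejer_nonneg[OF l(1)] by (simp add: integral_nonneg_AE)
  have "(LBINT x. indicator {-\<delta>..\<delta>} x * fejer l x) \<ge> 2 / pi * Psi (l * \<delta>)"
  proof (cases "2 / pi * Psi (l * \<delta>) \<ge> 0")
    case True
    then show ?thesis using e ennreal_inj[OF I0 True] by simp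
  next
    case False
    then show ?thesis using I0 by linarith
  qed
  then show ?thesis using l by (intro exI[of _ l]) auto
qed

text \<open>Fourier inversion for the Gaussian, read off from the characteristic function of the
  standard normal law. It is stated on the half-line because the kernel is represented by
  frequencies t \<ge> 0 and real parts.\<close>

lemma gaussian_fourier_half:
  assumes c: "c > 0"
  shows "(LBINT v. indicator {0..} v * (cos (v * Y) * exp (- (c * v\<^sup>2 / 2)))) = pi * (exp (- Y\<^sup>2 / (2 * c)) / sqrt (2 * pi * c))"
    and "integrable lborel (\<lambda>v. indicator {0..} v * (cos (v * Y) * exp (- (c * v\<^sup>2 / 2))))"
    and "integrable lborel (\<lambda>v. exp (- (c * v\<^sup>2 / 2)))"
proof -
  define g where "g v = cos (v * Y) * exp (- (c * v\<^sup>2 / 2))" for v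
  have e: "exp (- (c * v\<^sup>2 / 2)) = sqrt (2 * pi / c) * normal_density 0 (1 / sqrt c) v" for v
    using c by (simp add: normal_density_def power_divide real_sqrt_divide real_sqrt_mult field_simps)
  show ie: "integrable lborel (\<lambda>v. exp (- (c * v\<^sup>2 / 2)))" unfolding e using c by simp
  have ig: "integrable lborel g" unfolding g_def
    by (rule Bochner_Integration.integrable_bound[OF ie]) (auto simp: abs_mult intro!: mult_left_le_one_le)
  show ih: "integrable lborel (\<lambda>v. indicator {0..} v * (cos (v * Y) * exp (- (c * v\<^sup>2 / 2))))"
    using integrable_mult_indicator[OF _ ig, of "{0..}"] unfolding g_def by simp
  have ih2: "integrable lborel (\<lambda>v. indicator {..0} v * g v)"
    using integrable_mult_indicator[OF _ ig, of "{..0}"] by simp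
  have full: "(LBINT v. g v) = 2 * pi * (exp (- Y\<^sup>2 / (2 * c)) / sqrt (2 * pi * c))"
  proof -
    define t where "t = Y / sqrt c"
    have sc: "sqrt c > 0" using c by simp
    have "(LBINT v. g v) = (1 / sqrt c) * (LBINT v. g (0 + (1 / sqrt c) * v))"
      using sc by (subst lborel_integral_real_affine[where c="1 / sqrt c" and t=0]) auto
    also have "(\<lambda>v. g (0 + (1 / sqrt c) * v)) = (\<lambda>v. sqrt (2 * pi) * (Re (iexp (t * v)) * std_normal_density v))"
      unfolding g_def t_def std_normal_density_def using c
      by (auto simp: fun_eq_iff power_divide cis_conv_exp[symmetric] Re_exp field_simps)
    also have "(LBINT v. sqrt (2 * pi) * (Re (iexp (t * v)) * std_normal_density v)) = sqrt (2 * pi) * (LBINT v. Re (std_normal_density v *\<^sub>R iexp (t * v)))"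
      by (simp add: mult.commute)
    also have "(LBINT v. Re (std_normal_density v *\<^sub>R iexp (t * v))) = Re (LBINT v. std_normal_density v *\<^sub>R iexp (t * v))"
    proof (rule integral_Re)
      show "integrable lborel (\<lambda>v. std_normal_density v *\<^sub>R iexp (t * v))"
        by (rule Bochner_Integration.integrable_bound[of _ std_normal_density]) (auto simp: integrable_normal_density)
    qed
    also have "(LBINT v. std_normal_density v *\<^sub>R iexp (t * v)) = char std_normal_distribution t"
      unfolding char_def by (subst integral_density) auto
    also have "Re (char std_normal_distribution t) = exp (- t\<^sup>2 / 2)"
      by (simp add: char_std_normal_distribution)
    finally have f1: "(LBINT v. g v) = (1 / sqrt c) * (sqrt (2 * pi) * exp (- t\<^sup>2 / 2))" .
    have f2: "- t\<^sup>2 / 2 = - Y\<^sup>2 / (2 * c)" unfolding t_def using c by (simp add: power_divide)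
    have f3: "(1 / sqrt c) * sqrt (2 * pi) = 2 * pi * (1 / sqrt (2 * pi * c))"
    proof -
      have "sqrt (2 * pi) * sqrt (2 * pi) = 2 * pi" by simp
      then show ?thesis using sc by (simp add: real_sqrt_mult field_simps)
    qed
    have "(1 / sqrt c) * (sqrt (2 * pi) * exp (- t\<^sup>2 / 2)) = ((1 / sqrt c) * sqrt (2 * pi)) * exp (- t\<^sup>2 / 2)" by (simp only: mult.assoc)
    then show ?thesis unfolding f1 f3 f2 by simp
  qed
  have "(LBINT v. g v) = (LBINT v. indicator {0..} v * g v + indicator {..0} v * g v)"
  proof (rule integral_cong_AE)
    have "AE x in lborel. x \<noteq> (0::real)" by (rule AE_lborel_singleton)
    then show "AE x in lborel. g x = indicator {0..} x * g x + indicator {..0} x * g x"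
      by eventually_elim (auto simp: indicator_def)
  qed (auto simp: g_def[abs_def])
  also have "\<dots> = (LBINT v. indicator {0..} v * g v) + (LBINT v. indicator {..0} v * g v)"
    using ih ih2 unfolding g_def by (intro Bochner_Integration.integral_add) auto
  also have "(LBINT v. indicator {..0} v * g v) = (LBINT v. indicator {0..} v * g v)"
    by (subst lborel_integral_real_affine[where c="-1" and t=0]) (auto simp: g_def indicator_def intro!: Bochner_Integration.integral_cong)
  finally show "(LBINT v. indicator {0..} v * (cos (v * Y) * exp (- (c * v\<^sup>2 / 2)))) = pi * (exp (- Y\<^sup>2 / (2 * c)) / sqrt (2 * pi * c))"
    unfolding full by (simp add: g_def)
qed

lemma fop_iter_integral:
  assumes "\<And>x y. integrable M (\<lambda>t. G t x y)"
  shows "integrable M (\<lambda>t. (fop P f ^^ k) (G t) x y) \<and> (fop P f ^^ k) (\<lambda>x y. \<integral>t. G t x y \<partial>M) x y = (\<integral>t. (fop P f ^^ k) (G t) x y \<partial>M)"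
proof (induction k arbitrary: x y)
  case (Suc k)
  have e: "(fop P f ^^ Suc k) (G t) x y = (\<Sum>x'\<in>UNIV. P x x' * (fop P f ^^ k) (G t) x' (y + f x'))" for t
    by (simp add: fop_def[of P f "(fop P f ^^ k) _"])
  have i: "integrable M (\<lambda>t. P x x' * (fop P f ^^ k) (G t) x' (y + f x'))" for x'
    using Suc[of x' "y + f x'"] by simp
  have "(fop P f ^^ Suc k) (\<lambda>x y. \<integral>t. G t x y \<partial>M) x y = (\<Sum>x'\<in>UNIV. P x x' * (\<integral>t. (fop P f ^^ k) (G t) x' (y + f x') \<partial>M))"
    using Suc by (simp add: fop_def[of P f "(fop P f ^^ k) _"])
  also have "\<dots> = (\<Sum>x'\<in>UNIV. \<integral>t. P x x' * (fop P f ^^ k) (G t) x' (y + f x') \<partial>M)" by simp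
  also have "\<dots> = (\<integral>t. (\<Sum>x'\<in>UNIV. P x x' * (fop P f ^^ k) (G t) x' (y + f x')) \<partial>M)"
    by (rule Bochner_Integration.integral_sum[symmetric]) (use i in auto)
  finally show ?case unfolding e using i by auto
qed (use assms in simp)

context pos_chain
begin

text \<open>The last l steps replace the indicator of u by the constant \<open>\<nu> u\<close>, and
  the remaining k - l act on a constant; at frequency v / sqrt k a fixed number l of steps
  disappears in the limit.\<close>

lemma cop_cind_clt: "(\<lambda>k. (cop P f (v / sqrt k) ^^ k) (cind u) x) \<longlonglongrightarrow> of_real (\<nu> u * exp (- (s2 * v\<^sup>2 / 2)))"
proof (rule LIMSEQ_I)
  fix \<epsilon> :: real assume eps: "\<epsilon> > 0"
  obtain C1 where C1: "C1 > 0" "\<And>t k x. \<bar>t\<bar> \<le> 1 ==> norm ((cop P f t ^^ k) (\<lambda>_. 1) x - of_real (exp (- (s2 * t\<^sup>2 * k / 2)))) \<le> C1 * (k * \<bar>t\<bar> ^ 3 + \<bar>t\<bar>)"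
    using cop_one_clt by blast
  obtain C2 \<rho> where C20: "C2 > 0" "0 < \<rho>" "\<rho> < 1" "\<forall>t l g x. (\<forall>x. norm (g x) \<le> 1) -->
     norm ((cop P f t ^^ l) g x - (\<Sum>u\<in>UNIV. of_real (\<nu> u) * g u)) \<le> C2 * (l * \<bar>t\<bar> + \<rho> ^ l)"
    using cop_cind_mixing by (elim exE conjE)
  note C2 = C20(1-3) C20(4)[rule_format]
  have "(\<lambda>l. C2 * \<rho> ^ l) \<longlonglongrightarrow> 0" using C2 by (intro tendsto_eq_intros LIMSEQ_power_zero) auto
  then have "\<forall>\<^sub>F l in sequentially. C2 * \<rho> ^ l < \<epsilon>/2" using eps by (intro order_tendstoD) auto
  then obtain l where l: "C2 * \<rho> ^ l < \<epsilon>/2" by (auto simp: eventually_sequentially)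
  define e where "e k = C2 * (l * (\<bar>v\<bar> / sqrt k)) + C1 * (k * (\<bar>v\<bar> / sqrt k) ^ 3 + \<bar>v\<bar> / sqrt k) + \<bar>exp (- (s2 * (v / sqrt k)\<^sup>2 * (real k - real l) / 2)) - exp (- (s2 * v\<^sup>2 / 2))\<bar>" for k :: nat
  have "e \<longlonglongrightarrow> 0 + 0 + 0" unfolding e_def
  proof (intro tendsto_add)
    show "(\<lambda>k::nat. C2 * (l * (\<bar>v\<bar> / sqrt k))) \<longlonglongrightarrow> 0" by real_asymp
    have A: "(\<lambda>k::nat. real k * (1 / sqrt k) ^ 3) \<longlonglongrightarrow> 0" by real_asymp
    have B: "(\<lambda>k::nat. 1 / sqrt k) \<longlonglongrightarrow> 0" by real_asymp
    have "(\<lambda>k::nat. C1 * (\<bar>v\<bar> ^ 3 * (real k * (1 / sqrt k) ^ 3) + \<bar>v\<bar> * (1 / sqrt k))) \<longlonglongrightarrow> C1 * (\<bar>v\<bar> ^ 3 * 0 + \<bar>v\<bar> * 0)"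
      by (intro tendsto_intros A B)
    then show "(\<lambda>k::nat. C1 * (k * (\<bar>v\<bar> / sqrt k) ^ 3 + \<bar>v\<bar> / sqrt k)) \<longlonglongrightarrow> 0" by (simp add: power_divide mult.commute)
    have D: "(\<lambda>k::nat. (1 / sqrt k)\<^sup>2 * (real k - real l)) \<longlonglongrightarrow> 1" by real_asymp
    have "(\<lambda>k::nat. s2 * v\<^sup>2 / 2 * ((1 / sqrt k)\<^sup>2 * (real k - real l))) \<longlonglongrightarrow> s2 * v\<^sup>2 / 2 * 1" by (intro tendsto_intros D)
    then have "(\<lambda>k::nat. s2 * (v / sqrt k)\<^sup>2 * (real k - real l) / 2) \<longlonglongrightarrow> s2 * v\<^sup>2 / 2" by (simp add: power_divide ac_simps)
    then have "(\<lambda>k::nat. \<bar>exp (- (s2 * (v / sqrt k)\<^sup>2 * (real k - real l) / 2)) - exp (- (s2 * v\<^sup>2 / 2))\<bar>) \<longlonglongrightarrow> \<bar>exp (- (s2 * v\<^sup>2 / 2)) - exp (- (s2 * v\<^sup>2 / 2))\<bar>"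
      by (intro tendsto_rabs tendsto_diff tendsto_exp tendsto_minus tendsto_const)
    then show "(\<lambda>k::nat. \<bar>exp (- (s2 * (v / sqrt k)\<^sup>2 * (real k - real l) / 2)) - exp (- (s2 * v\<^sup>2 / 2))\<bar>) \<longlonglongrightarrow> 0" by simp
  qed
  then have ev1: "\<forall>\<^sub>F k in sequentially. e k < \<epsilon>/2" using eps by (intro order_tendstoD) auto
  have "(\<lambda>k::nat. \<bar>v\<bar> / sqrt k) \<longlonglongrightarrow> 0" by real_asymp
  then have ev2: "\<forall>\<^sub>F k in sequentially. \<bar>v\<bar> / sqrt k < 1" by (intro order_tendstoD) auto
  have "\<forall>\<^sub>F k in sequentially. norm ((cop P f (v / sqrt k) ^^ k) (cind u) x - of_real (\<nu> u * exp (- (s2 * v\<^sup>2 / 2)))) < \<epsilon>"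
    using ev1 ev2 eventually_ge_at_top[of l]
  proof eventually_elim
    case (elim k)
    define t where "t = v / sqrt k"
    have t: "\<bar>t\<bar> = \<bar>v\<bar> / sqrt k" "\<bar>t\<bar> \<le> 1" unfolding t_def using elim by auto
    have kl: "k = (k - l) + l" "real (k - l) = real k - real l" using elim by auto
    have nu1: "\<nu> u \<le> 1" using nu_sum member_le_sum[of u UNIV \<nu>] nu_nonneg by auto
    have "(\<Sum>w\<in>UNIV. of_real (\<nu> w) * cind u w) = complex_of_real (\<nu> u)" by (simp add: cind_def if_distrib[of "\<lambda>c. _ * c"] cong: if_cong)
    then have m: "norm ((cop P f t ^^ l) (cind u) x - of_real (\<nu> u)) \<le> C2 * (l * \<bar>t\<bar> + \<rho> ^ l)" for x
      using C2(4)[where g="cind u" and t=t and l=l and x=x] by (simp add: cind_def)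
    have one: "(cop P f t ^^ (k - l)) (\<lambda>x. of_real (\<nu> u) * 1) x = of_real (\<nu> u) * (cop P f t ^^ (k - l)) (\<lambda>x. 1) x" by (rule cop_iter_mult)
    have "(cop P f t ^^ k) (cind u) x = (cop P f t ^^ (k - l)) ((cop P f t ^^ l) (cind u)) x"
      by (subst kl(1)) (simp add: funpow_add)
    also have "\<dots> = (cop P f t ^^ (k - l)) (\<lambda>x. (cop P f t ^^ l) (cind u) x - of_real (\<nu> u)) x + of_real (\<nu> u) * (cop P f t ^^ (k - l)) (\<lambda>x. 1) x"
      unfolding cop_iter_diff using one by simp
    finally have d: "(cop P f t ^^ k) (cind u) x - of_real (\<nu> u * exp (- (s2 * v\<^sup>2 / 2))) =
       (cop P f t ^^ (k - l)) (\<lambda>x. (cop P f t ^^ l) (cind u) x - of_real (\<nu> u)) x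
       + of_real (\<nu> u) * ((cop P f t ^^ (k - l)) (\<lambda>x. 1) x - of_real (exp (- (s2 * t\<^sup>2 * (k - l) / 2))))
       + of_real (\<nu> u * (exp (- (s2 * t\<^sup>2 * (k - l) / 2)) - exp (- (s2 * v\<^sup>2 / 2))))" by (simp add: algebra_simps)
    have d1: "norm ((cop P f t ^^ (k - l)) (\<lambda>x. (cop P f t ^^ l) (cind u) x - of_real (\<nu> u)) x) \<le> C2 * (l * \<bar>t\<bar> + \<rho> ^ l)"
      by (rule cop_iter_bound) (rule m)
    have d2: "norm (of_real (\<nu> u) * ((cop P f t ^^ (k - l)) (\<lambda>x. 1) x - of_real (exp (- (s2 * t\<^sup>2 * (k - l) / 2))))) \<le> C1 * (k * \<bar>t\<bar> ^ 3 + \<bar>t\<bar>)"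
    proof -
      have "norm ((cop P f t ^^ (k - l)) (\<lambda>x. 1) x - of_real (exp (- (s2 * t\<^sup>2 * (k - l) / 2)))) \<le> C1 * (real (k - l) * \<bar>t\<bar> ^ 3 + \<bar>t\<bar>)" by (rule C1(2)[OF t(2)])
      also have "\<dots> \<le> C1 * (k * \<bar>t\<bar> ^ 3 + \<bar>t\<bar>)" using C1(1) by (intro mult_left_mono add_mono mult_right_mono) auto
      finally show ?thesis unfolding norm_mult norm_of_real abs_of_nonneg[OF nu_nonneg]
        by (rule order_trans[OF mult_left_le_one_le[OF norm_ge_zero nu_nonneg nu1]])
    qed
    have d3: "norm (complex_of_real (\<nu> u * (exp (- (s2 * t\<^sup>2 * (k - l) / 2)) - exp (- (s2 * v\<^sup>2 / 2))))) \<le> \<bar>exp (- (s2 * t\<^sup>2 * (real k - real l) / 2)) - exp (- (s2 * v\<^sup>2 / 2))\<bar>"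
      unfolding norm_of_real abs_mult kl(2) using nu1 nu_nonneg[of u] by (intro mult_left_le_one_le) auto
    have "norm ((cop P f t ^^ k) (cind u) x - of_real (\<nu> u * exp (- (s2 * v\<^sup>2 / 2)))) \<le> C2 * (l * \<bar>t\<bar> + \<rho> ^ l) + C1 * (k * \<bar>t\<bar> ^ 3 + \<bar>t\<bar>) + \<bar>exp (- (s2 * t\<^sup>2 * (real k - real l) / 2)) - exp (- (s2 * v\<^sup>2 / 2))\<bar>"
      unfolding d by (rule order_trans[OF norm_triangle_ineq add_mono[OF order_trans[OF norm_triangle_ineq add_mono[OF d1 d2]] d3]])
    also have "\<dots> = C2 * \<rho> ^ l + e k" unfolding e_def t(1) t_def by (simp add: algebra_simps)
    also have "\<dots> < \<epsilon>" using l elim(1) by simp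
    finally show ?case unfolding t_def .
  qed
  then show "\<exists>N. \<forall>n\<ge>N. norm ((cop P f (v / sqrt n) ^^ n) (cind u) x - of_real (\<nu> u * exp (- (s2 * v\<^sup>2 / 2)))) < \<epsilon>"
    by (simp add: eventually_sequentially)
qed

end

context nonlattice_chain
begin

text \<open>Fourier inversion at frequency v / sqrt k. The integrands converge pointwise by
  \<open>cop_cind_clt\<close> and are dominated by Gaussians thanks to \<open>cop_decay\<close>, so
  they converge in L1; the height y enters only through a phase, hence the error is uniform in
  y.\<close>

theorem local_limit:
  assumes l: "l > 0"
  shows "\<exists>e. e \<longlonglongrightarrow> 0 \<and> (\<forall>k\<ge>1. \<forall>x u y. \<bar>(fop P f ^^ k) (\<lambda>x y. (if x = u then 1 else 0) * fejer l y) x y - \<nu> u * gd s2 0 k y\<bar> \<le> e k / sqrt k)"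
proof -
  obtain C c where C: "C > 0" "c > 0" "\<And>t k g x. \<bar>t\<bar> \<le> l ==> (\<forall>x. norm (g x) \<le> 1) ==> norm ((cop P f t ^^ k) g x) \<le> C * exp (- (c * t\<^sup>2 * k))"
    using cop_decay[OF l] by metis
  define A where "A t k x u = (cop P f t ^^ k) (cind u) x" for t k x u
  have A_meas [measurable]: "(\<lambda>t. A t k x u) \<in> borel_measurable borel" for k x u
    unfolding A_def by (intro borel_measurable_continuous_onI continuous_cop_iter)
  \<comment> \<open>The Fourier integrand after rescaling; the cutoff by the triangle is where the
    compact frequency range comes from.\<close>
  define B where "B k x u v = of_real (indicator {0..l} (v / sqrt k) * (1 - v / sqrt k / l)) * A (v / sqrt k) k x u" for k :: nat and x u v
  define L where "L u v = complex_of_real (indicator {0..} v * (\<nu> u * exp (- (s2 * v\<^sup>2 / 2))))" for u v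
  define d where "d k x u = (LBINT v. norm (B k x u v - L u v))" for k x u
  define w where "w v = C * exp (- (2 * c * v\<^sup>2 / 2)) + exp (- (s2 * v\<^sup>2 / 2))" for v
  have B_meas [measurable]: "(\<lambda>v. B k x u v) \<in> borel_measurable borel" for k x u unfolding B_def by measurable
  have L_meas [measurable]: "(\<lambda>v. L u v) \<in> borel_measurable borel" for u unfolding L_def by measurable
  have [measurable]: "B k x u \<in> borel_measurable borel" "L u \<in> borel_measurable borel" for k x u
    using B_meas[of k x u] L_meas[of u] by simp_all
  have [measurable]: "(\<lambda>v. cis (v * a)) \<in> borel_measurable borel" for a
    by (intro borel_measurable_continuous_onI continuous_intros)
  have w_int: "integrable lborel w" unfolding w_def
    using gaussian_fourier_half(3)[of "2 * c"] gaussian_fourier_half(3)[OF s2_pos] C(2) by auto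
  have nu1: "\<nu> u \<le> 1" for u using nu_sum member_le_sum[of u UNIV \<nu>] nu_nonneg by auto
  have Bn: "norm (B k x u v) \<le> C * exp (- (2 * c * v\<^sup>2 / 2))" if k: "k \<ge> 1" for k x u v
  proof (cases "v / sqrt k \<in> {0..l}")
    case True
    have "norm (A (v / sqrt k) k x u) \<le> C * exp (- (c * (v / sqrt k)\<^sup>2 * k))"
      unfolding A_def by (rule C(3)) (use True in \<open>auto simp: cind_def\<close>)
    also have "c * (v / sqrt k)\<^sup>2 * k = 2 * c * v\<^sup>2 / 2" using k by (simp add: power_divide)
    finally have "norm (A (v / sqrt k) k x u) \<le> C * exp (- (2 * c * v\<^sup>2 / 2))" .
    moreover have "\<bar>1 - v / sqrt k / l\<bar> \<le> 1"
    proof -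
      define r where "r = v / sqrt k"
      have "0 \<le> r" "r \<le> l" using True unfolding r_def by auto
      then have "0 \<le> r / l" "r / l \<le> 1" using l by auto
      then show ?thesis unfolding r_def by linarith
    qed
    ultimately have "\<bar>1 - v / sqrt k / l\<bar> * norm (A (v / sqrt k) k x u) \<le> 1 * (C * exp (- (2 * c * v\<^sup>2 / 2)))"
      by (intro mult_mono) auto
    then show ?thesis unfolding B_def norm_mult norm_of_real using True by simp
  next
    case False
    then show ?thesis unfolding B_def using C(1) by simp
  qed
  have Ln: "norm (L u v) \<le> exp (- (s2 * v\<^sup>2 / 2))" for u v
    unfolding L_def norm_of_real using nu_nonneg[of u] nu1[of u] by (auto simp: indicator_def abs_mult intro!: mult_left_le_one_le)
  have BLn: "norm (B k x u v - L u v) \<le> w v" if "k \<ge> 1" for k x u v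
    unfolding w_def using norm_triangle_le_diff[OF add_mono[OF Bn[OF that] Ln]] by simp
  have BL_int: "integrable lborel (\<lambda>v. norm (B k x u v - L u v))" if "k \<ge> 1" for k x u
  proof (rule Bochner_Integration.integrable_bound[OF w_int])
    show "AE v in lborel. norm (norm (B k x u v - L u v)) \<le> norm (w v)"
      using order_trans[OF BLn[OF that] abs_ge_self] by simp
  qed measurable
  have d0: "(\<lambda>k. d k x u) \<longlonglongrightarrow> 0" for x u
  proof -
    \<comment> \<open>Indexed by \<open>Suc k\<close> since domination holds only from k = 1
      on.\<close>
    define sq where "sq k = (\<lambda>v. norm (B (Suc k) x u v - L u v))" for k
    define z where "z = (\<lambda>v::real. 0::real)"
    have "(\<lambda>k. integral\<^sup>L lborel (sq k)) \<longlonglongrightarrow> integral\<^sup>L lborel z"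
    proof (rule integral_dominated_convergence)
      show "integrable lborel w" by (rule w_int)
      show "z \<in> borel_measurable lborel" unfolding z_def by simp
      show "sq k \<in> borel_measurable lborel" for k unfolding sq_def by measurable
      show "AE v in lborel. (\<lambda>k. sq k v) \<longlonglongrightarrow> z v"
      proof (rule AE_I2)
        fix v :: real
        have "(\<lambda>k. B k x u v) \<longlonglongrightarrow> L u v"
        proof (cases "v \<ge> 0")
          case True
          have q: "(\<lambda>k::nat. v / sqrt k) \<longlonglongrightarrow> 0"
          proof -
            have "(\<lambda>k::nat. 1 / sqrt k) \<longlonglongrightarrow> 0" by real_asymp
            from tendsto_mult[OF tendsto_const[of v] this] show ?thesis by simp
          qed
          then have "\<forall>\<^sub>F k in sequentially. v / sqrt k < l" using l by (intro order_tendstoD) auto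
          then have ev: "\<forall>\<^sub>F k in sequentially. of_real (1 - v / sqrt k / l) * A (v / sqrt k) k x u = B k x u v"
            by eventually_elim (use True in \<open>auto simp: B_def\<close>)
          have "(\<lambda>k. of_real (1 - v / sqrt k / l) * A (v / sqrt k) k x u) \<longlonglongrightarrow> of_real (1 - 0 / l) * of_real (\<nu> u * exp (- (s2 * v\<^sup>2 / 2)))"
            unfolding A_def by (intro tendsto_intros q cop_cind_clt) (use l in auto)
          then have "(\<lambda>k. of_real (1 - v / sqrt k / l) * A (v / sqrt k) k x u) \<longlonglongrightarrow> L u v" using True by (simp add: L_def)
          then show ?thesis using ev by (rule Lim_transform_eventually)
        next
          case False
          have "B k x u v = 0" if "k \<ge> 1" for k
          proof -
            have "v / sqrt k < 0" using False that by (simp add: divide_less_0_iff)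
            then show ?thesis by (simp add: B_def)
          qed
          then have "\<forall>\<^sub>F k in sequentially. B k x u v = 0" unfolding eventually_sequentially by blast
          moreover have "L u v = 0" using False by (simp add: L_def)
          ultimately show ?thesis by (simp add: tendsto_eventually)
        qed
        then have "(\<lambda>k. B (Suc k) x u v) \<longlonglongrightarrow> L u v" by (rule LIMSEQ_Suc)
        then have "(\<lambda>k. norm (B (Suc k) x u v - L u v)) \<longlonglongrightarrow> norm (L u v - L u v)" by (intro tendsto_intros)
        then show "(\<lambda>k. sq k v) \<longlonglongrightarrow> z v" by (simp add: sq_def z_def)
      qed
      show "AE v in lborel. norm (sq k v) \<le> w v" for k using BLn[of "Suc k" x u] by (simp add: sq_def)
    qed
    then have "(\<lambda>k. d (Suc k) x u) \<longlonglongrightarrow> 0" unfolding d_def sq_def z_def by simp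
    then show ?thesis by (rule LIMSEQ_imp_Suc)
  qed
  \<comment> \<open>Summing the L1 distances over all pairs of states makes the rate uniform in
    both.\<close>
  define e where "e k = (\<Sum>x\<in>UNIV. \<Sum>u\<in>UNIV. d k x u) / pi" for k
  have "(\<lambda>k. (\<Sum>x\<in>UNIV. \<Sum>u\<in>UNIV. d k x u) / pi) \<longlonglongrightarrow> (\<Sum>x\<in>(UNIV::'a set). \<Sum>u\<in>(UNIV::'a set). 0) / pi"
    by (intro tendsto_intros d0) auto
  then have e0: "e \<longlonglongrightarrow> 0" unfolding e_def by simp
  have dn: "0 \<le> d k x u" for k x u unfolding d_def by simp
  have de: "d k x u \<le> pi * e k" for k x u
  proof -
    have "d k x u \<le> (\<Sum>u\<in>UNIV. d k x u)" by (rule member_le_sum) (use dn in auto)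
    also have "\<dots> \<le> (\<Sum>x\<in>UNIV. \<Sum>u\<in>UNIV. d k x u)" by (rule member_le_sum[of x UNIV "\<lambda>x. \<Sum>u\<in>UNIV. d k x u"]) (auto intro!: sum_nonneg dn)
    finally show ?thesis unfolding e_def by simp
  qed
  have main: "\<bar>(fop P f ^^ k) (\<lambda>x y. (if x = u then 1 else 0) * fejer l y) x y - \<nu> u * gd s2 0 k y\<bar> \<le> e k / sqrt k" if k: "k \<ge> 1" for k x u y
  proof -
    define S where "S = sqrt (real k)"
    have S: "S > 0" unfolding S_def using k by simp
    \<comment> \<open>The kernel as a superposition of plane waves, on which the free chain acts
      through the twisted operator.\<close>
    define G where "G t x y = (1 / pi * ((1 - t / l) * indicator {0..l} t)) * Re (cis (t * y) * cind u x)" for t x y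
    have Gi: "integrable lborel (\<lambda>t. G t x y)" and Gv: "(LBINT t. G t x y) = (if x = u then 1 else 0) * fejer l y" for x y
    proof -
      have eq: "(\<lambda>t. G t x y) = (\<lambda>t. (if x = u then 1 else 0) / pi * ((1 - t / l) * cos (t * y) * indicator {0..l} t))"
        by (auto simp: G_def cind_def fun_eq_iff)
      show "integrable lborel (\<lambda>t. G t x y)" unfolding eq
        using has_bochner_integral_integrable fejer_fourier[OF l, of y] by (intro integrable_mult_right) (auto simp: has_bochner_integral_iff)
      show "(LBINT t. G t x y) = (if x = u then 1 else 0) * fejer l y" unfolding eq
        using has_bochner_integral_integral_eq[OF fejer_fourier[OF l, of y]] by simp
    qed
    have "(\<lambda>x y. (if x = u then 1 else 0) * fejer l y) = (\<lambda>x y. LBINT t. G t x y)" by (simp add: Gv)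
    then have "(fop P f ^^ k) (\<lambda>x y. (if x = u then 1 else 0) * fejer l y) x y = (fop P f ^^ k) (\<lambda>x y. LBINT t. G t x y) x y" by simp
    also have "\<dots> = (LBINT t. (fop P f ^^ k) (G t) x y)" using fop_iter_integral[of lborel G, OF Gi] by blast
    also have "\<dots> = (LBINT t. (1 / pi * ((1 - t / l) * indicator {0..l} t)) * Re (cis (t * y) * A t k x u))"
      unfolding G_def A_def fop_iter_mult cop_fop ..
    also have "\<dots> = \<bar>1 / S\<bar> *\<^sub>R (LBINT v. (1 / pi * ((1 - (0 + 1 / S * v) / l) * indicator {0..l} (0 + 1 / S * v))) * Re (cis ((0 + 1 / S * v) * y) * A (0 + 1 / S * v) k x u))"
      by (rule lborel_integral_real_affine) (use S in auto)
    also have "\<dots> = 1 / (S * pi) * (LBINT v. Re (cis (v * (y / S)) * B k x u v))"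
    proof -
      have "(\<lambda>v. (1 / pi * ((1 - (0 + 1 / S * v) / l) * indicator {0..l} (0 + 1 / S * v))) * Re (cis ((0 + 1 / S * v) * y) * A (0 + 1 / S * v) k x u))
         = (\<lambda>v. 1 / pi * Re (cis (v * (y / S)) * B k x u v))"
      proof
        fix v
        have "cis (v * (y / S)) * B k x u v = of_real (indicator {0..l} (v / S) * (1 - v / S / l)) * (cis (v * (y / S)) * A (v / S) k x u)"
          unfolding B_def S_def by (simp add: ac_simps)
        moreover have "Re (complex_of_real a * z) = a * Re z" for a z by simp
        ultimately have "Re (cis (v * (y / S)) * B k x u v) = (indicator {0..l} (v / S) * (1 - v / S / l)) * Re (cis (v * (y / S)) * A (v / S) k x u)" by (simp only:)
        then show "(1 / pi * ((1 - (0 + 1 / S * v) / l) * indicator {0..l} (0 + 1 / S * v))) * Re (cis ((0 + 1 / S * v) * y) * A (0 + 1 / S * v) k x u) = 1 / pi * Re (cis (v * (y / S)) * B k x u v)"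
          by simp
      qed
      then show ?thesis using S by simp
    qed
    finally have f1: "(fop P f ^^ k) (\<lambda>x y. (if x = u then 1 else 0) * fejer l y) x y = 1 / (S * pi) * (LBINT v. Re (cis (v * (y / S)) * B k x u v))" .
    have f2: "\<nu> u * gd s2 0 k y = 1 / (S * pi) * (LBINT v. Re (cis (v * (y / S)) * L u v))"
    proof -
      have "(\<lambda>v. Re (cis (v * (y / S)) * L u v)) = (\<lambda>v. \<nu> u * (indicator {0..} v * (cos (v * (y / S)) * exp (- (s2 * v\<^sup>2 / 2)))))"
        by (auto simp: L_def fun_eq_iff)
      then have "(LBINT v. Re (cis (v * (y / S)) * L u v)) = \<nu> u * (pi * (exp (- (y / S)\<^sup>2 / (2 * s2)) / sqrt (2 * pi * s2)))"
        using gaussian_fourier_half(1)[OF s2_pos, of "y / S"] by simp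
      moreover have "gd s2 0 k y = 1 / S * (exp (- (y / S)\<^sup>2 / (2 * s2)) / sqrt (2 * pi * s2))"
        unfolding gd_0 S_def using k by (simp add: power_divide real_sqrt_mult field_simps)
      ultimately show ?thesis using S by simp
    qed
    \<comment> \<open>The phase carrying y has modulus one, so it drops out of the error.\<close>
    have nb: "\<bar>Re (cis a * z)\<bar> \<le> norm z" for a z using abs_Re_le_cmod[of "cis a * z"] by (simp add: norm_mult)
    have i1: "integrable lborel (\<lambda>v. Re (cis (v * (y / S)) * B k x u v))"
    proof (rule Bochner_Integration.integrable_bound[OF w_int])
      show "AE v in lborel. norm (Re (cis (v * (y / S)) * B k x u v)) \<le> norm (w v)"
      proof (rule AE_I2)
        fix v
        have "\<bar>Re (cis (v * (y / S)) * B k x u v)\<bar> \<le> C * exp (- (2 * c * v\<^sup>2 / 2))" using nb Bn[OF k] by (rule order_trans)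
        moreover have "C * exp (- (2 * c * v\<^sup>2 / 2)) \<le> w v" unfolding w_def by simp
        ultimately show "norm (Re (cis (v * (y / S)) * B k x u v)) \<le> norm (w v)" unfolding real_norm_def by linarith
      qed
    qed measurable
    have i2: "integrable lborel (\<lambda>v. Re (cis (v * (y / S)) * L u v))"
    proof (rule Bochner_Integration.integrable_bound[OF w_int])
      show "AE v in lborel. norm (Re (cis (v * (y / S)) * L u v)) \<le> norm (w v)"
      proof (rule AE_I2)
        fix v
        have "\<bar>Re (cis (v * (y / S)) * L u v)\<bar> \<le> exp (- (s2 * v\<^sup>2 / 2))" using nb Ln by (rule order_trans)
        moreover have "exp (- (s2 * v\<^sup>2 / 2)) \<le> w v" unfolding w_def using C(1) by simp
        ultimately show "norm (Re (cis (v * (y / S)) * L u v)) \<le> norm (w v)" unfolding real_norm_def by linarith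
      qed
    qed measurable
    have "(LBINT v. Re (cis (v * (y / S)) * B k x u v)) - (LBINT v. Re (cis (v * (y / S)) * L u v)) = (LBINT v. Re (cis (v * (y / S)) * (B k x u v - L u v)))"
      using Bochner_Integration.integral_diff[OF i1 i2] by (simp only: right_diff_distrib minus_complex.sel)
    also have "\<bar>\<dots>\<bar> \<le> d k x u"
      unfolding d_def
    proof (rule integral_abs_bound_integral)
      show "integrable lborel (\<lambda>v. Re (cis (v * (y / S)) * (B k x u v - L u v)))"
        using Bochner_Integration.integrable_diff[OF i1 i2] by (simp only: right_diff_distrib minus_complex.sel)
    qed (rule BL_int[OF k], rule nb)
    also have "\<dots> \<le> pi * e k" by (rule de)
    finally have "\<bar>(LBINT v. Re (cis (v * (y / S)) * B k x u v)) - (LBINT v. Re (cis (v * (y / S)) * L u v))\<bar> \<le> pi * e k" .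
    then have le: "1 / (S * pi) * \<bar>(LBINT v. Re (cis (v * (y / S)) * B k x u v)) - (LBINT v. Re (cis (v * (y / S)) * L u v))\<bar> \<le> 1 / (S * pi) * (pi * e k)"
      using S by (intro mult_left_mono) auto
    have eq: "1 / (S * pi) * (pi * e k) = e k / sqrt k" using S unfolding S_def by simp
    have pos: "0 < 1 / (S * pi)" using S by simp
    show ?thesis unfolding f1 f2 right_diff_distrib[symmetric] abs_mult abs_of_pos[OF pos] using le unfolding eq .
  qed
  show ?thesis using e0 main by blast
qed

end

text \<open>The targets of the local limit theorem. No continuity is asked, since windows and their
  images under the killed chain must qualify; smoothing makes up for it.\<close>

definition nice :: "('a => real => real) => bool" where
  "nice g \<longleftrightarrow> (\<forall>x. g x \<in> borel_measurable borel \<and> integrable lborel (g x)) \<and> (\<forall>x y. 0 \<le> g x y) \<and> (\<exists>b. \<forall>x y. g x y \<le> b)"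

lemma niceD:
  assumes "nice g"
  shows "g x \<in> borel_measurable borel" "integrable lborel (g x)" "0 \<le> g x y" "\<exists>b. \<forall>x y. g x y \<le> b"
  using assms by (auto simp: nice_def)

lemma integral_translate:
  fixes h :: "real => real"
  shows "(LBINT v. h (y + v)) = (LBINT v. h v)"
  using lborel_integral_real_affine[of 1 h y] by simp

lemma integrable_translate:
  fixes h :: "real => real"
  shows "integrable lborel h ==> integrable lborel (\<lambda>v. h (y + v))"
  using lborel_integrable_real_affine[of h 1 y] by simp

lemma integrable_bounded_mult:
  fixes h k :: "real => real"
  assumes "integrable lborel h" "k \<in> borel_measurable borel" "\<And>v. \<bar>k v\<bar> \<le> b"
  shows "integrable lborel (\<lambda>v. h v * k v)"
proof (rule Bochner_Integration.integrable_bound)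
  show "integrable lborel (\<lambda>v. b * h v)" using assms(1) by simp
  show "(\<lambda>v. h v * k v) \<in> borel_measurable lborel" using assms by measurable
  show "AE v in lborel. norm (h v * k v) \<le> norm (b * h v)"
  proof (rule AE_I2)
    fix v
    have "\<bar>k v\<bar> * \<bar>h v\<bar> \<le> \<bar>b\<bar> * \<bar>h v\<bar>" using assms(3)[of v] by (intro mult_right_mono) auto
    then show "norm (h v * k v) \<le> norm (b * h v)" by (simp add: abs_mult mult.commute)
  qed
qed

lemma fejer_le: "l > 0 ==> fejer l v \<le> l"
proof (cases "v = 0")
  case True
  assume "l > 0"
  then have "l * 1 \<le> l * (2 * pi)" using pi_ge_two by (intro mult_left_mono) auto
  then show ?thesis using True by (simp add: fejer_def divide_le_eq)
next
  case False
  assume l: "l > 0"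
  have "1 - cos (l * v) = 2 * (sin (l * v / 2))\<^sup>2" using cos_double_sin[of "l * v / 2"] by simp
  also have "\<dots> \<le> 2 * (l * v / 2)\<^sup>2" using power_mono[OF abs_sin_x_le_abs_x[of "l * v / 2"] abs_ge_zero, of 2, unfolded power2_abs] by linarith
  also have "\<dots> \<le> l * (pi * l * v\<^sup>2)"
  proof -
    have "(l * v)\<^sup>2 * (1/2) \<le> (l * v)\<^sup>2 * pi" using pi_ge_two by (intro mult_left_mono) auto
    moreover have "2 * (l * v / 2)\<^sup>2 = (l * v)\<^sup>2 * (1/2)" "l * (pi * l * v\<^sup>2) = (l * v)\<^sup>2 * pi"
      by (simp_all add: power2_eq_square)
    ultimately show ?thesis by (simp only:)
  qed
  finally show ?thesis using False l by (simp add: fejer_def divide_le_eq)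
qed

context primitive
begin

lemma fop_measurable:
  assumes "\<And>x. g x \<in> borel_measurable borel"
  shows "(\<lambda>v. (fop P f ^^ k) g x (y + v)) \<in> borel_measurable borel"
proof (induction k arbitrary: x y)
  case 0
  have "(\<lambda>v. y + v) \<in> borel \<rightarrow>\<^sub>M borel" by measurable
  from measurable_compose[OF this assms[of x]] show ?case by simp
next
  case (Suc k)
  have e: "(\<lambda>v. (fop P f ^^ Suc k) g x (y + v)) = (\<lambda>v. \<Sum>x'\<in>UNIV. P x x' * (fop P f ^^ k) g x' ((y + f x') + v))"
    by (auto simp: fop_def[of P f "(fop P f ^^ k) g"] fun_eq_iff algebra_simps)
  show ?case unfolding e by (intro borel_measurable_sum borel_measurable_times Suc) auto
qed

text \<open>Fubini: smoothing the target by an even kernel is the same as integrating the target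
  against the kernel started from each of its points. So the local limit theorem for the kernel,
  centred anywhere, controls every \<open>nice\<close> target.\<close>

lemma fop_convolution:
  assumes g: "nice g" and K: "integrable lborel K" "K \<in> borel_measurable borel" "\<And>v. \<bar>K v\<bar> \<le> c" "\<And>v. K (- v) = K v"
  shows "integrable lborel (\<lambda>v. (fop P f ^^ k) g x (y + v) * K v)"
    and "\<And>u. integrable lborel (\<lambda>w. g u w * (fop P f ^^ k) (\<lambda>x y. (if x = u then 1 else 0) * K y) x (y - w))"
    and "(LBINT v. (fop P f ^^ k) g x (y + v) * K v) = (\<Sum>u\<in>UNIV. LBINT w. g u w * (fop P f ^^ k) (\<lambda>x y. (if x = u then 1 else 0) * K y) x (y - w))"
proof -
  obtain b where b: "\<And>x y. g x y \<le> b" using niceD(4)[OF g] by blast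
  have gb: "\<bar>g x y\<bar> \<le> b" for x y using b[of x y] niceD(3)[OF g, of x y] by simp
  show i1: "integrable lborel (\<lambda>v. (fop P f ^^ k) g x (y + v) * K v)" for k x y
  proof -
    have "integrable lborel (\<lambda>v. K v * (fop P f ^^ k) g x (y + v))"
      by (rule integrable_bounded_mult[OF K(1) fop_measurable fop_iter_bound[OF gb]]) (use niceD(1)[OF g] in auto)
    then show ?thesis by (simp add: mult.commute)
  qed
  show i2: "integrable lborel (\<lambda>w. g u w * (fop P f ^^ k) (\<lambda>x y. (if x = u then 1 else 0) * K y) x (y - w))" for u k x y
  proof (rule integrable_bounded_mult[OF niceD(2)[OF g]])
    have m: "(\<lambda>v. (fop P f ^^ k) (\<lambda>x y. (if x = u then 1 else 0) * K y) x (y + v)) \<in> borel_measurable borel"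
      by (rule fop_measurable) (use K(2) in auto)
    have "(\<lambda>w. - w) \<in> borel \<rightarrow>\<^sub>M (borel :: real measure)" by measurable
    from measurable_compose[OF this m] show "(\<lambda>w. (fop P f ^^ k) (\<lambda>x y. (if x = u then 1 else 0) * K y) x (y - w)) \<in> borel_measurable borel"
      by simp
    show "\<bar>(fop P f ^^ k) (\<lambda>x y. (if x = u then 1 else 0) * K y) x (y - w)\<bar> \<le> c" for w
      by (rule fop_iter_bound) (use K(3) order_trans[OF abs_ge_zero K(3)] in auto)
  qed
  show "(LBINT v. (fop P f ^^ k) g x (y + v) * K v) = (\<Sum>u\<in>UNIV. LBINT w. g u w * (fop P f ^^ k) (\<lambda>x y. (if x = u then 1 else 0) * K y) x (y - w))"
  proof (induction k arbitrary: x y)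
    case 0
    have "(\<Sum>u\<in>UNIV. LBINT w. g u w * (if x = u then 1 else 0) * K (y - w)) = (\<Sum>u\<in>UNIV. (if u = x then 1 else 0) * (LBINT w. g u w * K (y - w)))"
      by (intro sum.cong refl) auto
    also have "\<dots> = (LBINT w. g x w * K (y - w))" by (rule sum_indicator_left)
    also have "\<dots> = (LBINT v. g x (y + v) * K (y - (y + v)))"
      using integral_translate[of "\<lambda>w. g x w * K (y - w)" y] by simp
    also have "\<dots> = (LBINT v. g x (y + v) * K v)" using K(4) by simp
    finally show ?case by (simp add: mult.assoc)
  next
    case (Suc k)
    have "(LBINT v. (fop P f ^^ Suc k) g x (y + v) * K v) = (LBINT v. (\<Sum>x'\<in>UNIV. P x x' * ((fop P f ^^ k) g x' ((y + f x') + v) * K v)))"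
    proof (intro Bochner_Integration.integral_cong refl)
      fix v
      have "(fop P f ^^ Suc k) g x (y + v) = (\<Sum>x'\<in>UNIV. P x x' * (fop P f ^^ k) g x' ((y + f x') + v))"
        by (simp add: fop_def[of P f "(fop P f ^^ k) g"] algebra_simps)
      then show "(fop P f ^^ Suc k) g x (y + v) * K v = (\<Sum>x'\<in>UNIV. P x x' * ((fop P f ^^ k) g x' ((y + f x') + v) * K v))"
        by (simp only: sum_distrib_right mult.assoc)
    qed
    also have "\<dots> = (\<Sum>x'\<in>UNIV. P x x' * (LBINT v. (fop P f ^^ k) g x' ((y + f x') + v) * K v))"
      by (subst Bochner_Integration.integral_sum) (use i1 in auto)
    also have "\<dots> = (\<Sum>x'\<in>UNIV. P x x' * (\<Sum>u\<in>UNIV. LBINT w. g u w * (fop P f ^^ k) (\<lambda>x y. (if x = u then 1 else 0) * K y) x' (y + f x' - w)))"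
      by (simp only: Suc)
    also have "\<dots> = (\<Sum>u\<in>UNIV. \<Sum>x'\<in>UNIV. LBINT w. P x x' * (g u w * (fop P f ^^ k) (\<lambda>x y. (if x = u then 1 else 0) * K y) x' (y + f x' - w)))"
      unfolding sum_distrib_left by (subst sum.swap) simp
    also have "\<dots> = (\<Sum>u\<in>UNIV. LBINT w. (\<Sum>x'\<in>UNIV. P x x' * (g u w * (fop P f ^^ k) (\<lambda>x y. (if x = u then 1 else 0) * K y) x' (y + f x' - w))))"
      by (intro sum.cong refl, subst Bochner_Integration.integral_sum) (use i2 in auto)
    also have "\<dots> = (\<Sum>u\<in>UNIV. LBINT w. g u w * (fop P f ^^ Suc k) (\<lambda>x y. (if x = u then 1 else 0) * K y) x (y - w))"
    proof (intro sum.cong refl Bochner_Integration.integral_cong)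
      fix u w
      have "(fop P f ^^ Suc k) (\<lambda>x y. (if x = u then 1 else 0) * K y) x (y - w) = (\<Sum>x'\<in>UNIV. P x x' * (fop P f ^^ k) (\<lambda>x y. (if x = u then 1 else 0) * K y) x' (y + f x' - w))"
        by (simp add: fop_def[of P f "(fop P f ^^ k) _"] algebra_simps)
      then show "(\<Sum>x'\<in>UNIV. P x x' * (g u w * (fop P f ^^ k) (\<lambda>x y. (if x = u then 1 else 0) * K y) x' (y + f x' - w))) = g u w * (fop P f ^^ Suc k) (\<lambda>x y. (if x = u then 1 else 0) * K y) x (y - w)"
        by (simp only: sum_distrib_left mult.left_commute)
    qed
    finally show ?case .
  qed
qed

text \<open>The chain commutes with translations in the height, hence with averaging over shifts of
  its target.\<close>

lemma fop_smoothing: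
  assumes g: "nice g" and K: "integrable lborel K" "K \<in> borel_measurable borel" "\<And>v. \<bar>K v\<bar> \<le> c"
  shows "(fop P f ^^ k) (\<lambda>x y. LBINT v. g x (y + s + v) * K v) x y = (LBINT v. (fop P f ^^ k) g x (y + s + v) * K v)"
proof -
  obtain b where b: "\<And>x y. g x y \<le> b" using niceD(4)[OF g] by blast
  have gb: "\<bar>g x y\<bar> \<le> b" for x y using b[of x y] niceD(3)[OF g, of x y] by simp
  define G where "G v x y = K v * g x (y + (s + v))" for v x y
  have i: "integrable lborel (\<lambda>v. G v x y)" for x y unfolding G_def
  proof (rule integrable_bounded_mult[OF K(1)])
    show "(\<lambda>v. g x (y + (s + v))) \<in> borel_measurable borel"
      using fop_measurable[of g, where f=f and k=0 and x=x and y="y + s"] niceD(1)[OF g] by (simp add: add.assoc)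
  qed (rule gb)
  have "(\<lambda>x y. LBINT v. g x (y + s + v) * K v) = (\<lambda>x y. LBINT v. G v x y)"
    by (simp add: G_def mult.commute add.assoc)
  then have "(fop P f ^^ k) (\<lambda>x y. LBINT v. g x (y + s + v) * K v) x y = (LBINT v. (fop P f ^^ k) (G v) x y)"
    using fop_iter_integral[of lborel G, OF i, where P=P and f=f and k=k and x=x and y=y] by simp
  also have "\<dots> = (LBINT v. (fop P f ^^ k) g x (y + s + v) * K v)"
    unfolding G_def fop_iter_mult fop_iter_shift by (simp add: mult.commute add.assoc)
  finally show ?thesis .
qed

end

context nonlattice_chain
begin

definition mass :: "('a => real => real) => real" where
  "mass g = (\<Sum>x\<in>UNIV. \<nu> x * (LBINT y. g x y))"

text \<open>What the local limit theorem predicts for the free chain started at height y and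
  observed through g: the state is distributed by \<open>\<nu>\<close>, the height by a Gaussian
  centred at y.\<close>

definition gconv :: "('a => real => real) => real => real => real" where
  "gconv g s y = (\<Sum>x\<in>UNIV. \<nu> x * (LBINT w. g x w * gd s2 0 s (w - y)))"

text \<open>\<open>\<nu>\<close> is bounded below on a finite space, so integrals with and without
  the weight are comparable.\<close>

lemma mass_bound: "\<exists>C>0. \<forall>g. nice g --> (\<Sum>x\<in>UNIV. LBINT y. g x y) \<le> C * mass g"
proof -
  define m where "m = Min (range \<nu>)"
  have m: "m > 0" "\<And>x. m \<le> \<nu> x" unfolding m_def using nu_pos by (auto simp: Min_gr_iff)
  have "(\<Sum>x\<in>UNIV. LBINT y. g x y) \<le> (1 / m) * mass g" if g: "nice g" for g :: "'a => real => real"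
  proof -
    have "m * (\<Sum>x\<in>UNIV. LBINT y. g x y) \<le> mass g"
      unfolding mass_def sum_distrib_left
      by (intro sum_mono mult_right_mono m(2)) (use niceD(3)[OF g] in simp)
    then show ?thesis using m by (simp add: field_simps)
  qed
  then show ?thesis using m by (intro exI[of _ "1 / m"]) auto
qed

lemma mass_nonneg: "nice g ==> 0 \<le> mass g"
  unfolding mass_def by (intro sum_nonneg mult_nonneg_nonneg nu_nonneg integral_nonneg_AE) (auto intro: niceD(3))

lemma gd0_even: "gd c 0 s (- y) = gd c 0 s y"
  by (simp add: gd_0)

lemma gd_measurable [measurable]: "gd s2 0 s \<in> borel_measurable borel"
  unfolding gd_0[abs_def] by measurable

text \<open>The kernel estimate integrated against g. The shift s is there because the smoothing
  will be used off centre; it moves the Gaussian by O(\<delta>/k), which is absorbed in the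
  error.\<close>

lemma smoothed_local_limit:
  assumes l: "l > 0" and \<delta>: "\<delta> > 0"
  shows "\<exists>e. e \<longlonglongrightarrow> 0 \<and> (\<forall>k\<ge>1. \<forall>g x y s. nice g --> \<bar>s\<bar> \<le> \<delta> -->
     \<bar>(LBINT v. (fop P f ^^ k) g x (y + s + v) * fejer l v) - gconv g k y\<bar> \<le> e k / sqrt k * mass g)"
proof -
  obtain e1 where e1: "e1 \<longlonglongrightarrow> 0" "\<And>k x u y. k \<ge> 1 ==> \<bar>(fop P f ^^ k) (\<lambda>x y. (if x = u then 1 else 0) * fejer l y) x y - \<nu> u * gd s2 0 k y\<bar> \<le> e1 k / sqrt k"
    using local_limit[OF l] by blast
  obtain C2 where C2: "C2 > 0" "\<And>j s y. j \<le> 6 ==> s > 0 ==> \<bar>gd s2 j s y\<bar> \<le> C2 / (sqrt s) ^ Suc j"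
    using gd_bound_uniform[OF s2_pos] by blast
  obtain C3 where C3: "C3 > 0" "\<And>g. nice g ==> (\<Sum>x\<in>UNIV. LBINT y. g x y) \<le> C3 * mass g" using mass_bound by blast
  define e where "e k = C3 * (e1 k + C2 * \<delta> / sqrt k)" for k :: nat
  have "(\<lambda>k::nat. 1 / sqrt k) \<longlonglongrightarrow> 0" by real_asymp
  from tendsto_mult[OF tendsto_const[of "C2 * \<delta>"] this] have "(\<lambda>k::nat. C2 * \<delta> / sqrt k) \<longlonglongrightarrow> 0" by simp
  from tendsto_mult[OF tendsto_const[of C3] tendsto_add[OF e1(1) this]] have e0: "e \<longlonglongrightarrow> 0" unfolding e_def by simp
  have "\<bar>(LBINT v. (fop P f ^^ k) g x (y + s + v) * fejer l v) - gconv g k y\<bar> \<le> e k / sqrt k * mass g"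
    if k: "k \<ge> 1" and g: "nice g" and s: "\<bar>s\<bar> \<le> \<delta>" for k g x y s
  proof -
    have fK: "integrable lborel (fejer l)" "fejer l \<in> borel_measurable borel" "\<And>v. \<bar>fejer l v\<bar> \<le> l" "\<And>v. fejer l (- v) = fejer l v"
      using fejer_integral[OF l] fejer_nonneg[OF l] fejer_le[OF l] fejer_even by auto
    define \<Phi> where "\<Phi> u z = (fop P f ^^ k) (\<lambda>x y. (if x = u then 1 else 0) * fejer l y) x z" for u z
    note cv = fop_convolution[OF g fK]
    have sk: "sqrt k > 0" "sqrt k * sqrt k = k" using k by auto
    have eq: "(LBINT v. (fop P f ^^ k) g x (y + s + v) * fejer l v) = (\<Sum>u\<in>UNIV. LBINT w. g u w * \<Phi> u (y + s - w))"
      unfolding \<Phi>_def by (rule cv(3))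
    have i1: "integrable lborel (\<lambda>w. g u w * \<Phi> u (y + s - w))" for u unfolding \<Phi>_def by (rule cv(2))
    have gdb: "\<bar>gd s2 0 k w\<bar> \<le> C2 / sqrt k" for w using C2(2)[of 0 "real k" w] k by simp
    have mm: "(\<lambda>w. gd s2 0 k (w - y)) \<in> borel_measurable borel" by measurable
    have i2: "integrable lborel (\<lambda>w. g u w * gd s2 0 k (w - y))" for u
      by (rule integrable_bounded_mult[OF niceD(2)[OF g] mm gdb])
    have ek: "e1 k / sqrt k + C2 * \<delta> / sqrt k / sqrt k \<ge> 0"
    proof -
      have "0 \<le> e1 k / sqrt k" using e1(2)[OF k, of undefined undefined 0] by (meson abs_ge_zero order_trans)
      then show ?thesis using C2 \<delta> by simp
    qed
    have pt: "\<bar>\<Phi> u (y + s - w) - \<nu> u * gd s2 0 k (w - y)\<bar> \<le> e1 k / sqrt k + C2 * \<delta> / sqrt k / sqrt k" for u w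
    proof -
      have 1: "\<bar>\<Phi> u (y + s - w) - \<nu> u * gd s2 0 k (y + s - w)\<bar> \<le> e1 k / sqrt k" unfolding \<Phi>_def by (rule e1(2)[OF k])
      have "\<bar>gd s2 0 k ((y - w) + s) - (\<Sum>j<1. gd s2 (0 + j) k (y - w) / fact j * s ^ j)\<bar> \<le> C2 / k * \<bar>s\<bar> ^ 1"
        by (rule heat_taylor_y[OF heat_seq_gd[OF s2_pos]]) (use C2(2)[of 1 "real k"] k sk(2) in auto)
      then have "\<bar>gd s2 0 k (y + s - w) - gd s2 0 k (y - w)\<bar> \<le> C2 / k * \<bar>s\<bar>" by (simp add: algebra_simps)
      also have "\<dots> \<le> C2 / k * \<delta>" using s C2(1) by (intro mult_left_mono) auto
      also have "\<dots> = C2 * \<delta> / sqrt k / sqrt k" unfolding divide_divide_eq_left sk(2) by simp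
      finally have 2: "\<bar>gd s2 0 k (y + s - w) - gd s2 0 k (w - y)\<bar> \<le> C2 * \<delta> / sqrt k / sqrt k"
        using gd0_even[of s2 k "w - y"] by simp
      have nu1: "\<nu> u \<le> 1" using nu_sum member_le_sum[of u UNIV \<nu>] nu_nonneg by auto
      have "\<bar>\<nu> u * gd s2 0 k (y + s - w) - \<nu> u * gd s2 0 k (w - y)\<bar> = \<nu> u * \<bar>gd s2 0 k (y + s - w) - gd s2 0 k (w - y)\<bar>"
        unfolding right_diff_distrib[symmetric] abs_mult abs_of_nonneg[OF nu_nonneg] ..
      also have "\<dots> \<le> \<bar>gd s2 0 k (y + s - w) - gd s2 0 k (w - y)\<bar>" by (rule mult_left_le_one_le[OF abs_ge_zero nu_nonneg nu1])
      finally show ?thesis using 1 2 by linarith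
    qed
    have eqd: "(\<Sum>u\<in>UNIV. LBINT w. g u w * \<Phi> u (y + s - w)) - gconv g k y = (\<Sum>u\<in>UNIV. (LBINT w. g u w * (\<Phi> u (y + s - w) - \<nu> u * gd s2 0 k (w - y))))"
      unfolding gconv_def sum_subtractf[symmetric]
    proof (rule sum.cong[OF refl])
      fix u
      have "(LBINT w. g u w * (\<Phi> u (y + s - w) - \<nu> u * gd s2 0 k (w - y))) = (LBINT w. g u w * \<Phi> u (y + s - w) - \<nu> u * (g u w * gd s2 0 k (w - y)))"
        by (simp add: algebra_simps)
      also have "\<dots> = (LBINT w. g u w * \<Phi> u (y + s - w)) - (LBINT w. \<nu> u * (g u w * gd s2 0 k (w - y)))"
        by (rule Bochner_Integration.integral_diff) (use i1 i2 in auto)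
      finally show "(LBINT w. g u w * \<Phi> u (y + s - w)) - \<nu> u * (LBINT w. g u w * gd s2 0 k (w - y)) = (LBINT w. g u w * (\<Phi> u (y + s - w) - \<nu> u * gd s2 0 k (w - y)))" by simp
    qed
    have "\<bar>\<Sum>u\<in>UNIV. (LBINT w. g u w * (\<Phi> u (y + s - w) - \<nu> u * gd s2 0 k (w - y)))\<bar> \<le> (\<Sum>u\<in>UNIV. LBINT w. (e1 k / sqrt k + C2 * \<delta> / sqrt k / sqrt k) * g u w)"
    proof (rule order_trans[OF sum_abs], rule sum_mono, rule integral_abs_bound_integral)
      fix u
      have "integrable lborel (\<lambda>w. g u w * \<Phi> u (y + s - w) - \<nu> u * (g u w * gd s2 0 k (w - y)))" using i1 i2 by auto
      then show "integrable lborel (\<lambda>w. g u w * (\<Phi> u (y + s - w) - \<nu> u * gd s2 0 k (w - y)))" by (simp add: algebra_simps)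
      show "integrable lborel (\<lambda>w. (e1 k / sqrt k + C2 * \<delta> / sqrt k / sqrt k) * g u w)" using niceD(2)[OF g] by simp
      fix w
      show "\<bar>g u w * (\<Phi> u (y + s - w) - \<nu> u * gd s2 0 k (w - y))\<bar> \<le> (e1 k / sqrt k + C2 * \<delta> / sqrt k / sqrt k) * g u w"
        unfolding abs_mult abs_of_nonneg[OF niceD(3)[OF g]] mult.commute[of _ "g u w"]
        by (rule mult_left_mono[OF pt niceD(3)[OF g]])
    qed
    also have "\<dots> = (e1 k / sqrt k + C2 * \<delta> / sqrt k / sqrt k) * (\<Sum>u\<in>UNIV. LBINT w. g u w)" by (simp only: Bochner_Integration.integral_mult_right_zero sum_distrib_left)
    also have "\<dots> \<le> (e1 k / sqrt k + C2 * \<delta> / sqrt k / sqrt k) * (C3 * mass g)" by (rule mult_left_mono[OF C3(2)[OF g] ek])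
    also have "\<dots> = e k / sqrt k * mass g" unfolding e_def add_divide_distrib[symmetric] by simp
    finally show ?thesis unfolding eq eqd .
  qed
  then show ?thesis using e0 by blast
qed

lemma gconv_bound: "\<exists>C>0. \<forall>g s y. nice g --> s > 0 --> 0 \<le> gconv g s y \<and> gconv g s y \<le> C / sqrt s * mass g"
proof -
  obtain C2 where C2: "C2 > 0" "\<And>j s y. j \<le> 6 ==> s > 0 ==> \<bar>gd s2 j s y\<bar> \<le> C2 / (sqrt s) ^ Suc j"
    using gd_bound_uniform[OF s2_pos] by blast
  have "0 \<le> gconv g s y \<and> gconv g s y \<le> C2 / sqrt s * mass g" if g: "nice g" and s: "s > 0" for g s y
  proof
    have gdb: "\<bar>gd s2 0 s w\<bar> \<le> C2 / sqrt s" for w using C2(2)[of 0 s w] s by simp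
    have gd0: "0 \<le> gd s2 0 s w" for w using s2_pos s by (simp add: gd_0)
    show "0 \<le> gconv g s y" unfolding gconv_def
      by (intro sum_nonneg mult_nonneg_nonneg nu_nonneg integral_nonneg_AE) (use niceD(3)[OF g] gd0 in auto)
    have mm: "(\<lambda>w. gd s2 0 s (w - y)) \<in> borel_measurable borel" by measurable
    have "gconv g s y \<le> (\<Sum>x\<in>UNIV. \<nu> x * (LBINT w. C2 / sqrt s * g x w))" unfolding gconv_def
    proof (intro sum_mono mult_left_mono nu_nonneg integral_mono)
      fix x w
      show "integrable lborel (\<lambda>w. g x w * gd s2 0 s (w - y))"
        by (rule integrable_bounded_mult[OF niceD(2)[OF g] mm gdb])
      show "integrable lborel (\<lambda>w. C2 / sqrt s * g x w)" using niceD(2)[OF g] by simp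
      show "g x w * gd s2 0 s (w - y) \<le> C2 / sqrt s * g x w" unfolding mult.commute[of _ "g x w"]
        by (rule mult_left_mono[OF _ niceD(3)[OF g]]) (use gdb[of "w - y"] in linarith)
    qed
    also have "\<dots> = C2 / sqrt s * mass g" unfolding mass_def by (simp add: sum_distrib_left algebra_simps)
    finally show "gconv g s y \<le> C2 / sqrt s * mass g" .
  qed
  then show ?thesis using C2(1) by blast
qed

text \<open>Centring the kernel at \<delta>/2 turns its central part [-\<delta>/2, \<delta>/2] into
  shifts in [0, \<delta>], for which g dominates h; the rest of the kernel is nonnegative and can be
  discarded.\<close>

lemma shift_dominated_upper:
  assumes g: "nice g" and h: "\<And>x y v. 0 \<le> v ==> v \<le> \<delta> ==> h x y \<le> g x (y + v)" and \<delta>: "\<delta> > 0" and l: "l > 0"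
  shows "(LBINT v. indicator {-(\<delta>/2)..\<delta>/2} v * fejer l v) * (fop P f ^^ k) h x y \<le> (LBINT v. (fop P f ^^ k) g x (y + \<delta>/2 + v) * fejer l v)"
proof -
  define \<kappa> where "\<kappa> = (LBINT v. indicator {-(\<delta>/2)..\<delta>/2} v * fejer l v)"
  have fK: "integrable lborel (fejer l)" "fejer l \<in> borel_measurable borel" "\<And>v. \<bar>fejer l v\<bar> \<le> l"
    using fejer_integral[OF l] fejer_nonneg[OF l] fejer_le[OF l] by auto
  obtain b where b: "\<And>x y. g x y \<le> b" using niceD(4)[OF g] by blast
  have gb: "\<bar>g x y\<bar> \<le> b" for x y using b[of x y] niceD(3)[OF g, of x y] by simp
  have pt: "\<kappa> * h x y \<le> (LBINT v. g x (y + \<delta>/2 + v) * fejer l v)" for x y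
  proof -
    have ind: "integrable lborel (\<lambda>v. indicator {-(\<delta>/2)..\<delta>/2} v * fejer l v)"
      using integrable_mult_indicator[OF _ fK(1), of "{-(\<delta>/2)..\<delta>/2}"] by simp
    have "\<kappa> * h x y = (LBINT v. h x y * (indicator {-(\<delta>/2)..\<delta>/2} v * fejer l v))" unfolding \<kappa>_def by simp
    also have "\<dots> \<le> (LBINT v. g x (y + \<delta>/2 + v) * fejer l v)"
    proof (rule integral_mono)
      show "integrable lborel (\<lambda>v. h x y * (indicator {-(\<delta>/2)..\<delta>/2} v * fejer l v))" using ind by simp
      have "integrable lborel (\<lambda>v. fejer l v * g x (y + \<delta>/2 + v))"
        by (rule integrable_bounded_mult[OF fK(1) _ gb]) (use fop_measurable[of g, where f=f and k=0 and x=x and y="y + \<delta>/2"] niceD(1)[OF g] in simp)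
      then show "integrable lborel (\<lambda>v. g x (y + \<delta>/2 + v) * fejer l v)" by (simp add: mult.commute)
      fix v
      show "h x y * (indicator {-(\<delta>/2)..\<delta>/2} v * fejer l v) \<le> g x (y + \<delta>/2 + v) * fejer l v"
      proof (cases "v \<in> {-(\<delta>/2)..\<delta>/2}")
        case True
        have "h x y \<le> g x (y + (\<delta>/2 + v))" by (rule h) (use True in auto)
        then show ?thesis using True fejer_nonneg[OF l, of v] by (simp add: mult_right_mono add.assoc)
      next
        case False
        then show ?thesis using niceD(3)[OF g] fejer_nonneg[OF l, of v] by simp
      qed
    qed
    finally show ?thesis .
  qed
  have "\<kappa> * (fop P f ^^ k) h x y = (fop P f ^^ k) (\<lambda>x y. \<kappa> * h x y) x y" by (rule fop_iter_mult[symmetric])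
  also have "\<dots> \<le> (fop P f ^^ k) (\<lambda>x y. LBINT v. g x (y + \<delta>/2 + v) * fejer l v) x y"
    by (rule fop_iter_mono) (rule pt)
  also have "\<dots> = (LBINT v. (fop P f ^^ k) g x (y + \<delta>/2 + v) * fejer l v)" by (rule fop_smoothing[OF g fK])
  finally show ?thesis unfolding \<kappa>_def .
qed

text \<open>Half of the kernel's mass suffices for a bound valid for every k \<ge> 1, since a
  convergent error sequence is bounded.\<close>

theorem fop_crude_bound:
  assumes \<delta>: "\<delta> > 0"
  shows "\<exists>C>0. \<forall>k\<ge>1. \<forall>g h x y. nice g --> (\<forall>x y v. 0 \<le> v --> v \<le> \<delta> --> h x y \<le> g x (y + v)) -->
     (fop P f ^^ k) h x y \<le> C / sqrt k * mass g"
proof -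
  obtain l where l: "l > 0" "(LBINT x. indicator {-(\<delta>/2)..\<delta>/2} x * fejer l x) \<ge> 1 - 1/2"
    using fejer_concentrates[of "\<delta>/2" "1/2"] \<delta> by auto
  define \<kappa> where "\<kappa> = (LBINT x. indicator {-(\<delta>/2)..\<delta>/2} x * fejer l x)"
  have \<kappa>: "\<kappa> \<ge> 1/2" using l(2) unfolding \<kappa>_def by simp
  obtain e where e0: "e \<longlonglongrightarrow> 0" "\<forall>k\<ge>1. \<forall>g x y s. nice g --> \<bar>s\<bar> \<le> \<delta> -->
     \<bar>(LBINT v. (fop P f ^^ k) g x (y + s + v) * fejer l v) - gconv g k y\<bar> \<le> e k / sqrt k * mass g"
    using smoothed_local_limit[OF l(1) \<delta>] by (elim exE conjE)
  note e = e0(1) e0(2)[rule_format]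
  obtain C1 where C1: "C1 > 0" "\<And>g s y. nice g ==> s > 0 ==> 0 \<le> gconv g s y \<and> gconv g s y \<le> C1 / sqrt s * mass g"
    using gconv_bound by blast
  have "Bseq e" using e(1) convergentI convergent_imp_Bseq by blast
  then obtain E where E: "E > 0" "\<And>k. \<bar>e k\<bar> \<le> E" unfolding Bseq_def real_norm_def by blast
  have "(fop P f ^^ k) h x y \<le> 2 * (C1 + E) / sqrt k * mass g"
    if k: "k \<ge> 1" and g: "nice g" and h: "\<forall>x y v. 0 \<le> v --> v \<le> \<delta> --> h x y \<le> g x (y + v)" for k g h x y
  proof -
    have sk: "sqrt k > 0" using k by simp
    have m0: "0 \<le> mass g" by (rule mass_nonneg[OF g])
    have "\<kappa> * (fop P f ^^ k) h x y \<le> (LBINT v. (fop P f ^^ k) g x (y + \<delta>/2 + v) * fejer l v)"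
      unfolding \<kappa>_def by (rule shift_dominated_upper[OF g _ \<delta> l(1)]) (use h in auto)
    also have "\<dots> \<le> gconv g k y + e k / sqrt k * mass g" using e(2)[OF k g, of "\<delta>/2" x y] \<delta> by linarith
    also have "\<dots> \<le> C1 / sqrt k * mass g + E / sqrt k * mass g"
    proof (rule add_mono)
      show "gconv g k y \<le> C1 / sqrt k * mass g" using C1(2)[OF g, of "real k" y] k by simp
      show "e k / sqrt k * mass g \<le> E / sqrt k * mass g"
        using E(2)[of k] sk m0 by (intro mult_right_mono divide_right_mono) auto
    qed
    also have "\<dots> = (C1 + E) / sqrt k * mass g" by (simp add: add_divide_distrib distrib_right)
    finally have u: "\<kappa> * (fop P f ^^ k) h x y \<le> (C1 + E) / sqrt k * mass g" .
    show ?thesis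
    proof (cases "(fop P f ^^ k) h x y \<le> 0")
      case True
      also have "0 \<le> 2 * (C1 + E) / sqrt k * mass g" using C1(1) E(1) sk m0 by simp
      finally show ?thesis .
    next
      case False
      then have "1/2 * (fop P f ^^ k) h x y \<le> \<kappa> * (fop P f ^^ k) h x y" using \<kappa> by (intro mult_right_mono) auto
      moreover have "2 * (C1 + E) / sqrt k * mass g = 2 * ((C1 + E) / sqrt k * mass g)" by simp
      ultimately show ?thesis using u by linarith
    qed
  qed
  then show ?thesis using C1(1) E(1) by (intro exI[of _ "2 * (C1 + E)"]) auto
qed

text \<open>As for the crude bound, but with all but \<zeta>/2 of the kernel's mass near 0 and k so
  large that the local limit error is below \<zeta>/2.\<close>

theorem fop_upper:
  assumes \<delta>: "\<delta> > 0" and \<zeta>: "0 < \<zeta>" "\<zeta> \<le> 1"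
  shows "\<exists>K0. \<forall>k\<ge>K0. \<forall>g h x y. nice g --> (\<forall>x y v. 0 \<le> v --> v \<le> \<delta> --> h x y \<le> g x (y + v)) -->
     (fop P f ^^ k) h x y \<le> (1 + \<zeta>) * gconv g k y + \<zeta> / sqrt k * mass g"
proof -
  obtain l where l: "l > 0" "(LBINT x. indicator {-(\<delta>/2)..\<delta>/2} x * fejer l x) \<ge> 1 - \<zeta>/2"
    using fejer_concentrates[of "\<delta>/2" "\<zeta>/2"] \<delta> \<zeta> by auto
  define \<kappa> where "\<kappa> = (LBINT x. indicator {-(\<delta>/2)..\<delta>/2} x * fejer l x)"
  have \<kappa>: "\<kappa> \<ge> 1 - \<zeta>/2" using l(2) unfolding \<kappa>_def by simp
  obtain e where e0: "e \<longlonglongrightarrow> 0" "\<forall>k\<ge>1. \<forall>g x y s. nice g --> \<bar>s\<bar> \<le> \<delta> -->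
     \<bar>(LBINT v. (fop P f ^^ k) g x (y + s + v) * fejer l v) - gconv g k y\<bar> \<le> e k / sqrt k * mass g"
    using smoothed_local_limit[OF l(1) \<delta>] by (elim exE conjE)
  note e = e0(1) e0(2)[rule_format]
  obtain C1 where C1: "C1 > 0" "\<And>g s y. nice g ==> s > 0 ==> 0 \<le> gconv g s y \<and> gconv g s y \<le> C1 / sqrt s * mass g"
    using gconv_bound by blast
  have "\<forall>\<^sub>F k in sequentially. e k < \<zeta>/2" using e(1) \<zeta> by (intro order_tendstoD) auto
  then obtain K1 where K1: "\<And>k. k \<ge> K1 ==> e k < \<zeta>/2" by (auto simp: eventually_sequentially)
  have "(fop P f ^^ k) h x y \<le> (1 + \<zeta>) * gconv g k y + \<zeta> / sqrt k * mass g"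
    if k0: "k \<ge> max K1 1" and g: "nice g" and h: "\<forall>x y v. 0 \<le> v --> v \<le> \<delta> --> h x y \<le> g x (y + v)" for k g h x y
  proof -
    have k: "k \<ge> 1" "k \<ge> K1" using k0 by auto
    have sk: "sqrt k > 0" using k by simp
    have m0: "0 \<le> mass g" by (rule mass_nonneg[OF g])
    have gc0: "0 \<le> gconv g k y" using C1(2)[OF g, of "real k" y] k by simp
    have "\<kappa> * (fop P f ^^ k) h x y \<le> (LBINT v. (fop P f ^^ k) g x (y + \<delta>/2 + v) * fejer l v)"
      unfolding \<kappa>_def by (rule shift_dominated_upper[OF g _ \<delta> l(1)]) (use h in auto)
    also have "\<dots> \<le> gconv g k y + e k / sqrt k * mass g" using e(2)[OF k(1) g, of "\<delta>/2" x y] \<delta> by linarith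
    also have "e k / sqrt k * mass g \<le> (\<zeta>/2) / sqrt k * mass g"
      using K1[OF k(2)] sk m0 by (intro mult_right_mono divide_right_mono) auto
    finally have u: "\<kappa> * (fop P f ^^ k) h x y \<le> gconv g k y + (\<zeta>/2) / sqrt k * mass g" by simp
    show ?thesis
    proof (cases "(fop P f ^^ k) h x y \<le> 0")
      case True
      also have "0 \<le> (1 + \<zeta>) * gconv g k y + \<zeta> / sqrt k * mass g" using \<zeta> gc0 sk m0 by simp
      finally show ?thesis .
    next
      case False
      define A where "A = (fop P f ^^ k) h x y"
      define B where "B = gconv g k y + (\<zeta>/2) / sqrt k * mass g"
      have B0: "B \<ge> 0" unfolding B_def using gc0 \<zeta> sk m0 by simp
      have "(1 - \<zeta>/2) * A \<le> \<kappa> * A" using \<kappa> False unfolding A_def by (intro mult_right_mono) auto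
      then have "(1 - \<zeta>/2) * A \<le> B" using u unfolding A_def B_def by linarith
      then have "(1 + \<zeta>) * ((1 - \<zeta>/2) * A) \<le> (1 + \<zeta>) * B" using \<zeta> by (intro mult_left_mono) auto
      \<comment> \<open>The lost mass is recovered by the factor 1 + \<zeta>, because (1 +
        \<zeta>)(1 - \<zeta>/2) \<ge> 1 for 0 < \<zeta> \<le> 1.\<close>
      moreover have "1 * A \<le> ((1 + \<zeta>) * (1 - \<zeta>/2)) * A"
      proof (rule mult_right_mono)
        have "0 \<le> \<zeta> * (1 - \<zeta>) / 2" using \<zeta> by simp
        then show "1 \<le> (1 + \<zeta>) * (1 - \<zeta>/2)" by (simp add: field_simps)
      qed (use False in \<open>auto simp: A_def\<close>)
      ultimately have "A \<le> (1 + \<zeta>) * B" by (simp add: mult.assoc)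
      also have "\<dots> = (1 + \<zeta>) * gconv g k y + ((1 + \<zeta>) / 2) * (\<zeta> / sqrt k * mass g)" unfolding B_def by (simp add: field_simps)
      also have "\<dots> \<le> (1 + \<zeta>) * gconv g k y + 1 * (\<zeta> / sqrt k * mass g)"
        using \<zeta> sk m0 by (intro add_left_mono mult_right_mono) auto
      finally show ?thesis unfolding A_def by simp
    qed
  qed
  then show ?thesis by blast
qed

text \<open>For a lower bound the tails of the kernel cannot be discarded; what they contribute is
  at most their small mass times the crude bound, hence small compared with \<open>mass g\<close> /
  sqrt k.\<close>

theorem fop_lower:
  assumes \<delta>: "\<delta> > 0" and \<zeta>: "0 < \<zeta>"
  shows "\<exists>K0. \<forall>k\<ge>K0. \<forall>g h x y. nice g --> nice h --> (\<forall>x y v. 0 \<le> v --> v \<le> \<delta> --> h x y \<le> g x (y + v)) -->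
     (fop P f ^^ k) g x y \<ge> gconv h k y - \<zeta> / sqrt k * mass g"
proof -
  obtain C where C0: "C > 0" "\<forall>k\<ge>1. \<forall>g h x y. nice g --> (\<forall>x y v. 0 \<le> v --> v \<le> \<delta> --> h x y \<le> g x (y + v)) -->
     (fop P f ^^ k) h x y \<le> C / sqrt k * mass g" using fop_crude_bound[OF \<delta>] by (elim exE conjE)
  note C = C0(1) C0(2)[rule_format]
  \<comment> \<open>The tail mass is multiplied by the crude constant C, so this choice leaves half
    of the allowed error for the tails and half for the local limit theorem.\<close>
  define \<zeta>' where "\<zeta>' = \<zeta> / (2 * C)"
  have \<zeta>': "\<zeta>' > 0" unfolding \<zeta>'_def using \<zeta> C(1) by simp
  obtain l where l: "l > 0" "(LBINT x. indicator {-(\<delta>/2)..\<delta>/2} x * fejer l x) \<ge> 1 - \<zeta>'"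
    using fejer_concentrates[of "\<delta>/2" \<zeta>'] \<delta> \<zeta>' by auto
  define J where "J = {-(\<delta>/2)..\<delta>/2}"
  define \<kappa> where "\<kappa> = (LBINT x. indicator J x * fejer l x)"
  have \<kappa>: "\<kappa> \<ge> 1 - \<zeta>'" using l(2) unfolding \<kappa>_def J_def by simp
  obtain e where e0: "e \<longlonglongrightarrow> 0" "\<forall>k\<ge>1. \<forall>g x y s. nice g --> \<bar>s\<bar> \<le> \<delta> -->
     \<bar>(LBINT v. (fop P f ^^ k) g x (y + s + v) * fejer l v) - gconv g k y\<bar> \<le> e k / sqrt k * mass g"
    using smoothed_local_limit[OF l(1) \<delta>] by (elim exE conjE)
  note e = e0(1) e0(2)[rule_format]
  have "\<forall>\<^sub>F k in sequentially. e k < \<zeta>/2" using e(1) \<zeta> by (intro order_tendstoD) auto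
  then obtain K1 where K1: "\<And>k. k \<ge> K1 ==> e k < \<zeta>/2" by (auto simp: eventually_sequentially)
  have fK: "integrable lborel (fejer l)" "fejer l \<in> borel_measurable borel" "\<And>v. \<bar>fejer l v\<bar> \<le> l"
    using fejer_integral[OF l(1)] fejer_nonneg[OF l(1)] fejer_le[OF l(1)] by auto
  have JK: "integrable lborel (\<lambda>v. indicator J v * fejer l v)"
    using integrable_mult_indicator[OF _ fK(1), of J] unfolding J_def by simp
  have "(fop P f ^^ k) g x y \<ge> gconv h k y - \<zeta> / sqrt k * mass g"
    if k0: "k \<ge> max K1 1" and g: "nice g" and hn: "nice h" and h: "\<forall>x y v. 0 \<le> v --> v \<le> \<delta> --> h x y \<le> g x (y + v)" for k g h x y
  proof -
    have k: "k \<ge> 1" "k \<ge> K1" using k0 by auto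
    have sk: "sqrt k > 0" using k by simp
    have mg: "0 \<le> mass g" by (rule mass_nonneg[OF g])
    have hg: "h x y \<le> g x y" for x y using h[rule_format, where v=0 and x=x and y=y] \<delta> by simp
    have mh: "mass h \<le> mass g" unfolding mass_def
      by (intro sum_mono mult_left_mono nu_nonneg integral_mono niceD(2)[OF g] niceD(2)[OF hn] hg)
    obtain b where b: "\<And>x y. h x y \<le> b" using niceD(4)[OF hn] by blast
    have hb: "\<bar>h x y\<bar> \<le> b" for x y using b[of x y] niceD(3)[OF hn, of x y] by simp
    \<comment> \<open>The kernel cut off outside [-\<delta>/2, \<delta>/2]; averaging h with it,
      centred at -\<delta>/2, stays below g.\<close>
    define KJ where "KJ v = indicator J v * fejer l v" for v
    have KJm: "KJ \<in> borel_measurable borel" unfolding KJ_def[abs_def] J_def by measurable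
    have KJb: "\<bar>KJ v\<bar> \<le> l" for v unfolding KJ_def using fK(3)[of v] l(1) by (auto simp: indicator_def)
    have KJi: "integrable lborel KJ" using JK unfolding KJ_def[abs_def] .
    have KJ0: "0 \<le> KJ v" for v unfolding KJ_def using fejer_nonneg[OF l(1)] by simp
    have KJ1: "(LBINT v. KJ v) \<le> 1"
    proof -
      have "(LBINT v. KJ v) \<le> (LBINT v. fejer l v)"
        by (intro integral_mono KJi fK(1)) (use fejer_nonneg[OF l(1)] in \<open>auto simp: KJ_def indicator_def\<close>)
      then show ?thesis using fejer_integral(2)[OF l(1)] by simp
    qed
    have hm: "(\<lambda>v. h x (y + v)) \<in> borel_measurable borel" for x y
      using fop_measurable[of h, where f=f and k=0 and x=x and y=y] niceD(1)[OF hn] by simp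
    have pt: "(LBINT v. h x (y + - (\<delta>/2) + v) * KJ v) \<le> g x y" for x y
    proof -
      have "(LBINT v. h x (y + - (\<delta>/2) + v) * KJ v) \<le> (LBINT v. g x y * KJ v)"
      proof (rule integral_mono)
        have "integrable lborel (\<lambda>v. KJ v * h x (y + - (\<delta>/2) + v))" by (rule integrable_bounded_mult[OF KJi hm hb])
        then show "integrable lborel (\<lambda>v. h x (y + - (\<delta>/2) + v) * KJ v)" by (simp add: mult.commute)
        show "integrable lborel (\<lambda>v. g x y * KJ v)" using KJi by simp
        fix v
        show "h x (y + - (\<delta>/2) + v) * KJ v \<le> g x y * KJ v"
        proof (cases "v \<in> J")
          case True
          have "h x (y + - (\<delta>/2) + v) \<le> g x ((y + - (\<delta>/2) + v) + (\<delta>/2 - v))"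
            by (rule h[rule_format]) (use True in \<open>auto simp: J_def\<close>)
          then have "h x (y + - (\<delta>/2) + v) \<le> g x y" by simp
          then show ?thesis using KJ0[of v] by (intro mult_right_mono) auto
        next
          case False then show ?thesis by (simp add: KJ_def)
        qed
      qed
      also have "\<dots> = g x y * (LBINT v. KJ v)" by simp
      also have "\<dots> \<le> g x y * 1" using KJ1 niceD(3)[OF g] by (intro mult_left_mono) auto
      finally show ?thesis by simp
    qed
    have "(LBINT v. (fop P f ^^ k) h x (y + - (\<delta>/2) + v) * KJ v) = (fop P f ^^ k) (\<lambda>x y. LBINT v. h x (y + - (\<delta>/2) + v) * KJ v) x y"
      by (rule fop_smoothing[OF hn KJi KJm KJb, symmetric])
    also have "\<dots> \<le> (fop P f ^^ k) g x y" by (rule fop_iter_mono) (rule pt)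
    finally have A: "(LBINT v. (fop P f ^^ k) h x (y + - (\<delta>/2) + v) * KJ v) \<le> (fop P f ^^ k) g x y" .
    define H where "H v = (fop P f ^^ k) h x (y + - (\<delta>/2) + v)" for v
    have H: "0 \<le> H v" "H v \<le> C / sqrt k * mass g" for v
      unfolding H_def using fop_iter_nonneg[of h] niceD(3)[OF hn] C(2)[OF k(1) g h[rule_format]] by auto
    have Hm: "H \<in> borel_measurable borel" unfolding H_def[abs_def] by (rule fop_measurable) (use niceD(1)[OF hn] in auto)
    have Hb: "\<bar>H v\<bar> \<le> C / sqrt k * mass g" for v using H[of v] by simp
    have i1: "integrable lborel (\<lambda>v. H v * fejer l v)" and i2: "integrable lborel (\<lambda>v. H v * KJ v)"
      using integrable_bounded_mult[OF fK(1) Hm Hb] integrable_bounded_mult[OF KJi Hm Hb] by (simp_all add: mult.commute)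
    have "(LBINT v. H v * fejer l v) - (LBINT v. H v * KJ v) = (LBINT v. H v * fejer l v - H v * KJ v)"
      by (rule Bochner_Integration.integral_diff[OF i1 i2, symmetric])
    also have "\<dots> \<le> (LBINT v. (C / sqrt k * mass g) * (fejer l v - KJ v))"
    proof (rule integral_mono)
      show "integrable lborel (\<lambda>v. H v * fejer l v - H v * KJ v)" using i1 i2 by simp
      show "integrable lborel (\<lambda>v. (C / sqrt k * mass g) * (fejer l v - KJ v))" using fK(1) KJi by simp
      fix v
      have "0 \<le> fejer l v - KJ v" unfolding KJ_def using fejer_nonneg[OF l(1)] by (auto simp: indicator_def)
      then show "H v * fejer l v - H v * KJ v \<le> (C / sqrt k * mass g) * (fejer l v - KJ v)"
        unfolding right_diff_distrib[symmetric] using H(2)[of v] by (intro mult_right_mono)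
    qed
    also have "\<dots> = (C / sqrt k * mass g) * (1 - \<kappa>)"
    proof -
      have "(LBINT v. fejer l v - KJ v) = 1 - \<kappa>"
        using Bochner_Integration.integral_diff[OF fK(1) KJi] fejer_integral(2)[OF l(1)] unfolding \<kappa>_def KJ_def by simp
      then show ?thesis by simp
    qed
    also have "\<dots> \<le> (C / sqrt k * mass g) * \<zeta>'" using \<kappa> C(1) sk mg by (intro mult_left_mono) auto
    also have "\<dots> = (\<zeta>/2) / sqrt k * mass g" unfolding \<zeta>'_def using C(1) by (simp add: field_simps)
    finally have D: "(LBINT v. H v * fejer l v) - (\<zeta>/2) / sqrt k * mass g \<le> (LBINT v. H v * KJ v)" by simp
    have "gconv h k y - e k / sqrt k * mass h \<le> (LBINT v. H v * fejer l v)"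
      using e(2)[OF k(1) hn, of "- (\<delta>/2)" x y] \<delta> unfolding H_def by linarith
    moreover have "e k / sqrt k * mass h \<le> (\<zeta>/2) / sqrt k * mass g"
    proof -
      have "e k / sqrt k * mass h \<le> (\<zeta>/2) / sqrt k * mass h"
        using K1[OF k(2)] sk mass_nonneg[OF hn] by (intro mult_right_mono divide_right_mono) auto
      also have "\<dots> \<le> (\<zeta>/2) / sqrt k * mass g" using mh \<zeta> sk by (intro mult_left_mono) auto
      finally show ?thesis .
    qed
    moreover have "(\<zeta>/2) / sqrt k * mass g + (\<zeta>/2) / sqrt k * mass g = \<zeta> / sqrt k * mass g" by (simp add: field_simps)
    ultimately show ?thesis using A D unfolding H_def by linarith
  qed
  then show ?thesis by blast
qed

end

section \<open>Duality and the uniform bound\<close>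

text \<open>Raising the whole path by v \<ge> 0 can only keep it alive longer.\<close>

lemma (in primitive) kop_iter_shift:
  assumes "\<And>x y. y > 0 ==> g x y \<le> h x (y + v)" "\<And>x y. y > 0 ==> 0 \<le> h x y" "v \<ge> 0"
  shows "n > 0 \<or> y > 0 ==> (kop P f ^^ n) g x y \<le> (kop P f ^^ n) h x (y + v)"
proof (induction n arbitrary: x y)
  case (Suc n)
  have "(if y + f x' > 0 then (kop P f ^^ n) g x' (y + f x') else 0) \<le> (if y + v + f x' > 0 then (kop P f ^^ n) h x' (y + v + f x') else 0)" for x'
  proof (cases "y + f x' > 0")
    case True
    then show ?thesis using Suc.IH[of "y + f x'" x'] assms(3) by (simp add: algebra_simps)
  next
    case False
    then show ?thesis using kop_iter_nonneg[of h n "y + v + f x'" f x'] assms(2) by auto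
  qed
  then show ?case
    by (simp add: kop_def[of P f "(kop P f ^^ n) _"]) (intro sum_mono mult_left_mono P_nonneg, auto)
qed (use assms in auto)

text \<open>The test functions paired with \<open>nice\<close> targets: a class stable under the
  adjoint operator.\<close>

definition bmeas :: "('a => real => real) => bool" where
  "bmeas \<eta> \<longleftrightarrow> (\<forall>x. \<eta> x \<in> borel_measurable borel) \<and> (\<exists>b. \<forall>x y. \<bar>\<eta> x y\<bar> \<le> b)"

lemma (in primitive) nice_kop:
  assumes g: "nice g"
  shows "nice (kop P f g)"
proof -
  obtain b where b: "\<And>x y. g x y \<le> b" using niceD(4)[OF g] by blast
  have b0: "0 \<le> b" using b niceD(3)[OF g] order_trans by blast
  define G where "G x' y = (if y > 0 then g x' y else 0)" for x' y
  have Gm: "G x' \<in> borel_measurable borel" for x'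
    unfolding G_def[abs_def] using niceD(1)[OF g, of x'] by measurable
  have Gi: "integrable lborel (G x')" for x'
    by (rule Bochner_Integration.integrable_bound[OF niceD(2)[OF g, of x']]) (use Gm niceD(3)[OF g] in \<open>auto simp: G_def\<close>)
  have e: "kop P f g x = (\<lambda>y. \<Sum>x'\<in>UNIV. P x x' * G x' (f x' + y))" for x
    by (auto simp: kop_def G_def fun_eq_iff add.commute)
  have m: "(\<lambda>y. G x' (f x' + y)) \<in> borel_measurable borel" for x'
  proof -
    have "(\<lambda>y. f x' + y) \<in> borel \<rightarrow>\<^sub>M borel" by measurable
    from measurable_compose[OF this Gm[of x']] show ?thesis .
  qed
  have "kop P f g x y \<le> b" for x y
  proof -
    have "kop P f g x y \<le> (\<Sum>x'\<in>UNIV. P x x' * b)" unfolding kop_def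
      using b b0 by (intro sum_mono mult_left_mono P_nonneg) auto
    then show ?thesis by (simp add: sum_distrib_right[symmetric] P_sum)
  qed
  moreover have "0 \<le> kop P f g x y" for x y unfolding kop_def
    using niceD(3)[OF g] by (intro sum_nonneg mult_nonneg_nonneg P_nonneg) auto
  moreover have "kop P f g x \<in> borel_measurable borel" for x unfolding e
    by (intro borel_measurable_sum borel_measurable_times m) auto
  moreover have "integrable lborel (kop P f g x)" for x unfolding e
    by (intro Bochner_Integration.integrable_sum integrable_mult_right integrable_translate Gi)
  ultimately show ?thesis unfolding nice_def by blast
qed

lemma (in primitive) nice_kop_iter: "nice g ==> nice ((kop P f ^^ n) g)"
  by (induction n) (auto intro: nice_kop)

definition win :: "('a => real) => real => real => 'a => real => real" where
  "win \<psi> z a x y = (if y \<in> {z..z+a} then \<psi> x else 0)"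

lemma nice_win:
  fixes \<psi> :: "'a::finite => real"
  assumes "\<And>x. 0 \<le> \<psi> x"
  shows "nice (win \<psi> z a)"
proof -
  have e: "win \<psi> z a x = (\<lambda>y. \<psi> x * indicator {z..z+a} y)" for x by (auto simp: win_def fun_eq_iff indicator_def)
  have "win \<psi> z a x y \<le> l1norm \<psi>" for x y
    using l1norm_bound[of \<psi> x] l1norm_nonneg[of \<psi>] by (auto simp: win_def)
  moreover have "integrable lborel (win \<psi> z a x)" for x unfolding e
    by (intro integrable_mult_right integrable_real_indicator) (auto simp: emeasure_lborel_Icc_eq)
  ultimately show ?thesis unfolding nice_def using assms by (auto simp: e win_def)
qed

section \<open>Time reversal and the adjoint of the killed operator\<close>

context nonlattice_chain
begin

definition Ps :: "'a => 'a => real" where "Ps x x' = \<nu> x' / \<nu> x * P x' x"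

lemma nu_Ps: "\<nu> x * Ps x x' = \<nu> x' * P x' x"
  unfolding Ps_def using nu_pos[of x] by simp

text \<open>\<open>Ps\<close> is the adjoint of P in L2(\<open>\<nu>\<close>), by detailed exchange
  of the weights \<open>\<nu>\<close>(x) P(x, x').\<close>

lemma Pop_adjoint: "(\<Sum>x\<in>UNIV. \<nu> x * (h x * (Pop P ^^ n) g x)) = (\<Sum>x\<in>UNIV. \<nu> x * ((Pop Ps ^^ n) h x * g x))"
proof (induction n arbitrary: h)
  case (Suc n)
  have one: "(\<Sum>x\<in>UNIV. \<nu> x * (h x * Pop P g x)) = (\<Sum>x\<in>UNIV. \<nu> x * (Pop Ps h x * g x))" for g h
  proof -
    have "(\<Sum>x\<in>UNIV. \<nu> x * (h x * Pop P g x)) = (\<Sum>x\<in>UNIV. \<Sum>x'\<in>UNIV. (\<nu> x * P x x') * (h x * g x'))"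
      unfolding Pop_def by (simp add: sum_distrib_left algebra_simps)
    also have "\<dots> = (\<Sum>x'\<in>UNIV. \<Sum>x\<in>UNIV. (\<nu> x * P x x') * (h x * g x'))" by (rule sum.swap)
    also have "\<dots> = (\<Sum>x\<in>UNIV. \<nu> x * (Pop Ps h x * g x))"
      unfolding Pop_def nu_Ps[symmetric] by (simp add: sum_distrib_left sum_distrib_right algebra_simps)
    finally show ?thesis .
  qed
  have "(\<Sum>x\<in>UNIV. \<nu> x * (h x * (Pop P ^^ Suc n) g x)) = (\<Sum>x\<in>UNIV. \<nu> x * (Pop Ps h x * (Pop P ^^ n) g x))"
    using one[of h "(Pop P ^^ n) g"] by simp
  also have "\<dots> = (\<Sum>x\<in>UNIV. \<nu> x * ((Pop Ps ^^ n) (Pop Ps h) x * g x))" by (rule Suc)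
  finally show ?case by (simp add: funpow_swap1)
qed simp

lemma Ps_nonneg: "0 \<le> Ps x x'"
  unfolding Ps_def using nu_nonneg P_nonneg by simp

lemma Ps_sum: "(\<Sum>x'\<in>UNIV. Ps x x') = 1"
proof -
  have "\<nu> x * (\<Sum>x'\<in>UNIV. Ps x x') = (\<Sum>x'\<in>UNIV. \<nu> x' * P x' x)" unfolding sum_distrib_left nu_Ps ..
  also have "\<dots> = \<nu> x * 1" using invariant by (simp add: invariant_prob_def)
  finally show ?thesis using nu_pos[of x] by simp
qed

lemma Ps_invariant: "(\<Sum>x\<in>UNIV. \<nu> x * Ps x x') = \<nu> x'"
  unfolding nu_Ps using P_sum by (simp add: sum_distrib_left[symmetric])

text \<open>Stationary covariances are unchanged under time reversal, and the sign of f cancels in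
  products.\<close>

lemma asym_var_dual: "asym_var Ps (\<lambda>u. - f u) \<nu> = asym_var P f \<nu>"
proof -
  have "(\<Sum>x\<in>UNIV. \<nu> x * - f x * (Pop Ps ^^ Suc n) (\<lambda>u. - f u) x) = (\<Sum>x\<in>UNIV. \<nu> x * f x * (Pop P ^^ Suc n) f x)" for n
  proof -
    have "(Pop Ps ^^ Suc n) (\<lambda>u. - f u) x = - (Pop Ps ^^ Suc n) f x" for x
      using Pop_iter_mult[of "Suc n" Ps "-1" f x] by (simp del: funpow.simps)
    then have "(\<Sum>x\<in>UNIV. \<nu> x * - f x * (Pop Ps ^^ Suc n) (\<lambda>u. - f u) x) = (\<Sum>x\<in>UNIV. \<nu> x * ((Pop Ps ^^ Suc n) f x * f x))"
      by (simp add: ac_simps del: funpow.simps)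
    also have "\<dots> = (\<Sum>x\<in>UNIV. \<nu> x * (f x * (Pop P ^^ Suc n) f x))" by (rule Pop_adjoint[symmetric])
    finally show ?thesis by (simp add: mult.assoc del: funpow.simps)
  qed
  then show ?thesis unfolding asym_var_def by (simp del: funpow.simps)
qed

text \<open>The adjoint identity between two indicators gives positivity of the powers of
  \<open>Ps\<close>; the variance is positive because it is the same.\<close>

sublocale dual: pos_chain Ps "\<lambda>u. - f u" \<nu>
proof
  show "0 \<le> Ps x x'" "(\<Sum>x'\<in>UNIV. Ps x x') = 1" for x x' by (rule Ps_nonneg Ps_sum)+
  obtain k0 where k0: "k0 \<ge> 1" "\<And>x x'. (Pop P ^^ k0) (\<lambda>u. if u = x' then 1 else 0) x > 0" using P_prim by blast
  have "(Pop Ps ^^ k0) (\<lambda>u. if u = x' then 1 else 0) x > 0" for x x'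
  proof -
    have "(\<Sum>w\<in>UNIV. \<nu> w * ((if w = x' then 1 else 0) * (Pop P ^^ k0) (\<lambda>u. if u = x then 1 else 0) w)) = (\<Sum>w\<in>UNIV. \<nu> w * ((Pop Ps ^^ k0) (\<lambda>u. if u = x' then 1 else 0) w * (if w = x then 1 else 0)))"
      by (rule Pop_adjoint)
    moreover have "(\<Sum>w\<in>UNIV. \<nu> w * ((if w = x' then 1 else 0) * (Pop P ^^ k0) (\<lambda>u. if u = x then 1 else 0) w)) = \<nu> x' * (Pop P ^^ k0) (\<lambda>u. if u = x then 1 else 0) x'"
      using sum_indicator_left[of x' "\<lambda>w. \<nu> w * (Pop P ^^ k0) (\<lambda>u. if u = x then 1 else 0) w"] by (simp add: ac_simps)
    moreover have "(\<Sum>w\<in>UNIV. \<nu> w * ((Pop Ps ^^ k0) (\<lambda>u. if u = x' then 1 else 0) w * (if w = x then 1 else 0))) = \<nu> x * (Pop Ps ^^ k0) (\<lambda>u. if u = x' then 1 else 0) x"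
      using sum_indicator_right[of "\<lambda>w. \<nu> w * (Pop Ps ^^ k0) (\<lambda>u. if u = x' then 1 else 0) w" x] by (simp add: ac_simps)
    ultimately have "\<nu> x * (Pop Ps ^^ k0) (\<lambda>u. if u = x' then 1 else 0) x = \<nu> x' * (Pop P ^^ k0) (\<lambda>u. if u = x then 1 else 0) x'" by simp
    moreover have "\<dots> > 0" using k0(2) nu_pos by simp
    ultimately show ?thesis using nu_pos[of x] by (metis zero_less_mult_pos)
  qed
  then show "\<exists>k0\<ge>1. \<forall>x x'. (Pop Ps ^^ k0) (\<lambda>u. if u = x' then 1 else 0) x > 0" using k0(1) by blast
  show ip: "invariant_prob Ps \<nu>" unfolding invariant_prob_def using nu_nonneg nu_sum Ps_invariant by blast
  show ce: "(\<Sum>x\<in>UNIV. \<nu> x * - f x) = 0" using centered by (simp add: sum_negf)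
  have P1: "primitive Ps"
    by unfold_locales (use Ps_nonneg Ps_sum \<open>\<exists>k0\<ge>1. \<forall>x x'. (Pop Ps ^^ k0) (\<lambda>u. if u = x' then 1 else 0) x > 0\<close> in auto)
  interpret c: centered_chain Ps "\<lambda>u. - f u" \<nu>
    by (intro centered_chain.intro centered_chain_axioms.intro P1 ip ce)
  show "0 < centered_chain.s2 Ps (\<lambda>u. - f u) \<nu>" unfolding c.s2_def asym_var_dual using s2_pos unfolding s2_def .
qed

lemma dual_s2: "dual.s2 = s2"
  unfolding dual.s2_def s2_def by (rule asym_var_dual)

abbreviation kopd where "kopd \<equiv> kop Ps (\<lambda>u. - f u)"
abbreviation fopd where "fopd \<equiv> fop Ps (\<lambda>u. - f u)"

text \<open>The adjoint of \<open>kop P f\<close> for \<open>\<nu>\<close> times Lebesgue measure.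
  Unlike the killed dual operator it tests the height before moving and moves by the state being
  left, which is how a reversed step looks.\<close>

definition kadj :: "('a => real => real) => 'a => real => real" where
  "kadj \<eta> x y = (if y > 0 then (\<Sum>x'\<in>UNIV. Ps x x' * \<eta> x' (y - f x)) else 0)"

lemma bmeas_kadj:
  assumes "bmeas \<eta>"
  shows "bmeas (kadj \<eta>)"
proof -
  obtain b where b: "\<And>x y. \<bar>\<eta> x y\<bar> \<le> b" using assms unfolding bmeas_def by blast
  have b0: "b \<ge> 0" using b order_trans[OF abs_ge_zero] by blast
  have m: "(\<lambda>y. \<eta> x' (y - c)) \<in> borel_measurable borel" for x' c
  proof -
    have "(\<lambda>y. y - c) \<in> borel \<rightarrow>\<^sub>M borel" by measurable
    from measurable_compose[OF this] assms show ?thesis unfolding bmeas_def by blast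
  qed
  have "kadj \<eta> x \<in> borel_measurable borel" for x
    unfolding kadj_def[abs_def] by (intro measurable_If borel_measurable_sum borel_measurable_times m) auto
  moreover have "\<bar>kadj \<eta> x y\<bar> \<le> b" for x y
  proof -
    have "\<bar>\<Sum>x'\<in>UNIV. Ps x x' * \<eta> x' (y - f x)\<bar> \<le> (\<Sum>x'\<in>UNIV. Ps x x' * b)"
      by (rule order_trans[OF sum_abs], rule sum_mono) (use b Ps_nonneg in \<open>auto simp: abs_mult intro!: mult_left_mono\<close>)
    then show ?thesis unfolding kadj_def using b0 by (simp add: sum_distrib_right[symmetric] Ps_sum)
  qed
  ultimately show ?thesis unfolding bmeas_def by blast
qed

lemma kop_adjoint:
  assumes g: "nice g" and \<eta>: "bmeas \<eta>"
  shows "(\<Sum>x\<in>UNIV. \<nu> x * (LBINT y. \<eta> x y * kop P f g x y)) = (\<Sum>x\<in>UNIV. \<nu> x * (LBINT y. kadj \<eta> x y * g x y))"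
proof -
  obtain b where b: "\<And>x y. \<bar>\<eta> x y\<bar> \<le> b" using \<eta> unfolding bmeas_def by blast
  have \<eta>m: "\<eta> x \<in> borel_measurable borel" for x using \<eta> unfolding bmeas_def by blast
  define G where "G x' y = (if y > 0 then g x' y else 0)" for x' y
  have Gm: "G x' \<in> borel_measurable borel" for x'
    unfolding G_def[abs_def] using niceD(1)[OF g, of x'] by measurable
  have Gi: "integrable lborel (G x')" for x'
    by (rule Bochner_Integration.integrable_bound[OF niceD(2)[OF g, of x']]) (use Gm niceD(3)[OF g] in \<open>auto simp: G_def\<close>)
  have \<eta>m2: "(\<lambda>y. \<eta> x (y - c)) \<in> borel_measurable borel" for x c
  proof -
    have "(\<lambda>y. y - c) \<in> borel \<rightarrow>\<^sub>M borel" by measurable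
    from measurable_compose[OF this \<eta>m] show ?thesis .
  qed
  have i: "integrable lborel (\<lambda>y. G x' y * \<eta> x (y - f x'))" for x x'
    by (rule integrable_bounded_mult[OF Gi \<eta>m2 b])
  have i': "integrable lborel (\<lambda>y. \<eta> x y * G x' (f x' + y))" for x x'
    using integrable_bounded_mult[OF integrable_translate[OF Gi[of x'], of "f x'"] \<eta>m b] by (simp add: mult.commute)
  have L: "(LBINT y. \<eta> x y * kop P f g x y) = (\<Sum>x'\<in>UNIV. P x x' * (LBINT y. G x' y * \<eta> x (y - f x')))" for x
  proof -
    have "(LBINT y. \<eta> x y * kop P f g x y) = (LBINT y. (\<Sum>x'\<in>UNIV. P x x' * (\<eta> x y * G x' (f x' + y))))"
      by (intro Bochner_Integration.integral_cong refl) (auto simp: kop_def G_def sum_distrib_left add.commute intro!: sum.cong)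
    also have "\<dots> = (\<Sum>x'\<in>UNIV. P x x' * (LBINT y. \<eta> x y * G x' (f x' + y)))"
      by (subst Bochner_Integration.integral_sum) (use i' in auto)
    also have "\<dots> = (\<Sum>x'\<in>UNIV. P x x' * (LBINT y. G x' y * \<eta> x (y - f x')))"
    proof (intro sum.cong refl arg_cong2[where f="(*)"])
      fix x'
      show "(LBINT y. \<eta> x y * G x' (f x' + y)) = (LBINT y. G x' y * \<eta> x (y - f x'))"
        using integral_translate[of "\<lambda>y. G x' y * \<eta> x (y - f x')" "f x'"] by (simp add: mult.commute)
    qed
    finally show ?thesis .
  qed
  have R: "(LBINT y. kadj \<eta> x' y * g x' y) = (\<Sum>x\<in>UNIV. Ps x' x * (LBINT y. G x' y * \<eta> x (y - f x')))" for x'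
  proof -
    have "(LBINT y. kadj \<eta> x' y * g x' y) = (LBINT y. (\<Sum>x\<in>UNIV. Ps x' x * (G x' y * \<eta> x (y - f x'))))"
      by (intro Bochner_Integration.integral_cong refl) (auto simp: kadj_def G_def sum_distrib_left sum_distrib_right ac_simps intro!: sum.cong)
    also have "\<dots> = (\<Sum>x\<in>UNIV. Ps x' x * (LBINT y. G x' y * \<eta> x (y - f x')))"
      by (subst Bochner_Integration.integral_sum) (use i in auto)
    finally show ?thesis .
  qed
  have "(\<Sum>x\<in>UNIV. \<nu> x * (LBINT y. \<eta> x y * kop P f g x y)) = (\<Sum>x\<in>UNIV. \<Sum>x'\<in>UNIV. (\<nu> x * P x x') * (LBINT y. G x' y * \<eta> x (y - f x')))"
    unfolding L by (simp add: sum_distrib_left mult.assoc)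
  also have "\<dots> = (\<Sum>x'\<in>UNIV. \<Sum>x\<in>UNIV. (\<nu> x * P x x') * (LBINT y. G x' y * \<eta> x (y - f x')))" by (rule sum.swap)
  also have "\<dots> = (\<Sum>x\<in>UNIV. \<nu> x * (LBINT y. kadj \<eta> x y * g x y))"
    unfolding R nu_Ps[symmetric] by (simp add: sum_distrib_left mult.assoc)
  finally show ?thesis .
qed

lemma kop_iter_adjoint:
  assumes g: "nice g" and \<eta>: "bmeas \<eta>"
  shows "(\<Sum>x\<in>UNIV. \<nu> x * (LBINT y. \<eta> x y * (kop P f ^^ n) g x y)) = (\<Sum>x\<in>UNIV. \<nu> x * (LBINT y. (kadj ^^ n) \<eta> x y * g x y))"
  using \<eta>
proof (induction n arbitrary: \<eta>)
  case (Suc n)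
  have "(\<Sum>x\<in>UNIV. \<nu> x * (LBINT y. \<eta> x y * (kop P f ^^ Suc n) g x y)) = (\<Sum>x\<in>UNIV. \<nu> x * (LBINT y. kadj \<eta> x y * (kop P f ^^ n) g x y))"
    using kop_adjoint[OF nice_kop_iter[OF g] Suc.prems, of n] by simp
  also have "\<dots> = (\<Sum>x\<in>UNIV. \<nu> x * (LBINT y. (kadj ^^ n) (kadj \<eta>) x y * g x y))"
    by (rule Suc.IH[OF bmeas_kadj[OF Suc.prems]])
  finally show ?case by (simp add: funpow_swap1)
qed simp

text \<open>Shifting the bookkeeping by one step turns \<open>kadj\<close> into the killed dual
  operator, except at the two ends. The window end y and the height y - f x must be positive, which
  gives the two conditions; the last reversed move reaches the starting height of the original path,
  which is never tested, hence one free step. This accounts for n + 2 against n.\<close>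

lemma kadj_iter:
  "(kadj ^^ (n + 2)) (\<lambda>x y. h y) x y = (if y > 0 \<and> y - f x > 0 then (kopd ^^ n) (fopd (\<lambda>x y. h y)) x (y - f x) else 0)"
proof (induction n arbitrary: x y)
  case 0
  have "kadj (\<lambda>x y. h y) x y = (if y > 0 then h (y - f x) else 0)" for x y
    unfolding kadj_def by (simp add: sum_distrib_right[symmetric] Ps_sum)
  then have "kadj (kadj (\<lambda>x y. h y)) x y = (if y > 0 \<and> y - f x > 0 then fopd (\<lambda>x y. h y) x (y - f x) else 0)"
    unfolding kadj_def[of "kadj (\<lambda>x y. h y)"] fop_def by simp
  then show ?case by (simp add: numeral_2_eq_2)
next
  case (Suc n)
  have "(kadj ^^ (Suc n + 2)) (\<lambda>x y. h y) x y = (if y > 0 then \<Sum>x'\<in>UNIV. Ps x x' * (kadj ^^ (n + 2)) (\<lambda>x y. h y) x' (y - f x) else 0)"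
    by (simp add: kadj_def[of "(kadj ^^ _) _"] kadj_def[of "kadj _"])
  also have "\<dots> = (if y > 0 \<and> y - f x > 0 then kopd ((kopd ^^ n) (fopd (\<lambda>x y. h y))) x (y - f x) else 0)"
    unfolding Suc kop_def[of Ps _ "(kopd ^^ n) _"] by (auto intro!: sum.cong)
  finally show ?case by simp
qed

text \<open>The path into the target g is read backwards from its end point.\<close>

lemma duality:
  assumes g: "nice g" and h: "h \<in> borel_measurable borel" "\<And>y. \<bar>h y\<bar> \<le> b"
  shows "(\<Sum>x\<in>UNIV. \<nu> x * (LBINT y. h y * (kop P f ^^ (n + 2)) g x y)) =
     (\<Sum>x\<in>UNIV. \<nu> x * (LBINT y. (if y > 0 \<and> y - f x > 0 then (kopd ^^ n) (fopd (\<lambda>x y. h y)) x (y - f x) else 0) * g x y))"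
  using kop_iter_adjoint[OF g, of "\<lambda>x y. h y" "n + 2"] h unfolding kadj_iter bmeas_def by blast

end

section \<open>Mass of a window carried back, and the cut in three\<close>

lemma win_range: "(\<forall>u. 0 \<le> \<psi> u \<and> \<psi> u \<le> M) ==> 0 \<le> win \<psi> z a x y \<and> win \<psi> z a x y \<le> M"
  using order_trans[of 0 "\<psi> x" M] by (auto simp: win_def)

lemma win_integral: "a > 0 ==> (LBINT y. win \<psi> z a x y) = \<psi> x * a"
proof -
  assume a: "a > 0"
  have e: "win \<psi> z a x = (\<lambda>y. \<psi> x * indicator {z..z+a} y)" by (auto simp: win_def fun_eq_iff indicator_def)
  show ?thesis unfolding e using a by simp
qed

lemma integral_mult_win_le:
  fixes \<psi> :: "'a::finite => real"
  assumes \<psi>: "\<forall>u. 0 \<le> \<psi> u \<and> \<psi> u \<le> M" and a: "a > 0"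
    and h: "h \<in> borel_measurable borel" "\<And>y. y \<in> {z..z+a} ==> \<bar>h y\<bar> \<le> b" and b: "b \<ge> 0"
  shows "integrable lborel (\<lambda>y. h y * win \<psi> z a x y)" "\<bar>LBINT y. h y * win \<psi> z a x y\<bar> \<le> b * M * a"
proof -
  have w: "integrable lborel (win \<psi> z a x)" and wm [measurable]: "win \<psi> z a x \<in> borel_measurable borel"
    using niceD(1,2)[OF nice_win] \<psi> by blast+
  note h(1) [measurable]
  have pt: "\<bar>h y * win \<psi> z a x y\<bar> \<le> b * win \<psi> z a x y" for y
    using h(2)[of y] \<psi> b by (auto simp: win_def abs_mult intro!: mult_right_mono)
  have bw: "integrable lborel (\<lambda>y. b * win \<psi> z a x y)" using w by simp
  have "norm (h y * win \<psi> z a x y) \<le> norm (b * win \<psi> z a x y)" for y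
    using order_trans[OF pt[of y] abs_ge_self] by simp
  then show i: "integrable lborel (\<lambda>y. h y * win \<psi> z a x y)"
    by (intro Bochner_Integration.integrable_bound[OF bw]) auto
  have "\<bar>LBINT y. h y * win \<psi> z a x y\<bar> \<le> (LBINT y. b * win \<psi> z a x y)"
    by (rule order_trans[OF integral_abs_bound], rule integral_mono) (use i bw pt in auto)
  also have "\<dots> = b * (\<psi> x * a)" by (simp add: win_integral[OF a])
  also have "\<dots> \<le> b * (M * a)" using \<psi> a b by (intro mult_left_mono mult_right_mono) auto
  finally show "\<bar>LBINT y. h y * win \<psi> z a x y\<bar> \<le> b * M * a" by (simp add: mult.assoc)
qed

context nonlattice_chain
begin

lemma nu_abs_le:
  assumes "\<And>x. \<bar>g x\<bar> \<le> b"
  shows "\<bar>\<Sum>x\<in>UNIV. \<nu> x * g x\<bar> \<le> b"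
proof -
  have "\<bar>\<Sum>x\<in>UNIV. \<nu> x * g x\<bar> \<le> (\<Sum>x\<in>UNIV. \<nu> x * b)"
    by (rule order_trans[OF sum_abs], rule sum_mono) (use assms nu_nonneg in \<open>auto simp: abs_mult intro!: mult_left_mono\<close>)
  then show ?thesis by (simp add: sum_distrib_right[symmetric] nu_sum)
qed

lemma bmeas_dual_iter:
  assumes h: "h \<in> borel_measurable borel" "\<And>y. \<bar>h y\<bar> \<le> b"
  shows "bmeas (\<lambda>x y. if y > 0 \<and> y - f x > 0 then (kopd ^^ n) (fopd (\<lambda>x y. h y)) x (y - f x) else 0)"
proof -
  have "bmeas ((kadj ^^ k) (\<lambda>x y. h y))" for k
  proof (induction k)
    case 0 show ?case using h unfolding bmeas_def by auto
  qed (use bmeas_kadj in auto)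
  from this[of "n+2"] have "bmeas (\<lambda>x y. (kadj ^^ (n + 2)) (\<lambda>x y. h y) x y)" by simp
  then show ?thesis unfolding kadj_iter .
qed

lemma surv_integrand_bound:
  "\<exists>C>0. \<forall>n\<ge>1. \<forall>x y z a. 0 \<le> z --> 0 < a --> y \<le> z + a --> dual.surv (\<lambda>u. - f u) n x (y - f x) \<le> C * (1 + z + a) / sqrt n"
proof -
  from dual.survival_bound obtain C0 where C0: "C0 > 0" "\<forall>n\<ge>1. \<forall>x y. dual.surv (\<lambda>u. - f u) n x y \<le> C0 * (1 + max y 0) / sqrt n" by blast
  have "dual.surv (\<lambda>u. - f u) n x (y - f x) \<le> C0 * (1 + l1norm f) * (1 + z + a) / sqrt n"
    if n: "n \<ge> 1" and z: "0 \<le> z" "0 < a" "y \<le> z + a" for n x y z a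
  proof -
    have "1 + max (y - f x) 0 \<le> 1 + (z + a) + l1norm f" using z l1norm_bound[of f x] by auto
    also have "\<dots> \<le> (1 + l1norm f) * (1 + z + a)" using z l1norm_nonneg[of f] by (simp add: algebra_simps add_increasing)
    finally have "C0 * (1 + max (y - f x) 0) / sqrt n \<le> C0 * ((1 + l1norm f) * (1 + z + a)) / sqrt n"
      using C0(1) by (intro divide_right_mono mult_left_mono) auto
    then show ?thesis using C0(2)[rule_format, OF n, of x "y - f x"] by (simp add: mult.assoc)
  qed
  then show ?thesis using C0(1) l1norm_nonneg[of f] by (intro exI[of _ "C0 * (1 + l1norm f)"]) (auto intro!: mult_pos_pos add_pos_nonneg)
qed

text \<open>Duality with the constant 1: the mass of all starting points leading alive into the
  window is the dual survival probability integrated over the window, of order (1 + z + a)/sqrt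
  n.\<close>

lemma mass_window:
  "\<exists>C>0. \<forall>n\<ge>1. \<forall>\<psi> M a z. (\<forall>u. 0 \<le> \<psi> u \<and> \<psi> u \<le> M) --> a > 0 --> z \<ge> 0 -->
     mass ((kop P f ^^ (n + 2)) (win \<psi> z a)) \<le> C * M * a * (1 + z + a) / sqrt n"
proof -
  from surv_integrand_bound obtain C where C: "C > 0" "\<forall>n\<ge>1. \<forall>x y z a. 0 \<le> z --> 0 < a --> y \<le> z + a --> dual.surv (\<lambda>u. - f u) n x (y - f x) \<le> C * (1 + z + a) / sqrt n" by blast
  have "mass ((kop P f ^^ (n + 2)) (win \<psi> z a)) \<le> C * M * a * (1 + z + a) / sqrt n"
    if n: "n \<ge> 1" and \<psi>: "\<forall>u. 0 \<le> \<psi> u \<and> \<psi> u \<le> M" and a: "a > 0" and z: "z \<ge> 0" for n \<psi> M a z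
  proof -
    have nw: "nice (win \<psi> z a)" using nice_win[of \<psi>] \<psi> by blast
    define D where "D x y = (if y > 0 \<and> y - f x > 0 then (kopd ^^ n) (fopd (\<lambda>x y. 1)) x (y - f x) else 0)" for x y
    have f1: "fopd (\<lambda>x y. 1) = (\<lambda>x y. 1)" using dual.fop_iter_const[where n=1 and c=1 and f="\<lambda>u. - f u"] by (auto simp: fun_eq_iff)
    have D: "D x y = (if y > 0 \<and> y - f x > 0 then dual.surv (\<lambda>u. - f u) n x (y - f x) else 0)" for x y
      unfolding D_def f1 dual.surv_def ..
    have bm: "bmeas D" unfolding D_def[abs_def] by (rule bmeas_dual_iter[of "\<lambda>y. 1" 1]) auto
    have Dm: "D x \<in> borel_measurable borel" for x using bm unfolding bmeas_def by blast
    have pos: "0 \<le> C * (1 + z + a) / sqrt n" using C(1) a z by simp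
    have "mass ((kop P f ^^ (n + 2)) (win \<psi> z a)) = (\<Sum>x\<in>UNIV. \<nu> x * (LBINT y. D x y * win \<psi> z a x y))"
      using duality[OF nw, of "\<lambda>y. 1" 1 n] unfolding mass_def D_def by simp
    also have "\<dots> \<le> C * (1 + z + a) / sqrt n * M * a"
    proof (rule order_trans[OF abs_ge_self], rule nu_abs_le)
      fix x
      show "\<bar>LBINT y. D x y * win \<psi> z a x y\<bar> \<le> C * (1 + z + a) / sqrt n * M * a"
      proof (rule integral_mult_win_le(2)[OF \<psi> a Dm _ pos])
        fix y assume "y \<in> {z..z+a}"
        then show "\<bar>D x y\<bar> \<le> C * (1 + z + a) / sqrt n"
          using C(2)[rule_format, OF n z a, of y x] pos dual.surv_range(1)[of "\<lambda>u. - f u" n x "y - f x"] unfolding D by auto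
      qed
    qed
    finally show ?thesis by (simp add: ac_simps)
  qed
  then show ?thesis using C(1) by blast
qed

text \<open>A start higher by v ends higher by v, still inside the window widened by \<delta>; this
  is the domination asked for by the local limit theorems.\<close>

lemma window_shift:
  assumes "\<forall>u. 0 \<le> \<psi> u" "0 \<le> v" "v \<le> \<delta>" "n > 0"
  shows "(kop P f ^^ n) (win \<psi> z a) x y \<le> (kop P f ^^ n) (win \<psi> z (a + \<delta>)) x (y + v)"
  by (rule kop_iter_shift) (use assms in \<open>auto simp: win_def\<close>)

lemma nice_window: "(\<forall>u. 0 \<le> \<psi> u) ==> nice ((kop P f ^^ n) (win \<psi> z a))"
  by (rule nice_kop_iter, rule nice_win) auto

text \<open>Three factors n^(-1/2): survival over the first third, the crude local bound over the
  middle one with the killing dropped, and the mass of the window carried back over the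
  last.\<close>

lemma window_bound:
  "\<exists>C>0. \<forall>n\<ge>1. \<forall>\<psi> M a z x y. (\<forall>u. 0 \<le> \<psi> u \<and> \<psi> u \<le> M) --> a > 0 --> z \<ge> 0 -->
     (kop P f ^^ n) (win \<psi> z a) x y \<le> C * M * (1 + a) * (1 + z + a) * (1 + max y 0) / (sqrt n) ^ 3"
proof -
  from mass_window obtain C1 where C1: "C1 > 0" "\<forall>n\<ge>1. \<forall>\<psi> M a z. (\<forall>u. 0 \<le> \<psi> u \<and> \<psi> u \<le> M) --> a > 0 --> z \<ge> 0 -->
     mass ((kop P f ^^ (n + 2)) (win \<psi> z a)) \<le> C1 * M * a * (1 + z + a) / sqrt n" by blast
  from fop_crude_bound[of 1] obtain C2 where C2: "C2 > 0" "\<forall>k\<ge>1. \<forall>g h x y. nice g --> (\<forall>x y v. 0 \<le> v --> v \<le> 1 --> h x y \<le> g x (y + v)) -->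
     (fop P f ^^ k) h x y \<le> C2 / sqrt k * mass g" by auto
  from survival_bound obtain C3 where C3: "C3 > 0" "\<forall>n\<ge>1. \<forall>x y. surv f n x y \<le> C3 * (1 + max y 0) / sqrt n" by blast
  \<comment> \<open>All three square roots are at least sqrt n / 3, whence 27; the factor 4 comes
    from widening a to a + 1 in two places. The extra 27 covers n < 9, where the trivial bound by M
    is used.\<close>
  define C where "C = 108 * (C1 * C2 * C3) + 27"
  have Cp: "C > 0" "27 \<le> C" "108 * (C1 * C2 * C3) \<le> C" unfolding C_def using C1(1) C2(1) C3(1) by (simp_all add: add_pos_pos)
  have "(kop P f ^^ n) (win \<psi> z a) x y \<le> C * M * (1 + a) * (1 + z + a) * (1 + max y 0) / (sqrt n) ^ 3"
    if n: "n \<ge> 1" and \<psi>: "\<forall>u. 0 \<le> \<psi> u \<and> \<psi> u \<le> M" and a: "a > 0" and z: "z \<ge> 0" for n \<psi> M a z x y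
  proof (cases "n < 9")
    case True
    have M: "M \<ge> 0" using \<psi> order_trans by blast
    have "(kop P f ^^ n) (win \<psi> z a) x y \<le> M * surv f n x y"
      by (rule order_trans[OF abs_ge_self], rule kop_iter_sup_bound) (use win_range[OF \<psi>] n in auto)
    also have "\<dots> \<le> M * 1" using M surv_range(2) by (intro mult_left_mono) auto
    also have "\<dots> \<le> C * M * (1 + a) * (1 + z + a) * (1 + max y 0) / (sqrt n) ^ 3"
    proof -
      have s: "sqrt n \<le> 3" "0 < sqrt n" using True n real_sqrt_le_mono[of n 9] by auto
      have "(sqrt n) ^ 3 \<le> 3 ^ 3" using s by (intro power_mono) auto
      then have "(sqrt n) ^ 3 \<le> C" using Cp(2) by simp
      moreover have "1 \<le> (1 + a) * ((1 + z + a) * (1 + max y 0))"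
        using a z by (intro mult_ge1_I) auto
      ultimately have "(sqrt n) ^ 3 * 1 \<le> C * ((1 + a) * ((1 + z + a) * (1 + max y 0)))"
        using Cp(1) s by (intro mult_mono) auto
      from mult_left_mono[OF this M] show ?thesis using s by (simp add: field_simps)
    qed
    finally show ?thesis .
  next
    case False
    define i where "i = n div 3"
    \<comment> \<open>Two of the steps are reserved for the ends of the duality formula.\<close>
    define l where "l = n - 2 * i - 2"
    have il: "i \<ge> 1" "l \<ge> 1" "n = i + (i + (l + 2))" "n \<le> 9 * i" "n \<le> 9 * l" using False unfolding i_def l_def by auto
    have M: "M \<ge> 0" using \<psi> order_trans by blast
    define s where "s = sqrt n / 3"
    have s: "s > 0" "s \<le> sqrt i" "s \<le> sqrt l"
      unfolding s_def using n il real_sqrt_le_mono[of n "9 * i"] real_sqrt_le_mono[of n "9 * l"] by (auto simp: real_sqrt_mult)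
    \<comment> \<open>The crude bound is used with \<delta> = 1, so it is the mass of the window of
      length a + 1 that enters.\<close>
    define Q where "Q = C1 * M * (a + 1) * (1 + z + (a + 1)) / sqrt l"
    have Q0: "0 \<le> Q" unfolding Q_def using C1(1) M a z by simp
    have mQ: "mass ((kop P f ^^ (l + 2)) (win \<psi> z (a + 1))) \<le> Q"
      unfolding Q_def using C1(2)[rule_format, OF il(2) \<psi>[rule_format], of "a + 1" z] a z by auto
    have inner: "(kop P f ^^ i) ((kop P f ^^ (l + 2)) (win \<psi> z a)) x y \<le> C2 / sqrt i * Q" for x y
    proof -
      have "(kop P f ^^ i) ((kop P f ^^ (l + 2)) (win \<psi> z a)) x y \<le> (fop P f ^^ i) ((kop P f ^^ (l + 2)) (win \<psi> z a)) x y"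
        using kop_iter_le_fop_iter niceD(3)[OF nice_window] \<psi> by blast
      also have "\<dots> \<le> C2 / sqrt i * mass ((kop P f ^^ (l + 2)) (win \<psi> z (a + 1)))"
        by (rule C2(2)[rule_format, OF il(1) nice_window window_shift]) (use \<psi> in auto)
      also have "\<dots> \<le> C2 / sqrt i * Q" using mQ C2(1) by (intro mult_left_mono) auto
      finally show ?thesis .
    qed
    have inner0: "0 \<le> (kop P f ^^ i) ((kop P f ^^ (l + 2)) (win \<psi> z a)) x y" for x y
      using kop_iter_le_fop_iter niceD(3)[OF nice_window] \<psi> by blast
    have "(kop P f ^^ n) (win \<psi> z a) x y = (kop P f ^^ i) ((kop P f ^^ i) ((kop P f ^^ (l + 2)) (win \<psi> z a))) x y"
      by (subst il(3)) (simp only: funpow_add o_apply)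
    also have "\<dots> \<le> C2 / sqrt i * Q * surv f i x y"
      by (rule order_trans[OF abs_ge_self], rule kop_iter_sup_bound) (use inner inner0 il(1) in auto)
    also have "\<dots> \<le> C2 / sqrt i * Q * (C3 * (1 + max y 0) / sqrt i)"
      using C3(2) il(1) C2(1) Q0 by (intro mult_left_mono) auto
    also have "\<dots> \<le> C2 / s * (C1 * M * (2 * (1 + a)) * (2 * (1 + z + a)) / s) * (C3 * (1 + max y 0) / s)"
    proof -
      have "Q \<le> C1 * M * (2 * (1 + a)) * (2 * (1 + z + a)) / s" unfolding Q_def
        using C1(1) M a z s by (intro frac_le mult_mono mult_nonneg_nonneg) auto
      moreover have "C2 / sqrt i \<le> C2 / s" "C3 * (1 + max y 0) / sqrt i \<le> C3 * (1 + max y 0) / s"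
        using C2(1) C3(1) s by (intro frac_le; simp)+
      ultimately show ?thesis
        using C1(1) C2(1) C3(1) M a z s Q0 by (intro mult_mono) auto
    qed
    also have "\<dots> = 108 * (C1 * C2 * C3) * (M * (1 + a) * (1 + z + a) * (1 + max y 0)) / (sqrt n) ^ 3"
      unfolding s_def using n by (simp add: field_simps power3_eq_cube)
    also have "\<dots> \<le> C * (M * (1 + a) * (1 + z + a) * (1 + max y 0)) / (sqrt n) ^ 3"
      using Cp(3) M a z by (intro divide_right_mono mult_right_mono) auto
    finally show ?thesis by (simp add: mult.assoc)
  qed
  then show ?thesis using Cp(1) by blast
qed

end

section \<open>Local asymptotics of the killed chain\<close>

lemma kop_measurable:
  assumes "\<And>x. g x \<in> borel_measurable borel"
  shows "(kop P f ^^ n) g x \<in> borel_measurable borel"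
proof (induction n arbitrary: x)
  case (Suc n)
  have m: "(\<lambda>y. (kop P f ^^ n) g x' (y + f x')) \<in> borel_measurable borel" for x'
  proof -
    have "(\<lambda>y. y + f x') \<in> borel \<rightarrow>\<^sub>M borel" by measurable
    from measurable_compose[OF this Suc] show ?thesis .
  qed
  have "(kop P f ^^ Suc n) g x = (\<lambda>y. \<Sum>x'\<in>UNIV. P x x' * (if y + f x' > 0 then (kop P f ^^ n) g x' (y + f x') else 0))"
    by (simp add: fun_eq_iff kop_def)
  then show ?case by (simp only:) (intro borel_measurable_sum borel_measurable_times measurable_If m, auto)
qed (use assms in simp)

lemma (in pos_chain) W_measurable: "W x \<in> borel_measurable borel"
proof (rule borel_measurable_LIMSEQ_real)
  show "(\<lambda>k. (kop P f ^^ k) lin x y) \<longlonglongrightarrow> W x y" for y by (rule W_limit)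
  show "(kop P f ^^ k) lin x \<in> borel_measurable borel" for k by (rule kop_measurable) measurable
qed

text \<open>One killed step of \<open>lin\<close> is already within O(1 + max y 0) of
  \<open>W\<close>.\<close>

lemma (in pos_chain) W_growth: "\<exists>C>0. \<forall>x y. \<bar>W x y\<bar> \<le> C * (1 + \<bar>y\<bar>)"
proof -
  from W_rate obtain C where C: "C > 0" "\<forall>k x y. k \<ge> 1 --> \<bar>(kop P f ^^ k) lin x y - W x y\<bar> \<le> C * (1 + max y 0) / sqrt k" by blast
  define F where "F = l1norm f + l1norm rr"
  have F: "F \<ge> 0" unfolding F_def using l1norm_nonneg[of f] l1norm_nonneg[of rr] by simp
  have "\<bar>W x y\<bar> \<le> (C + 1 + F) * (1 + \<bar>y\<bar>)" for x y
  proof -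
    have "\<bar>kop P f lin x y\<bar> \<le> (\<Sum>x'\<in>UNIV. P x x' * (\<bar>y\<bar> + F))" unfolding kop_def
    proof (rule order_trans[OF sum_abs], rule sum_mono)
      fix x'
      have "\<bar>if y + f x' > 0 then y + f x' + rr x' else 0\<bar> \<le> \<bar>y\<bar> + F"
        using l1norm_bound[of f x'] l1norm_bound[of rr x'] F unfolding F_def by auto
      then show "\<bar>P x x' * (if y + f x' > 0 then y + f x' + rr x' else 0)\<bar> \<le> P x x' * (\<bar>y\<bar> + F)"
        using P_nonneg by (auto simp: abs_mult intro!: mult_left_mono)
    qed
    then have 1: "\<bar>kop P f lin x y\<bar> \<le> \<bar>y\<bar> + F" by (simp add: sum_distrib_right[symmetric] P_sum)
    have 2: "\<bar>kop P f lin x y - W x y\<bar> \<le> C * (1 + max y 0)" using C(2)[rule_format, of 1 x y] by simp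
    have "C * (1 + max y 0) \<le> C * (1 + \<bar>y\<bar>)" using C(1) by (intro mult_left_mono) auto
    moreover have "\<bar>y\<bar> + F \<le> (1 + F) * (1 + \<bar>y\<bar>)" using F by (simp add: algebra_simps add_increasing)
    ultimately have "\<bar>W x y\<bar> \<le> C * (1 + \<bar>y\<bar>) + (1 + F) * (1 + \<bar>y\<bar>)" using 1 2 by linarith
    then show ?thesis by (simp add: algebra_simps)
  qed
  then show ?thesis using C(1) F by (intro exI[of _ "C + 1 + F"]) auto
qed

text \<open>The j-th derivative is of order t^(-(j+1)/2); for t \<ge> 1 this is weakened to integer
  powers, which is all the heat comparison needs.\<close>

lemma gd_small_bound:
  assumes "c > 0"
  shows "\<exists>C>0. \<forall>t w. t \<ge> 1 --> \<bar>gd c 1 t w\<bar> \<le> C / t \<and> \<bar>gd c 2 t w\<bar> \<le> C / t \<and> \<bar>gd c 3 t w\<bar> \<le> C / t\<^sup>2 \<and> \<bar>gd c 4 t w\<bar> \<le> C / t\<^sup>2"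
proof -
  from gd_bound_uniform[OF assms] obtain C where C: "C > 0" "\<forall>j\<le>6. \<forall>s y. s > 0 --> \<bar>gd c j s y\<bar> \<le> C / (sqrt s) ^ Suc j" by blast
  have "\<bar>gd c 1 t w\<bar> \<le> C / t \<and> \<bar>gd c 2 t w\<bar> \<le> C / t \<and> \<bar>gd c 3 t w\<bar> \<le> C / t\<^sup>2 \<and> \<bar>gd c 4 t w\<bar> \<le> C / t\<^sup>2" if t: "t \<ge> 1" for t w
  proof -
    have s: "sqrt t \<ge> 1" using t by simp
    have e: "(sqrt t)^2 = t" "(sqrt t)^4 = t\<^sup>2" using t by (simp_all add: power4_eq_xxxx power2_eq_square)
    have p: "(sqrt t)^2 \<le> (sqrt t)^3" "(sqrt t)^4 \<le> (sqrt t)^5" using s by (intro power_increasing; simp)+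
    have q: "C / (sqrt t)^3 \<le> C / (sqrt t)^2" "C / (sqrt t)^5 \<le> C / (sqrt t)^4"
      using p C(1) s by (intro divide_left_mono; simp)+
    have "\<bar>gd c 1 t w\<bar> \<le> C / (sqrt t)^2" "\<bar>gd c 2 t w\<bar> \<le> C / (sqrt t)^3" "\<bar>gd c 3 t w\<bar> \<le> C / (sqrt t)^4" "\<bar>gd c 4 t w\<bar> \<le> C / (sqrt t)^5"
      using C(2)[rule_format, of 1 t w] C(2)[rule_format, of 2 t w] C(2)[rule_format, of 3 t w] C(2)[rule_format, of 4 t w] t
      by (simp_all add: eval_nat_numeral)
    then show ?thesis using q unfolding e by linarith
  qed
  then show ?thesis using C(1) by blast
qed

lemma gd_even:
  "gd c 0 s (- y) = gd c 0 s y" "gd c 1 s (- y) = - gd c 1 s y" "gd c 2 s (- y) = gd c 2 s y"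
  "gd c 1 s 0 = 0" "gd c 3 s 0 = 0"
  by (simp_all add: gd_0 gd_1 gd_SS numeral_2_eq_2 numeral_3_eq_3 minus_divide_left[symmetric])

lemma gd0_abs_moment:
  assumes "c > 0"
  shows "\<exists>C>0. \<forall>s\<ge>1. integrable lborel (\<lambda>w. (1 + \<bar>w\<bar>) * gd c 0 s w) \<and> (LBINT w. (1 + \<bar>w\<bar>) * gd c 0 s w) \<le> C * sqrt s"
proof -
  define C where "C = 1 + sqrt c * sqrt (2 / pi)"
  have "integrable lborel (\<lambda>w. (1 + \<bar>w\<bar>) * gd c 0 s w) \<and> (LBINT w. (1 + \<bar>w\<bar>) * gd c 0 s w) \<le> C * sqrt s" if s: "s \<ge> 1" for s
  proof -
    define \<sigma> where "\<sigma> = sqrt (c * s)"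
    have \<sigma>: "\<sigma> > 0" unfolding \<sigma>_def using assms s by simp
    have h1: "has_bochner_integral lborel (\<lambda>x. normal_density 0 \<sigma> x * \<bar>x\<bar>) (\<sigma> * sqrt (2 / pi))"
      using normal_moment_abs_odd[OF \<sigma>, of 0 0] by simp
    have h0: "has_bochner_integral lborel (normal_density 0 \<sigma>) 1"
      using integrable_normal_density[OF \<sigma>, of 0] integral_normal_density[OF \<sigma>, of 0] by (simp add: has_bochner_integral_iff)
    have e: "(\<lambda>w. (1 + \<bar>w\<bar>) * gd c 0 s w) = (\<lambda>w. normal_density 0 \<sigma> w + normal_density 0 \<sigma> w * \<bar>w\<bar>)"
      using gd_normal_density[OF assms, of s] s by (simp add: fun_eq_iff \<sigma>_def algebra_simps)
    have hb: "has_bochner_integral lborel (\<lambda>w. (1 + \<bar>w\<bar>) * gd c 0 s w) (1 + \<sigma> * sqrt (2 / pi))"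
      unfolding e by (rule has_bochner_integral_add[OF h0 h1])
    have "\<sigma> * sqrt (2 / pi) = sqrt c * sqrt (2 / pi) * sqrt s" unfolding \<sigma>_def by (simp add: real_sqrt_mult)
    moreover have "1 \<le> sqrt s" using s by simp
    ultimately have "1 + \<sigma> * sqrt (2 / pi) \<le> C * sqrt s" unfolding C_def by (simp add: algebra_simps)
    then show ?thesis using hb by (simp add: has_bochner_integral_iff)
  qed
  moreover have "C > 0" unfolding C_def using assms by (intro add_pos_nonneg) auto
  ultimately show ?thesis by blast
qed

context nonlattice_chain
begin

text \<open>The harmonic function of the dual chain after its first move from x, with the two
  positivity conditions left over from \<open>kadj_iter\<close>. For y > 0 it is the value of V* in
  the stated integrand once X_1* = x.\<close>

definition dW :: "'a => real => real" where
  "dW x y = (if y > 0 \<and> y - f x > 0 then dual.W x (y - f x) else 0)"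

definition limint :: "('a => real) => real => real => real" where
  "limint \<psi> z a = (\<Sum>x\<in>UNIV. \<nu> x * (LBINT y. dW x y * win \<psi> z a x y))"

lemma dW_measurable: "dW x \<in> borel_measurable borel"
proof -
  have "(\<lambda>y. y - f x) \<in> borel \<rightarrow>\<^sub>M borel" by measurable
  from measurable_compose[OF this dual.W_measurable] have [measurable]: "(\<lambda>y. dual.W x (y - f x)) \<in> borel_measurable borel" .
  show ?thesis unfolding dW_def[abs_def] by measurable
qed

lemma dW_bound: "\<exists>C>0. \<forall>x y. y \<le> B --> \<bar>dW x y\<bar> \<le> C"
proof -
  from dual.W_growth obtain C where C: "C > 0" "\<forall>x y. \<bar>dual.W x y\<bar> \<le> C * (1 + \<bar>y\<bar>)" by blast
  define D where "D = C * (1 + \<bar>B\<bar> + l1norm f)"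
  have D: "D > 0" unfolding D_def using C(1) l1norm_nonneg[of f] by (intro mult_pos_pos) auto
  have "\<bar>dW x y\<bar> \<le> D" if y: "y \<le> B" for x y
  proof (cases "y > 0 \<and> y - f x > 0")
    case True
    have "\<bar>dual.W x (y - f x)\<bar> \<le> C * (1 + \<bar>y - f x\<bar>)" using C(2) by blast
    also have "\<dots> \<le> D" unfolding D_def using C(1) True y l1norm_bound[of f x] by (intro mult_left_mono) auto
    finally show ?thesis using True by (simp add: dW_def)
  qed (use D in \<open>auto simp: dW_def\<close>)
  then show ?thesis using D by blast
qed

text \<open>Two windows with common lower end differ, up to one point, by the window between their
  upper ends, on which \<open>dW\<close> is bounded. This Lipschitz bound pays for the widening by
  \<delta>.\<close>

lemma limint_bound:
  assumes \<psi>: "\<forall>u. 0 \<le> \<psi> u \<and> \<psi> u \<le> M"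
  shows "\<exists>L>0. \<forall>a b. 0 < a --> a < b --> b \<le> A --> \<bar>limint \<psi> z b - limint \<psi> z a\<bar> \<le> L * (b - a)"
proof -
  from dW_bound[of "z + A"] obtain C where C: "C > 0" "\<forall>x y. y \<le> z + A --> \<bar>dW x y\<bar> \<le> C" by blast
  have M: "M \<ge> 0" using \<psi> order_trans by blast
  have "\<bar>limint \<psi> z b - limint \<psi> z a\<bar> \<le> (C * M + 1) * (b - a)" if a: "0 < a" "a < b" "b \<le> A" for a b
  proof -
    have i: "integrable lborel (\<lambda>y. dW x y * win \<psi> z b x y)" "integrable lborel (\<lambda>y. dW x y * win \<psi> z a x y)" for x
      by (rule integral_mult_win_le(1)[OF \<psi> _ dW_measurable _ less_imp_le[OF C(1)]]; use C(2) a in auto)+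
    have "limint \<psi> z b - limint \<psi> z a = (\<Sum>x\<in>UNIV. \<nu> x * (LBINT y. dW x y * (win \<psi> z b x y - win \<psi> z a x y)))"
      unfolding limint_def sum_subtractf[symmetric] right_diff_distrib Bochner_Integration.integral_diff[OF i] ..
    also have "\<dots> = (\<Sum>x\<in>UNIV. \<nu> x * (LBINT y. dW x y * win \<psi> (z + a) (b - a) x y))"
    proof (intro sum.cong refl arg_cong2[where f="(*)"])
      fix x
      show "(LBINT y. dW x y * (win \<psi> z b x y - win \<psi> z a x y)) = (LBINT y. dW x y * win \<psi> (z + a) (b - a) x y)"
      proof (rule integral_cong_AE)
        have [measurable]: "win \<psi> z c x \<in> borel_measurable borel" for z c
          using niceD(1)[OF nice_win] \<psi> by blast
        note dW_measurable [measurable]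
        show "(\<lambda>y. dW x y * (win \<psi> z b x y - win \<psi> z a x y)) \<in> borel_measurable lborel"
          "(\<lambda>y. dW x y * win \<psi> (z + a) (b - a) x y) \<in> borel_measurable lborel" by measurable
        show "AE y in lborel. dW x y * (win \<psi> z b x y - win \<psi> z a x y) = dW x y * win \<psi> (z + a) (b - a) x y"
          using AE_lborel_singleton[of "z + a"] by eventually_elim (use a in \<open>auto simp: win_def\<close>)
      qed
    qed
    finally have e: "limint \<psi> z b - limint \<psi> z a = (\<Sum>x\<in>UNIV. \<nu> x * (LBINT y. dW x y * win \<psi> (z + a) (b - a) x y))" .
    have "\<bar>limint \<psi> z b - limint \<psi> z a\<bar> \<le> C * M * (b - a)" unfolding e
      by (rule nu_abs_le, rule integral_mult_win_le(2)[OF \<psi> _ dW_measurable _ less_imp_le[OF C(1)]]) (use C(2) a in auto)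
    also have "\<dots> \<le> (C * M + 1) * (b - a)" using a by (intro mult_right_mono) auto
    finally show ?thesis .
  qed
  then show ?thesis using C(1) M by (intro exI[of _ "C * M + 1"]) (auto intro: add_nonneg_pos)
qed

text \<open>The heat kernel of Brownian motion killed at 0 (method of images), with its space
  derivatives in w. It is odd in w, as the comparison for the killed chain requires.\<close>

definition refl_kernel :: "real => nat => real => real => real" where
  "refl_kernel y j s w = gd s2 j s (w + (- y)) - gd s2 j s (w + y)"

lemma heat_seq_refl_kernel: "heat_seq s2 (refl_kernel y)"
  unfolding refl_kernel_def[abs_def] by (intro heat_seq_diff heat_seq_shift heat_seq_gd s2_pos)

lemma refl_kernel_measurable: "refl_kernel y 0 s \<in> borel_measurable borel"
  unfolding refl_kernel_def[abs_def] by measurable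

lemma refl_kernel_bound:
  "\<exists>C>0. \<forall>t w y. t \<ge> 1 --> \<bar>refl_kernel y 1 t w\<bar> \<le> C / t \<and> \<bar>refl_kernel y 2 t w\<bar> \<le> C / t \<and> \<bar>refl_kernel y 3 t w\<bar> \<le> C / t\<^sup>2 \<and> \<bar>refl_kernel y 4 t w\<bar> \<le> C / t\<^sup>2"
proof -
  from gd_small_bound[OF s2_pos] obtain C where C: "C > 0"
    "\<forall>t w. t \<ge> 1 --> \<bar>gd s2 1 t w\<bar> \<le> C / t \<and> \<bar>gd s2 2 t w\<bar> \<le> C / t \<and> \<bar>gd s2 3 t w\<bar> \<le> C / t\<^sup>2 \<and> \<bar>gd s2 4 t w\<bar> \<le> C / t\<^sup>2" by blast
  have "\<bar>refl_kernel y 1 t w\<bar> \<le> (2*C) / t \<and> \<bar>refl_kernel y 2 t w\<bar> \<le> (2*C) / t \<and> \<bar>refl_kernel y 3 t w\<bar> \<le> (2*C) / t\<^sup>2 \<and> \<bar>refl_kernel y 4 t w\<bar> \<le> (2*C) / t\<^sup>2" if "t \<ge> 1" for t w y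
  proof -
    have "(2*C) / t = C / t + C / t" "(2*C) / t\<^sup>2 = C / t\<^sup>2 + C / t\<^sup>2" by (simp_all add: add_divide_distrib[symmetric])
    moreover have "\<bar>p - q\<bar> \<le> r + r" if "\<bar>p\<bar> \<le> r" "\<bar>q\<bar> \<le> r" for p q r :: real using that by linarith
    ultimately show ?thesis unfolding refl_kernel_def
      using C(2)[rule_format, OF that, of "w + - y"] C(2)[rule_format, OF that, of "w + y"] by presburger
  qed
  then show ?thesis using C(1) by (intro exI[of _ "2*C"]) auto
qed

text \<open>\<open>kop_heat\<close> for the dual chain and the reflected kernel. The free last step
  is absorbed beforehand: it changes the kernel by O(1/k) only, and this is multiplied by a survival
  probability.\<close>

lemma dual_kernel_estimate:
  assumes z: "z \<ge> 0" and A: "A > 0"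
  shows "\<exists>C>0. \<forall>k n y x w. k \<ge> (1::nat) --> n \<ge> (1::nat) --> 0 < w --> w \<le> z + A --> w - f x > 0 -->
    \<bar>(kopd ^^ n) (fopd (\<lambda>x w. refl_kernel y 0 k w)) x (w - f x) + 2 * gd s2 1 (real k + real n) y * dual.W x (w - f x)\<bar>
      \<le> C * (sqrt n / (real k)\<^sup>2 + 1 / (real k * sqrt n))"
proof -
  from refl_kernel_bound obtain B where B: "B > 0"
    "\<forall>t w y. t \<ge> 1 --> \<bar>refl_kernel y 1 t w\<bar> \<le> B / t \<and> \<bar>refl_kernel y 2 t w\<bar> \<le> B / t \<and> \<bar>refl_kernel y 3 t w\<bar> \<le> B / t\<^sup>2 \<and> \<bar>refl_kernel y 4 t w\<bar> \<le> B / t\<^sup>2" by blast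
  obtain Ck where Ck: "Ck > 0" "\<forall>h m B B1 k x y. heat_seq s2 h --> m > 0 --> k \<ge> 1 --> y \<ge> - l1norm (\<lambda>u. - f u) -->
     (\<forall>t w. m \<le> t --> t \<le> m + real k --> \<bar>h 3 t w\<bar> \<le> B \<and> \<bar>h 4 t w\<bar> \<le> B) -->
     (\<forall>t. m \<le> t --> t \<le> m + real k --> h 0 t 0 = 0 \<and> h 2 t 0 = 0) -->
     (\<forall>w. \<bar>h 1 m w\<bar> \<le> B1 \<and> \<bar>h 2 m w\<bar> \<le> B1) --> \<bar>h 1 (m + k) 0\<bar> \<le> B1 -->
     \<bar>(kopd ^^ k) (\<lambda>x y. h 0 m y) x y - h 1 (m + k) 0 * dual.W x y\<bar> \<le> Ck * (1 + \<bar>y\<bar>) ^ 3 * (B * sqrt k + B1 / sqrt k)"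
    using dual.kop_heat[unfolded dual_s2] by (elim exE conjE)
  from surv_integrand_bound obtain Cs where Cs: "Cs > 0" "\<forall>n\<ge>1. \<forall>x y z a. 0 \<le> z --> 0 < a --> y \<le> z + a --> dual.surv (\<lambda>u. - f u) n x (y - f x) \<le> Cs * (1 + z + a) / sqrt n" by blast
  define F where "F = l1norm f"
  have F: "F \<ge> 0" unfolding F_def by (rule l1norm_nonneg)
  define R where "R = 1 + z + A + F"
  define C where "C = B * F * (Cs * (1 + z + A)) + Ck * R^3 * B"
  have Cp: "C > 0" unfolding C_def using B(1) Ck(1) Cs(1) F z A R_def by (intro add_nonneg_pos mult_pos_pos mult_nonneg_nonneg) auto
  have "\<bar>(kopd ^^ n) (fopd (\<lambda>x w. refl_kernel y 0 k w)) x (w - f x) + 2 * gd s2 1 (real k + real n) y * dual.W x (w - f x)\<bar>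
      \<le> C * (sqrt n / (real k)\<^sup>2 + 1 / (real k * sqrt n))"
    if k: "k \<ge> (1::nat)" and n: "n \<ge> (1::nat)" and w: "0 < w" "w \<le> z + A" "w - f x > 0" for k n y x w
  proof -
    define h where "h = refl_kernel y"
    have hs: "heat_seq s2 h" unfolding h_def by (rule heat_seq_refl_kernel)
    have kp: "real k > 0" "real k \<ge> 1" and np: "sqrt n > 0" using k n by auto
    define E where "E x w = fopd (\<lambda>x w. h 0 k w) x w - h 0 k w" for x w
    have E: "\<bar>E x w\<bar> \<le> B / k * F" for x w
    proof -
      have "E x w = (\<Sum>x'\<in>UNIV. Ps x x' * (h 0 k (w + - f x') - h 0 k w))"
        unfolding E_def fop_def by (simp add: right_diff_distrib sum_subtractf sum_distrib_right[symmetric] Ps_sum)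
      also have "\<bar>\<dots>\<bar> \<le> (\<Sum>x'\<in>UNIV. Ps x x' * (B / k * F))"
      proof (rule order_trans[OF sum_abs], rule sum_mono)
        fix x'
        have "\<bar>h 0 k (w + - f x') - (\<Sum>m<1. h (0 + m) k w / fact m * (- f x') ^ m)\<bar> \<le> B / k * \<bar>- f x'\<bar> ^ 1"
          by (rule heat_taylor_y[OF hs kp(1)]) (use B(2) kp in \<open>auto simp: h_def\<close>)
        then have "\<bar>h 0 k (w + - f x') - h 0 k w\<bar> \<le> B / k * \<bar>f x'\<bar>" by simp
        also have "\<dots> \<le> B / k * F" unfolding F_def using B(1) l1norm_bound[of f x'] by (intro mult_left_mono) auto
        finally show "\<bar>Ps x x' * (h 0 k (w + - f x') - h 0 k w)\<bar> \<le> Ps x x' * (B / k * F)"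
          unfolding abs_mult using Ps_nonneg[of x x'] mult_left_mono by fastforce
      qed
      finally show ?thesis unfolding sum_distrib_right[symmetric] Ps_sum by simp
    qed
    have s: "(kopd ^^ n) (fopd (\<lambda>x w. h 0 k w)) x (w - f x) = (kopd ^^ n) (\<lambda>x w. h 0 k w) x (w - f x) + (kopd ^^ n) E x (w - f x)"
      using kop_iter_diff[where P=Ps and f="\<lambda>u. - f u" and n=n and g="fopd (\<lambda>x w. h 0 k w)" and h="\<lambda>x w. h 0 k w" and x=x and y="w - f x"] unfolding E_def[abs_def] by simp
    have "\<bar>(kopd ^^ n) E x (w - f x)\<bar> \<le> B / k * F * dual.surv (\<lambda>u. - f u) n x (w - f x)"
      by (rule dual.kop_iter_sup_bound) (use E n in auto)
    also have "\<dots> \<le> B / k * F * (Cs * (1 + z + A) / sqrt n)"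
      using Cs(2) n z A w B(1) F by (intro mult_left_mono) auto
    finally have e1: "\<bar>(kopd ^^ n) E x (w - f x)\<bar> \<le> B * F * (Cs * (1 + z + A)) * (1 / (real k * sqrt n))" by simp
    \<comment> \<open>The slope of the odd kernel at the origin; the two images contribute equally,
      hence the factor 2.\<close>
    have h10: "h 1 (real k + real n) 0 = - 2 * gd s2 1 (real k + real n) y"
      unfolding h_def refl_kernel_def using gd_even(2)[of s2 "real k + real n" y] by simp
    have b3: "\<bar>h 3 t v\<bar> \<le> B / (real k)\<^sup>2 \<and> \<bar>h 4 t v\<bar> \<le> B / (real k)\<^sup>2" if "real k \<le> t" for t v
    proof -
      have "B / t\<^sup>2 \<le> B / (real k)\<^sup>2" using that kp B(1) by (intro divide_left_mono power_mono) auto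
      then show ?thesis unfolding h_def using B(2)[rule_format, of t y v] that kp by fastforce
    qed
    have b1: "\<bar>h 1 t v\<bar> \<le> B / k \<and> \<bar>h 2 t v\<bar> \<le> B / k" if "real k \<le> t" for t v
    proof -
      have "B / t \<le> B / k" using that kp B(1) by (intro divide_left_mono) auto
      then show ?thesis unfolding h_def using B(2)[rule_format, of t y v] that kp by fastforce
    qed
    have z0: "h 0 t 0 = 0 \<and> h 2 t 0 = 0" for t
      unfolding h_def refl_kernel_def using gd_even(1,3)[of s2 t y] by simp
    have y0: "w - f x \<ge> - l1norm (\<lambda>u. - f u)" using w(3) l1norm_nonneg[of "\<lambda>u. - f u"] by linarith
    have b4: "\<forall>t v. real k \<le> t --> t \<le> real k + real n --> \<bar>h 3 t v\<bar> \<le> B / (real k)\<^sup>2 \<and> \<bar>h 4 t v\<bar> \<le> B / (real k)\<^sup>2"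
      using b3 by blast
    have b5: "\<forall>t. real k \<le> t --> t \<le> real k + real n --> h 0 t 0 = 0 \<and> h 2 t 0 = 0" using z0 by blast
    have b6: "\<forall>v. \<bar>h 1 k v\<bar> \<le> B / k \<and> \<bar>h 2 k v\<bar> \<le> B / k" using b1 by blast
    have b7: "\<bar>h 1 (real k + real n) 0\<bar> \<le> B / k" using b1[of "real k + real n" 0] by simp
    have "\<bar>(kopd ^^ n) (\<lambda>x y. h 0 k y) x (w - f x) - h 1 (real k + real n) 0 * dual.W x (w - f x)\<bar> \<le> Ck * (1 + \<bar>w - f x\<bar>) ^ 3 * (B / (real k)\<^sup>2 * sqrt n + B / k / sqrt n)"
      using Ck(2) hs kp(1) n y0 b4 b5 b6 b7 by blast
    also have "\<dots> \<le> Ck * R ^ 3 * (B / (real k)\<^sup>2 * sqrt n + B / k / sqrt n)"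
    proof (intro mult_right_mono mult_left_mono power_mono)
      show "1 + \<bar>w - f x\<bar> \<le> R" unfolding R_def F_def using w l1norm_bound[of f x] by auto
    qed (use Ck(1) B(1) in auto)
    also have "\<dots> = Ck * R^3 * B * (sqrt n / (real k)\<^sup>2 + 1 / (real k * sqrt n))" by (simp add: algebra_simps)
    finally have e2: "\<bar>(kopd ^^ n) (\<lambda>x y. h 0 k y) x (w - f x) + 2 * gd s2 1 (real k + real n) y * dual.W x (w - f x)\<bar> \<le> Ck * R^3 * B * (sqrt n / (real k)\<^sup>2 + 1 / (real k * sqrt n))"
      unfolding h10 by simp
    have "B * F * (Cs * (1 + z + A)) * (1 / (real k * sqrt n)) \<le> B * F * (Cs * (1 + z + A)) * (sqrt n / (real k)\<^sup>2 + 1 / (real k * sqrt n))"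
      using B(1) F Cs(1) z A by (intro mult_left_mono) auto
    then have "\<bar>(kopd ^^ n) (fopd (\<lambda>x w. h 0 k w)) x (w - f x) + 2 * gd s2 1 (real k + real n) y * dual.W x (w - f x)\<bar>
       \<le> B * F * (Cs * (1 + z + A)) * (sqrt n / (real k)\<^sup>2 + 1 / (real k * sqrt n)) + Ck * R^3 * B * (sqrt n / (real k)\<^sup>2 + 1 / (real k * sqrt n))"
      using e1 e2 unfolding s by linarith
    then show ?thesis unfolding C_def h_def by (simp add: distrib_right)
  qed
  then show ?thesis using Cp by blast
qed

text \<open>Duality moves the killed steps onto the reflected kernel, where
  \<open>dual_kernel_estimate\<close> holds pointwise on the window; integration over the window
  produces \<open>limint\<close>.\<close>

lemma reflected_mass:
  assumes z: "z \<ge> 0" and A: "A > 0" and \<psi>: "\<forall>u. 0 \<le> \<psi> u \<and> \<psi> u \<le> M"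
  shows "\<exists>C>0. \<forall>k n y a. k \<ge> (1::nat) --> n \<ge> (1::nat) --> 0 < a --> a \<le> A -->
    \<bar>(\<Sum>x\<in>UNIV. \<nu> x * (LBINT w. refl_kernel y 0 k w * (kop P f ^^ (n + 2)) (win \<psi> z a) x w)) + 2 * gd s2 1 (real k + real n) y * limint \<psi> z a\<bar>
      \<le> C * (sqrt n / (real k)\<^sup>2 + 1 / (real k * sqrt n))"
proof -
  from dual_kernel_estimate[OF z A] obtain C where C: "C > 0" "\<forall>k n y x w. k \<ge> (1::nat) --> n \<ge> (1::nat) --> 0 < w --> w \<le> z + A --> w - f x > 0 -->
    \<bar>(kopd ^^ n) (fopd (\<lambda>x w. refl_kernel y 0 k w)) x (w - f x) + 2 * gd s2 1 (real k + real n) y * dual.W x (w - f x)\<bar>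
      \<le> C * (sqrt n / (real k)\<^sup>2 + 1 / (real k * sqrt n))" by blast
  from gd_bound[OF s2_pos, of 0] obtain G where G: "G > 0" "\<forall>s y. s > 0 --> \<bar>gd s2 0 s y\<bar> \<le> G / (sqrt s) ^ Suc 0" by blast
  from dW_bound[of "z + A"] obtain CW where CW: "CW > 0" "\<forall>x y. y \<le> z + A --> \<bar>dW x y\<bar> \<le> CW" by blast
  have M: "M \<ge> 0" using \<psi> order_trans by blast
  have "\<bar>(\<Sum>x\<in>UNIV. \<nu> x * (LBINT w. refl_kernel y 0 k w * (kop P f ^^ (n + 2)) (win \<psi> z a) x w)) + 2 * gd s2 1 (real k + real n) y * limint \<psi> z a\<bar>
      \<le> (C * M * A + 1) * (sqrt n / (real k)\<^sup>2 + 1 / (real k * sqrt n))"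
    if k: "k \<ge> (1::nat)" and n: "n \<ge> (1::nat)" and a: "0 < a" "a \<le> A" for k n y a
  proof -
    define q where "q = 2 * gd s2 1 (real k + real n) y"
    define r where "r = sqrt n / (real k)\<^sup>2 + 1 / (real k * sqrt n)"
    have r: "r \<ge> 0" unfolding r_def by simp
    define D where "D x w = (if w > 0 \<and> w - f x > 0 then (kopd ^^ n) (fopd (\<lambda>x w. refl_kernel y 0 k w)) x (w - f x) else 0)" for x w
    have hb: "\<bar>refl_kernel y 0 k w\<bar> \<le> 2 * (G / sqrt k)" for w
      unfolding refl_kernel_def using G(2)[rule_format, of k "w + - y"] G(2)[rule_format, of k "w + y"] k by auto
    have bm: "bmeas D" unfolding D_def[abs_def] by (rule bmeas_dual_iter[OF refl_kernel_measurable hb])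
    have Dm: "D x \<in> borel_measurable borel" for x using bm unfolding bmeas_def by blast
    obtain b where b: "\<And>x w. \<bar>D x w\<bar> \<le> b" using bm unfolding bmeas_def by blast
    have b0: "b \<ge> 0" using b order_trans[OF abs_ge_zero] by blast
    have i1: "integrable lborel (\<lambda>w. D x w * win \<psi> z a x w)" for x
      by (rule integral_mult_win_le(1)[OF \<psi> a(1) Dm b b0])
    have i2: "integrable lborel (\<lambda>w. dW x w * win \<psi> z a x w)" for x
      by (rule integral_mult_win_le(1)[OF \<psi> a(1) dW_measurable _ less_imp_le[OF CW(1)]]) (use CW(2) a in auto)
    have nw: "nice (win \<psi> z a)" using nice_win[of \<psi>] \<psi> by blast
    have "(\<Sum>x\<in>UNIV. \<nu> x * (LBINT w. refl_kernel y 0 k w * (kop P f ^^ (n + 2)) (win \<psi> z a) x w)) + q * limint \<psi> z a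
       = (\<Sum>x\<in>UNIV. \<nu> x * (LBINT w. D x w * win \<psi> z a x w)) + q * limint \<psi> z a"
      unfolding D_def duality[OF nw refl_kernel_measurable hb] ..
    also have "\<dots> = (\<Sum>x\<in>UNIV. \<nu> x * ((LBINT w. D x w * win \<psi> z a x w) + q * (LBINT w. dW x w * win \<psi> z a x w)))"
      unfolding limint_def by (simp add: sum_distrib_left sum.distrib distrib_left mult.left_commute)
    also have "\<dots> = (\<Sum>x\<in>UNIV. \<nu> x * (LBINT w. (D x w + q * dW x w) * win \<psi> z a x w))"
    proof (intro sum.cong refl arg_cong2[where f="(*)"])
      fix x
      have "(LBINT w. (D x w + q * dW x w) * win \<psi> z a x w) = (LBINT w. D x w * win \<psi> z a x w + q * (dW x w * win \<psi> z a x w))"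
        by (simp add: distrib_right mult.assoc)
      then show "(LBINT w. D x w * win \<psi> z a x w) + q * (LBINT w. dW x w * win \<psi> z a x w) = (LBINT w. (D x w + q * dW x w) * win \<psi> z a x w)"
        using i1 i2 by simp
    qed
    finally have e: "(\<Sum>x\<in>UNIV. \<nu> x * (LBINT w. refl_kernel y 0 k w * (kop P f ^^ (n + 2)) (win \<psi> z a) x w)) + q * limint \<psi> z a
       = (\<Sum>x\<in>UNIV. \<nu> x * (LBINT w. (D x w + q * dW x w) * win \<psi> z a x w))" .
    have "\<bar>\<Sum>x\<in>UNIV. \<nu> x * (LBINT w. (D x w + q * dW x w) * win \<psi> z a x w)\<bar> \<le> C * r * M * a"
    proof (rule nu_abs_le, rule integral_mult_win_le(2)[OF \<psi> a(1)])
      fix x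
      show "(\<lambda>w. D x w + q * dW x w) \<in> borel_measurable borel" using Dm[of x] dW_measurable[of x] by measurable
      show "\<bar>D x w + q * dW x w\<bar> \<le> C * r" if "w \<in> {z..z + a}" for w
        using C(2)[rule_format, OF k n, of w x y] that a C(1) r unfolding D_def dW_def q_def r_def[symmetric] by auto
    qed (use C(1) r in auto)
    also have "\<dots> \<le> (C * M * A + 1) * r"
    proof -
      have "C * r * M * a \<le> C * r * M * A" using C(1) r M a by (intro mult_left_mono) auto
      then show ?thesis using r by (simp add: algebra_simps)
    qed
    finally show ?thesis unfolding e[unfolded q_def] q_def r_def .
  qed
  then show ?thesis using C(1) M A by (intro exI[of _ "C * M * A + 1"]) (auto intro: add_nonneg_pos)
qed

end

context nonlattice_chain
begin

lemma window_bound_fixed: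
  assumes z: "z \<ge> 0" and A: "A > 0" and \<psi>: "\<forall>u. 0 \<le> \<psi> u \<and> \<psi> u \<le> M"
  shows "\<exists>C>0. \<forall>n a x y. n \<ge> (1::nat) --> 0 < a --> a \<le> A --> 0 \<le> (kop P f ^^ (n + 2)) (win \<psi> z a) x y \<and>
     (kop P f ^^ (n + 2)) (win \<psi> z a) x y \<le> C * (1 + max y 0) / (sqrt n) ^ 3"
proof -
  from window_bound obtain C where C: "C > 0" "\<forall>n\<ge>1. \<forall>\<psi> M a z x y. (\<forall>u. 0 \<le> \<psi> u \<and> \<psi> u \<le> M) --> a > 0 --> z \<ge> 0 -->
     (kop P f ^^ n) (win \<psi> z a) x y \<le> C * M * (1 + a) * (1 + z + a) * (1 + max y 0) / (sqrt n) ^ 3" by blast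
  have M: "M \<ge> 0" using \<psi> order_trans by blast
  define K where "K = C * M * (1 + A) * (1 + z + A) + 1"
  have K: "K > 0" "C * M * (1 + A) * (1 + z + A) \<le> K" unfolding K_def using C(1) M A z by (auto intro!: add_nonneg_pos)
  have "0 \<le> (kop P f ^^ (n + 2)) (win \<psi> z a) x y \<and> (kop P f ^^ (n + 2)) (win \<psi> z a) x y \<le> K * (1 + max y 0) / (sqrt n) ^ 3"
    if n: "n \<ge> 1" and a: "0 < a" "a \<le> A" for n a x y
  proof
    show "0 \<le> (kop P f ^^ (n + 2)) (win \<psi> z a) x y" using niceD(3)[OF nice_window] \<psi> by blast
    have n2: "n + 2 \<ge> 1" by simp
    have "(kop P f ^^ (n + 2)) (win \<psi> z a) x y \<le> C * M * (1 + a) * (1 + z + a) * (1 + max y 0) / (sqrt (n + 2)) ^ 3"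
      by (rule C(2)[rule_format, OF n2 \<psi>[rule_format] a(1) z])
    also have "\<dots> \<le> K * (1 + max y 0) / (sqrt n) ^ 3"
    proof (rule frac_le)
      have "C * M * (1 + a) * (1 + z + a) \<le> C * M * (1 + A) * (1 + z + A)"
        using C(1) M a z by (intro mult_mono mult_nonneg_nonneg) auto
      then show "C * M * (1 + a) * (1 + z + a) * (1 + max y 0) \<le> K * (1 + max y 0)" using K(2) by (intro mult_right_mono) auto
      show "(sqrt n) ^ 3 \<le> (sqrt (n + 2)) ^ 3" by (intro power_mono) auto
    qed (use K(1) n in auto)
    finally show "(kop P f ^^ (n + 2)) (win \<psi> z a) x y \<le> K * (1 + max y 0) / (sqrt n) ^ 3" .
  qed
  then show ?thesis using K(1) by blast
qed

text \<open>Adding the mirror image is nearly free: the carried-back window is at most n^(-3/2)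
  times a linear function of the height, and its integral against the Gaussian centred at -y is a
  first moment, of order sqrt k.\<close>

lemma gconv_window:
  assumes z: "z \<ge> 0" and A: "A > 0" and \<psi>: "\<forall>u. 0 \<le> \<psi> u \<and> \<psi> u \<le> M"
  shows "\<exists>C>0. \<forall>k n y a. k \<ge> (1::nat) --> n \<ge> (1::nat) --> 0 < a --> a \<le> A --> y > 0 -->
    \<bar>gconv ((kop P f ^^ (n + 2)) (win \<psi> z a)) k y + 2 * gd s2 1 (real k + real n) y * limint \<psi> z a\<bar>
      \<le> C * (sqrt n / (real k)\<^sup>2 + 1 / (real k * sqrt n) + sqrt k / (sqrt n) ^ 3)"
proof -
  from reflected_mass[OF z A \<psi>] obtain C1 where C1: "C1 > 0" "\<forall>k n y a. k \<ge> (1::nat) --> n \<ge> (1::nat) --> 0 < a --> a \<le> A -->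
    \<bar>(\<Sum>x\<in>UNIV. \<nu> x * (LBINT w. refl_kernel y 0 k w * (kop P f ^^ (n + 2)) (win \<psi> z a) x w)) + 2 * gd s2 1 (real k + real n) y * limint \<psi> z a\<bar>
      \<le> C1 * (sqrt n / (real k)\<^sup>2 + 1 / (real k * sqrt n))" by blast
  from window_bound_fixed[OF z A \<psi>] obtain C2 where C2: "C2 > 0" "\<forall>n a x y. n \<ge> (1::nat) --> 0 < a --> a \<le> A --> 0 \<le> (kop P f ^^ (n + 2)) (win \<psi> z a) x y \<and>
     (kop P f ^^ (n + 2)) (win \<psi> z a) x y \<le> C2 * (1 + max y 0) / (sqrt n) ^ 3" by blast
  from gd0_abs_moment[OF s2_pos] obtain C3 where C3: "C3 > 0" "\<forall>s\<ge>1. integrable lborel (\<lambda>w. (1 + \<bar>w\<bar>) * gd s2 0 s w) \<and> (LBINT w. (1 + \<bar>w\<bar>) * gd s2 0 s w) \<le> C3 * sqrt s" by blast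
  from gd_bound[OF s2_pos, of 0] obtain G where G: "G > 0" "\<forall>s y. s > 0 --> \<bar>gd s2 0 s y\<bar> \<le> G / (sqrt s) ^ Suc 0" by blast
  have "\<bar>gconv ((kop P f ^^ (n + 2)) (win \<psi> z a)) k y + 2 * gd s2 1 (real k + real n) y * limint \<psi> z a\<bar>
      \<le> (C1 + C2 * C3) * (sqrt n / (real k)\<^sup>2 + 1 / (real k * sqrt n) + sqrt k / (sqrt n) ^ 3)"
    if k: "k \<ge> (1::nat)" and n: "n \<ge> (1::nat)" and a: "0 < a" "a \<le> A" and y: "y > 0" for k n y a
  proof -
    define g where "g = (kop P f ^^ (n + 2)) (win \<psi> z a)"
    have ng: "nice g" unfolding g_def by (rule nice_window) (use \<psi> in auto)
    define q where "q = 2 * gd s2 1 (real k + real n) y"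
    have gm: "(\<lambda>w. gd s2 0 k (w + y)) \<in> borel_measurable borel" by measurable
    have gb: "\<bar>gd s2 0 k (w + y)\<bar> \<le> G / sqrt k" for w using G(2) k by auto
    have rb: "\<bar>refl_kernel y 0 k w\<bar> \<le> 2 * (G / sqrt k)" for w
      unfolding refl_kernel_def using G(2)[rule_format, of k "w + - y"] G(2)[rule_format, of k "w + y"] k by auto
    have i1: "integrable lborel (\<lambda>w. g x w * gd s2 0 k (w + y))" for x
      by (rule integrable_bounded_mult[OF niceD(2)[OF ng] gm gb])
    have i2: "integrable lborel (\<lambda>w. refl_kernel y 0 k w * g x w)" for x
      using integrable_bounded_mult[OF niceD(2)[OF ng] refl_kernel_measurable rb] by (simp add: mult.commute)
    have pt: "g x w * gd s2 0 k (w - y) = refl_kernel y 0 k w * g x w + g x w * gd s2 0 k (w + y)" for x w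
      unfolding refl_kernel_def by (simp add: algebra_simps)
    have e: "gconv g k y = (\<Sum>x\<in>UNIV. \<nu> x * (LBINT w. refl_kernel y 0 k w * g x w)) + (\<Sum>x\<in>UNIV. \<nu> x * (LBINT w. g x w * gd s2 0 k (w + y)))"
      unfolding gconv_def pt sum.distrib[symmetric] distrib_left[symmetric] Bochner_Integration.integral_add[OF i2 i1] ..
    define b where "b = C2 / (sqrt n) ^ 3"
    have b: "b > 0" unfolding b_def using C2(1) n by simp
    define H where "H w = (1 + \<bar>w\<bar>) * gd s2 0 k w" for w
    have kk: "real k \<ge> 1" using k by simp
    have Hi: "integrable lborel H" "(LBINT w. H w) \<le> C3 * sqrt k" using C3(2)[rule_format, OF kk] unfolding H_def[abs_def] by auto
    have Hi2: "integrable lborel (\<lambda>w. H (y + w))" by (rule integrable_translate[OF Hi(1)])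
    have "\<bar>\<Sum>x\<in>UNIV. \<nu> x * (LBINT w. g x w * gd s2 0 k (w + y))\<bar> \<le> b * (C3 * sqrt k)"
    proof (rule nu_abs_le)
      fix x
      have g0: "0 \<le> gd s2 0 k v" for v using s2_pos by (simp add: gd_0)
      \<comment> \<open>Since y > 0, the positive part of w is at most its distance to the mirror
        centre -y; this makes the bound uniform in y.\<close>
      have p: "\<bar>g x w * gd s2 0 k (w + y)\<bar> \<le> b * H (y + w)" for w
      proof -
        have "g x w \<le> C2 * (1 + max w 0) / (sqrt n) ^ 3" using C2(2) n a unfolding g_def by blast
        also have "\<dots> = b * (1 + max w 0)" unfolding b_def by simp
        also have "\<dots> \<le> b * (1 + \<bar>y + w\<bar>)" using b y by (intro mult_left_mono) auto
        finally have "g x w * gd s2 0 k (w + y) \<le> b * (1 + \<bar>y + w\<bar>) * gd s2 0 k (w + y)" using g0 by (rule mult_right_mono)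
        then show ?thesis using g0[of "w + y"] niceD(3)[OF ng, of x w] unfolding H_def by (simp add: abs_mult ac_simps)
      qed
      have "\<bar>LBINT w. g x w * gd s2 0 k (w + y)\<bar> \<le> (LBINT w. b * H (y + w))"
        by (rule order_trans[OF integral_abs_bound], rule integral_mono) (use i1 Hi2 p in auto)
      also have "\<dots> = b * (LBINT w. H w)" using integral_translate[of H y] by simp
      also have "\<dots> \<le> b * (C3 * sqrt k)" using Hi(2) b by (intro mult_left_mono) auto
      finally show "\<bar>LBINT w. g x w * gd s2 0 k (w + y)\<bar> \<le> b * (C3 * sqrt k)" .
    qed
    moreover have "b * (C3 * sqrt k) = C2 * C3 * (sqrt k / (sqrt n) ^ 3)" unfolding b_def by simp
    moreover have "\<bar>(\<Sum>x\<in>UNIV. \<nu> x * (LBINT w. refl_kernel y 0 k w * g x w)) + q * limint \<psi> z a\<bar> \<le> C1 * (sqrt n / (real k)\<^sup>2 + 1 / (real k * sqrt n))"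
      unfolding g_def q_def using C1(2) k n a by blast
    ultimately have "\<bar>gconv g k y + q * limint \<psi> z a\<bar> \<le> C1 * (sqrt n / (real k)\<^sup>2 + 1 / (real k * sqrt n)) + C2 * C3 * (sqrt k / (sqrt n) ^ 3)"
      unfolding e by linarith
    also have "\<dots> \<le> (C1 + C2 * C3) * (sqrt n / (real k)\<^sup>2 + 1 / (real k * sqrt n)) + (C1 + C2 * C3) * (sqrt k / (sqrt n) ^ 3)"
      using C1(1) C2(1) C3(1) by (intro add_mono mult_right_mono) auto
    finally show ?thesis unfolding g_def q_def by (simp only: distrib_left)
  qed
  then show ?thesis using C1(1) C2(1) C3(1) by (intro exI[of _ "C1 + C2 * C3"]) (auto intro!: add_pos_pos)
qed

text \<open>A free path that should have been killed is at a height at most 0 at that moment. From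
  there it reaches height O(sqrt k) in mean in the steps left, where the carried-back window is
  O(sqrt k / n^(3/2)).\<close>

lemma killing_error:
  assumes z: "z \<ge> 0" and A: "A > 0" and \<psi>: "\<forall>u. 0 \<le> \<psi> u \<and> \<psi> u \<le> M"
  shows "\<exists>C>0. \<forall>k n x y a. k \<ge> (1::nat) --> n \<ge> (1::nat) --> 0 < a --> a \<le> A --> y > 0 -->
    (fop P f ^^ k) ((kop P f ^^ (n + 2)) (win \<psi> z a)) x y - (kop P f ^^ k) ((kop P f ^^ (n + 2)) (win \<psi> z a)) x y
      \<le> C * (sqrt k / (sqrt n) ^ 3)"
proof -
  from window_bound_fixed[OF z A \<psi>] obtain C2 where C2: "C2 > 0" "\<forall>n a x y. n \<ge> (1::nat) --> 0 < a --> a \<le> A --> 0 \<le> (kop P f ^^ (n + 2)) (win \<psi> z a) x y \<and>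
     (kop P f ^^ (n + 2)) (win \<psi> z a) x y \<le> C2 * (1 + max y 0) / (sqrt n) ^ 3" by blast
  from abs_moment obtain C3 where C3: "C3 > 0" "\<forall>n x y. (fop P f ^^ n) (\<lambda>x w. \<bar>w - y\<bar>) x y \<le> C3 * sqrt (1 + real n)" by blast
  have "(fop P f ^^ k) ((kop P f ^^ (n + 2)) (win \<psi> z a)) x y - (kop P f ^^ k) ((kop P f ^^ (n + 2)) (win \<psi> z a)) x y
      \<le> (C2 * (1 + C3)) * (sqrt k / (sqrt n) ^ 3)"
    if k: "k \<ge> (1::nat)" and n: "n \<ge> (1::nat)" and a: "0 < a" "a \<le> A" and y: "y > 0" for k n x y a
  proof -
    define g where "g = (kop P f ^^ (n + 2)) (win \<psi> z a)"
    have g0: "0 \<le> g x w" for x w unfolding g_def using niceD(3)[OF nice_window] \<psi> by blast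
    define b where "b = C2 / (sqrt n) ^ 3"
    have b: "b > 0" unfolding b_def using C2(1) n by simp
    have gb: "g x w \<le> b * (1 + max w 0)" for x w
    proof -
      have "g x w \<le> C2 * (1 + max w 0) / (sqrt n) ^ 3" using C2(2) n a unfolding g_def by blast
      then show ?thesis unfolding b_def by simp
    qed
    define c where "c = b * (1 + C3) * sqrt k"
    \<comment> \<open>For a start w \<le> 0 the final height is at most the displacement, whose
      first moment is known.\<close>
    have c: "\<bar>(fop P f ^^ i) g x w\<bar> \<le> c" if i: "i < k" and w: "w \<le> 0" for i x w
    proof -
      have "(fop P f ^^ i) g x w \<le> (fop P f ^^ i) (\<lambda>x v. b * (1 + \<bar>v - w\<bar>)) x w"
      proof (rule fop_iter_mono)
        fix x v
        have "b * (1 + max v 0) \<le> b * (1 + \<bar>v - w\<bar>)" using b w by (intro mult_left_mono) auto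
        then show "g x v \<le> b * (1 + \<bar>v - w\<bar>)" using gb[of x v] by linarith
      qed
      also have "\<dots> = b * (1 + (fop P f ^^ i) (\<lambda>x v. \<bar>v - w\<bar>) x w)"
        by (simp only: fop_iter_mult fop_iter_add fop_iter_const)
      also have "\<dots> \<le> b * (1 + C3 * sqrt (1 + real i))" using C3(2) b by (intro mult_left_mono add_left_mono) auto
      also have "\<dots> \<le> b * (sqrt k + C3 * sqrt k)" using i b C3(1) by (intro mult_left_mono add_mono) auto
      finally show ?thesis using fop_iter_nonneg[of g i f x w] g0 unfolding c_def by (simp add: algebra_simps)
    qed
    have c0: "c \<ge> 0" unfolding c_def using b C3(1) by simp
    have tm: "\<bar>(kop P f ^^ j) (\<lambda>x y. kop P f ((fop P f ^^ (k - 1 - j)) g) x y - (fop P f ^^ (k - j)) g x y) x y\<bar>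
        \<le> c * (surv f j x y - surv f (Suc j) x y)" if j: "j < k" for j
    proof -
      have "\<bar>(kop P f ^^ j) (\<lambda>x y. kop P f ((fop P f ^^ (k - 1 - j)) g) x y - (fop P f ^^ (k - j)) g x y) x y\<bar> \<le> (kop P f ^^ j) (\<lambda>x y. c * exit1 x y) x y"
      proof (rule kop_iter_abs_le)
        fix x' y' :: _ assume y': "(y'::real) > 0"
        have s: "k - j = Suc (k - 1 - j)" using j by simp
        have "\<bar>fop P f ((fop P f ^^ (k - 1 - j)) g) x' y' - kop P f ((fop P f ^^ (k - 1 - j)) g) x' y'\<bar> \<le> c * exit1 x' y'"
          by (rule kop_exit_bound) (use y' l1norm_nonneg[of f] c[of "k - 1 - j"] j in auto)
        then show "\<bar>kop P f ((fop P f ^^ (k - 1 - j)) g) x' y' - (fop P f ^^ (k - j)) g x' y'\<bar> \<le> c * exit1 x' y'"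
          unfolding s by (simp add: abs_minus_commute)
      qed (use y in simp)
      then show ?thesis by (simp only: kop_iter_mult kop_iter_exit1)
    qed
    have "(kop P f ^^ k) g x y = (fop P f ^^ k) g x y + (\<Sum>j<k. (kop P f ^^ j) (\<lambda>x y. kop P f ((fop P f ^^ (k - 1 - j)) g) x y - (fop P f ^^ (k - j)) g x y) x y)"
      using kop_telescope[of k "\<lambda>i. (fop P f ^^ i) g" x y] by simp
    then have "(fop P f ^^ k) g x y - (kop P f ^^ k) g x y \<le> \<bar>\<Sum>j<k. (kop P f ^^ j) (\<lambda>x y. kop P f ((fop P f ^^ (k - 1 - j)) g) x y - (fop P f ^^ (k - j)) g x y) x y\<bar>"
      by linarith
    also have "\<dots> \<le> (\<Sum>j<k. c * (surv f j x y - surv f (Suc j) x y))"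
      by (rule order_trans[OF sum_abs], rule sum_mono) (use tm in auto)
    \<comment> \<open>The exit probabilities telescope to a quantity at most 1, so the number of
      steps does not enter again.\<close>
    also have "\<dots> = c * (surv f 0 x y - surv f k x y)"
      unfolding sum_distrib_left[symmetric] sum_lessThan_telescope'[of "\<lambda>j. surv f j x y"] ..
    also have "\<dots> \<le> c * 1" using c0 surv_range(1)[of f k x y] surv_range(2)[of f 0 x y] by (intro mult_left_mono) linarith+
    finally show ?thesis unfolding g_def c_def b_def by (simp add: ac_simps)
  qed
  then show ?thesis using C2(1) C3(1) by (intro exI[of _ "C2 * (1 + C3)"]) (auto intro!: mult_pos_pos add_pos_pos)
qed

end

text \<open>With k about \<epsilon> m, the first two errors are O(m^(-3/2)) with a constant
  depending on \<epsilon>, and the third is O(sqrt \<epsilon> / m): only the last one needs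
  \<epsilon> small.\<close>

lemma split_bounds:
  fixes \<epsilon> :: real and m k n :: nat
  assumes \<epsilon>: "0 < \<epsilon>" "\<epsilon> \<le> 1/2" and m: "\<epsilon> * m \<ge> 2" and k: "k = nat \<lfloor>\<epsilon> * m\<rfloor>" and n: "n = m - k"
  shows "k \<ge> 1" "n \<ge> 1" "m = k + n"
    "sqrt n / (real k)\<^sup>2 + 1 / (real k * sqrt n) + sqrt k / (sqrt n) ^ 3 \<le> ((16 / \<epsilon>\<^sup>2 + 4 / \<epsilon>) / sqrt m + 8 * sqrt \<epsilon>) / m"
    "sqrt k / (sqrt n) ^ 3 \<le> ((16 / \<epsilon>\<^sup>2 + 4 / \<epsilon>) / sqrt m + 8 * sqrt \<epsilon>) / m"
    "1 / (sqrt k * sqrt n) \<le> 4 / (sqrt \<epsilon> * m)"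
proof -
  have fl: "real k = of_int \<lfloor>\<epsilon> * m\<rfloor>" unfolding k using m by simp
  have kl: "\<epsilon> * m / 2 \<le> k" "k \<le> \<epsilon> * m" unfolding fl using m by linarith+
  have km: "\<epsilon> * m \<le> m / 2" using mult_right_mono[OF \<epsilon>(2), of m] by simp
  have kn: "k \<le> m" using kl km by linarith
  have mp: "real m > 0" using m \<epsilon> by (cases "m = 0") auto
  have nr: "real n = real m - real k" unfolding n using kn by simp
  have nl: "m / 2 \<le> n" "n \<le> m" using nr kl km by linarith+
  show k1: "k \<ge> 1" using kl m by (cases k) auto
  show n1: "n \<ge> 1" using nl mp by (cases n) auto
  show "m = k + n" using n kn by simp
  define s where "s = sqrt m"
  define t where "t = sqrt \<epsilon>"
  have s: "s > 0" "s * s = m" unfolding s_def using mp by auto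
  have t: "t > 0" "t * t = \<epsilon>" unfolding t_def using \<epsilon> by auto
  have n_up: "sqrt n \<le> s" unfolding s_def using nl by simp
  have "sqrt (m / 4) \<le> sqrt n" using nl by (intro real_sqrt_le_mono) linarith
  then have n_lo: "s / 2 \<le> sqrt n" unfolding s_def by (simp add: real_sqrt_divide)
  have k_up: "sqrt k \<le> t * s" unfolding t_def s_def real_sqrt_mult[symmetric] using kl by simp
  have "sqrt (\<epsilon> * m / 4) \<le> sqrt k" using kl m by (intro real_sqrt_le_mono) linarith
  then have k_lo: "t * s / 2 \<le> sqrt k" unfolding t_def s_def by (simp add: real_sqrt_divide real_sqrt_mult)
  have k2: "t * t * (s * s) / 2 \<le> k" unfolding s t using kl by simp
  have A: "sqrt n / (real k)\<^sup>2 \<le> s / (t * t * (s * s) / 2)\<^sup>2"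
    using n_up k2 s(1) t(1) by (intro frac_le power_mono) auto
  have B: "1 / (real k * sqrt n) \<le> 1 / ((t * t * (s * s) / 2) * (s / 2))"
    using k2 n_lo s(1) t(1) k1 n1 by (intro divide_left_mono mult_mono mult_pos_pos) auto
  have C: "sqrt k / (sqrt n) ^ 3 \<le> t * s / (s / 2) ^ 3"
    using k_up n_lo s t by (intro frac_le power_mono) auto
  have "s / (t * t * (s * s) / 2)\<^sup>2 + 1 / ((t * t * (s * s) / 2) * (s / 2)) + t * s / (s / 2) ^ 3
      = ((4 / (t * t)\<^sup>2 + 4 / (t * t)) / s + 8 * t) / (s * s)"
    using s(1) t(1) by (simp add: field_simps power2_eq_square power3_eq_cube)
  also have "\<dots> \<le> ((16 / (t * t)\<^sup>2 + 4 / (t * t)) / s + 8 * t) / (s * s)"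
    using s(1) t(1) by (intro divide_right_mono add_mono) auto
  finally have D: "s / (t * t * (s * s) / 2)\<^sup>2 + 1 / ((t * t * (s * s) / 2) * (s / 2)) + t * s / (s / 2) ^ 3 \<le> ((16 / \<epsilon>\<^sup>2 + 4 / \<epsilon>) / sqrt m + 8 * sqrt \<epsilon>) / m"
    unfolding s(2) t(2) unfolding s_def t_def .
  show E: "sqrt n / (real k)\<^sup>2 + 1 / (real k * sqrt n) + sqrt k / (sqrt n) ^ 3 \<le> ((16 / \<epsilon>\<^sup>2 + 4 / \<epsilon>) / sqrt m + 8 * sqrt \<epsilon>) / m"
    using A B C D by linarith
  have "0 \<le> sqrt n / (real k)\<^sup>2" "0 \<le> 1 / (real k * sqrt n)" by simp_all
  then show "sqrt k / (sqrt n) ^ 3 \<le> ((16 / \<epsilon>\<^sup>2 + 4 / \<epsilon>) / sqrt m + 8 * sqrt \<epsilon>) / m" using E by linarith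
  have "1 / (sqrt k * sqrt n) \<le> 1 / ((t * s / 2) * (s / 2))"
    using k_lo n_lo s t k1 n1 by (intro divide_left_mono mult_mono mult_pos_pos) auto
  also have "\<dots> = 4 / (t * (s * s))" by simp
  finally show "1 / (sqrt k * sqrt n) \<le> 4 / (sqrt \<epsilon> * m)" unfolding s(2) unfolding t_def .
qed

context nonlattice_chain
begin

text \<open>Dropping the killing helps from above; from below it costs \<open>killing_error\<close>.
  The local limit errors carry the mass of the carried-back window, hence the factor 1/(sqrt k sqrt
  n). The threshold \<open>K0\<close> does not depend on n, x or y.\<close>

lemma window_sandwich:
  assumes z: "z \<ge> 0" and a: "a > 0" and \<psi>: "\<forall>u. 0 \<le> \<psi> u \<and> \<psi> u \<le> M"
  shows "\<exists>C>0. \<forall>\<delta> \<zeta>. 0 < \<delta> --> \<delta> \<le> 1 --> \<delta> < a --> 0 < \<zeta> --> \<zeta> \<le> 1 --> (\<exists>K0. \<forall>k n x y. k \<ge> K0 --> k \<ge> 1 --> n \<ge> (1::nat) --> y > 0 -->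
     (kop P f ^^ (k + n + 2)) (win \<psi> z a) x y \<le> gconv ((kop P f ^^ (n + 2)) (win \<psi> z (a + \<delta>))) k y + C * \<zeta> * (1 / (sqrt k * sqrt n)) \<and>
     (kop P f ^^ (k + n + 2)) (win \<psi> z a) x y \<ge> gconv ((kop P f ^^ (n + 2)) (win \<psi> z (a - \<delta>))) k y - C * \<zeta> * (1 / (sqrt k * sqrt n)) - C * (sqrt k / (sqrt n) ^ 3))"
proof -
  define A where "A = a + 1"
  have A: "A > 0" unfolding A_def using a by simp
  have M: "M \<ge> 0" using \<psi> order_trans by blast
  from killing_error[OF z A \<psi>] obtain C2 where C2: "C2 > 0" "\<forall>k n x y a. k \<ge> (1::nat) --> n \<ge> (1::nat) --> 0 < a --> a \<le> A --> y > 0 -->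
    (fop P f ^^ k) ((kop P f ^^ (n + 2)) (win \<psi> z a)) x y - (kop P f ^^ k) ((kop P f ^^ (n + 2)) (win \<psi> z a)) x y
      \<le> C2 * (sqrt k / (sqrt n) ^ 3)" by blast
  from mass_window obtain C3 where C3: "C3 > 0" "\<forall>n\<ge>1. \<forall>\<psi> M a z. (\<forall>u. 0 \<le> \<psi> u \<and> \<psi> u \<le> M) --> a > 0 --> z \<ge> 0 -->
     mass ((kop P f ^^ (n + 2)) (win \<psi> z a)) \<le> C3 * M * a * (1 + z + a) / sqrt n" by blast
  from gconv_bound obtain C4 where C4: "C4 > 0" "\<forall>g s y. nice g --> s > 0 --> 0 \<le> gconv g s y \<and> gconv g s y \<le> C4 / sqrt s * mass g" by blast
  define Q where "Q = C3 * M * A * (1 + z + A)"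
  have Q: "Q \<ge> 0" unfolding Q_def using C3(1) M A z by simp
  have mQ: "mass ((kop P f ^^ (n + 2)) (win \<psi> z b)) \<le> Q / sqrt n" if n: "n \<ge> 1" and b: "0 < b" "b \<le> A" for n b
  proof -
    have "mass ((kop P f ^^ (n + 2)) (win \<psi> z b)) \<le> C3 * M * b * (1 + z + b) / sqrt n"
      by (rule C3(2)[rule_format, OF n \<psi>[rule_format] b(1) z])
    also have "\<dots> \<le> Q / sqrt n" unfolding Q_def using C3(1) M b z by (intro divide_right_mono mult_mono mult_nonneg_nonneg) auto
    finally show ?thesis .
  qed
  define C where "C = (C4 + 1) * Q + C2"
  have C: "C > 0" "(C4 + 1) * Q \<le> C" "C2 \<le> C" unfolding C_def using C2(1) C4(1) Q by (auto intro!: add_nonneg_pos)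
  have ng: "nice ((kop P f ^^ (n + 2)) (win \<psi> z b))" for n b by (rule nice_window) (use \<psi> in auto)
  have ks: "(kop P f ^^ (k + n + 2)) (win \<psi> z a) x y = (kop P f ^^ k) ((kop P f ^^ (n + 2)) (win \<psi> z a)) x y" for k n x y
    by (simp only: add.assoc funpow_add_apply)
  have "\<exists>K0. \<forall>k n x y. k \<ge> K0 --> k \<ge> 1 --> n \<ge> (1::nat) --> y > 0 -->
     (kop P f ^^ (k + n + 2)) (win \<psi> z a) x y \<le> gconv ((kop P f ^^ (n + 2)) (win \<psi> z (a + \<delta>))) k y + C * \<zeta> * (1 / (sqrt k * sqrt n)) \<and>
     (kop P f ^^ (k + n + 2)) (win \<psi> z a) x y \<ge> gconv ((kop P f ^^ (n + 2)) (win \<psi> z (a - \<delta>))) k y - C * \<zeta> * (1 / (sqrt k * sqrt n)) - C * (sqrt k / (sqrt n) ^ 3)"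
    if \<delta>: "0 < \<delta>" "\<delta> \<le> 1" "\<delta> < a" and \<zeta>: "0 < \<zeta>" "\<zeta> \<le> 1" for \<delta> \<zeta>
  proof -
    obtain K1 where K1: "\<forall>k\<ge>K1. \<forall>g h x y. nice g --> (\<forall>x y v. 0 \<le> v --> v \<le> \<delta> --> h x y \<le> g x (y + v)) -->
     (fop P f ^^ k) h x y \<le> (1 + \<zeta>) * gconv g k y + \<zeta> / sqrt k * mass g" using fop_upper[OF \<delta>(1) \<zeta>] by blast
    obtain K2 where K2: "\<forall>k\<ge>K2. \<forall>g h x y. nice g --> nice h --> (\<forall>x y v. 0 \<le> v --> v \<le> \<delta> --> h x y \<le> g x (y + v)) -->
     (fop P f ^^ k) g x y \<ge> gconv h k y - \<zeta> / sqrt k * mass g" using fop_lower[OF \<delta>(1) \<zeta>(1)] by blast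
    have "(kop P f ^^ (k + n + 2)) (win \<psi> z a) x y \<le> gconv ((kop P f ^^ (n + 2)) (win \<psi> z (a + \<delta>))) k y + C * \<zeta> * (1 / (sqrt k * sqrt n)) \<and>
     (kop P f ^^ (k + n + 2)) (win \<psi> z a) x y \<ge> gconv ((kop P f ^^ (n + 2)) (win \<psi> z (a - \<delta>))) k y - C * \<zeta> * (1 / (sqrt k * sqrt n)) - C * (sqrt k / (sqrt n) ^ 3)"
      if k: "k \<ge> max K1 K2" "k \<ge> 1" and n: "n \<ge> 1" and y: "y > 0" for k n x y
    proof
      define r where "r = 1 / (sqrt k * sqrt n)"
      have r: "r \<ge> 0" unfolding r_def by simp
      have kr: "real k > 0" using k by simp
      define g where "g b = (kop P f ^^ (n + 2)) (win \<psi> z b)" for b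
      have dom: "g b x y \<le> g (b + \<delta>) x (y + v)" if "0 \<le> v" "v \<le> \<delta>" for b x y v
        unfolding g_def by (rule window_shift) (use that \<psi> in auto)
      have mr: "1 / sqrt k * mass (g b) \<le> Q * r" if "0 < b" "b \<le> A" for b
      proof -
        have "1 / sqrt k * mass (g b) \<le> 1 / sqrt k * (Q / sqrt n)" unfolding g_def using mQ[OF n that] by (intro mult_left_mono) auto
        then show ?thesis unfolding r_def by simp
      qed
      have ad: "0 < a + \<delta>" "a + \<delta> \<le> A" "a \<le> A" unfolding A_def using a \<delta> by auto
      have "(kop P f ^^ k) (g a) x y \<le> (fop P f ^^ k) (g a) x y"
        using kop_iter_le_fop_iter niceD(3)[OF ng] unfolding g_def by blast
      also have "\<dots> \<le> (1 + \<zeta>) * gconv (g (a + \<delta>)) k y + \<zeta> / sqrt k * mass (g (a + \<delta>))"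
        using K1 k ng dom unfolding g_def by auto
      also have "\<dots> = gconv (g (a + \<delta>)) k y + \<zeta> * (gconv (g (a + \<delta>)) k y + 1 / sqrt k * mass (g (a + \<delta>)))"
        by (simp add: algebra_simps)
      also have "\<dots> \<le> gconv (g (a + \<delta>)) k y + \<zeta> * (C4 * (Q * r) + Q * r)"
      proof -
        have "gconv (g (a + \<delta>)) k y \<le> C4 / sqrt k * mass (g (a + \<delta>))" using C4(2) ng kr unfolding g_def by blast
        also have "\<dots> = C4 * (1 / sqrt k * mass (g (a + \<delta>)))" by simp
        also have "\<dots> \<le> C4 * (Q * r)" using mr[OF ad(1,2)] C4(1) by (intro mult_left_mono) auto
        finally have "gconv (g (a + \<delta>)) k y \<le> C4 * (Q * r)" .
        then show ?thesis using mr[OF ad(1,2)] \<zeta>(1) by (intro add_left_mono mult_left_mono add_mono) auto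
      qed
      also have "\<zeta> * (C4 * (Q * r) + Q * r) = ((C4 + 1) * Q) * \<zeta> * r" by (simp add: algebra_simps)
      also have "gconv (g (a + \<delta>)) k y + ((C4 + 1) * Q) * \<zeta> * r \<le> gconv (g (a + \<delta>)) k y + C * \<zeta> * r"
        using C(2) \<zeta> r by (intro add_left_mono mult_right_mono) auto
      finally show "(kop P f ^^ (k + n + 2)) (win \<psi> z a) x y \<le> gconv ((kop P f ^^ (n + 2)) (win \<psi> z (a + \<delta>))) k y + C * \<zeta> * (1 / (sqrt k * sqrt n))"
        unfolding ks g_def r_def .
      have l1: "gconv (g (a - \<delta>)) k y - \<zeta> / sqrt k * mass (g a) \<le> (fop P f ^^ k) (g a) x y"
        using K2 k ng dom[of _ "a - \<delta>"] unfolding g_def by auto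
      have "\<zeta> / sqrt k * mass (g a) = \<zeta> * (1 / sqrt k * mass (g a))" by simp
      also have "\<dots> \<le> \<zeta> * (Q * r)" using mr[OF a ad(3)] \<zeta> by (intro mult_left_mono) auto
      also have "\<dots> = Q * \<zeta> * r" by simp
      also have "\<dots> \<le> C * \<zeta> * r"
      proof -
        have "Q \<le> (C4 + 1) * Q" using Q C4(1) by (simp add: algebra_simps)
        then show ?thesis using C(2) \<zeta> r by (intro mult_right_mono) auto
      qed
      finally have l2: "\<zeta> / sqrt k * mass (g a) \<le> C * \<zeta> * r" .
      have l3: "(fop P f ^^ k) (g a) x y - (kop P f ^^ k) (g a) x y \<le> C2 * (sqrt k / (sqrt n) ^ 3)"
        unfolding g_def using C2(2) k n a ad y by blast
      have l4: "C2 * (sqrt k / (sqrt n) ^ 3) \<le> C * (sqrt k / (sqrt n) ^ 3)" using C(3) by (intro mult_right_mono) auto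
      from l1 l2 l3 l4 show "(kop P f ^^ (k + n + 2)) (win \<psi> z a) x y \<ge> gconv ((kop P f ^^ (n + 2)) (win \<psi> z (a - \<delta>))) k y - C * \<zeta> * (1 / (sqrt k * sqrt n)) - C * (sqrt k / (sqrt n) ^ 3)"
        unfolding ks g_def r_def by linarith
    qed
    then show ?thesis by blast
  qed
  then show ?thesis using C(1) by blast
qed

text \<open>Uniformity over all y > 0 is the point: the estimate will be inserted under further
  killed steps, where the height is random but positive.\<close>

theorem bulk_asymptotics:
  assumes z: "z \<ge> 0" and a: "a > 0" and \<psi>: "\<forall>u. 0 \<le> \<psi> u \<and> \<psi> u \<le> M" and \<eta>: "\<eta> > 0"
  shows "\<exists>N. \<forall>m\<ge>N. \<forall>x y. y > 0 --> \<bar>(kop P f ^^ (m + 2)) (win \<psi> z a) x y + 2 * gd s2 1 m y * limint \<psi> z a\<bar> \<le> \<eta> / m"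
proof -
  define A where "A = a + 1"
  have A: "A > 0" unfolding A_def using a by simp
  from gconv_window[OF z A \<psi>] obtain C1 where C1: "C1 > 0" "\<forall>k n y a. k \<ge> (1::nat) --> n \<ge> (1::nat) --> 0 < a --> a \<le> A --> y > 0 -->
    \<bar>gconv ((kop P f ^^ (n + 2)) (win \<psi> z a)) k y + 2 * gd s2 1 (real k + real n) y * limint \<psi> z a\<bar>
      \<le> C1 * (sqrt n / (real k)\<^sup>2 + 1 / (real k * sqrt n) + sqrt k / (sqrt n) ^ 3)" by blast
  from window_sandwich[OF z a \<psi>] obtain C2 where C2: "C2 > 0" "\<forall>\<delta> \<zeta>. 0 < \<delta> --> \<delta> \<le> 1 --> \<delta> < a --> 0 < \<zeta> --> \<zeta> \<le> 1 --> (\<exists>K0. \<forall>k n x y. k \<ge> K0 --> k \<ge> 1 --> n \<ge> (1::nat) --> y > 0 -->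
     (kop P f ^^ (k + n + 2)) (win \<psi> z a) x y \<le> gconv ((kop P f ^^ (n + 2)) (win \<psi> z (a + \<delta>))) k y + C2 * \<zeta> * (1 / (sqrt k * sqrt n)) \<and>
     (kop P f ^^ (k + n + 2)) (win \<psi> z a) x y \<ge> gconv ((kop P f ^^ (n + 2)) (win \<psi> z (a - \<delta>))) k y - C2 * \<zeta> * (1 / (sqrt k * sqrt n)) - C2 * (sqrt k / (sqrt n) ^ 3))" by blast
  from limint_bound[OF \<psi>, of A z] obtain L where L: "L > 0" "\<forall>a b. 0 < a --> a < b --> b \<le> A --> \<bar>limint \<psi> z b - limint \<psi> z a\<bar> \<le> L * (b - a)" by blast
  from gd_small_bound[OF s2_pos] obtain Cg where Cg: "Cg > 0" "\<forall>t w. t \<ge> 1 --> \<bar>gd s2 1 t w\<bar> \<le> Cg / t \<and> \<bar>gd s2 2 t w\<bar> \<le> Cg / t \<and> \<bar>gd s2 3 t w\<bar> \<le> Cg / t\<^sup>2 \<and> \<bar>gd s2 4 t w\<bar> \<le> Cg / t\<^sup>2" by blast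
  \<comment> \<open>\<epsilon> is the square of e because the reflection and killing errors are
    proportional to sqrt \<epsilon>. A quarter of \<eta> is allotted to these, to the terms decaying
    like D / sqrt m, to the widening and to the local limit error.\<close>
  define e where "e = min (1/2) (\<eta> / (32 * (C1 + C2)))"
  define \<epsilon> where "\<epsilon> = e\<^sup>2"
  have e: "0 < e" "e \<le> 1/2" "8 * ((C1 + C2) * e) \<le> \<eta> / 4"
  proof -
    show "0 < e" unfolding e_def using \<eta> C1(1) C2(1) by auto
    show "e \<le> 1/2" unfolding e_def by (rule min.cobounded1)
    have "(C1 + C2) * e \<le> (C1 + C2) * (\<eta> / (32 * (C1 + C2)))" unfolding e_def using C1(1) C2(1) by (intro mult_left_mono) auto
    also have "\<dots> = \<eta> / 32" using C1(1) C2(1) by (simp add: field_simps)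
    finally show "8 * ((C1 + C2) * e) \<le> \<eta> / 4" by simp
  qed
  have \<epsilon>: "0 < \<epsilon>" "\<epsilon> \<le> 1/2" "sqrt \<epsilon> = e"
  proof -
    show "0 < \<epsilon>" "sqrt \<epsilon> = e" unfolding \<epsilon>_def using e by auto
    have "e\<^sup>2 \<le> (1/2)\<^sup>2" using e by (intro power_mono) auto
    then show "\<epsilon> \<le> 1/2" unfolding \<epsilon>_def by (simp add: power2_eq_square)
  qed
  \<comment> \<open>Chosen so that the Lipschitz change of \<open>limint\<close>, multiplied by the
    slope 2 Cg/m, stays within its quarter.\<close>
  define \<delta> where "\<delta> = min (min 1 (a/2)) (\<eta> / (8 * (Cg * L)))"
  have \<delta>: "0 < \<delta>" "\<delta> \<le> 1" "\<delta> < a" "2 * (Cg * L * \<delta>) \<le> \<eta> / 4"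
  proof -
    show "0 < \<delta>" "\<delta> \<le> 1" "\<delta> < a" unfolding \<delta>_def using \<eta> a Cg(1) L(1) by auto
    have "Cg * L * \<delta> \<le> Cg * L * (\<eta> / (8 * (Cg * L)))" unfolding \<delta>_def using Cg(1) L(1) by (intro mult_left_mono) auto
    also have "\<dots> = \<eta> / 8" using Cg(1) L(1) by (simp add: field_simps)
    finally show "2 * (Cg * L * \<delta>) \<le> \<eta> / 4" by simp
  qed
  \<comment> \<open>The local limit error is \<zeta> / (sqrt k sqrt n), and splitting at \<epsilon>
    m costs a factor 4/e.\<close>
  define \<zeta> where "\<zeta> = min 1 (\<eta> * e / (16 * C2))"
  have \<zeta>: "0 < \<zeta>" "\<zeta> \<le> 1" "C2 * \<zeta> * (4 / e) \<le> \<eta> / 4"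
  proof -
    show "0 < \<zeta>" "\<zeta> \<le> 1" unfolding \<zeta>_def using \<eta> e C2(1) by auto
    have "C2 * \<zeta> * (4 / e) \<le> C2 * (\<eta> * e / (16 * C2)) * (4 / e)" unfolding \<zeta>_def using C2(1) e(1) by (intro mult_left_mono mult_right_mono) auto
    also have "\<dots> = \<eta> / 4" using C2(1) e(1) by (simp add: field_simps)
    finally show "C2 * \<zeta> * (4 / e) \<le> \<eta> / 4" .
  qed
  obtain K0 where K0: "\<forall>k n x y. k \<ge> K0 --> k \<ge> 1 --> n \<ge> (1::nat) --> y > 0 -->
     (kop P f ^^ (k + n + 2)) (win \<psi> z a) x y \<le> gconv ((kop P f ^^ (n + 2)) (win \<psi> z (a + \<delta>))) k y + C2 * \<zeta> * (1 / (sqrt k * sqrt n)) \<and>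
     (kop P f ^^ (k + n + 2)) (win \<psi> z a) x y \<ge> gconv ((kop P f ^^ (n + 2)) (win \<psi> z (a - \<delta>))) k y - C2 * \<zeta> * (1 / (sqrt k * sqrt n)) - C2 * (sqrt k / (sqrt n) ^ 3)"
    using C2(2) \<delta> \<zeta> by blast
  define D where "D = (C1 + C2) * (16 / \<epsilon>\<^sup>2 + 4 / \<epsilon>)"
  have D: "D > 0" unfolding D_def using C1(1) C2(1) \<epsilon> by (intro mult_pos_pos add_pos_pos) auto
  \<comment> \<open>One condition makes k exceed the threshold \<open>K0\<close>, the other makes D
    / sqrt m at most \<eta>/4.\<close>
  obtain N where N: "real N \<ge> max ((K0 + 2) / \<epsilon>) ((4 * D / \<eta>)\<^sup>2)" using real_arch_simple by blast
  have "\<bar>(kop P f ^^ (m + 2)) (win \<psi> z a) x y + 2 * gd s2 1 m y * limint \<psi> z a\<bar> \<le> \<eta> / m" if m: "m \<ge> N" and y: "y > 0" for m x y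
  proof -
    have mN: "real m \<ge> (K0 + 2) / \<epsilon>" "real m \<ge> (4 * D / \<eta>)\<^sup>2" using N m by (auto intro: order_trans)
    have em: "\<epsilon> * m \<ge> K0 + 2" using mN(1) \<epsilon>(1) by (simp add: field_simps)
    then have em2: "\<epsilon> * m \<ge> 2" by linarith
    have mp: "real m > 0" using em2 \<epsilon>(1) by (cases "m = 0") auto
    define k where "k = nat \<lfloor>\<epsilon> * m\<rfloor>"
    define n where "n = m - k"
    note sb = split_bounds[OF \<epsilon>(1,2) em2 k_def n_def]
    have kK: "k \<ge> K0" unfolding k_def using em by (simp add: le_nat_iff le_floor_iff)
    have "sqrt ((4 * D / \<eta>)\<^sup>2) \<le> sqrt m" using mN(2) by (rule real_sqrt_le_mono)
    then have "4 * D / \<eta> \<le> sqrt m" using D \<eta> by simp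
    then have Dm: "D / sqrt m \<le> \<eta> / 4" using mp \<eta> by (simp add: field_simps)
    define T where "T = ((16 / \<epsilon>\<^sup>2 + 4 / \<epsilon>) / sqrt m + 8 * sqrt \<epsilon>) / m"
    define E1 where "E1 = sqrt n / (real k)\<^sup>2 + 1 / (real k * sqrt n) + sqrt k / (sqrt n) ^ 3"
    define E2 where "E2 = sqrt k / (sqrt n) ^ 3"
    define E3 where "E3 = 1 / (sqrt k * sqrt n)"
    have T: "E1 \<le> T" "E2 \<le> T" "E3 \<le> 4 / (e * m)" using sb(4,5,6) unfolding E1_def E2_def E3_def T_def \<epsilon>(3) by auto
    have "(C1 + C2) * T = (D / sqrt m + 8 * ((C1 + C2) * e)) / m" unfolding T_def D_def \<epsilon>(3) by (simp add: field_simps)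
    also have "\<dots> \<le> (\<eta> / 4 + \<eta> / 4) / m" using Dm e(3) by (intro divide_right_mono add_mono) auto
    finally have CT: "C1 * T + C2 * T \<le> \<eta> / 2 / m" by (simp add: distrib_right)
    have CE1: "C1 * E1 \<le> C1 * T" and CE2: "C2 * E2 \<le> C2 * T" using T C1(1) C2(1) by (auto intro: mult_left_mono)
    have "C2 * E2 \<ge> 0" unfolding E2_def using C2(1) by simp
    then have CT0: "0 \<le> C2 * T" using CE2 by linarith
    have "C2 * \<zeta> * E3 \<le> C2 * \<zeta> * (4 / (e * m))" using T(3) C2(1) \<zeta>(1) by (intro mult_left_mono) auto
    also have "\<dots> = C2 * \<zeta> * (4 / e) / m" by simp
    also have "\<dots> \<le> \<eta> / 4 / m" using \<zeta>(3) by (intro divide_right_mono) auto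
    finally have CE3: "C2 * \<zeta> * E3 \<le> \<eta> / 4 / m" .
    define q where "q = 2 * gd s2 1 m y"
    have qb: "\<bar>q * (limint \<psi> z c - limint \<psi> z d)\<bar> \<le> \<eta> / 4 / m" if "0 < c" "c < d" "d \<le> A" "d - c = \<delta>" for c d
    proof -
      have m1: "real m \<ge> 1" using mp by simp
      have "\<bar>limint \<psi> z c - limint \<psi> z d\<bar> \<le> L * \<delta>" using L(2)[rule_format, OF that(1-3)] that(4) by (simp add: abs_minus_commute)
      moreover have "\<bar>q\<bar> \<le> 2 * (Cg / m)" unfolding q_def using Cg(2)[rule_format, OF m1, of y] by (simp add: abs_mult)
      ultimately have "\<bar>q\<bar> * \<bar>limint \<psi> z c - limint \<psi> z d\<bar> \<le> 2 * (Cg / m) * (L * \<delta>)" using Cg(1) by (intro mult_mono) auto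
      also have "\<dots> = 2 * (Cg * L * \<delta>) / m" by simp
      also have "\<dots> \<le> \<eta> / 4 / m" using \<delta>(4) by (intro divide_right_mono) auto
      finally show ?thesis by (simp only: abs_mult)
    qed
    have mk: "real k + real n = real m" using sb(3) by simp
    have g: "\<bar>gconv ((kop P f ^^ (n + 2)) (win \<psi> z b)) k y + q * limint \<psi> z b\<bar> \<le> C1 * E1" if "0 < b" "b \<le> A" for b
      using C1(2)[rule_format, OF sb(1,2) that y] unfolding mk q_def E1_def .
    have up: "\<bar>gconv ((kop P f ^^ (n + 2)) (win \<psi> z (a + \<delta>))) k y + q * limint \<psi> z (a + \<delta>)\<bar> \<le> C1 * E1"
      and lo: "\<bar>gconv ((kop P f ^^ (n + 2)) (win \<psi> z (a - \<delta>))) k y + q * limint \<psi> z (a - \<delta>)\<bar> \<le> C1 * E1"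
      by (rule g; use a \<delta> A_def in simp)+
    have q1: "\<bar>q * limint \<psi> z a - q * limint \<psi> z (a + \<delta>)\<bar> \<le> \<eta> / 4 / m" and q2: "\<bar>q * limint \<psi> z (a - \<delta>) - q * limint \<psi> z a\<bar> \<le> \<eta> / 4 / m"
      using qb[of a "a + \<delta>"] qb[of "a - \<delta>" a] a \<delta> unfolding A_def right_diff_distrib by auto
    have main: "(kop P f ^^ (m + 2)) (win \<psi> z a) x y \<le> gconv ((kop P f ^^ (n + 2)) (win \<psi> z (a + \<delta>))) k y + C2 * \<zeta> * E3"
       "(kop P f ^^ (m + 2)) (win \<psi> z a) x y \<ge> gconv ((kop P f ^^ (n + 2)) (win \<psi> z (a - \<delta>))) k y - C2 * \<zeta> * E3 - C2 * E2"
      using K0[rule_format, OF kK sb(1,2) y, of x] unfolding sb(3)[symmetric] E2_def E3_def by auto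
    have "\<eta> / m = \<eta> / 2 / m + \<eta> / 4 / m + \<eta> / 4 / m" by (simp add: field_simps)
    then show ?thesis using main up lo q1 q2 CE1 CE2 CT CT0 CE3 unfolding q_def[symmetric] by linarith
  qed
  then show ?thesis by blast
qed

end

lemma powr_three_halves: "real n powr (3/2) = (sqrt n) ^ 3"
proof (cases "n = 0")
  case False
  have "real n powr (3/2) = real n powr (1 + 1/2)" by simp
  also have "\<dots> = real n * sqrt n" using False by (simp only: powr_add powr_half_sqrt) simp
  finally show ?thesis by (simp add: power3_eq_cube)
qed simp

lemma gd2_at_0: "gd c 2 t 0 = - 1 / (c * t * sqrt (2 * pi * c * t))"
  by (simp add: numeral_2_eq_2 gd_SS gd_0)

context nonlattice_chain
begin

text \<open>The main term of the bulk asymptotics is itself an odd heat function: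
  \<open>gd 1\<close> and its second derivative vanish at the origin, so \<open>kop_heat\<close>
  applies with slope \<open>gd 2\<close>.\<close>

lemma kop_iter_gd1:
  "\<exists>C>0. \<forall>m k x y. m \<ge> (1::nat) --> k \<ge> (1::nat) --> y \<ge> - l1norm f -->
     \<bar>(kop P f ^^ k) (\<lambda>x y. gd s2 1 m y) x y - gd s2 2 (real m + real k) 0 * W x y\<bar>
       \<le> C * (1 + \<bar>y\<bar>) ^ 3 * (sqrt k / (sqrt m) ^ 5 + 1 / ((sqrt m) ^ 3 * sqrt k))"
proof -
  obtain Ck where Ck: "Ck > 0" "\<forall>h m B B1 k x y. heat_seq s2 h --> m > 0 --> k \<ge> 1 --> y \<ge> - l1norm f -->
     (\<forall>t w. m \<le> t --> t \<le> m + real k --> \<bar>h 3 t w\<bar> \<le> B \<and> \<bar>h 4 t w\<bar> \<le> B) -->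
     (\<forall>t. m \<le> t --> t \<le> m + real k --> h 0 t 0 = 0 \<and> h 2 t 0 = 0) -->
     (\<forall>w. \<bar>h 1 m w\<bar> \<le> B1 \<and> \<bar>h 2 m w\<bar> \<le> B1) --> \<bar>h 1 (m + k) 0\<bar> \<le> B1 -->
     \<bar>(kop P f ^^ k) (\<lambda>x y. h 0 m y) x y - h 1 (m + k) 0 * W x y\<bar> \<le> Ck * (1 + \<bar>y\<bar>) ^ 3 * (B * sqrt k + B1 / sqrt k)"
    using kop_heat by (elim exE conjE)
  from gd_bound_uniform[OF s2_pos] obtain C where C: "C > 0" "\<forall>j\<le>6. \<forall>s y. s > 0 --> \<bar>gd s2 j s y\<bar> \<le> C / (sqrt s) ^ Suc j" by blast
  have "\<bar>(kop P f ^^ k) (\<lambda>x y. gd s2 1 m y) x y - gd s2 2 (real m + real k) 0 * W x y\<bar>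
       \<le> (Ck * C) * (1 + \<bar>y\<bar>) ^ 3 * (sqrt k / (sqrt m) ^ 5 + 1 / ((sqrt m) ^ 3 * sqrt k))"
    if m: "m \<ge> (1::nat)" and k: "k \<ge> (1::nat)" and y: "y \<ge> - l1norm f" for m k x y
  proof -
    define h where "h j = gd s2 (Suc j)" for j
    have hs: "heat_seq s2 h" unfolding h_def[abs_def] by (rule heat_seq_Suc[OF heat_seq_gd[OF s2_pos]])
    have mp: "real m > 0" "sqrt m \<ge> 1" using m by auto
    have gb: "\<bar>gd s2 j t w\<bar> \<le> C / (sqrt m) ^ i" if t: "real m \<le> t" and j: "j \<le> 6" "i \<le> Suc j" for j i t w
    proof -
      have t0: "t > 0" using t mp by linarith
      have "\<bar>gd s2 j t w\<bar> \<le> C / (sqrt t) ^ Suc j" using C(2) j t0 by blast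
      also have "\<dots> \<le> C / (sqrt m) ^ Suc j" using C(1) t mp t0 by (intro divide_left_mono power_mono mult_pos_pos zero_less_power) auto
      also have "\<dots> \<le> C / (sqrt m) ^ i" using C(1) mp j by (intro divide_left_mono power_increasing mult_pos_pos zero_less_power) auto
      finally show ?thesis .
    qed
    have b4: "\<forall>t v. real m \<le> t --> t \<le> real m + real k --> \<bar>h 3 t v\<bar> \<le> C / (sqrt m) ^ 5 \<and> \<bar>h 4 t v\<bar> \<le> C / (sqrt m) ^ 5"
      unfolding h_def using gb by auto
    have b5: "\<forall>t. real m \<le> t --> t \<le> real m + real k --> h 0 t 0 = 0 \<and> h 2 t 0 = 0"
      unfolding h_def using gd_even(4,5)[of s2] by (simp add: numeral_3_eq_3)
    have b6: "\<forall>v. \<bar>h 1 m v\<bar> \<le> C / (sqrt m) ^ 3 \<and> \<bar>h 2 m v\<bar> \<le> C / (sqrt m) ^ 3"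
      unfolding h_def using gb by auto
    have b7: "\<bar>h 1 (real m + real k) 0\<bar> \<le> C / (sqrt m) ^ 3" unfolding h_def using gb by auto
    have "\<bar>(kop P f ^^ k) (\<lambda>x y. h 0 m y) x y - h 1 (real m + real k) 0 * W x y\<bar> \<le> Ck * (1 + \<bar>y\<bar>) ^ 3 * (C / (sqrt m) ^ 5 * sqrt k + C / (sqrt m) ^ 3 / sqrt k)"
      using Ck(2) hs mp(1) k y b4 b5 b6 b7 by blast
    moreover have "h 0 = gd s2 1" "h 1 = gd s2 2" unfolding h_def by (simp_all add: numeral_2_eq_2)
    moreover have "Ck * (1 + \<bar>y\<bar>) ^ 3 * (C / (sqrt m) ^ 5 * sqrt k + C / (sqrt m) ^ 3 / sqrt k) = (Ck * C) * (1 + \<bar>y\<bar>) ^ 3 * (sqrt k / (sqrt m) ^ 5 + 1 / ((sqrt m) ^ 3 * sqrt k))"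
      by (simp add: algebra_simps)
    ultimately show ?thesis by (simp only:)
  qed
  then show ?thesis using Ck(1) C(1) by (intro exI[of _ "Ck * C"]) auto
qed

lemma half_split:
  fixes n k m :: nat
  assumes n: "n \<ge> 8" and k: "k = n div 2" and m: "m = n - k - 2"
  shows "k \<ge> 1" "m \<ge> 1" "n = k + (m + 2)" "sqrt k \<le> sqrt n" "sqrt n / 2 \<le> sqrt k" "sqrt n / 2 \<le> sqrt m"
proof -
  show "k \<ge> 1" "m \<ge> 1" "n = k + (m + 2)" "sqrt k \<le> sqrt n" using n k m by auto
  have "n \<le> 4 * k" "n \<le> 4 * m" using n k m by auto
  then have "sqrt n \<le> sqrt (4 * real k)" "sqrt n \<le> sqrt (4 * real m)" by (auto intro!: real_sqrt_le_mono)
  then show "sqrt n / 2 \<le> sqrt k" "sqrt n / 2 \<le> sqrt m" by (auto simp: real_sqrt_mult)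
qed

text \<open>The bulk asymptotics over the second half has error \<eta>/m uniformly in the height
  reached, and surviving the first half costs n^(-1/2); so the errors are o(n^(-3/2)), while the
  main term is evaluated by \<open>kop_iter_gd1\<close>.\<close>

lemma window_two_step:
  assumes z: "z \<ge> 0" and a: "a > 0" and \<psi>: "\<forall>u. 0 \<le> \<psi> u \<and> \<psi> u \<le> M" and y: "y \<ge> - l1norm f"
  shows "(\<lambda>n. (sqrt n) ^ 3 * ((kop P f ^^ n) (win \<psi> z a) x y + 2 * limint \<psi> z a * (gd s2 2 (real n - 2) 0 * W x y))) \<longlonglongrightarrow> 0"
proof (rule LIMSEQ_I)
  fix r :: real assume r: "r > 0"
  define I where "I = limint \<psi> z a"
  from kop_iter_gd1 obtain C where C: "C > 0" "\<forall>m k x y. m \<ge> (1::nat) --> k \<ge> (1::nat) --> y \<ge> - l1norm f -->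
     \<bar>(kop P f ^^ k) (\<lambda>x y. gd s2 1 m y) x y - gd s2 2 (real m + real k) 0 * W x y\<bar>
       \<le> C * (1 + \<bar>y\<bar>) ^ 3 * (sqrt k / (sqrt m) ^ 5 + 1 / ((sqrt m) ^ 3 * sqrt k))" by blast
  from survival_bound obtain C3 where C3: "C3 > 0" "\<forall>n\<ge>1. \<forall>x y. surv f n x y \<le> C3 * (1 + max y 0) / sqrt n" by blast
  define Y where "Y = C3 * (1 + max y 0)"
  have Y: "Y > 0" unfolding Y_def using C3(1) by (intro mult_pos_pos) auto
  \<comment> \<open>Replacing m and k by n/4 in the error bound produces the factor 8; the choice
    makes this part r/2.\<close>
  define \<eta> where "\<eta> = r / (16 * Y)"
  have \<eta>: "\<eta> > 0" unfolding \<eta>_def using r Y by simp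
  obtain N where N: "\<forall>m\<ge>N. \<forall>x y. y > 0 --> \<bar>(kop P f ^^ (m + 2)) (win \<psi> z a) x y + 2 * gd s2 1 m y * I\<bar> \<le> \<eta> / m"
    using bulk_asymptotics[OF z a \<psi> \<eta>] unfolding I_def by blast
  \<comment> \<open>96 is twice 48 = 32 + 16, the constants left by sqrt n / 2 in the two errors of
    \<open>kop_iter_gd1\<close>.\<close>
  define D where "D = 96 * (\<bar>I\<bar> * (C * (1 + \<bar>y\<bar>) ^ 3)) + 1"
  have D: "D > 0" unfolding D_def using C(1) by (intro add_nonneg_pos) auto
  obtain N1 where N1: "real N1 > (4 * D / r)\<^sup>2" using reals_Archimedean2 by blast
  have "\<bar>(sqrt n) ^ 3 * ((kop P f ^^ n) (win \<psi> z a) x y + 2 * I * (gd s2 2 (real n - 2) 0 * W x y))\<bar> < r"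
    if n: "n \<ge> max (max 8 (2 * N + 8)) N1" for n
  proof -
    define k where "k = n div 2"
    define m where "m = n - k - 2"
    have n8: "n \<ge> 8" using n by simp
    note hs = half_split[OF n8 k_def m_def]
    have mN: "m \<ge> N" unfolding m_def k_def using n by auto
    define s where "s = sqrt n"
    have s: "s > 0" unfolding s_def using n by simp
    have nk: "real n - 2 = real m + real k" using hs(3) by simp
    have kk: "(kop P f ^^ n) (win \<psi> z a) x y = (kop P f ^^ k) ((kop P f ^^ (m + 2)) (win \<psi> z a)) x y"
      by (subst hs(3)) (simp only: funpow_add_apply)
    define E where "E x y = (kop P f ^^ (m + 2)) (win \<psi> z a) x y + 2 * I * gd s2 1 m y" for x y
    have E: "\<bar>E x y\<bar> \<le> \<eta> / m" if "y > 0" for x y unfolding E_def using N mN that by (simp add: mult.assoc mult.left_commute mult.commute)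
    have "(kop P f ^^ k) E x y = (kop P f ^^ k) ((kop P f ^^ (m + 2)) (win \<psi> z a)) x y + 2 * I * (kop P f ^^ k) (\<lambda>x y. gd s2 1 m y) x y"
      unfolding E_def[abs_def] by (simp only: kop_iter_add kop_iter_mult)
    then have e: "(kop P f ^^ n) (win \<psi> z a) x y + 2 * I * (gd s2 2 (real n - 2) 0 * W x y) =
        (kop P f ^^ k) E x y - 2 * I * ((kop P f ^^ k) (\<lambda>x y. gd s2 1 m y) x y - gd s2 2 (real m + real k) 0 * W x y)"
      unfolding kk nk by (simp add: algebra_simps)
    have "\<bar>(kop P f ^^ k) E x y\<bar> \<le> \<eta> / m * surv f k x y"
      by (rule kop_iter_sup_bound) (use E hs(1) in auto)
    also have "\<dots> \<le> \<eta> / m * (Y / sqrt k)" unfolding Y_def using C3(2) hs(1) \<eta> by (intro mult_left_mono) auto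
    also have "\<dots> \<le> \<eta> / (s / 2)^2 * (Y / (s / 2))"
    proof -
      have "(s / 2)^2 \<le> (sqrt m)^2" unfolding s_def using hs(6) by (intro power_mono) auto
      then have "\<eta> / m \<le> \<eta> / (s / 2)^2" using \<eta> s hs(2) by (intro divide_left_mono mult_pos_pos) auto
      moreover have "Y / sqrt k \<le> Y / (s / 2)" using Y s hs(1,5) unfolding s_def by (intro divide_left_mono mult_pos_pos) auto
      ultimately show ?thesis using \<eta> Y by (intro mult_mono) auto
    qed
    also have "\<dots> = 8 * \<eta> * Y / s ^ 3" using s by (simp add: field_simps power2_eq_square power3_eq_cube)
    also have "\<dots> = r / 2 / s ^ 3" unfolding \<eta>_def using Y by simp
    finally have e1: "\<bar>(kop P f ^^ k) E x y\<bar> \<le> r / 2 / s ^ 3" .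
    have "\<bar>(kop P f ^^ k) (\<lambda>x y. gd s2 1 m y) x y - gd s2 2 (real m + real k) 0 * W x y\<bar>
       \<le> C * (1 + \<bar>y\<bar>) ^ 3 * (sqrt k / (sqrt m) ^ 5 + 1 / ((sqrt m) ^ 3 * sqrt k))" using C(2) hs(1,2) y by blast
    also have "\<dots> \<le> C * (1 + \<bar>y\<bar>) ^ 3 * (s / (s / 2) ^ 5 + 1 / ((s / 2) ^ 3 * (s / 2)))"
      using C(1) hs s unfolding s_def
      by (intro mult_left_mono add_mono frac_le divide_left_mono power_mono mult_mono mult_pos_pos zero_less_power) auto
    also have "\<dots> = C * (1 + \<bar>y\<bar>) ^ 3 * (48 / s / s ^ 3)" using s by (simp add: field_simps eval_nat_numeral)
    finally have "\<bar>2 * I\<bar> * \<bar>(kop P f ^^ k) (\<lambda>x y. gd s2 1 m y) x y - gd s2 2 (real m + real k) 0 * W x y\<bar> \<le> \<bar>2 * I\<bar> * (C * (1 + \<bar>y\<bar>) ^ 3 * (48 / s / s ^ 3))"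
      by (intro mult_left_mono) auto
    also have "\<dots> = (96 * (\<bar>I\<bar> * (C * (1 + \<bar>y\<bar>) ^ 3))) / s / s ^ 3" by (simp add: abs_mult)
    also have "\<dots> \<le> D / s / s ^ 3" unfolding D_def using s by (intro divide_right_mono) auto
    finally have e2: "\<bar>2 * I * ((kop P f ^^ k) (\<lambda>x y. gd s2 1 m y) x y - gd s2 2 (real m + real k) 0 * W x y)\<bar> \<le> D / s / s ^ 3"
      by (simp only: abs_mult)
    have "sqrt ((4 * D / r)\<^sup>2) < s" unfolding s_def using N1 n by (intro real_sqrt_less_mono) auto
    then have "4 * D / r < s" using D r by simp
    then have "D / s < r / 4" using s r by (simp add: field_simps)
    then have "D / s / s ^ 3 < r / 4 / s ^ 3" using s by (intro divide_strict_right_mono) auto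
    then have "\<bar>(kop P f ^^ n) (win \<psi> z a) x y + 2 * I * (gd s2 2 (real n - 2) 0 * W x y)\<bar> < r / 2 / s ^ 3 + r / 4 / s ^ 3"
      unfolding e using e1 e2 by linarith
    also have "\<dots> \<le> r / s ^ 3" using r s by (simp add: field_simps)
    finally have "s ^ 3 * \<bar>(kop P f ^^ n) (win \<psi> z a) x y + 2 * I * (gd s2 2 (real n - 2) 0 * W x y)\<bar> < r"
      using s by (simp add: field_simps)
    then show ?thesis using s unfolding s_def[symmetric] by (simp add: abs_mult)
  qed
  then show "\<exists>no. \<forall>n\<ge>no. norm ((sqrt n) ^ 3 * ((kop P f ^^ n) (win \<psi> z a) x y + 2 * limint \<psi> z a * (gd s2 2 (real n - 2) 0 * W x y)) - 0) < r"
    unfolding I_def by (intro exI[of _ "max (max 8 (2 * N + 8)) N1"]) auto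
qed

text \<open>What remains is the value of the second Gaussian derivative at 0, whose minus sign
  cancels that of the bulk asymptotics. Starts below -|f| are killed at once and both sides
  vanish.\<close>

theorem window_limit:
  assumes z: "z \<ge> 0" and a: "a > 0" and \<psi>: "\<forall>u. 0 \<le> \<psi> u \<and> \<psi> u \<le> M"
  shows "(\<lambda>n. real n powr (3/2) * (kop P f ^^ n) (win \<psi> z a) x y) \<longlonglongrightarrow> 2 * W x y / (sqrt (2 * pi) * sqrt s2 ^ 3) * limint \<psi> z a"
proof (cases "y \<ge> - l1norm f")
  case True
  define c where "c = 2 * W x y / (sqrt (2 * pi) * sqrt s2 ^ 3) * limint \<psi> z a"
  \<comment> \<open>The two steps used up by duality leave n - 2 in the Gaussian; the ratio tends to
    1.\<close>
  have L: "(\<lambda>n. (sqrt n) ^ 3 / ((real n - 2) * sqrt (real n - 2))) \<longlonglongrightarrow> 1" by real_asymp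
  have "(\<lambda>n. c * ((sqrt n) ^ 3 / ((real n - 2) * sqrt (real n - 2)))) \<longlonglongrightarrow> c * 1" by (rule tendsto_mult[OF tendsto_const L])
  from tendsto_add[OF window_two_step[OF z a \<psi> True, of x] this]
  have "(\<lambda>n. (sqrt n) ^ 3 * ((kop P f ^^ n) (win \<psi> z a) x y + 2 * limint \<psi> z a * (gd s2 2 (real n - 2) 0 * W x y)) + c * ((sqrt n) ^ 3 / ((real n - 2) * sqrt (real n - 2)))) \<longlonglongrightarrow> c"
    by simp
  moreover have "\<forall>\<^sub>F n in sequentially. (sqrt n) ^ 3 * ((kop P f ^^ n) (win \<psi> z a) x y + 2 * limint \<psi> z a * (gd s2 2 (real n - 2) 0 * W x y)) + c * ((sqrt n) ^ 3 / ((real n - 2) * sqrt (real n - 2)))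
     = real n powr (3/2) * (kop P f ^^ n) (win \<psi> z a) x y"
    using eventually_ge_at_top[of 3]
  proof eventually_elim
    fix n :: nat assume n: "3 \<le> n"
    define t where "t = real n - 2"
    have t: "t > 0" unfolding t_def using n by simp
    have "gd s2 2 t 0 = - 1 / (sqrt (2 * pi) * sqrt s2 ^ 3) / (t * sqrt t)"
      unfolding gd2_at_0 using s2_pos t by (simp add: real_sqrt_mult power3_eq_cube)
    then have "2 * limint \<psi> z a * (gd s2 2 t 0 * W x y) = - c / (t * sqrt t)" unfolding c_def by simp
    then show "(sqrt n) ^ 3 * ((kop P f ^^ n) (win \<psi> z a) x y + 2 * limint \<psi> z a * (gd s2 2 (real n - 2) 0 * W x y)) + c * ((sqrt n) ^ 3 / ((real n - 2) * sqrt (real n - 2)))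
     = real n powr (3/2) * (kop P f ^^ n) (win \<psi> z a) x y"
      unfolding t_def[symmetric] powr_three_halves by (simp add: algebra_simps)
  qed
  ultimately show ?thesis unfolding c_def[symmetric] by (rule Lim_transform_eventually)
next
  case False
  have "(kop P f ^^ Suc n) (win \<psi> z a) x y = 0" for n using kop_below[of y f "(kop P f ^^ n) (win \<psi> z a)" x] False by simp
  then have "(\<lambda>n. real (Suc n) powr (3/2) * (kop P f ^^ Suc n) (win \<psi> z a) x y) \<longlonglongrightarrow> 0" by simp
  then have "(\<lambda>n. real n powr (3/2) * (kop P f ^^ n) (win \<psi> z a) x y) \<longlonglongrightarrow> 0" by (rule LIMSEQ_imp_Suc)
  then show ?thesis using W_below[of y x] False by simp
qed

text \<open>Passage from the Lebesgue integral to the gauge integral of the statement.\<close>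

lemma limint_eq_integral:
  assumes z: "z \<ge> 0" and a: "a > 0" and \<psi>: "\<forall>u. 0 \<le> \<psi> u \<and> \<psi> u \<le> M"
  shows "limint \<psi> z a = integral {z..z+a} (\<lambda>y. \<Sum>u\<in>UNIV. \<nu> u * \<psi> u * (if y - f u > 0 then dual.W u (y - f u) else 0))"
proof -
  define Q where "Q y = (\<Sum>u\<in>UNIV. \<nu> u * \<psi> u * dW u y)" for y
  from dW_bound[of "z + a"] obtain C where C: "C > 0" "\<forall>x y. y \<le> z + a --> \<bar>dW x y\<bar> \<le> C" by blast
  have i: "integrable lborel (\<lambda>y. dW x y * win \<psi> z a x y)" for x
    by (rule integral_mult_win_le(1)[OF \<psi> a dW_measurable _ less_imp_le[OF C(1)]]) (use C(2) in auto)
  have e: "indicator {z..z+a} y *\<^sub>R Q y = (\<Sum>u\<in>UNIV. \<nu> u * (dW u y * win \<psi> z a u y))" for y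
    unfolding Q_def win_def by (auto simp: indicator_def intro!: sum.cong)
  have "set_integrable lborel {z..z+a} Q" unfolding set_integrable_def e
    by (intro Bochner_Integration.integrable_sum integrable_mult_right i)
  from set_borel_integral_eq_integral(2)[OF this]
  have "integral {z..z+a} Q = (LBINT y. (\<Sum>u\<in>UNIV. \<nu> u * (dW u y * win \<psi> z a u y)))"
    unfolding set_lebesgue_integral_def e ..
  also have "\<dots> = limint \<psi> z a" unfolding limint_def
    by (subst Bochner_Integration.integral_sum) (use i in auto)
  finally have "limint \<psi> z a = integral {z..z+a} Q" ..
  \<comment> \<open>\<open>dW\<close> also demands y > 0, which on the window can fail only at y =
    0, a null set.\<close>
  also have "\<dots> = integral {z..z+a} (\<lambda>y. \<Sum>u\<in>UNIV. \<nu> u * \<psi> u * (if y - f u > 0 then dual.W u (y - f u) else 0))"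
    by (rule integral_spike[of "{0}"]) (use z in \<open>auto simp: Q_def dW_def intro!: sum.cong\<close>)
  finally show ?thesis .
qed

end

text \<open>The quadratic factor from \<open>window_bound\<close> is bounded by the cubic one,
  separately for a \<le> 1 and a > 1.\<close>

lemma cube_bound: "(a::real) > 0 ==> z \<ge> 0 ==> (1 + a) * (1 + z + a) \<le> 4 * ((1 + a ^ 3) * (1 + z))"
proof -
  assume a: "a > 0" and z: "z \<ge> 0"
  have "(1 + a)\<^sup>2 \<le> 4 * (1 + a ^ 3)"
  proof (cases "a \<le> 1")
    case True
    have "(1 + a)\<^sup>2 \<le> 2\<^sup>2" using True a by (intro power_mono) auto
    then show ?thesis using a by (simp add: add_increasing2)
  next
    case False
    have "(1 + a)\<^sup>2 \<le> (2 * a)\<^sup>2" using False by (intro power_mono) auto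
    moreover have "a\<^sup>2 \<le> a ^ 3" using False by (intro power_increasing) auto
    ultimately show ?thesis by (simp add: power_mult_distrib)
  qed
  then have "(1 + a)\<^sup>2 * (1 + z) \<le> 4 * (1 + a ^ 3) * (1 + z)" using z by (intro mult_right_mono) auto
  moreover have "(1 + a) * (1 + z + a) \<le> (1 + a) * ((1 + a) * (1 + z))"
    using a z by (intro mult_left_mono) (auto simp: algebra_simps)
  ultimately show ?thesis by (simp add: power2_eq_square algebra_simps)
qed

theorem theorem2p5:
  fixes P :: "'a::finite \<Rightarrow> 'a \<Rightarrow> real" and f :: "'a \<Rightarrow> real"
  assumes "stochastic P" and "H1 P" and "H2 P f" and "H3 P f"
  shows "(\<forall>(\<psi>::'a \<Rightarrow> real) a x y z. (\<forall>u. \<psi> u \<ge> 0) \<longrightarrow> a > 0 \<longrightarrow> z \<ge> 0 \<longrightarrow>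
            ((\<lambda>n. real n powr (3/2) * local_exp P f \<psi> x y z a n) \<longlonglongrightarrow>
              2 * Vfun P f (sigma P f) x y / (sqrt (2 * pi) * sigma P f ^ 3) *
                integral {z..z+a} (dual_integrand P f \<psi>)))
       \<and> (\<exists>c>0. \<forall>(\<psi>::'a \<Rightarrow> real) a y z n. a > 0 \<longrightarrow> (\<forall>u. \<psi> u \<ge> 0) \<longrightarrow> z \<ge> 0 \<longrightarrow> n \<ge> 1 \<longrightarrow>
            Max (range (\<lambda>x. local_exp P f \<psi> x y z a n))
              \<le> c * Max (range (\<lambda>u. \<bar>\<psi> u\<bar>)) / real n powr (3/2)
                 * (1 + a ^ 3) * (1 + z) * (1 + max y 0))"
proof -
  define \<nu> where "\<nu> = inv_prob P"
  interpret primitive P by (rule primitiveI[OF assms(1,2)])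
  have inv: "invariant_prob P \<nu>" unfolding \<nu>_def by (rule invariant_prob_inv_prob)
  have cen: "(\<Sum>x\<in>UNIV. \<nu> x * f x) = 0" using assms(3) unfolding H2_def \<nu>_def by (simp add: mult.commute)
  interpret centered_chain P f \<nu> by unfold_locales (use inv cen in auto)
  \<comment> \<open>(H3) at slope 0 and lattice {0} gives a cycle with nonzero sum, which is what
    positivity of the variance requires.\<close>
  obtain n xs where cyc: "(\<Prod>k<n. P (xs k) (xs (Suc k))) * P (xs n) (xs 0) > 0" "(\<Sum>k\<le>n. f (xs k)) - real (n + 1) * 0 \<notin> {0 * of_int m | m. True}"
    using assms(4) unfolding H3_def by blast
  have s2p: "s2 > 0" by (rule s2_pos_if_cycle[OF cyc(1)]) (use cyc(2) in auto)
  interpret nonlattice_chain P f \<nu> by unfold_locales (use s2p assms(4) in auto)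
  have sig: "sigma P f = sqrt s2" unfolding sigma_def s2_def asym_var_def by (simp only: \<nu>_def)
  have ps: "Pstar P = Ps" by (intro ext) (unfold Pstar_def Ps_def, simp only: \<nu>_def)
  have V: "Vfun P f (sigma P f) x y = W x y" for x y unfolding sig by (rule Vfun_eq_W)
  have Vd: "Vfun (Pstar P) (\<lambda>u. - f u) (sigma P f) x y = dual.W x y" for x y
    unfolding sig ps dual_s2[symmetric] by (rule dual.Vfun_eq_W)
  have di: "dual_integrand P f \<psi> = (\<lambda>y. \<Sum>u\<in>UNIV. \<nu> u * \<psi> u * (if y - f u > 0 then dual.W u (y - f u) else 0))" for \<psi>
  \<comment> \<open>Invariance of \<open>\<nu>\<close> under the dual matrix integrates out the
    starting point X_0*.\<close>
  proof
    fix z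
    have "(\<Sum>x0\<in>UNIV. inv_prob P x0 * Pstar P x0 x') = inv_prob P x'" for x'
      using Ps_invariant[of x'] unfolding ps \<nu>_def .
    from dual_integrand_eq[of P, OF this, of f \<psi> z]
    show "dual_integrand P f \<psi> z = (\<Sum>u\<in>UNIV. \<nu> u * \<psi> u * (if z - f u > 0 then dual.W u (z - f u) else 0))"
      unfolding Vd unfolding \<nu>_def .
  qed
  have le: "local_exp P f \<psi> x y z a n = (kop P f ^^ n) (win \<psi> z a) x y" for \<psi> x y z a n
    unfolding local_exp_kop win_def[abs_def] ..
  have mx: "\<forall>u. 0 \<le> \<psi> u \<and> \<psi> u \<le> Max (range (\<lambda>u. \<bar>\<psi> u\<bar>))" if "\<forall>u. \<psi> u \<ge> 0" for \<psi> :: "'a => real"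
    using that by (auto intro!: order_trans[OF abs_ge_self] Max_ge)
  show ?thesis
  proof (intro conjI allI impI)
    fix \<psi> :: "'a => real" and a y z :: real and x
    assume \<psi>: "\<forall>u. \<psi> u \<ge> 0" and a: "a > 0" and z: "z \<ge> 0"
    show "(\<lambda>n. real n powr (3/2) * local_exp P f \<psi> x y z a n) \<longlonglongrightarrow>
       2 * Vfun P f (sigma P f) x y / (sqrt (2 * pi) * sigma P f ^ 3) * integral {z..z+a} (dual_integrand P f \<psi>)"
      unfolding V di le limint_eq_integral[OF z a mx[OF \<psi>], symmetric] unfolding sig
      by (rule window_limit[OF z a mx[OF \<psi>]])
  next
    from window_bound obtain C where C: "C > 0" "\<forall>n\<ge>1. \<forall>\<psi> M a z x y. (\<forall>u. 0 \<le> \<psi> u \<and> \<psi> u \<le> M) --> a > 0 --> z \<ge> 0 -->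
     (kop P f ^^ n) (win \<psi> z a) x y \<le> C * M * (1 + a) * (1 + z + a) * (1 + max y 0) / (sqrt n) ^ 3" by blast
    show "\<exists>c>0. \<forall>(\<psi>::'a => real) a y z n. a > 0 --> (\<forall>u. \<psi> u \<ge> 0) --> z \<ge> 0 --> n \<ge> 1 -->
            Max (range (\<lambda>x. local_exp P f \<psi> x y z a n))
              \<le> c * Max (range (\<lambda>u. \<bar>\<psi> u\<bar>)) / real n powr (3/2) * (1 + a ^ 3) * (1 + z) * (1 + max y 0)"
    \<comment> \<open>The 4 is the factor of \<open>cube_bound\<close>.\<close>
    proof (intro exI[of _ "4 * C"] conjI allI impI)
      show "4 * C > 0" using C(1) by simp
      fix \<psi> :: "'a => real" and a y z :: real and n :: nat
      assume a: "a > 0" and \<psi>: "\<forall>u. \<psi> u \<ge> 0" and z: "z \<ge> 0" and n: "n \<ge> 1"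
      define M where "M = Max (range (\<lambda>u. \<bar>\<psi> u\<bar>))"
      have M: "\<forall>u. 0 \<le> \<psi> u \<and> \<psi> u \<le> M" unfolding M_def by (rule mx[OF \<psi>])
      have M0: "M \<ge> 0" using M order_trans by blast
      have "(kop P f ^^ n) (win \<psi> z a) x y \<le> 4 * C * M / (sqrt n) ^ 3 * (1 + a ^ 3) * (1 + z) * (1 + max y 0)" for x
      proof -
        have "(kop P f ^^ n) (win \<psi> z a) x y \<le> C * M * (1 + a) * (1 + z + a) * (1 + max y 0) / (sqrt n) ^ 3"
          by (rule C(2)[rule_format, OF n M[rule_format] a z])
        also have "\<dots> = C * M * (1 + max y 0) / (sqrt n) ^ 3 * ((1 + a) * (1 + z + a))" by simp
        also have "\<dots> \<le> C * M * (1 + max y 0) / (sqrt n) ^ 3 * (4 * ((1 + a ^ 3) * (1 + z)))"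
          using C(1) M0 cube_bound[OF a z] by (intro mult_left_mono) auto
        finally show ?thesis by (simp add: mult.assoc mult.left_commute mult.commute)
      qed
      then show "Max (range (\<lambda>x. local_exp P f \<psi> x y z a n)) \<le> 4 * C * Max (range (\<lambda>u. \<bar>\<psi> u\<bar>)) / real n powr (3/2) * (1 + a ^ 3) * (1 + z) * (1 + max y 0)"
        unfolding le powr_three_halves M_def[symmetric] by (intro Max.boundedI) auto
    qed
  qed
qed

end
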